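(* Let $n\ge 1$. The orbit structure (the multiset of orbit sizes) of the rowmotion operator $\mathrm{Row}_B\colon\pi_\downarrow^B(B_n)\to\pi_\downarrow^B(B_n)$ is the same as that of rowmotion $\mathrm{Row}\colon\mathcal J(\mathrm{SS}_n)\to\mathcal J(\mathrm{SS}_n)$, where $\mathrm{SS}_n$ is the shifted staircase with $n(2n-1)$ elements.
   Context: Type $B$ setup. Let $w_0=(2n)(2n-1)\cdots 1\in S_{2n}$ and $\beta(x)=w_0xw_0$. $B_n$ is the subgroup $\{x\in S_{2n}:\beta(x)=x\}$, a Coxeter group with simple generators $s_i^B=s_is_{2n-i}$ ($1\le i\le n-1$) and $s_n^B=s_n$, where $s_i=(i\ i{+}1)$. Let $c=c_+c_-$ with $c_+=\prod_{i\in[n]\text{ even}}s_i^B$ and $c_-=\prod_{i\in[n]\text{ odd}}s_i^B$, a bipartite Coxeter element of $B_n$. BiCambrian congruence. For a finite Coxeter system $(W,S)$ with Coxeter element $c$, the $c$-Cambrian congruence is the smallest lattice congruence of the right weak order on $W$ such that, for each pair $s,t\in S$ with $m(s,t)\ge3$ and $s$ preceding $t$ in a reduced word of $c$, $t\equiv tsts\cdots$ (alternating word with $m(s,t)-1$ letters). The $c$-biCambrian congruence is the common refinement (intersection) of the $c$-Cambrian and $c^{-1}$-Cambrian congruences. Each class of a lattice congruence of a finite lattice is an interval. $\pi_\downarrow^B\colon B_n\to B_n$ sends an element to the minimum of its $c$-biCambrian congruence class in $B_n$; $\pi_\downarrow^B(B_n)$, ordered by the weak order on $B_n$, is a finite semidistributive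 lattice isomorphic to the $c$-biCambrian lattice of $B_n$. $\mathrm{Row}_B$ is rowmotion on it. Rowmotion on a finite semidistributive lattice $L$. An element $j$ is join-irreducible if it covers exactly one element, denoted $j_*$; for such $j$, the set $\{z\in L:z\wedge j=j_*\}$ has a maximum, denoted $\kappa(j)$. For each cover relation $x\lessdot y$ there is a unique join-irreducible $j_{xy}$ with $j_{xy}\le y$ and $\kappa(j_{xy})\ge x$. Put $\mathcal D(z)=\{j_{xz}:x\lessdot z\}$ and $\mathcal U(z)=\{j_{zy}:z\lessdot y\}$. For each $x\in L$ there is a unique $\mathrm{Row}(x)\in L$ with $\mathcal U(\mathrm{Row}(x))=\mathcal D(x)$; $\mathrm{Row}\colon L\to L$ is a bijection. Shifted staircase. $\mathrm{SS}_n=\{(x,y)\in[2n-1]\times[2n-1]:x\le y\}$ with the componentwise order. $\mathcal J(P)$ is the set of order ideals of $P$ ordered by inclusion, and on it $\mathrm{Row}(I)=\{x\in P:x\not\ge y\text{ for all maximal elements }y\text{ of }I\}$. *)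

theory Defs
  imports
    "HOL-Algebra.Sym_Groups"
    "HOL-Algebra.Multiplicative_Group"
    "HOL-Algebra.Lattice"
    "HOL-Combinatorics.Orbits"
    "HOL-Library.Multiset"
    "HOL-Library.Product_Order"
begin

section \<open>Orbit structure\<close>

text \<open>
  The forward orbit \<^term>\<open>orbit f x = {(f ^^ k) x | k. 0 < k}\<close> is the full orbit of \<open>x\<close>
  (in particular it contains \<open>x\<close>) when \<open>f\<close> permutes the finite set \<open>A\<close>, the only intended use.
\<close>

definition orbit_structure :: "('a \<Rightarrow> 'a) \<Rightarrow> 'a set \<Rightarrow> nat multiset" where
  "orbit_structure f A = image_mset card (mset_set (orbit f ` A))"


section \<open>Weak order and biCambrian congruences\<close>

text \<open>Throughout, \<open>(G, S)\<close> is meant to be a finite Coxeter system; words are lists over \<open>S\<close>.\<close>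

definition word_prod :: "('a, 'b) monoid_scheme \<Rightarrow> 'a list \<Rightarrow> 'a" where
  "word_prod G ws = foldr (mult G) ws (one G)"

definition reduced_word :: "('a, 'b) monoid_scheme \<Rightarrow> 'a set \<Rightarrow> 'a list \<Rightarrow> 'a \<Rightarrow> bool" where
  "reduced_word G S ws w \<longleftrightarrow>
     set ws \<subseteq> S \<and> word_prod G ws = w \<and>
     (\<forall>vs. set vs \<subseteq> S \<and> word_prod G vs = w \<longrightarrow> length ws \<le> length vs)"

text \<open>The right weak order: \<open>u \<le> w\<close> iff \<open>u\<close> is a prefix of \<open>w\<close>.\<close>

definition weak_order :: "('a, 'b) monoid_scheme \<Rightarrow> 'a set \<Rightarrow> 'a gorder" where
  "weak_order G S =
     \<lparr> carrier = carrier G, eq = (=),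
       le = (\<lambda>u w. \<exists>us vs. word_prod G us = u \<and> reduced_word G S (us @ vs) w) \<rparr>"

definition lattice_congruence :: "('a, 'b) gorder_scheme \<Rightarrow> ('a \<times> 'a) set \<Rightarrow> bool" where
  "lattice_congruence L \<theta> \<longleftrightarrow>
     equiv (carrier L) \<theta> \<and>
     (\<forall>x x' y y'. (x, x') \<in> \<theta> \<longrightarrow> (y, y') \<in> \<theta> \<longrightarrow>
        (x \<squnion>\<^bsub>L\<^esub> y, x' \<squnion>\<^bsub>L\<^esub> y') \<in> \<theta> \<and> (x \<sqinter>\<^bsub>L\<^esub> y, x' \<sqinter>\<^bsub>L\<^esub> y') \<in> \<theta>)"

definition precedes :: "('a, 'b) monoid_scheme \<Rightarrow> 'a set \<Rightarrow> 'a \<Rightarrow> 'a \<Rightarrow> 'a \<Rightarrow> bool" where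
  "precedes G S c s t \<longleftrightarrow>
     (\<exists>ws i j. reduced_word G S ws c \<and> i < j \<and> j < length ws \<and> ws ! i = s \<and> ws ! j = t)"

definition alternating_word :: "'a \<Rightarrow> 'a \<Rightarrow> nat \<Rightarrow> 'a list" where
  "alternating_word t s k = map (\<lambda>i. if even i then t else s) [0..<k]"

definition cambrian_generators ::
    "('a, 'b) monoid_scheme \<Rightarrow> 'a set \<Rightarrow> 'a \<Rightarrow> ('a \<times> 'a) set" where
  "cambrian_generators G S c =
     {(t, word_prod G (alternating_word t s (group.ord G (s \<otimes>\<^bsub>G\<^esub> t) - 1))) | s t.
        s \<in> S \<and> t \<in> S \<and> group.ord G (s \<otimes>\<^bsub>G\<^esub> t) \<ge> 3 \<and> precedes G S c s t}"

definition cambrian_congruence ::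
    "('a, 'b) monoid_scheme \<Rightarrow> 'a set \<Rightarrow> 'a \<Rightarrow> ('a \<times> 'a) set" where
  "cambrian_congruence G S c =
     \<Inter> {\<theta>. lattice_congruence (weak_order G S) \<theta> \<and> cambrian_generators G S c \<subseteq> \<theta>}"

definition bicambrian_congruence ::
    "('a, 'b) monoid_scheme \<Rightarrow> 'a set \<Rightarrow> 'a \<Rightarrow> ('a \<times> 'a) set" where
  "bicambrian_congruence G S c =
     cambrian_congruence G S c \<inter> cambrian_congruence G S (inv\<^bsub>G\<^esub> c)"

text \<open>The minimum of the congruence class of \<open>x\<close>.\<close>

definition pi_down :: "('a, 'b) monoid_scheme \<Rightarrow> 'a set \<Rightarrow> 'a \<Rightarrow> 'a \<Rightarrow> 'a" where
  "pi_down G S c x = (THE m. least (weak_order G S) m (bicambrian_congruence G S c `` {x}))"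


section \<open>Rowmotion on a finite semidistributive lattice\<close>

definition covers :: "('a, 'b) gorder_scheme \<Rightarrow> 'a \<Rightarrow> 'a \<Rightarrow> bool" where
  "covers L x y \<longleftrightarrow>
     x \<in> carrier L \<and> y \<in> carrier L \<and> x \<sqsubset>\<^bsub>L\<^esub> y \<and>
     \<not> (\<exists>z \<in> carrier L. x \<sqsubset>\<^bsub>L\<^esub> z \<and> z \<sqsubset>\<^bsub>L\<^esub> y)"

definition join_irreducible :: "('a, 'b) gorder_scheme \<Rightarrow> 'a \<Rightarrow> bool" where
  "join_irreducible L j \<longleftrightarrow> j \<in> carrier L \<and> (\<exists>!x. covers L x j)"

definition lower_cover :: "('a, 'b) gorder_scheme \<Rightarrow> 'a \<Rightarrow> 'a" where
  "lower_cover L j = (THE x. covers L x j)"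

definition kappa :: "('a, 'b) gorder_scheme \<Rightarrow> 'a \<Rightarrow> 'a" where
  "kappa L j = (THE m. greatest L m {z \<in> carrier L. z \<sqinter>\<^bsub>L\<^esub> j = lower_cover L j})"

definition cover_label :: "('a, 'b) gorder_scheme \<Rightarrow> 'a \<Rightarrow> 'a \<Rightarrow> 'a" where
  "cover_label L x y = (THE j. join_irreducible L j \<and> j \<sqsubseteq>\<^bsub>L\<^esub> y \<and> x \<sqsubseteq>\<^bsub>L\<^esub> kappa L j)"

definition down_labels :: "('a, 'b) gorder_scheme \<Rightarrow> 'a \<Rightarrow> 'a set" where
  "down_labels L z = {cover_label L x z | x. covers L x z}"

definition up_labels :: "('a, 'b) gorder_scheme \<Rightarrow> 'a \<Rightarrow> 'a set" where
  "up_labels L z = {cover_label L z y | y. covers L z y}"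

definition lattice_row :: "('a, 'b) gorder_scheme \<Rightarrow> 'a \<Rightarrow> 'a" where
  "lattice_row L x = (THE r. r \<in> carrier L \<and> up_labels L r = down_labels L x)"


section \<open>The Coxeter group of type B and its bipartite biCambrian lattice\<close>

definition longest_perm :: "nat \<Rightarrow> nat \<Rightarrow> nat" where
  "longest_perm m i = (if i \<in> {1..m} then m + 1 - i else i)"

definition type_B_group :: "nat \<Rightarrow> (nat \<Rightarrow> nat) monoid" where
  "type_B_group n = (sym_group (2 * n))
     \<lparr> carrier := {x \<in> carrier (sym_group (2 * n)).
                   longest_perm (2 * n) \<circ> x \<circ> longest_perm (2 * n) = x} \<rparr>"

definition adj_transp :: "nat \<Rightarrow> nat \<Rightarrow> nat" where
  "adj_transp i = transpose i (i + 1)"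

definition type_B_simple :: "nat \<Rightarrow> nat \<Rightarrow> (nat \<Rightarrow> nat)" where
  "type_B_simple n i =
     (if i = n then adj_transp n else adj_transp i \<circ> adj_transp (2 * n - i))"

definition type_B_simples :: "nat \<Rightarrow> (nat \<Rightarrow> nat) set" where
  "type_B_simples n = type_B_simple n ` {1..n}"

text \<open>
  The order of the factors within each of the two products below is immaterial, as generators
  whose indices have the same parity commute.
\<close>

definition c_plus :: "nat \<Rightarrow> (nat \<Rightarrow> nat)" where
  "c_plus n = word_prod (type_B_group n) (map (type_B_simple n) (filter even [1..<n + 1]))"

definition c_minus :: "nat \<Rightarrow> (nat \<Rightarrow> nat)" where
  "c_minus n = word_prod (type_B_group n) (map (type_B_simple n) (filter odd [1..<n + 1]))"

definition bipartite_coxeter_B :: "nat \<Rightarrow> (nat \<Rightarrow> nat)" where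
  "bipartite_coxeter_B n = c_plus n \<otimes>\<^bsub>type_B_group n\<^esub> c_minus n"

definition weak_order_B :: "nat \<Rightarrow> (nat \<Rightarrow> nat) gorder" where
  "weak_order_B n = weak_order (type_B_group n) (type_B_simples n)"

definition pi_down_B :: "nat \<Rightarrow> (nat \<Rightarrow> nat) \<Rightarrow> (nat \<Rightarrow> nat)" where
  "pi_down_B n = pi_down (type_B_group n) (type_B_simples n) (bipartite_coxeter_B n)"

text \<open>
  The set of class minima with the order induced from the weak order. Meets and joins in it are
  its own and need not agree with those of the weak order.
\<close>

definition bicambrian_lattice_B :: "nat \<Rightarrow> (nat \<Rightarrow> nat) gorder" where
  "bicambrian_lattice_B n =
     (weak_order_B n) \<lparr> carrier := pi_down_B n ` carrier (type_B_group n) \<rparr>"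

definition Row_B :: "nat \<Rightarrow> (nat \<Rightarrow> nat) \<Rightarrow> (nat \<Rightarrow> nat)" where
  "Row_B n = lattice_row (bicambrian_lattice_B n)"


section \<open>Rowmotion on order ideals and the shifted staircase\<close>

definition order_ideals :: "'a::order set \<Rightarrow> 'a set set" where
  "order_ideals P = {I. I \<subseteq> P \<and> (\<forall>x \<in> I. \<forall>y \<in> P. y \<le> x \<longrightarrow> y \<in> I)}"

definition maximal_elements :: "'a::order set \<Rightarrow> 'a set" where
  "maximal_elements I = {y \<in> I. \<not> (\<exists>z \<in> I. y < z)}"

definition ideal_row :: "'a::order set \<Rightarrow> 'a set \<Rightarrow> 'a set" where
  "ideal_row P I = {x \<in> P. \<forall>y \<in> maximal_elements I. \<not> y \<le> x}"

text \<open>The order on \<^typ>\<open>nat \<times> nat\<close> is the componentwise one of \<^theory>\<open>HOL-Library.Product_Order\<close>.\<close>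

definition shifted_staircase :: "nat \<Rightarrow> (nat \<times> nat) set" where
  "shifted_staircase n = {(x, y). x \<in> {1..2 * n - 1} \<and> y \<in> {1..2 * n - 1} \<and> x \<le> y}"

end

theory Submission imports Defs begin

text \<open>
  Elements of \<open>B\<^sub>n\<close> are handled through their inversion sets, the symmetric biclosed sets. The Cambrian congruence of
  \<open>c\<close> identifies two elements iff the same arcs lie below them, where an arc stands for a join-irreducible permutation
  that places the even values strictly between its ends on one side and the odd ones on the other; for the inverse of \<open>c\<close>
  the parities are exchanged. Hence the minima of the biCambrian classes are the elements in which the values between the
  ends of every descent alternate between the two sides. Covers in the lattice of minima are labelled by arcs, which are the
  descents of a class minimum and the ascents of a class maximum, so rowmotion turns the descents of the minimum of one
  class into the ascents of the maximum of another.

  A minimum is encoded by \<open>2 * n - 1\<close> bits, the \<open>i\<close>th telling whether the later of the two values \<open>i\<close> and \<open>i + 1\<close> is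
  an end of a descent, the lower end in the case of \<open>i\<close> and the upper end in the case of \<open>i + 1\<close>.
  Inserting the values in increasing order shows that the bits are arbitrary and determine the minimum.
  Comparing the descents of the minimum with the ascents of the maximum of one class shows that rowmotion shifts
  the bits cyclically and negates them. On the other side, an order ideal of the shifted staircase is encoded by a subset
  of \<open>{1..2 * n - 1}\<close> such that rowmotion is a cyclic shift that negates the bit wrapping around. As \<open>2 * n - 1\<close> is odd, the
  two shifts are conjugate.
\<close>

section \<open>Orbit structures of conjugate maps\<close>

text \<open>Each Cambrian congruence is defined as the smallest one, so besides naming the pairs it
  identifies, every collapse must be derived from the generators. Symmetry is the obstacle: a
  generator acts at a value \<open>r\<close> and at \<open>mir r\<close> at once, and an arc may
  pass left of both. A join with a parabolic element suffices while \<open>mir r\<close> does not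
  interfere; otherwise the arc is cut at \<open>r + 1\<close>, or the congruence is dualised. In the
  lattice of minima, labels unique up to equivalence at each cover do the work of
  semidistributivity. Why the shift negates: compare the values \<open>i\<close>,
  \<open>i + 1\<close>, \<open>i + 2\<close>. Unless \<open>i + 1\<close> stands last among them,
  their order alone fixes the two bits in question. If it does, both bits ask about
  \<open>i + 1\<close>, once as the upper end of an ascent of the class maximum and once as the
  lower end of a descent of the class minimum, and exactly one of the two occurs. In the staircase,
  an antichain is a nest of pairs \<open>(x_1, x_k)\<close>, \<open>(x_2, x_(k-1))\<close> and so
  on, so the set of its coordinates determines it; that set is the encoding.\<close>

lemma orbit_image_eq:
  assumes inj: "inj_on h A" and closed: "f ` A \<subseteq> A"
    and conj: "\<And>x. x \<in> A \<Longrightarrow> h (f x) = g (h x)" and x: "x \<in> A"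
  shows "orbit g (h x) = h ` orbit f x"
proof -
  have sub: "(f ^^ k) x \<in> A" for k
    by (induction k) (use x closed in auto)
  have pow: "(g ^^ k) (h x) = h ((f ^^ k) x)" for k
    by (induction k) (use conj sub in auto)
  show ?thesis unfolding orbit_altdef using pow by auto
qed

lemma orbit_structure_conj:
  assumes bij: "bij_betw h A B" and closed: "f ` A \<subseteq> A"
    and conj: "\<And>x. x \<in> A \<Longrightarrow> h (f x) = g (h x)"
  shows "orbit_structure f A = orbit_structure g B"
proof -
  have inj: "inj_on h A" and B: "B = h ` A"
    using bij by (auto simp: bij_betw_def)
  have sub: "orbit f x \<subseteq> A" if "x \<in> A" for x
  proof
    fix y assume "y \<in> orbit f x" then show "y \<in> A"
      by induction (use that closed in auto)
  qed
  have eq: "orbit g ` B = (`) h ` orbit f ` A"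
    using orbit_image_eq[OF inj closed conj] by (force simp: B image_image)
  \<comment> \<open>Distinct orbits need distinct images, or the multiset would lose
    multiplicities.\<close>
  have inj2: "inj_on ((`) h) (orbit f ` A)"
    using inj_on_image_eq_iff[OF inj] sub by (intro inj_onI) auto
  have "orbit_structure g B = image_mset card (image_mset ((`) h) (mset_set (orbit f ` A)))"
    unfolding orbit_structure_def eq using image_mset_mset_set[OF inj2] by simp
  also have "\<dots> = image_mset card (mset_set (orbit f ` A))"
    unfolding multiset.map_comp
  proof (rule image_mset_cong)
    fix U assume "U \<in># mset_set (orbit f ` A)"
    then have "U \<subseteq> A" using sub by (cases "finite (orbit f ` A)") auto
    then show "(card \<circ> (`) h) U = card U" using card_image inj inj_on_subset by (metis comp_apply)
  qed
  finally show ?thesis by (simp add: orbit_structure_def)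
qed

section \<open>Rowmotion on the shifted staircase\<close>

definition lows :: "nat set \<Rightarrow> nat \<Rightarrow> nat" where
  "lows X a = card {x \<in> X. x \<le> a}"

text \<open>For \<open>X\<close> with elements \<open>x_1 < ... < x_k\<close> this is the ideal
  generated by the nested pairs \<open>(x_i, x_(k+1-i))\<close> with \<open>i <= k + 1 - i\<close>:
  membership says that fewer elements of \<open>X\<close> lie below \<open>a\<close> than lie at or
  above \<open>b\<close>.\<close>

definition sub_ideal :: "nat \<Rightarrow> nat set \<Rightarrow> (nat \<times> nat) set" where
  "sub_ideal m X = {(a, b). 1 \<le> a \<and> a \<le> b \<and> b \<le> m \<and> lows X (a - 1) + lows X (b - 1) < card X}"

definition negacyclic :: "nat \<Rightarrow> nat set \<Rightarrow> nat set" where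
  "negacyclic m X = {i \<in> {1..m}. if i < m then i + 1 \<in> X else 1 \<notin> X}"

definition stair :: "nat \<Rightarrow> nat \<Rightarrow> (nat \<times> nat) set" where
  "stair a b = {(x, y). a \<le> x \<and> x \<le> y \<and> y \<le> b}"

lemma shifted_staircase_stair: "shifted_staircase n = stair 1 (2 * n - 1)"
  by (auto simp: shifted_staircase_def stair_def)

lemma finite_stair: "finite (stair a b)"
  by (rule finite_subset[of _ "{..b} \<times> {..b}"]) (auto simp: stair_def)

lemma lows_step:
  assumes "finite X" "1 \<le> a"
  shows "lows X a = lows X (a - 1) + (if a \<in> X then 1 else 0)"
proof -
  have "{x \<in> X. x \<le> a} = {x \<in> X. x \<le> a - 1} \<union> (if a \<in> X then {a} else {})"
  proof (rule Set.set_eqI)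
    fix x
    have "x \<le> a \<longleftrightarrow> x \<le> a - 1 \<or> x = a" using assms(2) by auto
    then show "x \<in> {x \<in> X. x \<le> a} \<longleftrightarrow> x \<in> {x \<in> X. x \<le> a - 1} \<union> (if a \<in> X then {a} else {})"
      by auto
  qed
  moreover have "a \<notin> {x \<in> X. x \<le> a - 1}" using assms(2) by auto
  ultimately show ?thesis using assms(1) by (simp add: lows_def)
qed

lemma lows_mono: "finite X \<Longrightarrow> a \<le> b \<Longrightarrow> lows X a \<le> lows X b"
  unfolding lows_def by (rule card_mono) auto

lemma lows_0: "X \<subseteq> {1..m} \<Longrightarrow> lows X 0 = 0"
  by (auto simp: lows_def)

lemma lows_top: "X \<subseteq> {1..m} \<Longrightarrow> lows X m = card X"
proof -
  assume "X \<subseteq> {1..m}"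
  then have "{x \<in> X. x \<le> m} = X" by auto
  then show ?thesis by (simp add: lows_def)
qed

lemma less_pair_iff: "(a, b) < (c, d) \<longleftrightarrow> a \<le> c \<and> b \<le> d \<and> (a < c \<or> b < d)"
  for a b c d :: nat
  by (auto simp: less_prod_def less_eq_prod_def)

lemma sub_ideal_is_ideal:
  assumes X: "X \<subseteq> {1..m}" shows "sub_ideal m X \<in> order_ideals (stair 1 m)"
proof -
  have f: "finite X" using X finite_subset by blast
  have "lows X (c - 1) + lows X (d - 1) \<le> lows X (a - 1) + lows X (b - 1)" if "c \<le> a" "d \<le> b" for a b c d
    using lows_mono[OF f, of "c - 1" "a - 1"] lows_mono[OF f, of "d - 1" "b - 1"] that by linarith
  then have "(c, d) \<in> sub_ideal m X"
    if "(a, b) \<in> sub_ideal m X" "(c, d) \<in> stair 1 m" "c \<le> a" "d \<le> b" for a b c d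
    using that le_less_trans by (fastforce simp: sub_ideal_def stair_def)
  then show ?thesis unfolding order_ideals_def
    by (auto simp: sub_ideal_def stair_def less_eq_prod_def)
qed

text \<open>If \<open>c\<close> is the \<open>i\<close>-th element of \<open>X\<close>, the equation
  makes \<open>d\<close> the \<open>i\<close>-th from the top. Such a pair is maximal because
  raising either coordinate past an element of \<open>X\<close> lifts the count to
  \<open>card X\<close>.\<close>

lemma maximal_sub_ideal:
  assumes X: "X \<subseteq> {1..m}"
  shows "(c, d) \<in> maximal_elements (sub_ideal m X) \<longleftrightarrow>
    1 \<le> c \<and> c \<le> d \<and> d \<le> m \<and> c \<in> X \<and> d \<in> X \<and> lows X (c - 1) + lows X d = card X"
proof -
  have f: "finite X" using X finite_subset by blast
  show ?thesis
  proof
    assume max: "(c, d) \<in> maximal_elements (sub_ideal m X)"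
    then have mem: "1 \<le> c" "c \<le> d" "d \<le> m" "lows X (c - 1) + lows X (d - 1) < card X"
      by (auto simp: maximal_elements_def sub_ideal_def)
    have no: "(c', d') \<notin> sub_ideal m X" if "(c, d) < (c', d')" for c' d'
      using max that by (auto simp: maximal_elements_def)
    \<comment> \<open>For \<open>d = m\<close> there is no pair \<open>(c, d + 1)\<close> to
      exclude; the count of all of \<open>X\<close> takes its place.\<close>
    have ge: "lows X (c - 1) + lows X d \<ge> card X"
    proof (cases "d = m")
      case True then show ?thesis using lows_top[OF X] by simp
    next
      case False
      then have "(c, d + 1) \<notin> sub_ideal m X" by (intro no) (auto simp: less_pair_iff)
      then show ?thesis using False mem by (auto simp: sub_ideal_def)
    qed
    then have d: "d \<in> X" and eq: "lows X (c - 1) + lows X d = card X"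
      using lows_step[OF f, of d] mem by (auto split: if_splits)
    have c: "c \<in> X"
    proof (cases "c = d")
      case False
      then have "(c + 1, d) \<notin> sub_ideal m X" by (intro no) (auto simp: less_pair_iff)
      then have "lows X c + lows X (d - 1) \<ge> card X" using False mem by (auto simp: sub_ideal_def)
      then show ?thesis using lows_step[OF f, of c] lows_step[OF f, of d] mem eq d
        by (auto split: if_splits)
    qed (use d in simp)
    show "1 \<le> c \<and> c \<le> d \<and> d \<le> m \<and> c \<in> X \<and> d \<in> X \<and> lows X (c - 1) + lows X d = card X"
      using mem c d eq by auto
  next
    assume h: "1 \<le> c \<and> c \<le> d \<and> d \<le> m \<and> c \<in> X \<and> d \<in> X \<and> lows X (c - 1) + lows X d = card X"
    have sd: "lows X d = lows X (d - 1) + 1" and sc: "lows X c = lows X (c - 1) + 1"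
      using lows_step[OF f, of d] lows_step[OF f, of c] h by auto
    have no: "(c', d') \<notin> sub_ideal m X" if lt: "(c, d) < (c', d')" for c' d'
    proof
      assume "(c', d') \<in> sub_ideal m X"
      then have s: "lows X (c' - 1) + lows X (d' - 1) < card X" by (auto simp: sub_ideal_def)
      have le: "c \<le> c'" "d \<le> d'" "c < c' \<or> d < d'" using lt by (auto simp: less_pair_iff)
      have m1: "lows X (c - 1) \<le> lows X (c' - 1)" "lows X (d - 1) \<le> lows X (d' - 1)"
        using le by (auto intro!: lows_mono[OF f])
      show False
      proof (cases "c < c'")
        case True
        then have "lows X c \<le> lows X (c' - 1)" by (intro lows_mono[OF f]) auto
        then show False using s m1 sc sd h by linarith
      next
        case False
        then have "lows X d \<le> lows X (d' - 1)" using le by (intro lows_mono[OF f]) auto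
        then show False using s m1 sc sd h by linarith
      qed
    qed
    show "(c, d) \<in> maximal_elements (sub_ideal m X)"
      using h sd no by (auto simp: maximal_elements_def sub_ideal_def)
  qed
qed

text \<open>Lowering \<open>a\<close> and then \<open>b\<close> as far as the inequality permits
  stops on an element of \<open>X\<close> each time, hence on a maximal pair.\<close>

lemma above_maximal_sub_ideal:
  assumes X: "X \<subseteq> {1..m}" and ab: "(a, b) \<in> stair 1 m"
  shows "(\<exists>y \<in> maximal_elements (sub_ideal m X). y \<le> (a, b)) \<longleftrightarrow> lows X a + lows X b > card X"
proof -
  have f: "finite X" using X finite_subset by blast
  show ?thesis
  proof
    assume "\<exists>y \<in> maximal_elements (sub_ideal m X). y \<le> (a, b)"
    then obtain c d where m: "(c, d) \<in> maximal_elements (sub_ideal m X)" and le: "c \<le> a" "d \<le> b"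
      by (auto simp: less_eq_prod_def)
    have "lows X c + lows X d > card X"
      using m lows_step[OF f, of c] unfolding maximal_sub_ideal[OF X] by auto
    then show "lows X a + lows X b > card X"
      using lows_mono[OF f le(1)] lows_mono[OF f le(2)] by linarith
  next
    assume gt: "lows X a + lows X b > card X"
    define c where "c = (LEAST c. lows X c + lows X b > card X)"
    have cgt: "lows X c + lows X b > card X" unfolding c_def by (rule LeastI[of _ a]) (use gt in simp)
    have ca: "c \<le> a" unfolding c_def by (rule Least_le) (use gt in simp)
    have cmin: "lows X (c - 1) + lows X b \<le> card X" if "c \<ge> 1"
      using not_less_Least[of "c - 1" "\<lambda>c. lows X c + lows X b > card X"] that unfolding c_def by force
    have lb: "lows X b \<le> card X" unfolding lows_def using f by (intro card_mono) auto
    then have c1: "c \<ge> 1" using cgt lows_0[OF X] by (cases c) auto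
    \<comment> \<open>\<open>d\<close> is kept at or above \<open>c\<close>, so that the pair stays
      in the staircase; if it stops at \<open>c\<close>, it lies in \<open>X\<close> because
      \<open>c\<close> does.\<close>
    define d where "d = (LEAST d. c \<le> d \<and> lows X c + lows X d > card X)"
    have db: "d \<le> b" unfolding d_def by (rule Least_le) (use cgt ca ab in \<open>auto simp: stair_def\<close>)
    have d: "c \<le> d \<and> lows X c + lows X d > card X" unfolding d_def
      by (rule LeastI[of _ b]) (use cgt ca ab in \<open>auto simp: stair_def\<close>)
    have dmin: "lows X c + lows X (d - 1) \<le> card X" if "c < d"
      using not_less_Least[of "d - 1" "\<lambda>d. c \<le> d \<and> lows X c + lows X d > card X"] that unfolding d_def by force
    have le: "lows X d \<le> lows X b" by (rule lows_mono[OF f db])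
    have cX: "c \<in> X" and ceq: "lows X (c - 1) + lows X d = card X"
      using lows_step[OF f c1] cmin[OF c1] d le by (auto split: if_splits)
    have "d \<in> X"
    proof (cases "c = d")
      case False
      then show ?thesis using lows_step[OF f, of d] dmin d c1 by (auto split: if_splits)
    qed (use cX in simp)
    then have "(c, d) \<in> maximal_elements (sub_ideal m X)"
      unfolding maximal_sub_ideal[OF X] using c1 d db ab cX ceq by (auto simp: stair_def)
    then show "\<exists>y \<in> maximal_elements (sub_ideal m X). y \<le> (a, b)"
      using ca db by (intro bexI[of _ "(c, d)"]) (auto simp: less_eq_prod_def)
  qed
qed

lemma lows_negacyclic:
  assumes X: "X \<subseteq> {1..m}" and m: "m \<ge> 1" and i: "i < m"
  shows "lows (negacyclic m X) i + (if 1 \<in> X then 1 else 0) = lows X (i + 1)"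
  using i
proof (induction i)
  case 0
  have f: "finite X" using X finite_subset by blast
  have "lows (negacyclic m X) 0 = 0" by (rule lows_0[of _ m]) (auto simp: negacyclic_def)
  moreover have "lows X 1 = (if 1 \<in> X then 1 else 0)" using lows_step[OF f, of 1] lows_0[OF X] by simp
  ultimately show ?case by simp
next
  case (Suc i)
  have f: "finite X" using X finite_subset by blast
  have f': "finite (negacyclic m X)" by (auto simp: negacyclic_def)
  have "Suc i \<in> negacyclic m X \<longleftrightarrow> Suc i + 1 \<in> X" using Suc.prems by (auto simp: negacyclic_def)
  then show ?case using Suc lows_step[OF f', of "Suc i"] lows_step[OF f, of "Suc i + 1"] by auto
qed

lemma card_negacyclic:
  assumes X: "X \<subseteq> {1..m}" and m: "m \<ge> 1"
  shows "card (negacyclic m X) + (if 1 \<in> X then 1 else 0) = card X + (if 1 \<in> X then 0 else 1)"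
proof -
  have f': "finite (negacyclic m X)" by (auto simp: negacyclic_def)
  have "lows (negacyclic m X) m = card (negacyclic m X)"
    by (rule lows_top) (auto simp: negacyclic_def)
  moreover have "m \<in> negacyclic m X \<longleftrightarrow> 1 \<notin> X" using m by (auto simp: negacyclic_def)
  moreover have "lows X m = card X" by (rule lows_top[OF X])
  ultimately show ?thesis
    using lows_step[OF f' m] lows_negacyclic[OF X m, of "m - 1"] m by auto
qed

text \<open>Let \<open>e\<close> be 1 if \<open>X\<close> contains 1 and 0 otherwise. The shift
  lowers each of the two counts by \<open>e\<close> and changes the cardinality by
  \<open>1 - 2 * e\<close>. So the condition of being above no maximal pair,
  \<open>lows X a + lows X b <= card X\<close>, becomes the strict inequality that defines the new
  ideal.\<close>

lemma ideal_row_sub_ideal: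
  assumes X: "X \<subseteq> {1..m}" and m: "m \<ge> 1"
  shows "ideal_row (stair 1 m) (sub_ideal m X) = sub_ideal m (negacyclic m X)"
proof -
  have "(a, b) \<in> ideal_row (stair 1 m) (sub_ideal m X) \<longleftrightarrow> (a, b) \<in> sub_ideal m (negacyclic m X)" for a b
  proof (cases "(a, b) \<in> stair 1 m")
    case True
    then have r: "1 \<le> a" "a \<le> b" "b \<le> m" by (auto simp: stair_def)
    have "(a, b) \<in> ideal_row (stair 1 m) (sub_ideal m X) \<longleftrightarrow> lows X a + lows X b \<le> card X"
      using above_maximal_sub_ideal[OF X True] True by (auto simp: ideal_row_def)
    also have "\<dots> \<longleftrightarrow> (a, b) \<in> sub_ideal m (negacyclic m X)"
    proof -
      have "lows (negacyclic m X) (a - 1) + (if 1 \<in> X then 1 else 0) = lows X a"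
        "lows (negacyclic m X) (b - 1) + (if 1 \<in> X then 1 else 0) = lows X b"
        using lows_negacyclic[OF X m, of "a - 1"] lows_negacyclic[OF X m, of "b - 1"] r by simp_all
      moreover have "(a, b) \<in> sub_ideal m (negacyclic m X) \<longleftrightarrow>
          lows (negacyclic m X) (a - 1) + lows (negacyclic m X) (b - 1) < card (negacyclic m X)"
        using r by (simp add: sub_ideal_def)
      moreover note card_negacyclic[OF X m]
      ultimately show ?thesis by (cases "1 \<in> X") (simp; linarith)+
    qed
    finally show ?thesis .
  next
    case False
    then show ?thesis by (auto simp: ideal_row_def sub_ideal_def stair_def)
  qed
  then show ?thesis by auto
qed

lemma negacyclic_subset: "negacyclic m X \<subseteq> {1..m}"
  by (auto simp: negacyclic_def)

text \<open>The corner \<open>(1, m)\<close> shows whether \<open>m\<close> belongs to the set.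
  Rowmotion carries bit 1 to that place, negated, and enough applications of it carry any other bit
  to place 1.\<close>

lemma sub_ideal_inj_aux:
  assumes "X \<subseteq> {1..m}" "Y \<subseteq> {1..m}" "m \<ge> 1" "sub_ideal m X = sub_ideal m Y" "j < m"
  shows "j + 1 \<in> X \<longleftrightarrow> j + 1 \<in> Y"
  using assms
proof (induction j arbitrary: X Y)
  case (0 X Y)
  have top: "(1, m) \<in> sub_ideal m Z \<longleftrightarrow> m \<in> Z" if "Z \<subseteq> {1..m}" for Z
    using lows_step[of Z m] lows_top[OF that] lows_0[OF that] \<open>m \<ge> 1\<close> finite_subset[OF that]
    by (auto simp: sub_ideal_def split: if_splits)
  have "sub_ideal m (negacyclic m X) = sub_ideal m (negacyclic m Y)"
    using ideal_row_sub_ideal 0 by metis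
  then have "m \<in> negacyclic m X \<longleftrightarrow> m \<in> negacyclic m Y"
    using top negacyclic_subset by metis
  then show ?case using \<open>m \<ge> 1\<close> by (auto simp: negacyclic_def)
next
  case (Suc j X Y)
  have "sub_ideal m (negacyclic m X) = sub_ideal m (negacyclic m Y)"
    using ideal_row_sub_ideal Suc.prems by metis
  from Suc.IH[OF negacyclic_subset negacyclic_subset \<open>m \<ge> 1\<close> this] Suc.prems
  show ?case by (auto simp: negacyclic_def)
qed

lemma inj_sub_ideal: "m \<ge> 1 \<Longrightarrow> inj_on (sub_ideal m) (Pow {1..m})"
proof (rule inj_onI, goal_cases)
  case (1 X Y)
  then have "j + 1 \<in> X \<longleftrightarrow> j + 1 \<in> Y" if "j < m" for j
    using sub_ideal_inj_aux[of X m Y j] that by auto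
  then have "i \<in> X \<longleftrightarrow> i \<in> Y" if "i \<in> {1..m}" for i
    using that by (metis Suc_eq_plus1 Suc_le_eq atLeastAtMost_iff Suc_diff_1 le_eq_less_or_eq less_le_trans zero_less_one)
  then show ?case using 1 by blast
qed

text \<open>The boundary of an order ideal is a lattice path starting at the corner \<open>(a, b)\<close>.\<close>

lemma card_order_ideals_stair:
  "card (order_ideals (stair a (a + d))) = 2 ^ (d + 1)"
proof -
  have fin: "finite (order_ideals (stair a b))" for a b
    by (rule finite_subset[of _ "Pow (stair a b)"]) (auto simp: order_ideals_def finite_stair)
  have empty: "order_ideals (stair a b) = {{}}" if "b < a" for a b
    using that by (auto simp: order_ideals_def stair_def)
  \<comment> \<open>An ideal that contains the corner contains the whole first row; deleting this
    row leaves an arbitrary ideal of the staircase starting at \<open>a + 1\<close>.\<close>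
  have step: "card (order_ideals (stair a b)) =
      card (order_ideals (stair (a + 1) b)) + card {I \<in> order_ideals (stair a b). (a, b) \<notin> I}"
    if ab: "a \<le> b" for a b
  proof -
    let ?row = "{(a, y) |y. a \<le> y \<and> y \<le> b}"
    have "bij_betw (\<lambda>J. J \<union> ?row) (order_ideals (stair (a + 1) b)) {I \<in> order_ideals (stair a b). (a, b) \<in> I}"
    proof (rule bij_betw_byWitness[where f' = "\<lambda>I. I - ?row"])
      show "\<forall>J \<in> order_ideals (stair (a + 1) b). J \<union> ?row - ?row = J"
        by (fastforce simp: order_ideals_def stair_def)
      have "?row \<subseteq> I" if "I \<in> order_ideals (stair a b)" "(a, b) \<in> I" for I
      proof
        fix z assume z: "z \<in> ?row"
        then have "z \<in> stair a b" "z \<le> (a, b)" by (auto simp: stair_def less_eq_prod_def)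
        then show "z \<in> I" using that unfolding order_ideals_def by blast
      qed
      then show "\<forall>I \<in> {I \<in> order_ideals (stair a b). (a, b) \<in> I}. I - ?row \<union> ?row = I" by blast
      show "(\<lambda>J. J \<union> ?row) ` order_ideals (stair (a + 1) b) \<subseteq> {I \<in> order_ideals (stair a b). (a, b) \<in> I}"
      proof (intro image_subsetI CollectI conjI)
        fix J assume J: "J \<in> order_ideals (stair (a + 1) b)"
        have 1: "J \<union> ?row \<subseteq> stair a b" using J by (force simp: order_ideals_def stair_def)
        have 2: "y \<in> J \<union> ?row" if x: "x \<in> J \<union> ?row" and y: "y \<in> stair a b" and le: "y \<le> x" for x y
        proof (cases "y \<in> stair (a + 1) b")
          case True
          then have "x \<in> J" using x le by (auto simp: stair_def less_eq_prod_def)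
          then show ?thesis using True J le unfolding order_ideals_def by blast
        next
          case False
          then show ?thesis using y by (force simp: stair_def)
        qed
        show "J \<union> ?row \<in> order_ideals (stair a b)" unfolding order_ideals_def using 1 2 by blast
        show "(a, b) \<in> J \<union> ?row" using ab by auto
      qed
      show "(\<lambda>I. I - ?row) ` {I \<in> order_ideals (stair a b). (a, b) \<in> I} \<subseteq> order_ideals (stair (a + 1) b)"
      proof safe
        fix I assume I: "I \<in> order_ideals (stair a b)" "(a, b) \<in> I"
        have 1: "I - ?row \<subseteq> stair (a + 1) b"
        proof
          fix z assume z: "z \<in> I - ?row"
          then obtain x y where xy: "z = (x, y)" "a \<le> x" "x \<le> y" "y \<le> b"
            using I by (cases z) (auto simp: order_ideals_def stair_def)
          then have "x \<noteq> a" using z by auto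
          then show "z \<in> stair (a + 1) b" using xy by (auto simp: stair_def)
        qed
        have 2: "y \<in> I - ?row" if x: "x \<in> I - ?row" and y: "y \<in> stair (a + 1) b" and le: "y \<le> x" for x y
        proof -
          have "y \<in> stair a b" "y \<notin> ?row" using y by (auto simp: stair_def)
          then show ?thesis using x le I unfolding order_ideals_def by blast
        qed
        show "I - ?row \<in> order_ideals (stair (a + 1) b)" unfolding order_ideals_def using 1 2 by blast
      qed
    qed
    from bij_betw_same_card[OF this]
    have "card (order_ideals (stair (a + 1) b)) = card {I \<in> order_ideals (stair a b). (a, b) \<in> I}" .
    moreover have "order_ideals (stair a b) = {I \<in> order_ideals (stair a b). (a, b) \<in> I} \<union> {I \<in> order_ideals (stair a b). (a, b) \<notin> I}"
      by auto
    then have "card (order_ideals (stair a b)) = card {I \<in> order_ideals (stair a b). (a, b) \<in> I} + card {I \<in> order_ideals (stair a b). (a, b) \<notin> I}"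
      using fin[of a b] by (subst card_Un_disjoint[symmetric]) (auto intro: finite_subset)
    ultimately show ?thesis by simp
  qed
  \<comment> \<open>Every element of the last column lies above the corner, so an ideal without the
    corner avoids that column.\<close>
  have step2: "{I \<in> order_ideals (stair a (Suc b)). (a, Suc b) \<notin> I} = order_ideals (stair a b)"
    if ab: "a \<le> Suc b" for a b
  proof (intro equalityI subsetI)
    fix I assume "I \<in> {I \<in> order_ideals (stair a (Suc b)). (a, Suc b) \<notin> I}"
    then have I: "I \<in> order_ideals (stair a (Suc b))" "(a, Suc b) \<notin> I" by auto
    have 1: "I \<subseteq> stair a b"
    proof
      fix z assume z: "z \<in> I"
      then obtain x y where xy: "z = (x, y)" "a \<le> x" "x \<le> y" "y \<le> Suc b"
        using I by (cases z) (auto simp: order_ideals_def stair_def)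
      have "y \<noteq> Suc b"
      proof
        assume "y = Suc b"
        then have "(a, Suc b) \<le> z" "(a, Suc b) \<in> stair a (Suc b)"
          using xy ab by (auto simp: less_eq_prod_def stair_def)
        then show False using I z unfolding order_ideals_def by blast
      qed
      then show "z \<in> stair a b" using xy by (auto simp: stair_def)
    qed
    have 2: "y \<in> I" if "x \<in> I" "y \<in> stair a b" "y \<le> x" for x y
    proof -
      have "y \<in> stair a (Suc b)" using that by (auto simp: stair_def)
      then show ?thesis using I that unfolding order_ideals_def by blast
    qed
    show "I \<in> order_ideals (stair a b)" unfolding order_ideals_def using 1 2 by blast
  next
    fix I assume I: "I \<in> order_ideals (stair a b)"
    then have "I \<subseteq> stair a b" by (auto simp: order_ideals_def)
    then have 1: "I \<subseteq> stair a (Suc b)" "(a, Suc b) \<notin> I" by (auto simp: stair_def)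
    have 2: "y \<in> I" if "x \<in> I" "y \<in> stair a (Suc b)" "y \<le> x" for x y
    proof -
      have "y \<in> stair a b" using that \<open>I \<subseteq> stair a b\<close> by (cases x; cases y) (force simp: stair_def less_eq_prod_def)
      then show ?thesis using I that unfolding order_ideals_def by blast
    qed
    show "I \<in> {I \<in> order_ideals (stair a (Suc b)). (a, Suc b) \<notin> I}"
      unfolding order_ideals_def using 1 2 by blast
  qed
  show ?thesis
  proof (induction d arbitrary: a)
    case 0
    have "{I \<in> order_ideals (stair a a). (a, a) \<notin> I} = {{}}"
      by (auto simp: order_ideals_def stair_def)
    then show ?case using step[of a a] empty[of a "a + 1"] by simp
  next
    case (Suc d)
    have e: "a + Suc d = Suc (a + d)" by simp
    have "card (order_ideals (stair a (Suc (a + d)))) = card (order_ideals (stair (a + 1) ((a + 1) + d))) + card (order_ideals (stair a (a + d)))"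
      using step[of a "Suc (a + d)"] step2[of a "a + d"] by simp
    then show ?case unfolding e using Suc.IH[of a] Suc.IH[of "a + 1"] by simp
  qed
qed

text \<open>Injectivity together with the common cardinality \<open>2 ^ m\<close> replaces a
  reconstruction of the subset from the ideal.\<close>

lemma bij_sub_ideal:
  assumes m: "m \<ge> 1" shows "bij_betw (sub_ideal m) (Pow {1..m}) (order_ideals (stair 1 m))"
proof -
  have fin: "finite (order_ideals (stair 1 m))"
    by (rule finite_subset[of _ "Pow (stair 1 m)"]) (auto simp: order_ideals_def finite_stair)
  have "card (sub_ideal m ` Pow {1..m}) = 2 ^ m"
    using card_image[OF inj_sub_ideal[OF m]] card_Pow[of "{1..m}"] by simp
  moreover have "card (order_ideals (stair 1 m)) = 2 ^ m"
    using card_order_ideals_stair[of 1 "m - 1"] m by simp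
  moreover have "sub_ideal m ` Pow {1..m} \<subseteq> order_ideals (stair 1 m)"
    using sub_ideal_is_ideal by auto
  ultimately have "sub_ideal m ` Pow {1..m} = order_ideals (stair 1 m)"
    using card_subset_eq[OF fin] by metis
  then show ?thesis using inj_sub_ideal[OF m] by (simp add: bij_betw_def)
qed

lemma orbit_structure_ideal_row:
  assumes m: "m \<ge> 1"
  shows "orbit_structure (ideal_row (stair 1 m)) (order_ideals (stair 1 m)) =
    orbit_structure (negacyclic m) (Pow {1..m})"
  by (rule orbit_structure_conj[OF bij_sub_ideal[OF m], symmetric])
    (use negacyclic_subset ideal_row_sub_ideal[OF _ m] in auto)

section \<open>Rowmotion through labels\<close>

text \<open>
  \<open>A x\<close> plays the role of the labels \<open>\<lambda>\<close> with \<open>j\<^sub>\<lambda> \<le> x\<close> and \<open>B x\<close> that of the labels with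
  \<open>x \<le> \<kappa>(j\<^sub>\<lambda>)\<close>; several labels, related by \<open>E\<close>, may stand for the same join-irreducible.
\<close>

locale label_lattice =
  fixes L :: "('a, 'b) gorder_scheme" (structure)
    and A B :: "'a \<Rightarrow> 'l set" and E :: "'l \<Rightarrow> 'l \<Rightarrow> bool"
  assumes fin: "finite (carrier L)"
    and eq_eq: "\<And>x y. x .= y \<longleftrightarrow> x = y"
    and le_A: "\<And>x y. x \<in> carrier L \<Longrightarrow> y \<in> carrier L \<Longrightarrow> x \<sqsubseteq> y \<longleftrightarrow> A x \<subseteq> A y"
    and le_B: "\<And>x y. x \<in> carrier L \<Longrightarrow> y \<in> carrier L \<Longrightarrow> x \<sqsubseteq> y \<longleftrightarrow> B y \<subseteq> B x"
    and A_inj: "\<And>x y. x \<in> carrier L \<Longrightarrow> y \<in> carrier L \<Longrightarrow> A x = A y \<Longrightarrow> x = y"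
    and A_meet: "\<And>x y. x \<in> carrier L \<Longrightarrow> y \<in> carrier L \<Longrightarrow> \<exists>z \<in> carrier L. A z = A x \<inter> A y"
    and B_join: "\<And>x y. x \<in> carrier L \<Longrightarrow> y \<in> carrier L \<Longrightarrow> \<exists>z \<in> carrier L. B z = B x \<inter> B y"
    and disj: "\<And>x l. x \<in> carrier L \<Longrightarrow> l \<in> A x \<Longrightarrow> l \<in> B x \<Longrightarrow> False"
    and sep: "\<And>x y. x \<in> carrier L \<Longrightarrow> y \<in> carrier L \<Longrightarrow> \<not> y \<sqsubseteq> x \<Longrightarrow> \<exists>l. l \<in> A y \<and> l \<in> B x"
    and uniq: "\<And>x y l k. covers L x y \<Longrightarrow> l \<in> A y \<Longrightarrow> l \<in> B x \<Longrightarrow> k \<in> A y \<Longrightarrow> k \<in> B x \<Longrightarrow> E l k"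
    and E_A: "\<And>x l k. x \<in> carrier L \<Longrightarrow> l \<in> A x \<Longrightarrow> E l k \<Longrightarrow> k \<in> A x"
    and E_B: "\<And>x l k. x \<in> carrier L \<Longrightarrow> l \<in> B x \<Longrightarrow> E l k \<Longrightarrow> k \<in> B x"
begin

section \<open>Order and covers read off from the label sets\<close>

definition D :: "'a \<Rightarrow> 'l set" where "D y = {l. \<exists>x. covers L x y \<and> l \<in> A y \<and> l \<in> B x}"
definition U :: "'a \<Rightarrow> 'l set" where "U x = {l. \<exists>y. covers L x y \<and> l \<in> A y \<and> l \<in> B x}"

lemma refl_le: "x \<in> carrier L \<Longrightarrow> x \<sqsubseteq> x"
  by (simp add: le_A)

lemma antisym_le: "x \<in> carrier L \<Longrightarrow> y \<in> carrier L \<Longrightarrow> x \<sqsubseteq> y \<Longrightarrow> y \<sqsubseteq> x \<Longrightarrow> x = y"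
  using A_inj le_A by blast

lemma trans_le: "x \<in> carrier L \<Longrightarrow> y \<in> carrier L \<Longrightarrow> z \<in> carrier L \<Longrightarrow> x \<sqsubseteq> y \<Longrightarrow> y \<sqsubseteq> z \<Longrightarrow> x \<sqsubseteq> z"
  using le_A by blast

lemma coversD:
  assumes "covers L x y"
  shows "x \<in> carrier L" "y \<in> carrier L" "x \<sqsubseteq> y" "x \<noteq> y" "\<not> y \<sqsubseteq> x"
    "\<And>z. z \<in> carrier L \<Longrightarrow> x \<sqsubseteq> z \<Longrightarrow> z \<sqsubseteq> y \<Longrightarrow> z = x \<or> z = y"
  using assms antisym_le by (auto simp: covers_def lless_def eq_eq)

lemma coversI:
  assumes "x \<in> carrier L" "y \<in> carrier L" "x \<sqsubseteq> y" "x \<noteq> y"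
    "\<And>z. z \<in> carrier L \<Longrightarrow> x \<sqsubseteq> z \<Longrightarrow> z \<sqsubseteq> y \<Longrightarrow> z = x \<or> z = y"
  shows "covers L x y"
  using assms by (auto simp: covers_def lless_def eq_eq)

lemma A_minimal:
  assumes "S \<subseteq> carrier L" "S \<noteq> {}"
  obtains m where "m \<in> S" "\<And>z. z \<in> S \<Longrightarrow> z \<sqsubseteq> m \<Longrightarrow> z = m"
proof -
  have "finite (A ` S)" "A ` S \<noteq> {}" using assms fin finite_subset by auto
  from finite_has_minimal[OF this] obtain m where m: "m \<in> S" "\<forall>b \<in> A ` S. b \<subseteq> A m \<longrightarrow> A m = b"
    by auto
  have "z = m" if "z \<in> S" "z \<sqsubseteq> m" for z
  proof -
    have "A z \<subseteq> A m" using that assms(1) m(1) le_A[of z m] by blast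
    then have "A z = A m" using m(2) that by blast
    then show ?thesis using A_inj[of z m] that m assms(1) by blast
  qed
  then show thesis using that m by blast
qed

lemma A_maximal:
  assumes "S \<subseteq> carrier L" "S \<noteq> {}"
  obtains m where "m \<in> S" "\<And>z. z \<in> S \<Longrightarrow> m \<sqsubseteq> z \<Longrightarrow> z = m"
proof -
  have "finite (A ` S)" "A ` S \<noteq> {}" using assms fin finite_subset by auto
  from finite_has_maximal[OF this] obtain m where m: "m \<in> S" "\<forall>b \<in> A ` S. A m \<subseteq> b \<longrightarrow> A m = b"
    by auto
  have "z = m" if "z \<in> S" "m \<sqsubseteq> z" for z
  proof -
    have "A m \<subseteq> A z" using that assms(1) m(1) le_A[of m z] by blast
    then have "A z = A m" using m(2) that by blast
    then show ?thesis using A_inj[of z m] that m assms(1) by blast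
  qed
  then show thesis using that m by blast
qed

lemma cover_above:
  assumes "x \<in> carrier L" "y \<in> carrier L" "x \<sqsubseteq> y" "x \<noteq> y"
  obtains z where "covers L x z" "z \<sqsubseteq> y"
proof -
  let ?S = "{z \<in> carrier L. x \<sqsubseteq> z \<and> x \<noteq> z \<and> z \<sqsubseteq> y}"
  have "?S \<noteq> {}" using assms refl_le by auto
  then obtain m where m: "m \<in> ?S" "\<And>z. z \<in> ?S \<Longrightarrow> z \<sqsubseteq> m \<Longrightarrow> z = m"
    using A_minimal[of ?S] by blast
  have "covers L x m"
    by (rule coversI) (use assms m trans_le[of _ m y] in blast)+
  then show thesis using that m by blast
qed

lemma cover_below:
  assumes "x \<in> carrier L" "y \<in> carrier L" "x \<sqsubseteq> y" "x \<noteq> y"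
  obtains z where "covers L z y" "x \<sqsubseteq> z"
proof -
  let ?S = "{z \<in> carrier L. x \<sqsubseteq> z \<and> z \<noteq> y \<and> z \<sqsubseteq> y}"
  have "?S \<noteq> {}" using assms refl_le by auto
  then obtain m where m: "m \<in> ?S" "\<And>z. z \<in> ?S \<Longrightarrow> m \<sqsubseteq> z \<Longrightarrow> z = m"
    using A_maximal[of ?S] by blast
  have "covers L m y"
    by (rule coversI) (use assms m trans_le[of x m] in blast)+
  then show thesis using that m by blast
qed

section \<open>The join-irreducible and the meet-irreducible attached to a label\<close>

definition is_J :: "'l \<Rightarrow> 'a \<Rightarrow> bool" where
  "is_J l j \<longleftrightarrow> j \<in> carrier L \<and> (\<forall>z \<in> carrier L. l \<in> A z \<longleftrightarrow> j \<sqsubseteq> z)"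
definition is_M :: "'l \<Rightarrow> 'a \<Rightarrow> bool" where
  "is_M l m \<longleftrightarrow> m \<in> carrier L \<and> (\<forall>z \<in> carrier L. l \<in> B z \<longleftrightarrow> z \<sqsubseteq> m)"

text \<open>Closure under meets makes a minimal element carrying the label the least one. The
  element of \<open>is_M\<close> arises in the same way from joins and \<open>B\<close>.\<close>

lemma ex_J:
  assumes "y \<in> carrier L" "l \<in> A y" shows "\<exists>j. is_J l j"
proof -
  let ?S = "{z \<in> carrier L. l \<in> A z}"
  obtain m where m: "m \<in> ?S" "\<And>z. z \<in> ?S \<Longrightarrow> z \<sqsubseteq> m \<Longrightarrow> z = m"
    using A_minimal[of ?S] assms by blast
  have "m \<sqsubseteq> z" if z: "z \<in> ?S" for z
  proof -
    obtain w where w: "w \<in> carrier L" "A w = A m \<inter> A z" using A_meet[of m z] m z by blast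
    then have "w = m" using m z le_A[of w m] by auto
    then show ?thesis using w z m le_A[of m z] by auto
  qed
  then have "is_J l m" unfolding is_J_def using m le_A by blast
  then show ?thesis ..
qed

lemma ex_M:
  assumes "y \<in> carrier L" "l \<in> B y" shows "\<exists>j. is_M l j"
proof -
  let ?S = "{z \<in> carrier L. l \<in> B z}"
  obtain m where m: "m \<in> ?S" "\<And>z. z \<in> ?S \<Longrightarrow> m \<sqsubseteq> z \<Longrightarrow> z = m"
    using A_maximal[of ?S] assms by blast
  have "z \<sqsubseteq> m" if z: "z \<in> ?S" for z
  proof -
    obtain w where w: "w \<in> carrier L" "B w = B m \<inter> B z" using B_join[of m z] m z by blast
    then have "w = m" using m z le_B[of m w] by auto
    then show ?thesis using w z m le_B[of z m] by auto
  qed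
  then have "is_M l m" unfolding is_M_def using m le_B by blast
  then show ?thesis ..
qed

lemma is_J_unique: "is_J l j \<Longrightarrow> is_J l j' \<Longrightarrow> j = j'"
  using antisym_le refl_le unfolding is_J_def by blast

lemma meet_eq:
  assumes "x \<in> carrier L" "y \<in> carrier L" "z \<in> carrier L" "A z = A x \<inter> A y"
  shows "x \<sqinter> y = z"
proof -
  have g: "greatest L z (Lower L {x, y})"
    using assms le_A by (auto simp: greatest_def Lower_def)
  have "w = z" if "greatest L w (Lower L {x, y})" for w
    using that g antisym_le[of w z] by (auto simp: greatest_def Lower_def)
  then show ?thesis unfolding meet_def inf_def using g by (rule some_equality[rotated])
qed

text \<open>The two consequences of \<open>uniq\<close> that carry the semidistributivity of \<open>L\<close>.\<close>

lemma below_cover: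
  assumes "covers L x y" "l \<in> A y" "l \<in> B x" "z \<in> carrier L" "z \<sqsubseteq> y" "l \<notin> A z"
  shows "z \<sqsubseteq> x"
proof (rule ccontr)
  assume "\<not> z \<sqsubseteq> x"
  then obtain k where k: "k \<in> A z" "k \<in> B x" using sep[of x z] assms coversD[OF assms(1)] by blast
  then have "k \<in> A y" using assms le_A coversD[OF assms(1)] by blast
  then have "E k l" using uniq[OF assms(1)] k assms by blast
  then show False using E_A k assms by blast
qed

lemma above_cover:
  assumes "covers L x y" "l \<in> A y" "l \<in> B x" "z \<in> carrier L" "x \<sqsubseteq> z" "l \<notin> B z"
  shows "y \<sqsubseteq> z"
proof (rule ccontr)
  assume "\<not> y \<sqsubseteq> z"
  then obtain k where k: "k \<in> A y" "k \<in> B z" using sep[of z y] assms coversD[OF assms(1)] by blast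
  then have "k \<in> B x" using assms le_B coversD[OF assms(1)] by blast
  then have "E k l" using uniq[OF assms(1)] k assms by blast
  then show False using E_B k assms by blast
qed

text \<open>An element strictly below \<open>j\<close> lacks the label, so
  \<open>below_cover\<close> puts it below \<open>x\<close>. Hence everything strictly below
  \<open>j\<close> lies below the meet of \<open>j\<close> and \<open>x\<close>, which is the unique
  lower cover.\<close>

lemma J_lower_cover:
  assumes c: "covers L x y" "l \<in> A y" "l \<in> B x" and j: "is_J l j"
  obtains i where "covers L i j" "l \<in> A j" "l \<in> B i" "i \<sqsubseteq> x"
    "\<And>z. z \<in> carrier L \<Longrightarrow> z \<sqsubseteq> j \<Longrightarrow> z \<noteq> j \<Longrightarrow> z \<sqsubseteq> i"
proof -
  note cd = coversD[OF c(1)]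
  have jC: "j \<in> carrier L" and lj: "l \<in> A j" and jy: "j \<sqsubseteq> y"
    using j c cd refl_le unfolding is_J_def by auto
  obtain i where i: "i \<in> carrier L" "A i = A j \<inter> A x" using A_meet[of j x] jC cd by blast
  have ij: "i \<sqsubseteq> j" "i \<sqsubseteq> x" using i jC cd le_A by auto
  have lx: "l \<notin> A x" using disj c cd by blast
  have low: "z \<sqsubseteq> i" if z: "z \<in> carrier L" "z \<sqsubseteq> j" "z \<noteq> j" for z
  proof -
    have "l \<notin> A z" using j z antisym_le unfolding is_J_def by blast
    moreover have "z \<sqsubseteq> y" using trans_le z jC jy cd by blast
    ultimately have "z \<sqsubseteq> x" using below_cover[OF c z(1)] by blast
    then show ?thesis using z i jC cd le_A[of z x] le_A[of z j] le_A[of z i] by auto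
  qed
  have ne: "i \<noteq> j" using i lx lj by auto
  have "covers L i j"
    by (rule coversI[OF i(1) jC ij(1) ne]) (use low antisym_le i in blast)
  moreover have "l \<in> B i" using ij i cd c le_B by blast
  ultimately show thesis using that ij low lj by blast
qed

lemma lower_cover_eq:
  assumes "covers L i j" "\<And>z. z \<in> carrier L \<Longrightarrow> z \<sqsubseteq> j \<Longrightarrow> z \<noteq> j \<Longrightarrow> z \<sqsubseteq> i"
  shows "join_irreducible L j" "lower_cover L j = i"
proof -
  have "x = i" if "covers L x j" for x
    using assms coversD[OF that] coversD[OF assms(1)] by blast
  then have "\<exists>!x. covers L x j" using assms(1) by blast
  then show "join_irreducible L j" "lower_cover L j = i"
    using coversD[OF assms(1)] assms(1) unfolding join_irreducible_def lower_cover_def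
    by (auto intro: the1_equality)
qed

text \<open>An element whose meet with \<open>j\<close> is the lower cover of \<open>j\<close> lies
  above that lower cover but not above \<open>j\<close>. By \<open>above_cover\<close>, applied to
  the cover below \<open>j\<close>, it has the label in its \<open>B\<close>, that is, it lies below
  \<open>m\<close>.\<close>

lemma kappa_J:
  assumes c: "covers L x y" "l \<in> A y" "l \<in> B x" and j: "is_J l j" and m: "is_M l m"
  shows "join_irreducible L j" "kappa L j = m"
proof -
  obtain i where i: "covers L i j" "l \<in> A j" "l \<in> B i" "i \<sqsubseteq> x"
    and low: "\<And>z. z \<in> carrier L \<Longrightarrow> z \<sqsubseteq> j \<Longrightarrow> z \<noteq> j \<Longrightarrow> z \<sqsubseteq> i"
    using J_lower_cover[OF c j] by blast
  note id = coversD[OF i(1)]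
  from lower_cover_eq[OF i(1) low] show "join_irreducible L j" by blast
  have lc: "lower_cover L j = i" using lower_cover_eq[OF i(1) low] by blast
  have mC: "m \<in> carrier L" and lm: "l \<in> B m" and im: "i \<sqsubseteq> m"
    using m id i refl_le unfolding is_M_def by auto
  have m1: "m \<sqinter> j = i"
  proof -
    obtain w where w: "w \<in> carrier L" "A w = A m \<inter> A j" using A_meet[OF mC id(2)] by blast
    have "l \<notin> A w" using w disj mC lm by blast
    then have "w \<noteq> j" using i by auto
    then have "w \<sqsubseteq> i" using low w le_A id by auto
    moreover have "i \<sqsubseteq> w" using w im id mC le_A by auto
    ultimately have "w = i" using antisym_le w id by blast
    then show ?thesis using meet_eq[of m j w] w mC id by simp
  qed
  have max: "z \<sqsubseteq> m" if z: "z \<in> carrier L" "z \<sqinter> j = i" for z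
  proof -
    obtain w where w: "w \<in> carrier L" "A w = A z \<inter> A j" using A_meet[OF z(1) id(2)] by blast
    then have "w = i" using meet_eq[of z j w] z id by simp
    then have "i \<sqsubseteq> z" using w z id le_A by auto
    moreover have "l \<notin> A i" using disj[of i l] i id by blast
    then have "l \<notin> A z" using w \<open>w = i\<close> i by auto
    then have "\<not> j \<sqsubseteq> z" using le_A[of j z] z id i by blast
    ultimately have "l \<in> B z" using above_cover[OF i(1-3)] z by blast
    then show ?thesis using m z unfolding is_M_def by blast
  qed
  have g: "greatest L m {z \<in> carrier L. z \<sqinter> j = lower_cover L j}"
    using m1 max mC lc by (auto simp: greatest_def)
  have "n = m" if "greatest L n {z \<in> carrier L. z \<sqinter> j = lower_cover L j}" for n
    using that g antisym_le[of n m] mC unfolding greatest_def by blast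
  then show "kappa L j = m" unfolding kappa_def using g by blast
qed

lemma cover_label_eq:
  assumes c: "covers L x y" "l \<in> A y" "l \<in> B x" and j: "is_J l j"
  shows "cover_label L x y = j"
proof -
  note cd = coversD[OF c(1)]
  obtain m where m: "is_M l m" using ex_M c cd by blast
  show ?thesis unfolding cover_label_def
  proof (rule the_equality)
    show "join_irreducible L j \<and> j \<sqsubseteq> y \<and> x \<sqsubseteq> kappa L j"
      using kappa_J[OF c j m] j m c cd unfolding is_J_def is_M_def by auto
  next
    fix j' assume h: "join_irreducible L j' \<and> j' \<sqsubseteq> y \<and> x \<sqsubseteq> kappa L j'"
    then obtain x' where x': "covers L x' j'" and un: "\<And>z. covers L z j' \<Longrightarrow> z = x'"
      unfolding join_irreducible_def by blast
    note xd = coversD[OF x']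
    obtain k where k: "k \<in> A j'" "k \<in> B x'" using sep xd by blast
    \<comment> \<open>A label separating \<open>j'\<close> from its lower cover generates
      \<open>j'\<close>: if \<open>k\<close> were in \<open>A z\<close> without \<open>j'\<close>
      being below \<open>z\<close>, the meet of the two would lie below the lower cover and carry
      \<open>k\<close> into it.\<close>
    have Jk: "is_J k j'"
    proof -
      have "j' \<sqsubseteq> z" if z: "z \<in> carrier L" "k \<in> A z" for z
      proof (rule ccontr)
        assume n: "\<not> j' \<sqsubseteq> z"
        obtain w where w: "w \<in> carrier L" "A w = A z \<inter> A j'" using A_meet z xd by blast
        have "w \<sqsubseteq> j'" "w \<noteq> j'" using w n z xd le_A by auto
        then obtain v where "covers L v j'" "w \<sqsubseteq> v" using cover_below w xd by blast
        then have "w \<sqsubseteq> x'" using un by blast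
        then have "k \<in> A x'" using w z k xd le_A by blast
        then show False using disj xd k by blast
      qed
      then show ?thesis unfolding is_J_def using xd k le_A by blast
    qed
    obtain n where n: "is_M k n" using ex_M k xd by blast
    have "x \<sqsubseteq> n" using kappa_J[OF x' k Jk n] h by simp
    then have "k \<in> B x" using n cd unfolding is_M_def by blast
    moreover have "k \<in> A y" using Jk h cd unfolding is_J_def by blast
    ultimately have "E k l" "E l k" using uniq[OF c(1)] c by auto
    then have "l \<in> A z \<longleftrightarrow> k \<in> A z" if "z \<in> carrier L" for z using E_A that by blast
    then have "is_J l j'" using Jk unfolding is_J_def by blast
    then show "j' = j" using is_J_unique j by blast
  qed
qed

lemma down_labels_eq: "y \<in> carrier L \<Longrightarrow> down_labels L y = {j. \<exists>l \<in> D y. is_J l j}"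
proof -
  assume y: "y \<in> carrier L"
  have "\<exists>l \<in> D y. is_J l (cover_label L x y)" if c: "covers L x y" for x
  proof -
    obtain l where l: "l \<in> A y" "l \<in> B x" using sep coversD[OF c] by blast
    then obtain j where "is_J l j" using ex_J y by blast
    then show ?thesis using cover_label_eq[OF c l] l c unfolding D_def by blast
  qed
  moreover have "\<exists>x. j = cover_label L x y \<and> covers L x y" if "l \<in> D y" "is_J l j" for l j
    using that cover_label_eq unfolding D_def by blast
  ultimately show ?thesis unfolding down_labels_def by blast
qed

lemma up_labels_eq: "x \<in> carrier L \<Longrightarrow> up_labels L x = {j. \<exists>l \<in> U x. is_J l j}"
proof -
  assume x: "x \<in> carrier L"
  have "\<exists>l \<in> U x. is_J l (cover_label L x y)" if c: "covers L x y" for y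
  proof -
    obtain l where l: "l \<in> A y" "l \<in> B x" using sep coversD[OF c] by blast
    then obtain j where "is_J l j" using ex_J coversD[OF c] by blast
    then show ?thesis using cover_label_eq[OF c l] l c unfolding U_def by blast
  qed
  moreover have "\<exists>y. j = cover_label L x y \<and> covers L x y" if "l \<in> U x" "is_J l j" for l j
    using that cover_label_eq unfolding U_def by blast
  ultimately show ?thesis unfolding up_labels_def by blast
qed

text \<open>Both labels also sit on the single cover below their common join-irreducible, where
  labels are unique up to \<open>E\<close>.\<close>

lemma same_J_E:
  assumes "covers L x y" "l \<in> A y" "l \<in> B x" "covers L x' y'" "k \<in> A y'" "k \<in> B x'"
    "is_J l j" "is_J k j"
  shows "E l k"
proof -
  obtain i where i: "covers L i j" "l \<in> A j" "l \<in> B i"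
    "\<And>z. z \<in> carrier L \<Longrightarrow> z \<sqsubseteq> j \<Longrightarrow> z \<noteq> j \<Longrightarrow> z \<sqsubseteq> i"
    using J_lower_cover[OF assms(1-3,7)] by blast
  obtain i' where i': "covers L i' j" "k \<in> A j" "k \<in> B i'"
    "\<And>z. z \<in> carrier L \<Longrightarrow> z \<sqsubseteq> j \<Longrightarrow> z \<noteq> j \<Longrightarrow> z \<sqsubseteq> i'"
    using J_lower_cover[OF assms(4-6,8)] by blast
  have "i = i'" using lower_cover_eq[OF i(1,4)] lower_cover_eq[OF i'(1,4)] by simp
  then show ?thesis using uniq[OF i(1)] i i' by blast
qed

text \<open>This recovers \<open>r\<close> from \<open>U r\<close>. If \<open>z\<close> were not
  below \<open>r\<close>, a cover of \<open>r\<close> on the way up to the join of \<open>r\<close>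
  and \<open>z\<close> would have a label in both its \<open>A\<close> and its
  \<open>B\<close>.\<close>

lemma greatest_of_U:
  assumes r: "r \<in> carrier L" and z: "z \<in> carrier L" "U r \<subseteq> B z" shows "z \<sqsubseteq> r"
proof (rule ccontr)
  assume n: "\<not> z \<sqsubseteq> r"
  obtain t where t: "t \<in> carrier L" "B t = B r \<inter> B z" using B_join r z by blast
  have rt: "r \<sqsubseteq> t" "r \<noteq> t" "z \<sqsubseteq> t" using t r z n le_B by auto
  obtain w where w: "covers L r w" "w \<sqsubseteq> t" using cover_above[OF r t(1) rt(1,2)] by blast
  obtain l where l: "l \<in> A w" "l \<in> B r" using sep coversD[OF w(1)] by blast
  then have "l \<in> B z" using z w unfolding U_def by blast
  then have "l \<in> B w" using t l w le_B coversD[OF w(1)] by blast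
  then show False using disj l coversD[OF w(1)] by blast
qed

text \<open>The candidate \<open>r\<close> is the largest element with \<open>D x\<close> contained
  in \<open>B r\<close>, that is, the meet of all \<open>kappa j\<close> for the labels
  \<open>j\<close> of the lower covers of \<open>x\<close>.\<close>

lemma ex_row:
  assumes x: "x \<in> carrier L"
  obtains r where "r \<in> carrier L" "U r = D x"
proof -
  obtain b where b: "b \<in> carrier L" "\<And>z. z \<in> carrier L \<Longrightarrow> z \<sqsubseteq> b \<Longrightarrow> z = b"
    using A_minimal[of "carrier L"] x by blast
  have bot: "b \<sqsubseteq> z" if z: "z \<in> carrier L" for z
  proof -
    obtain w where "w \<in> carrier L" "A w = A b \<inter> A z" using A_meet b z by blast
    then show ?thesis using b z le_A by (metis inf_le1 inf_le2)
  qed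
  let ?S = "{z \<in> carrier L. D x \<subseteq> B z}"
  have "b \<in> ?S"
  proof -
    have "l \<in> B b" if "l \<in> D x" for l
    proof -
      obtain z where z: "covers L z x" "l \<in> B z" using \<open>l \<in> D x\<close> unfolding D_def by blast
      then show ?thesis using bot[of z] coversD(1)[OF z(1)] b(1) le_B[of b z] by blast
    qed
    then show ?thesis using b by blast
  qed
  then obtain r where r: "r \<in> ?S" "\<And>z. z \<in> ?S \<Longrightarrow> r \<sqsubseteq> z \<Longrightarrow> z = r"
    using A_maximal[of ?S] by blast
  have rC: "r \<in> carrier L" and rB: "D x \<subseteq> B r" using r by auto
  have rmax: "z \<sqsubseteq> r" if z: "z \<in> carrier L" "D x \<subseteq> B z" for z
  proof -
    obtain w where w: "w \<in> carrier L" "B w = B r \<inter> B z" using B_join rC z by blast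
    then have "w = r" using r z le_B[of r w] by auto
    then show ?thesis using w z rC le_B by auto
  qed
  \<comment> \<open>\<open>r\<close> lies above the lower cover of each of these \<open>j\<close>,
    and all labels of \<open>D x\<close> not equivalent to \<open>l\<close> stay in
    \<open>B j\<close>; so a join of \<open>r\<close> with \<open>j\<close> costs no other
    label.\<close>
  have key: "\<exists>j i. is_J l j \<and> covers L i j \<and> l \<in> A j \<and> l \<in> B i \<and> i \<sqsubseteq> r \<and>
      (\<forall>k \<in> D x. \<not> E l k \<longrightarrow> k \<in> B j)" if l: "l \<in> D x" for l
  proof -
    obtain u where u: "covers L u x" "l \<in> A x" "l \<in> B u" using l unfolding D_def by blast
    obtain j where j: "is_J l j" using ex_J u x by blast
    obtain i where i: "covers L i j" "l \<in> A j" "l \<in> B i" using J_lower_cover[OF u j] by blast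
    have jC: "j \<in> carrier L" "i \<in> carrier L" "i \<sqsubseteq> j" using coversD[OF i(1)] by auto
    have other: "k \<in> B j" if k: "k \<in> D x" "\<not> E l k" for k
    proof -
      obtain v where v: "covers L v x" "k \<in> A x" "k \<in> B v" using k unfolding D_def by blast
      \<comment> \<open>Distinct lower covers \<open>u\<close> and \<open>v\<close> of
        \<open>x\<close> are incomparable, so \<open>v\<close> carries \<open>l\<close> and
        therefore lies above \<open>j\<close>.\<close>
      have "u \<noteq> v" using uniq[OF u(1)] u v k by blast
      then have "\<not> v \<sqsubseteq> u"
        using coversD[OF u(1)] coversD[OF v(1)] by blast
      then have "l \<in> A v" using below_cover[OF u] coversD[OF v(1)] by blast
      then have "j \<sqsubseteq> v" using j coversD[OF v(1)] unfolding is_J_def by blast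
      then show ?thesis using v jC le_B coversD[OF v(1)] by blast
    qed
    have "D x \<subseteq> B i"
    proof
      fix k assume k: "k \<in> D x"
      show "k \<in> B i"
      proof (cases "E l k")
        case True then show ?thesis using E_B i jC by blast
      next
        case False then show ?thesis using other k jC le_B by blast
      qed
    qed
    then show ?thesis using rmax jC j i other by blast
  qed
  have inA: "l \<in> A w" if l: "l \<in> D x" and w: "w \<in> carrier L" "r \<sqsubseteq> w" "l \<notin> B w" for l w
  proof -
    obtain j i where j: "is_J l j" "covers L i j" "l \<in> A j" "l \<in> B i" "i \<sqsubseteq> r"
      using key[OF l] by blast
    have "i \<sqsubseteq> w" using trans_le[of i r w] coversD[OF j(2)] rC w j by blast
    then have "j \<sqsubseteq> w" using above_cover[OF j(2-4) w(1)] w by blast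
    then show ?thesis using j w unfolding is_J_def by blast
  qed
  \<comment> \<open>Between \<open>r\<close> and its join with \<open>j\<close>, only labels
    equivalent to \<open>l\<close> can leave \<open>B\<close>. By maximality of \<open>r\<close>
    some label of \<open>D x\<close> does leave at the first cover, which therefore has the label
    \<open>l\<close>.\<close>
  have "D x \<subseteq> U r"
  proof
    fix l assume l: "l \<in> D x"
    obtain j i where j: "is_J l j" "covers L i j" "l \<in> A j" "l \<in> B i" "i \<sqsubseteq> r"
      and other: "\<forall>k \<in> D x. \<not> E l k \<longrightarrow> k \<in> B j" using key[OF l] by blast
    have jC: "j \<in> carrier L" using coversD[OF j(2)] by auto
    obtain t where t: "t \<in> carrier L" "B t = B r \<inter> B j" using B_join rC jC by blast
    have "l \<notin> B j" using disj j jC by blast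
    then have rt: "r \<sqsubseteq> t" "r \<noteq> t" using t rC rB l le_B by auto
    obtain w where w: "covers L r w" "w \<sqsubseteq> t" using cover_above[OF rC t(1) rt] by blast
    note wd = coversD[OF w(1)]
    obtain k where k: "k \<in> D x" "k \<notin> B w" using rmax[of w] wd by blast
    have "E l k"
    proof (rule ccontr)
      assume "\<not> E l k"
      then have "k \<in> B t" using other k rB t by blast
      then show False using k w t wd le_B by blast
    qed
    then have "l \<notin> B w" using E_B wd k by blast
    then have "l \<in> A w" using inA l wd by blast
    then show "l \<in> U r" unfolding U_def using w rB l by blast
  qed
  moreover have "U r \<subseteq> D x"
  proof
    fix k assume "k \<in> U r"
    then obtain w where w: "covers L r w" "k \<in> A w" "k \<in> B r" unfolding U_def by blast
    note wd = coversD[OF w(1)]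
    obtain l where l: "l \<in> D x" "l \<notin> B w" using rmax[of w] wd by blast
    then have "l \<in> A w" using inA wd by blast
    then have "E l k" using uniq[OF w(1)] w l rB by blast
    then show "k \<in> D x" using l E_A E_B coversD unfolding D_def by blast
  qed
  ultimately show thesis using that rC by blast
qed

theorem lattice_row_labels:
  assumes x: "x \<in> carrier L"
  shows "lattice_row L x \<in> carrier L" "U (lattice_row L x) = D x"
proof -
  obtain r where r: "r \<in> carrier L" "U r = D x" using ex_row[OF x] by blast
  have "lattice_row L x = r" unfolding lattice_row_def
  proof (rule the_equality)
    show "r \<in> carrier L \<and> up_labels L r = down_labels L x"
      using r x up_labels_eq down_labels_eq by auto
  next
    fix s assume s: "s \<in> carrier L \<and> up_labels L s = down_labels L x"
    then have eq: "{j. \<exists>l \<in> U s. is_J l j} = {j. \<exists>l \<in> U r. is_J l j}"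
      using r x up_labels_eq down_labels_eq by auto
    \<comment> \<open>Equal sets of join-irreducibles give equal label sets, since each
      \<open>U q\<close> is closed under \<open>E\<close>.\<close>
    have sub: "U p \<subseteq> U q"
      if sub: "{j. \<exists>l \<in> U p. is_J l j} \<subseteq> {j. \<exists>l \<in> U q. is_J l j}" and p: "p \<in> carrier L" for p q
    proof
      fix l assume l: "l \<in> U p"
      then obtain y where y: "covers L p y" "l \<in> A y" "l \<in> B p" unfolding U_def by blast
      obtain j where j: "is_J l j" using ex_J y coversD by blast
      then obtain k where k: "k \<in> U q" "is_J k j" using sub l by blast
      then obtain z where z: "covers L q z" "k \<in> A z" "k \<in> B q" unfolding U_def by blast
      have "E k l" using same_J_E[OF z y k(2) j] .
      then show "l \<in> U q" using z E_A E_B coversD[OF z(1)] unfolding U_def by blast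
    qed
    have "U s = U r" using sub[of s r] sub[of r s] eq s r by auto
    moreover have "U q \<subseteq> B q" for q unfolding U_def by blast
    ultimately show "s = r" using greatest_of_U antisym_le s r by metis
  qed
  then show "lattice_row L x \<in> carrier L" "U (lattice_row L x) = D x" using r by auto
qed

end

section \<open>Words all of whose descents are alternating\<close>

text \<open>
  A word on the letters \<open>1, \<dots>, N\<close> is given by an injective position function \<open>P\<close>.
\<close>

definition nxt :: "(nat \<Rightarrow> nat) \<Rightarrow> nat \<Rightarrow> nat \<Rightarrow> nat \<Rightarrow> bool" where
  "nxt P N a b \<longleftrightarrow> a \<in> {1..N} \<and> b \<in> {1..N} \<and> P a < P b \<and> (\<forall>c \<in> {1..N}. \<not> (P a < P c \<and> P c < P b))"

definition alternating :: "(nat \<Rightarrow> nat) \<Rightarrow> nat \<Rightarrow> bool" where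
  "alternating P N \<longleftrightarrow> inj_on P {1..N} \<and>
     (\<forall>p q. nxt P N q p \<longrightarrow> p < q \<longrightarrow> (\<exists>e. \<forall>v. p < v \<longrightarrow> v < q \<longrightarrow> ((even v = e) \<longleftrightarrow> P q < P v)))"

text \<open>\<open>lbit\<close> asks about the later and \<open>rbit\<close> about the earlier of
  the two letters. Reversing both word and alphabet exchanges them, so a symmetric word is described
  by its \<open>lbit\<close> values alone, while the scan of a general word uses both.\<close>

definition lbit :: "(nat \<Rightarrow> nat) \<Rightarrow> nat \<Rightarrow> nat \<Rightarrow> bool" where
  "lbit P N i \<longleftrightarrow> (if P (i + 1) < P i then \<exists>q > i. nxt P N q i else \<exists>p < i + 1. nxt P N (i + 1) p)"
definition rbit :: "(nat \<Rightarrow> nat) \<Rightarrow> nat \<Rightarrow> nat \<Rightarrow> bool" where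
  "rbit P N i \<longleftrightarrow> (if P (i + 1) < P i then \<exists>p < i + 1. nxt P N (i + 1) p else \<exists>q > i. nxt P N q i)"

lemma nxtD:
  assumes "nxt P N a b"
  shows "1 \<le> a" "a \<le> N" "1 \<le> b" "b \<le> N" "P a < P b"
    "\<And>c. 1 \<le> c \<Longrightarrow> c \<le> N \<Longrightarrow> P a < P c \<Longrightarrow> P b \<le> P c"
proof -
  have h: "a \<in> {1..N}" "b \<in> {1..N}" "P a < P b" "\<And>c. c \<in> {1..N} \<Longrightarrow> \<not> (P a < P c \<and> P c < P b)"
    using assms by (auto simp: nxt_def)
  then show "1 \<le> a" "a \<le> N" "1 \<le> b" "b \<le> N" "P a < P b" by auto
  show "P b \<le> P c" if "1 \<le> c" "c \<le> N" "P a < P c" for c using h(4)[of c] that by auto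
qed

lemma inj_eq: "inj_on P {1..N} \<Longrightarrow> P a = P b \<Longrightarrow> 1 \<le> a \<Longrightarrow> a \<le> N \<Longrightarrow> 1 \<le> b \<Longrightarrow> b \<le> N \<Longrightarrow> a = (b :: nat)"
  by (auto dest: inj_onD)

lemma nxt_unique_right: "inj_on P {1..N} \<Longrightarrow> nxt P N a b \<Longrightarrow> nxt P N a c \<Longrightarrow> b = c"
  using nxtD[of P N a b] nxtD[of P N a c] inj_eq[of P N b c] by (meson le_antisym)

lemma nxt_exists:
  assumes inj: "inj_on P {1..N}" and a: "1 \<le> a" "a \<le> N" and b: "1 \<le> b" "b \<le> N" "P a < P b"
  shows "\<exists>c. nxt P N a c \<and> P c \<le> P b"
proof -
  let ?S = "{c \<in> {1..N}. P a < P c}"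
  have "finite (P ` ?S)" "P ` ?S \<noteq> {}" using b by auto
  then have "Min (P ` ?S) \<in> P ` ?S" by (rule Min_in)
  then obtain c where c: "c \<in> ?S" "P c = Min (P ` ?S)" by auto
  have le: "P c \<le> P d" if "d \<in> ?S" for d using that c(2) by simp
  have "nxt P N a c" unfolding nxt_def
  proof (intro conjI ballI)
    fix d assume "d \<in> {1..N}"
    then show "\<not> (P a < P d \<and> P d < P c)" using le[of d] by auto
  qed (use c(1) a in auto)
  moreover have "P c \<le> P b" using le b by auto
  ultimately show ?thesis by blast
qed

text \<open>\<open>q\<close> is the last letter before \<open>b\<close> that is at least
  \<open>t\<close>; its successor is then smaller than \<open>t\<close>.\<close>

lemma last_drop:
  assumes inj: "inj_on P {1..N}" and a: "1 \<le> a" "a \<le> N" "t \<le> a" and b: "1 \<le> b" "b \<le> N" "b < t"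
    and ab: "P a < P b"
  obtains q p where "nxt P N q p" "t \<le> q" "p < t" "P a \<le> P q" "P p \<le> P b"
    "\<And>c. 1 \<le> c \<Longrightarrow> c \<le> N \<Longrightarrow> t \<le> c \<Longrightarrow> P c < P b \<Longrightarrow> P c \<le> P q"
proof -
  let ?S = "{c \<in> {1..N}. t \<le> c \<and> P c < P b}"
  have "finite (P ` ?S)" "P ` ?S \<noteq> {}" using a ab by auto
  then have "Max (P ` ?S) \<in> P ` ?S" by (rule Max_in)
  then obtain q where q: "q \<in> ?S" "P q = Max (P ` ?S)" by auto
  have ge: "P d \<le> P q" if "d \<in> ?S" for d using that q(2) by simp
  obtain p where p: "nxt P N q p" "P p \<le> P b" using nxt_exists[OF inj, of q b] q b by auto
  have "p < t"
  proof (rule ccontr)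
    assume "\<not> p < t"
    then have "p \<noteq> b" using b by auto
    then have "P p \<noteq> P b" using inj_eq[OF inj, of p b] b nxtD[OF p(1)] by auto
    then have "p \<in> ?S" using \<open>\<not> p < t\<close> p(2) nxtD[OF p(1)] by auto
    then show False using ge nxtD(5)[OF p(1)] by force
  qed
  then show thesis using that[OF p(1)] p q ge a ab by auto
qed

lemma drop_exists:
  assumes "inj_on P {1..N}" "1 \<le> a" "a \<le> N" "t \<le> a" "1 \<le> b" "b \<le> N" "b < t" "P a < P b"
  obtains q p where "nxt P N q p" "t \<le> q" "p < t" "P a \<le> P q" "P p \<le> P b"
  using last_drop[OF assms] by metis

lemma last_rise:
  assumes inj: "inj_on P {1..N}" and a: "1 \<le> a" "a \<le> N" "a < t" and b: "1 \<le> b" "b \<le> N" "t \<le> b"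
    and ab: "P a < P b"
  obtains p q where "nxt P N p q" "t \<le> q" "p < t" "P a \<le> P p" "P q \<le> P b"
    "\<And>c. 1 \<le> c \<Longrightarrow> c \<le> N \<Longrightarrow> c < t \<Longrightarrow> P c < P b \<Longrightarrow> P c \<le> P p"
proof -
  let ?S = "{c \<in> {1..N}. c < t \<and> P c < P b}"
  have "finite (P ` ?S)" "P ` ?S \<noteq> {}" using a ab by auto
  then have "Max (P ` ?S) \<in> P ` ?S" by (rule Max_in)
  then obtain q where q: "q \<in> ?S" "P q = Max (P ` ?S)" by auto
  have ge: "P d \<le> P q" if "d \<in> ?S" for d using that q(2) by simp
  obtain p where p: "nxt P N q p" "P p \<le> P b" using nxt_exists[OF inj, of q b] q b by auto
  have "t \<le> p"
  proof (rule ccontr)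
    assume "\<not> t \<le> p"
    then have "p \<noteq> b" using b by auto
    then have "P p \<noteq> P b" using inj_eq[OF inj, of p b] b nxtD[OF p(1)] by auto
    then have "p \<in> ?S" using \<open>\<not> t \<le> p\<close> p(2) nxtD[OF p(1)] by auto
    then show False using ge nxtD(5)[OF p(1)] by force
  qed
  then show thesis using that[OF p(1)] p q ge a ab by auto
qed

lemma rise_exists:
  assumes "inj_on P {1..N}" "1 \<le> a" "a \<le> N" "a < t" "1 \<le> b" "b \<le> N" "t \<le> b" "P a < P b"
  obtains p q where "nxt P N p q" "t \<le> q" "p < t" "P a \<le> P p" "P q \<le> P b"
  using last_rise[OF assms] by metis

subsection \<open>Uniqueness\<close>

text \<open>
  The letters \<open>1, \<dots>, k\<close> are scanned in increasing order. A letter is marked if a letter larger than \<open>k\<close>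
  immediately precedes it, i.e. if the descent ending there is still open.
\<close>

definition marks :: "(nat \<Rightarrow> nat) \<Rightarrow> nat \<Rightarrow> nat \<Rightarrow> nat set" where
  "marks P N k = {p. p < k \<and> (\<exists>q > k. nxt P N q p)}"

lemma alternating_step:
  assumes "alternating P N" "nxt P N q p" "p < v" "v + 1 < q"
  shows "P q < P v \<longleftrightarrow> \<not> P q < P (v + 1)"
proof -
  obtain e where "\<And>v. p < v \<Longrightarrow> v < q \<Longrightarrow> (even v = e) \<longleftrightarrow> P q < P v"
    using assms unfolding alternating_def by fastforce
  from this[of v] this[of "v + 1"] show ?thesis using assms by auto
qed

text \<open>While the descent from \<open>q\<close> to \<open>p\<close> is open, the consecutive
  values \<open>k\<close> and \<open>k + 1\<close> lie on opposite sides of it, unless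
  \<open>k + 1\<close> is the letter \<open>q\<close> itself.\<close>

lemma mark_next:
  assumes alt: "alternating P N" and k: "1 \<le> k" "k < N" and p: "p \<in> marks P N k" and q: "nxt P N q p" "q > k"
  shows "P p < P k \<Longrightarrow> P (k + 1) < P p \<and> (q \<noteq> k + 1 \<longrightarrow> P (k + 1) < P q)"
    "P k < P p \<Longrightarrow> P k < P (k + 1) \<and> (q \<noteq> k + 1 \<longrightarrow> P p < P (k + 1))"
proof -
  have inj: "inj_on P {1..N}" using alt by (simp add: alternating_def)
  note qd = nxtD[OF q(1)]
  have pk: "p < k" using p by (simp add: marks_def)
  have out: "P k < P q" if "P k < P p"
  proof -
    have "P k \<noteq> P q" using inj_eq[OF inj, of k q] q qd k by auto
    moreover have "\<not> P q < P k" using qd(6)[of k] k that by auto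
    ultimately show ?thesis by linarith
  qed
  show "P (k + 1) < P p \<and> (q \<noteq> k + 1 \<longrightarrow> P (k + 1) < P q)" if r: "P p < P k"
  proof (cases "q = k + 1")
    case True then show ?thesis using qd by auto
  next
    case False
    then have "\<not> P q < P (k + 1)" using alternating_step[OF alt q(1) pk] q(2) r qd by auto
    moreover have "P q \<noteq> P (k + 1)" using inj_eq[OF inj, of q "k + 1"] False k qd by auto
    ultimately show ?thesis using qd by auto
  qed
  show "P k < P (k + 1) \<and> (q \<noteq> k + 1 \<longrightarrow> P p < P (k + 1))" if l: "P k < P p"
  proof (cases "q = k + 1")
    case True then show ?thesis using out[OF l] by auto
  next
    case False
    then have "P q < P (k + 1)" using alternating_step[OF alt q(1) pk] q(2) out[OF l] by auto
    then have "P p \<le> P (k + 1)" using qd(6)[of "k + 1"] k by auto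
    moreover have "P p \<noteq> P (k + 1)" using inj_eq[OF inj, of p "k + 1"] qd pk k by auto
    ultimately show ?thesis using False l by auto
  qed
qed

text \<open>Marks on both sides would require \<open>k + 1\<close> to stand both before and after
  \<open>k\<close>.\<close>

lemma marks_same_side:
  assumes alt: "alternating P N" and k: "1 \<le> k" "k < N"
    and p: "p \<in> marks P N k" "P p < P k" and p': "p' \<in> marks P N k"
  shows "P p' < P k"
proof (rule ccontr)
  assume n: "\<not> P p' < P k"
  have inj: "inj_on P {1..N}" using alt by (simp add: alternating_def)
  obtain q q' where q: "nxt P N q p" "q > k" "nxt P N q' p'" "q' > k" using p p' by (auto simp: marks_def)
  have "p' < k" using p' by (simp add: marks_def)
  then have "P p' \<noteq> P k" using inj_eq[OF inj, of p' k] k nxtD[OF q(3)] by auto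
  then have "P k < P p'" using n by linarith
  then show False using mark_next(1)[OF alt k p(1) q(1,2) p(2)] mark_next(2)[OF alt k p' q(3,4)] p(2) by auto
qed

text \<open>Here \<open>k\<close> lies right of all marks, so \<open>k + 1\<close> goes left of
  them. Its place among the letters up to \<open>k\<close> is just before the first mark: between
  \<open>k + 1\<close> and any smaller letter behind it some drop below \<open>k + 1\<close> occurs,
  and it ends at a mark or at \<open>k\<close>. Whether \<open>k + 1\<close> itself precedes that
  mark directly is \<open>rbit\<close>.\<close>

lemma scan_right:
  assumes alt: "alternating P N" and k: "1 \<le> k" "k < N" and m: "p0 \<in> marks P N k" "P p0 < P k"
  shows "\<And>a. 1 \<le> a \<Longrightarrow> a \<le> k \<Longrightarrow> P (k + 1) < P a \<longleftrightarrow> (\<exists>p \<in> marks P N k. P p \<le> P a)"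
    "\<And>p. p \<le> k \<Longrightarrow> nxt P N (k + 1) p \<longleftrightarrow> rbit P N k \<and> p \<in> marks P N k \<and> (\<forall>p' \<in> marks P N k. P p \<le> P p')"
    "P (k + 1) < P k"
proof -
  let ?M = "marks P N k"
  have inj: "inj_on P {1..N}" using alt by (simp add: alternating_def)
  have MD: "1 \<le> p" "p < k" "P p < P k" "P (k + 1) < P p" if p: "p \<in> ?M" for p
  proof -
    obtain q where q: "nxt P N q p" "q > k" using p by (auto simp: marks_def)
    show "1 \<le> p" "p < k" using nxtD[OF q(1)] p by (auto simp: marks_def)
    show "P p < P k" using marks_same_side[OF alt k m p] .
    then show "P (k + 1) < P p" using mark_next(1)[OF alt k p q] by blast
  qed
  show inv: "P (k + 1) < P k" using MD[OF m(1)] by linarith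
  show "P (k + 1) < P a \<longleftrightarrow> (\<exists>p \<in> ?M. P p \<le> P a)" if a: "1 \<le> a" "a \<le> k" for a
  proof
    assume "P (k + 1) < P a"
    then obtain q p where qp: "nxt P N q p" "k + 1 \<le> q" "p < k + 1" "P p \<le> P a"
      by (rule drop_exists[OF inj, of "k + 1" "k + 1" a, rotated 6]) (use a k in auto)
    show "\<exists>p \<in> ?M. P p \<le> P a"
    proof (cases "p = k")
      case True then show ?thesis using m qp by (intro bexI[of _ p0]) auto
    next
      case False
      then have "p < k" "q > k" using qp by auto
      then have "p \<in> ?M" using qp(1) unfolding marks_def by blast
      then show ?thesis using qp by blast
    qed
  next
    assume "\<exists>p \<in> ?M. P p \<le> P a" then show "P (k + 1) < P a" using MD by force
  qed
  have rb: "rbit P N k \<longleftrightarrow> (\<exists>p < k + 1. nxt P N (k + 1) p)" using inv by (simp add: rbit_def)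
  have nm: "p \<in> ?M \<and> (\<forall>p' \<in> ?M. P p \<le> P p')" if p: "nxt P N (k + 1) p" "p \<le> k" for p
  proof -
    have "p \<noteq> k" using nxtD(6)[OF p(1), of p0] MD[OF m(1)] k by auto
    then have "p \<in> ?M" using p by (auto simp: marks_def)
    moreover have "P p \<le> P p'" if "p' \<in> ?M" for p' using nxtD(6)[OF p(1), of p'] MD[OF that] k by auto
    ultimately show ?thesis by blast
  qed
  show "nxt P N (k + 1) p \<longleftrightarrow> rbit P N k \<and> p \<in> ?M \<and> (\<forall>p' \<in> ?M. P p \<le> P p')" if p: "p \<le> k" for p
  proof
    assume "nxt P N (k + 1) p"
    then show "rbit P N k \<and> p \<in> ?M \<and> (\<forall>p' \<in> ?M. P p \<le> P p')" using nm p rb by auto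
  next
    assume h: "rbit P N k \<and> p \<in> ?M \<and> (\<forall>p' \<in> ?M. P p \<le> P p')"
    then obtain p1 where p1: "nxt P N (k + 1) p1" "p1 < k + 1" using rb by auto
    then have "P p1 = P p" using nm[OF p1(1)] h by (simp add: le_antisym)
    then have "p1 = p" using inj_eq[OF inj, of p1 p] MD[of p] nm[OF p1(1)] p1 h MD[of p1] k by auto
    then show "nxt P N (k + 1) p" using p1 by simp
  qed
qed

text \<open>Here \<open>k\<close> lies left of all marks, so \<open>k + 1\<close> follows
  \<open>k\<close>. Either it closes the descent at the last mark and stands just before that mark,
  or it stands behind every smaller letter; \<open>lbit\<close> tells which.\<close>

lemma scan_left:
  assumes alt: "alternating P N" and k: "1 \<le> k" "k < N" and m: "p0 \<in> marks P N k" "\<not> P p0 < P k"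
  shows "\<And>a. 1 \<le> a \<Longrightarrow> a \<le> k \<Longrightarrow> P (k + 1) < P a \<longleftrightarrow> lbit P N k \<and> (\<forall>p \<in> marks P N k. P p \<le> P a)"
    "\<And>p. p \<le> k \<Longrightarrow> nxt P N (k + 1) p \<longleftrightarrow> lbit P N k \<and> p \<in> marks P N k \<and> (\<forall>p' \<in> marks P N k. P p' \<le> P p)"
    "\<not> P (k + 1) < P k"
proof -
  let ?M = "marks P N k"
  have inj: "inj_on P {1..N}" using alt by (simp add: alternating_def)
  have MD: "1 \<le> p" "p < k" "P k < P p" "P k < P (k + 1)" "\<not> nxt P N (k + 1) p \<Longrightarrow> P p < P (k + 1)"
    if p: "p \<in> ?M" for p
  proof -
    obtain q where q: "nxt P N q p" "q > k" using p by (auto simp: marks_def)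
    show 1: "1 \<le> p" "p < k" using nxtD[OF q(1)] p by (auto simp: marks_def)
    have "\<not> P p < P k" using marks_same_side[OF alt k p _ m(1)] m(2) by blast
    then show "P k < P p" using inj_eq[OF inj, of p k] 1 k by fastforce
    then show "P k < P (k + 1)" "\<not> nxt P N (k + 1) p \<Longrightarrow> P p < P (k + 1)"
      using mark_next(2)[OF alt k p q] q by auto
  qed
  show ninv: "\<not> P (k + 1) < P k" using MD[OF m(1)] by linarith
  have lb: "lbit P N k \<longleftrightarrow> (\<exists>p < k + 1. nxt P N (k + 1) p)" using ninv by (simp add: lbit_def)
  have nm: "p \<in> ?M \<and> (\<forall>p' \<in> ?M. P p' \<le> P p)" if p: "nxt P N (k + 1) p" "p \<le> k" for p
  proof -
    have "p \<noteq> k" using nxtD(5)[OF p(1)] ninv by auto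
    then have pM: "p \<in> ?M" using p by (auto simp: marks_def)
    moreover have "P p' \<le> P p" if "p' \<in> ?M" for p'
    proof (cases "nxt P N (k + 1) p'")
      case True then show ?thesis using nxt_unique_right[OF inj p(1)] by auto
    next
      case False then show ?thesis using MD[OF that] nxtD(5)[OF p(1)] by auto
    qed
    ultimately show ?thesis by blast
  qed
  show "P (k + 1) < P a \<longleftrightarrow> lbit P N k \<and> (\<forall>p \<in> ?M. P p \<le> P a)" if a: "1 \<le> a" "a \<le> k" for a
  proof
    assume lt: "P (k + 1) < P a"
    then obtain q p where qp: "nxt P N q p" "k + 1 \<le> q" "p < k + 1" "P (k + 1) \<le> P q" "P p \<le> P a"
      by (rule drop_exists[OF inj, of "k + 1" "k + 1" a, rotated 6]) (use a k in auto)
    have "p \<noteq> k" using nxtD(5)[OF qp(1)] qp(4) MD(4)[OF m(1)] by auto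
    then have "p < k" "q > k" using qp by auto
    then have pM: "p \<in> ?M" using qp(1) unfolding marks_def by blast
    have nx: "nxt P N (k + 1) p" using MD(5)[OF pM] nxtD(5)[OF qp(1)] qp(4) by linarith
    then show "lbit P N k \<and> (\<forall>p \<in> ?M. P p \<le> P a)" using lb qp nm[OF nx] by force
  next
    assume h: "lbit P N k \<and> (\<forall>p \<in> ?M. P p \<le> P a)"
    then obtain p where p: "nxt P N (k + 1) p" "p < k + 1" using lb by auto
    then have "P p \<le> P a" using nm[OF p(1)] h by auto
    then show "P (k + 1) < P a" using nxtD(5)[OF p(1)] by linarith
  qed
  show "nxt P N (k + 1) p \<longleftrightarrow> lbit P N k \<and> p \<in> ?M \<and> (\<forall>p' \<in> ?M. P p' \<le> P p)" if p: "p \<le> k" for p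
  proof
    assume "nxt P N (k + 1) p"
    then show "lbit P N k \<and> p \<in> ?M \<and> (\<forall>p' \<in> ?M. P p' \<le> P p)" using nm p lb by auto
  next
    assume h: "lbit P N k \<and> p \<in> ?M \<and> (\<forall>p' \<in> ?M. P p' \<le> P p)"
    then obtain p1 where p1: "nxt P N (k + 1) p1" "p1 < k + 1" using lb by auto
    then have "P p1 = P p" using nm[OF p1(1)] h by (simp add: le_antisym)
    then have "p1 = p" using inj_eq[OF inj, of p1 p] MD[of p] nm[OF p1(1)] p1 h MD[of p1] k by auto
    then show "nxt P N (k + 1) p" using p1 by simp
  qed
qed

text \<open>Without marks, a drop from letters above \<open>k\<close> to letters up to
  \<open>k\<close> can end only at \<open>k\<close>. So \<open>k + 1\<close> is placed just before
  \<open>k\<close> or behind every smaller letter.\<close>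

lemma scan_empty:
  assumes alt: "alternating P N" and k: "1 \<le> k" "k < N" and m: "marks P N k = {}"
  shows "\<And>a. 1 \<le> a \<Longrightarrow> a \<le> k \<Longrightarrow> P (k + 1) < P a \<longleftrightarrow> lbit P N k \<and> P k \<le> P a"
    "\<And>p. p \<le> k \<Longrightarrow> nxt P N (k + 1) p \<longleftrightarrow> lbit P N k \<and> rbit P N k \<and> p = k"
    "P (k + 1) < P k \<longleftrightarrow> lbit P N k"
proof -
  have inj: "inj_on P {1..N}" using alt by (simp add: alternating_def)
  have nk: "p = k" if "nxt P N (k + 1) p" "p \<le> k" for p
  proof (rule ccontr)
    assume "p \<noteq> k"
    then have "p \<in> marks P N k" unfolding marks_def using that by auto
    then show False using m by simp
  qed
  have l1: "P (k + 1) < P k" if "lbit P N k"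
  proof (rule ccontr)
    assume n: "\<not> P (k + 1) < P k"
    then obtain p where p: "nxt P N (k + 1) p" "p < k + 1" using \<open>lbit P N k\<close> unfolding lbit_def by auto
    then show False using nk[of p] nxtD(5)[OF p(1)] n by auto
  qed
  have d: "lbit P N k \<and> P k \<le> P a" if a: "1 \<le> a" "a \<le> k" "P (k + 1) < P a" for a
  proof -
    obtain q p where qp: "nxt P N q p" "k + 1 \<le> q" "p < k + 1" "P (k + 1) \<le> P q" "P p \<le> P a"
      using a(3) by (rule drop_exists[OF inj, of "k + 1" "k + 1" a, rotated 6]) (use a k in auto)
    have "p = k"
    proof (rule ccontr)
      assume "p \<noteq> k"
      then have "p < k" "q > k" using qp by auto
      then have "p \<in> marks P N k" using qp(1) unfolding marks_def by blast
      then show False using m by simp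
    qed
    moreover have "q > k" using qp(2) by simp
    ultimately have "P (k + 1) < P k" "\<exists>q > k. nxt P N q k" using qp nxtD(5)[OF qp(1)] by (force, blast)
    then show ?thesis using \<open>p = k\<close> qp by (simp add: lbit_def)
  qed
  show "P (k + 1) < P a \<longleftrightarrow> lbit P N k \<and> P k \<le> P a" if "1 \<le> a" "a \<le> k" for a
    using d[OF that] l1 by auto
  show 3: "P (k + 1) < P k \<longleftrightarrow> lbit P N k" using d[of k] l1 k by auto
  show "nxt P N (k + 1) p \<longleftrightarrow> lbit P N k \<and> rbit P N k \<and> p = k" if p: "p \<le> k" for p
  proof
    assume h: "nxt P N (k + 1) p"
    then have "p = k" using nk p by blast
    then have "P (k + 1) < P k" using nxtD(5)[OF h] by simp
    then show "lbit P N k \<and> rbit P N k \<and> p = k" using h \<open>p = k\<close> 3 by (auto simp: rbit_def)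
  next
    assume h: "lbit P N k \<and> rbit P N k \<and> p = k"
    then obtain p1 where "nxt P N (k + 1) p1" "p1 < k + 1" using l1 by (auto simp: rbit_def)
    then show "nxt P N (k + 1) p" using nk[of p1] h by auto
  qed
qed

definition same_order :: "nat \<Rightarrow> (nat \<Rightarrow> nat) \<Rightarrow> (nat \<Rightarrow> nat) \<Rightarrow> bool" where
  "same_order k P Q \<longleftrightarrow> (\<forall>a b. 1 \<le> a \<longrightarrow> a \<le> k \<longrightarrow> 1 \<le> b \<longrightarrow> b \<le> k \<longrightarrow> (P a < P b \<longleftrightarrow> Q a < Q b))"

lemma same_order_le:
  assumes "same_order k P Q" "1 \<le> a" "a \<le> k" "1 \<le> b" "b \<le> k"
  shows "P a < P b \<longleftrightarrow> Q a < Q b" "P a \<le> P b \<longleftrightarrow> Q a \<le> Q b"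
  using assms unfolding same_order_def by (auto simp flip: not_less)

lemma marks_range: "p \<in> marks P N k \<Longrightarrow> 1 \<le> p \<and> p < k"
  using nxtD by (auto simp: marks_def)

text \<open>The three scan lemmas express the place of \<open>k + 1\<close> by data that
  \<open>P\<close> and \<open>Q\<close> share: the order up to \<open>k\<close>, the marks and the
  two bits.\<close>

lemma scan_step:
  assumes altP: "alternating P N" and altQ: "alternating Q N" and k: "1 \<le> k" "k < N"
    and so: "same_order k P Q" and M: "marks P N k = marks Q N k"
    and l: "lbit P N k = lbit Q N k" and r: "rbit P N k = rbit Q N k"
  shows "same_order (k + 1) P Q" "marks P N (k + 1) = marks Q N (k + 1)"
proof -
  let ?M = "marks P N k"
  have injP: "inj_on P {1..N}" and injQ: "inj_on Q {1..N}" using altP altQ by (auto simp: alternating_def)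
  have mr: "1 \<le> p" "p \<le> k" if "p \<in> ?M" for p using marks_range[OF that] by auto
  have key: "(\<forall>a. 1 \<le> a \<longrightarrow> a \<le> k \<longrightarrow> (P (k + 1) < P a \<longleftrightarrow> Q (k + 1) < Q a)) \<and>
      (\<forall>p \<le> k. nxt P N (k + 1) p \<longleftrightarrow> nxt Q N (k + 1) p)"
  proof (cases "?M = {}")
    case True
    then have "marks Q N k = {}" using M by simp
    then show ?thesis
      using scan_empty(1,2)[OF altP k True] scan_empty(1,2)[OF altQ k] same_order_le(2)[OF so] k l r by auto
  next
    case False
    then obtain p0 where p0: "p0 \<in> ?M" by blast
    then have p0Q: "p0 \<in> marks Q N k" using M by simp
    have side: "P p0 < P k \<longleftrightarrow> Q p0 < Q k" using same_order_le(1)[OF so] mr[OF p0] k by auto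
    have le: "P p \<le> P a \<longleftrightarrow> Q p \<le> Q a" if "p \<in> ?M" "1 \<le> a" "a \<le> k" for p a
      using same_order_le(2)[OF so] mr[OF that(1)] that by auto
    show ?thesis
    proof (cases "P p0 < P k")
      case True
      then have TQ: "Q p0 < Q k" using side by simp
      note sP = scan_right[OF altP k p0 True] and sQ = scan_right[OF altQ k p0Q TQ]
      show ?thesis using sP(1,2) sQ(1,2) le mr M r by auto
    next
      case False
      then have FQ: "\<not> Q p0 < Q k" using side by simp
      note sP = scan_left[OF altP k p0 False] and sQ = scan_left[OF altQ k p0Q FQ]
      show ?thesis using sP(1,2) sQ(1,2) le mr M l by auto
    qed
  qed
  have neq: "P a \<noteq> P (k + 1)" "Q a \<noteq> Q (k + 1)" if "1 \<le> a" "a \<le> k" for a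
    using inj_eq[OF injP, of a "k + 1"] inj_eq[OF injQ, of a "k + 1"] that k by auto
  show so': "same_order (k + 1) P Q" unfolding same_order_def
  proof (intro allI impI)
    fix a b assume ab: "1 \<le> a" "a \<le> k + 1" "1 \<le> b" "b \<le> k + 1"
    consider "a \<le> k" "b \<le> k" | "a = k + 1" "b \<le> k" | "a \<le> k" "b = k + 1" | "a = k + 1" "b = k + 1"
      using ab by linarith
    then show "P a < P b \<longleftrightarrow> Q a < Q b"
    proof cases
      case 1 then show ?thesis using same_order_le(1)[OF so] ab by auto
    next
      case 2 then show ?thesis using key ab by auto
    next
      case 3
      then have "P a < P b \<longleftrightarrow> \<not> P b < P a" "Q a < Q b \<longleftrightarrow> \<not> Q b < Q a" using neq[of a] ab by auto
      then show ?thesis using key ab 3 by auto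
    qed auto
  qed
  have pk: "(\<exists>q > k. nxt P N q k) \<longleftrightarrow> (\<exists>q > k. nxt Q N q k)"
  proof -
    have "P (k + 1) < P k \<longleftrightarrow> Q (k + 1) < Q k" using key k by auto
    then show ?thesis using l r unfolding lbit_def rbit_def by auto
  qed
  \<comment> \<open>Passing to \<open>k + 1\<close> makes \<open>k\<close> a mark if a larger letter
    directly precedes it, and removes the mark of the letter directly behind
    \<open>k + 1\<close>.\<close>
  have split: "p \<in> marks R N (k + 1) \<longleftrightarrow> ((p \<in> marks R N k \<or> (p = k \<and> (\<exists>q > k. nxt R N q k))) \<and> \<not> nxt R N (k + 1) p)"
    if "inj_on R {1..N}" for R p
  proof -
    have un: "q = q'" if "nxt R N q p" "nxt R N q' p" for q q'
    proof -
      have "R q = R q'" using nxtD(5,6)[OF that(1)] nxtD(5,6)[OF that(2)] nxtD(1,2)[OF that(1)] nxtD(1,2)[OF that(2)]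
        by (meson leD linorder_neqE_nat)
      then show ?thesis using inj_eq[OF \<open>inj_on R {1..N}\<close>] nxtD(1,2)[OF that(1)] nxtD(1,2)[OF that(2)] by blast
    qed
    show ?thesis
    proof
      assume "p \<in> marks R N (k + 1)"
      then obtain q where q: "p < k + 1" "q > k + 1" "nxt R N q p" by (auto simp: marks_def)
      have "\<exists>q > k. nxt R N q p" using q by (intro exI[of _ q]) simp
      moreover have "\<not> nxt R N (k + 1) p" using un[OF q(3), of "k + 1"] q(2) by auto
      ultimately show "(p \<in> marks R N k \<or> (p = k \<and> (\<exists>q > k. nxt R N q k))) \<and> \<not> nxt R N (k + 1) p"
        using q(1) unfolding marks_def by (cases "p = k") auto
    next
      assume h: "(p \<in> marks R N k \<or> (p = k \<and> (\<exists>q > k. nxt R N q k))) \<and> \<not> nxt R N (k + 1) p"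
      then obtain q where q: "p \<le> k" "q > k" "nxt R N q p" by (auto simp: marks_def)
      then have "q \<noteq> k + 1" using h by auto
      then have "p < k + 1" "q > k + 1" using q by auto
      then show "p \<in> marks R N (k + 1)" using q(3) unfolding marks_def by blast
    qed
  qed
  show "marks P N (k + 1) = marks Q N (k + 1)"
  proof (rule Set.set_eqI)
    fix p
    show "p \<in> marks P N (k + 1) \<longleftrightarrow> p \<in> marks Q N (k + 1)"
    proof (cases "p \<le> k")
      case True
      then show ?thesis using split[OF injP, of p] split[OF injQ, of p] M pk key by blast
    next
      case False then show ?thesis by (auto simp: marks_def)
    qed
  qed
qed

theorem alternating_unique:
  assumes altP: "alternating P N" and altQ: "alternating Q N"
    and bits: "\<And>i. 1 \<le> i \<Longrightarrow> i < N \<Longrightarrow> lbit P N i = lbit Q N i \<and> rbit P N i = rbit Q N i"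
  shows "same_order N P Q"
proof (cases "N = 0")
  case False
  have "same_order k P Q \<and> marks P N k = marks Q N k" if "1 \<le> k" "k \<le> N" for k
    using that
  proof (induction k)
    case (Suc k)
    show ?case
    proof (cases "k = 0")
      case True
      have "marks P N 1 = {}" "marks Q N 1 = {}" using marks_range by fastforce+
      then show ?thesis using True by (simp add: same_order_def)
    next
      case False
      then show ?thesis using scan_step[OF altP altQ, of k] Suc bits[of k] by simp
    qed
  qed simp
  then show ?thesis using False by simp
qed (simp add: same_order_def)

subsection \<open>Existence\<close>

text \<open>
  The invariant of the scan. Placing \<open>k + 1\<close> before or after all marked letters alternates, so the marked letters
  all lie on the same side of \<open>k\<close> and their number, signed by that side, is an alternating sum of the bits.
\<close>

definition scanned :: "nat \<Rightarrow> (nat \<Rightarrow> nat) \<Rightarrow> nat set \<Rightarrow> (nat \<Rightarrow> bool) \<Rightarrow> (nat \<Rightarrow> bool) \<Rightarrow> bool" where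
  "scanned k P M l r \<longleftrightarrow> inj_on P {1..k} \<and> M \<subseteq> {1..<k} \<and>
     (\<forall>p q. nxt P k q p \<longrightarrow> p < q \<longrightarrow> p \<notin> M \<longrightarrow> (\<exists>e. \<forall>v. p < v \<longrightarrow> v < q \<longrightarrow> ((even v = e) \<longleftrightarrow> P q < P v))) \<and>
     (\<forall>p \<in> M. \<exists>e. \<forall>v. p < v \<longrightarrow> v \<le> k \<longrightarrow> ((even v = e) \<longleftrightarrow> P p < P v)) \<and>
     (\<forall>i. 1 \<le> i \<longrightarrow> i < k \<longrightarrow>
        (if P (i + 1) < P i then (i \<in> M \<or> (\<exists>q > i. nxt P k q i)) else (\<exists>p < i + 1. p \<notin> M \<and> nxt P k (i + 1) p)) = l i \<and>
        (if P (i + 1) < P i then (\<exists>p < i + 1. p \<notin> M \<and> nxt P k (i + 1) p) else (i \<in> M \<or> (\<exists>q > i. nxt P k q i))) = r i)"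

definition side :: "nat \<Rightarrow> (nat \<Rightarrow> nat) \<Rightarrow> nat set \<Rightarrow> bool \<Rightarrow> bool" where
  "side k P M sg \<longleftrightarrow> (\<forall>p \<in> M. P p < P k \<longleftrightarrow> sg)"

text \<open>The letter \<open>k + 1\<close> is inserted in front of all positions from
  \<open>T\<close> on: doubling makes room, as \<open>2 * T\<close> is below
  \<open>2 * P v + 1\<close> exactly if \<open>T <= P v\<close>. \<open>X\<close> holds the letter
  directly behind it, if there is one. If that letter stays in \<open>M'\<close>, a later letter
  will separate the two, so \<open>k + 1\<close> does not count as the upper end of a
  descent.\<close>

lemma scanned_insert:
  assumes sc: "scanned k P M l r" and k: "1 \<le> k"
    and nx: "\<And>p. 1 \<le> p \<Longrightarrow> p \<le> k \<Longrightarrow> (T \<le> P p \<and> (\<forall>v. 1 \<le> v \<longrightarrow> v \<le> k \<longrightarrow> T \<le> P v \<longrightarrow> P p \<le> P v)) \<longleftrightarrow> p \<in> X"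
    and X: "X \<subseteq> M \<union> {k}" "k \<in> X \<Longrightarrow> M = {}"
    and M': "M' \<subseteq> M \<union> {k}" "M - X \<subseteq> M'"
    and sg: "side k P M (\<not> sg)" "\<And>p. p \<in> M' \<Longrightarrow> P p < T \<longleftrightarrow> sg"
    and bits: "(if T \<le> P k then (k \<in> M' \<or> k \<in> X) else (\<exists>p \<in> X. p \<notin> M')) = l k"
      "(if T \<le> P k then (\<exists>p \<in> X. p \<notin> M') else (k \<in> M' \<or> k \<in> X)) = r k"
    and P': "P' = (\<lambda>v. if v = k + 1 then 2 * T else 2 * P v + 1)"
  shows "scanned (k + 1) P' M' l r" "side (k + 1) P' M' sg"
proof -
  have inj: "inj_on P {1..k}" and MK: "M \<subseteq> {1..<k}"
    and alt: "\<And>p q. nxt P k q p \<Longrightarrow> p < q \<Longrightarrow> p \<notin> M \<Longrightarrow> \<exists>e. \<forall>v. p < v \<longrightarrow> v < q \<longrightarrow> ((even v = e) \<longleftrightarrow> P q < P v)"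
    and malt: "\<And>p. p \<in> M \<Longrightarrow> \<exists>e. \<forall>v. p < v \<longrightarrow> v \<le> k \<longrightarrow> ((even v = e) \<longleftrightarrow> P p < P v)"
    and old: "\<And>i. 1 \<le> i \<Longrightarrow> i < k \<Longrightarrow>
        (if P (i + 1) < P i then (i \<in> M \<or> (\<exists>q > i. nxt P k q i)) else (\<exists>p < i + 1. p \<notin> M \<and> nxt P k (i + 1) p)) = l i \<and>
        (if P (i + 1) < P i then (\<exists>p < i + 1. p \<notin> M \<and> nxt P k (i + 1) p) else (i \<in> M \<or> (\<exists>q > i. nxt P k q i))) = r i"
    using sc unfolding scanned_def by blast+
  have P'k: "P' (k + 1) = 2 * T" "P' (Suc k) = 2 * T" and P'v: "\<And>v. v \<le> k \<Longrightarrow> P' v = 2 * P v + 1" by (auto simp: P')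
  have lt: "P' a < P' b \<longleftrightarrow> P a < P b" if "a \<le> k" "b \<le> k" for a b using that by (simp add: P'v)
  have ltk: "P' (k + 1) < P' a \<longleftrightarrow> T \<le> P a" "P' a < P' (k + 1) \<longleftrightarrow> P a < T" if "a \<le> k" for a
    using that P'v[OF that] P'k by auto
  have inj': "inj_on P' {1..k + 1}"
  proof (rule inj_onI)
    fix a b assume ab: "a \<in> {1..k + 1}" "b \<in> {1..k + 1}" "P' a = P' b"
    have par: "2 * T \<noteq> 2 * P v + 1" "2 * P v + 1 \<noteq> 2 * T" "2 * T \<noteq> Suc (2 * P v)" "Suc (2 * P v) \<noteq> 2 * T" for v by presburger+
    consider "a \<le> k" "b \<le> k" | "a = k + 1" "b = k + 1" | "a \<le> k" "b = k + 1" | "a = k + 1" "b \<le> k"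
      using ab by fastforce
    then show "a = b" using ab par inj_eq[OF inj, of a b] by cases (auto simp del: Suc_eq_plus1 simp: P'v P'k dest: sym)
  qed
  have XK: "1 \<le> p" "p \<le> k" if "p \<in> X" for p using that X MK k by auto
  have n1: "nxt P' (k + 1) (k + 1) p \<longleftrightarrow> p \<in> X" if p: "p \<le> k" for p
  proof -
    have "nxt P' (k + 1) (k + 1) p \<longleftrightarrow> 1 \<le> p \<and> P' (k + 1) < P' p \<and> (\<forall>c. 1 \<le> c \<longrightarrow> c \<le> k \<longrightarrow> \<not> (P' (k + 1) < P' c \<and> P' c < P' p))"
      unfolding nxt_def using p by (auto simp: le_Suc_eq)
    also have "\<dots> \<longleftrightarrow> 1 \<le> p \<and> T \<le> P p \<and> (\<forall>v. 1 \<le> v \<longrightarrow> v \<le> k \<longrightarrow> T \<le> P v \<longrightarrow> P p \<le> P v)"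
      using p by (auto simp del: Suc_eq_plus1 simp: ltk[unfolded Suc_eq_plus1[symmetric]] ltk lt not_less)
    also have "\<dots> \<longleftrightarrow> p \<in> X" using nx[of p] p XK[of p] by blast
    finally show ?thesis .
  qed
  have n2: "nxt P' (k + 1) q p \<longleftrightarrow> nxt P k q p \<and> p \<notin> X" if qp: "q \<le> k" "p \<le> k" for q p
  proof -
    have "nxt P' (k + 1) q p \<longleftrightarrow> nxt P k q p \<and> \<not> (P q < T \<and> T \<le> P p)"
    proof -
      have ball: "(\<forall>c \<in> {1..k + 1}. Q c) \<longleftrightarrow> Q (k + 1) \<and> (\<forall>c \<in> {1..k}. Q c)" for Q :: "nat \<Rightarrow> bool"
        using atLeastAtMostSuc_conv[of 1 k] by simp
      have "(\<forall>c \<in> {1..k}. \<not> (P' q < P' c \<and> P' c < P' p)) \<longleftrightarrow> (\<forall>c \<in> {1..k}. \<not> (P q < P c \<and> P c < P p))"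
        using lt qp by auto
      then show ?thesis unfolding nxt_def ball lt[OF qp] ltk(2)[OF qp(1)] ltk(1)[OF qp(2)] using qp by auto
    qed
    also have "\<dots> \<longleftrightarrow> nxt P k q p \<and> p \<notin> X"
    proof -
      have "(P q < T \<and> T \<le> P p) \<longleftrightarrow> p \<in> X" if n: "nxt P k q p"
      proof
        assume h: "P q < T \<and> T \<le> P p"
        have "P p \<le> P v" if "1 \<le> v" "v \<le> k" "T \<le> P v" for v
          using nxtD(6)[OF n, of v] that h by auto
        then show "p \<in> X" using nx[of p] nxtD[OF n] h by blast
      next
        assume "p \<in> X"
        then have "T \<le> P p" "\<And>v. 1 \<le> v \<Longrightarrow> v \<le> k \<Longrightarrow> T \<le> P v \<Longrightarrow> P p \<le> P v" using nx[of p] XK[of p] by auto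
        then show "P q < T \<and> T \<le> P p" using nxtD(1,2,5)[OF n] by (meson leD not_le_imp_less)
      qed
      then show ?thesis by blast
    qed
    finally show ?thesis .
  qed
  have Mp: "p \<in> M" if "p \<in> M'" "p < k" for p using that M' by auto
  have alt': "\<exists>e. \<forall>v. p < v \<longrightarrow> v < q \<longrightarrow> ((even v = e) \<longleftrightarrow> P' q < P' v)"
    if n: "nxt P' (k + 1) q p" "p < q" "p \<notin> M'" for p q
  proof (cases "q = k + 1")
    case True
    then have pX: "p \<in> X" using n1[of p] n by auto
    show ?thesis
    proof (cases "p = k")
      case True then show ?thesis using \<open>q = k + 1\<close> by auto
    next
      case False
      then have "p \<in> M" using pX X by auto
      then obtain e where e: "\<forall>v. p < v \<longrightarrow> v \<le> k \<longrightarrow> ((even v = e) \<longleftrightarrow> P p < P v)" using malt by blast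
      have "P' q < P' v \<longleftrightarrow> P p < P v" if v: "p < v" "v < q" for v
      proof -
        have "T \<le> P v \<longleftrightarrow> P p \<le> P v" using nx[of p] pX XK[OF pX] v True by (auto intro: le_trans)
        moreover have "P p \<noteq> P v" using inj_eq[OF inj, of p v] XK[OF pX] v True by auto
        ultimately show ?thesis using ltk(1)[of v] v True by auto
      qed
      then show ?thesis using e True by (intro exI[of _ e]) auto
    qed
  next
    case False
    then have qk: "q \<le> k" "p \<le> k" using nxtD[OF n(1)] n(2) by auto
    then have o: "nxt P k q p" "p \<notin> X" using n2 n by auto
    then have "p \<notin> M" using M' n by auto
    then obtain e where "\<forall>v. p < v \<longrightarrow> v < q \<longrightarrow> ((even v = e) \<longleftrightarrow> P q < P v)" using alt[OF o(1) n(2)] by blast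
    then show ?thesis using qk by (intro exI[of _ e]) (auto simp: lt)
  qed
  have malt': "\<exists>e. \<forall>v. p < v \<longrightarrow> v \<le> k + 1 \<longrightarrow> ((even v = e) \<longleftrightarrow> P' p < P' v)" if p: "p \<in> M'" for p
  proof -
    have pk: "p \<le> k" using p M' MK by auto
    have sgp: "P' p < P' (k + 1) \<longleftrightarrow> sg" using sg(2)[OF p] ltk(2)[OF pk] by simp
    show ?thesis
    proof (cases "p = k")
      case True
      then show ?thesis using sgp by (intro exI[of _ "even (k + 1) = sg"]) (auto simp: le_Suc_eq)
    next
      case False
      then have pM: "p \<in> M" using Mp p pk by auto
      then obtain e where e: "\<forall>v. p < v \<longrightarrow> v \<le> k \<longrightarrow> ((even v = e) \<longleftrightarrow> P p < P v)" using malt by blast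
      \<comment> \<open>The marks lay on the other side of \<open>k\<close>; the change of side at
        \<open>k + 1\<close> agrees with the change of parity, so the old \<open>e\<close> continues
        to work.\<close>
      have "p < k" "P p < P k \<longleftrightarrow> \<not> sg" using pM MK sg(1) unfolding side_def by auto
      then have "(even k = e) \<longleftrightarrow> \<not> sg" using e by blast
      then have "(even (k + 1) = e) \<longleftrightarrow> sg" by auto
      then show ?thesis using e sgp pk by (intro exI[of _ e]) (auto simp: le_Suc_eq lt)
    qed
  qed
  have up: "(i \<in> M' \<or> (\<exists>q > i. nxt P' (k + 1) q i)) \<longleftrightarrow> (i \<in> M \<or> (\<exists>q > i. nxt P k q i))" if i: "1 \<le> i" "i < k" for i
  proof (cases "i \<in> X")
    case True
    then have "i \<in> M" using X i by auto
    moreover have "nxt P' (k + 1) (k + 1) i" using n1[of i] True i by auto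
    ultimately show ?thesis using i by (metis less_SucI Suc_eq_plus1)
  next
    case False
    then have "i \<in> M' \<longleftrightarrow> i \<in> M" using M' i Mp by auto
    moreover have "(\<exists>q > i. nxt P' (k + 1) q i) \<longleftrightarrow> (\<exists>q > i. nxt P k q i)"
    proof
      assume "\<exists>q > i. nxt P' (k + 1) q i"
      then obtain q where q: "q > i" "nxt P' (k + 1) q i" by blast
      then have "q \<noteq> k + 1" using n1[of i] False i by auto
      then have "q \<le> k" using nxtD(2)[OF q(2)] by simp
      then show "\<exists>q > i. nxt P k q i" using n2[of q i] q i by auto
    next
      assume "\<exists>q > i. nxt P k q i"
      then obtain q where q: "q > i" "nxt P k q i" by blast
      then show "\<exists>q > i. nxt P' (k + 1) q i" using n2[of q i] nxtD(2)[OF q(2)] False i by auto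
    qed
    ultimately show ?thesis by blast
  qed
  have down: "(\<exists>p < i + 1. p \<notin> M' \<and> nxt P' (k + 1) (i + 1) p) \<longleftrightarrow> (\<exists>p < i + 1. p \<notin> M \<and> nxt P k (i + 1) p)"
    if i: "1 \<le> i" "i < k" for i
  proof -
    have "p \<notin> M' \<and> nxt P' (k + 1) (i + 1) p \<longleftrightarrow> p \<notin> M \<and> nxt P k (i + 1) p" if p: "p < i + 1" for p
    proof -
      have "nxt P' (k + 1) (i + 1) p \<longleftrightarrow> nxt P k (i + 1) p \<and> p \<notin> X" using n2[of "i + 1" p] i p by auto
      moreover have "p \<in> X \<Longrightarrow> p \<in> M" using X p i by auto
      moreover have "p \<notin> X \<Longrightarrow> p \<in> M' \<longleftrightarrow> p \<in> M" using M' Mp p i by auto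
      ultimately show ?thesis by blast
    qed
    then show ?thesis by blast
  qed
  have upk: "(k \<in> M' \<or> (\<exists>q > k. nxt P' (k + 1) q k)) \<longleftrightarrow> (k \<in> M' \<or> k \<in> X)"
  proof -
    have "(\<exists>q > k. nxt P' (k + 1) q k) \<longleftrightarrow> nxt P' (k + 1) (k + 1) k"
      using nxtD(2) by (metis Suc_eq_plus1 le_antisym lessI Suc_leI)
    then show ?thesis using n1[of k] by simp
  qed
  have downk: "(\<exists>p < k + 1. p \<notin> M' \<and> nxt P' (k + 1) (k + 1) p) \<longleftrightarrow> (\<exists>p \<in> X. p \<notin> M')"
    using n1 XK by (metis Suc_eq_plus1 less_Suc_eq_le)
  have new: "(if P' (i + 1) < P' i then (i \<in> M' \<or> (\<exists>q > i. nxt P' (k + 1) q i)) else (\<exists>p < i + 1. p \<notin> M' \<and> nxt P' (k + 1) (i + 1) p)) = l i \<and>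
        (if P' (i + 1) < P' i then (\<exists>p < i + 1. p \<notin> M' \<and> nxt P' (k + 1) (i + 1) p) else (i \<in> M' \<or> (\<exists>q > i. nxt P' (k + 1) q i))) = r i"
    if i: "1 \<le> i" "i < k + 1" for i
  proof (cases "i = k")
    case True
    have "P' (i + 1) < P' i \<longleftrightarrow> T \<le> P k" using ltk(1)[of k] True by simp
    then show ?thesis using bits unfolding True upk downk by simp
  next
    case False
    then have i': "1 \<le> i" "i < k" using i by auto
    have "P' (i + 1) < P' i \<longleftrightarrow> P (i + 1) < P i" using lt[of "i + 1" i] i' by simp
    then show ?thesis using old[OF i'] unfolding up[OF i'] down[OF i'] by simp
  qed
  have "M' \<subseteq> {1..<k} \<union> {k}" using M'(1) MK by blast
  also have "\<dots> = {1..<k + 1}" using k by auto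
  finally have "M' \<subseteq> {1..<k + 1}" .
  with inj' show "scanned (k + 1) P' M' l r" unfolding scanned_def using inj' alt' malt' new by blast
  show "side (k + 1) P' M' sg" unfolding side_def
    using sg(2) ltk(2) \<open>M' \<subseteq> {1..<k + 1}\<close> by (metis atLeastLessThan_iff less_Suc_eq_le Suc_eq_plus1 subsetD)
qed

text \<open>The side of the marks flips at each step, and their number changes by
  \<open>l k - r k\<close> or its opposite according to that side. With the sign
  \<open>(-1) ^ k\<close> the two alternations cancel, so \<open>bsum\<close> keeps track of the
  signed number of marks.\<close>

definition bsum :: "nat \<Rightarrow> (nat \<Rightarrow> bool) \<Rightarrow> (nat \<Rightarrow> bool) \<Rightarrow> int" where
  "bsum k l r = (\<Sum>i \<in> {1..<k}. (-1) ^ i * (of_bool (l i) - of_bool (r i)))"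

lemma bsum_Suc: "1 \<le> k \<Longrightarrow> bsum (k + 1) l r = bsum k l r + (-1) ^ k * (of_bool (l k) - of_bool (r k))"
  by (simp add: bsum_def)

lemma scanned_exists:
  assumes "1 \<le> k"
  shows "\<exists>P M sg. scanned k P M l r \<and> side k P M sg \<and>
    bsum k l r = (if sg then (-1) ^ k else - ((-1) ^ k)) * int (card M)"
  using assms
proof (induction k)
  case (Suc k)
  show ?case
  proof (cases "k = 0")
    case True
    have "\<not> nxt (\<lambda>_. 0) 1 q p" for q p by (simp add: nxt_def)
    then have "scanned 1 (\<lambda>_. 0) {} l r" by (simp add: scanned_def)
    moreover have "side 1 (\<lambda>_. 0) {} True" by (simp add: side_def)
    moreover have "bsum 1 l r = (if True then (-1) ^ 1 else - ((-1) ^ 1)) * int (card ({} :: nat set))" by (simp add: bsum_def)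
    ultimately show ?thesis unfolding True by (intro exI[of _ "\<lambda>_. 0"] exI[of _ "{}"] exI[of _ True]) simp
  next
    case False
    then have k: "1 \<le> k" by simp
    then obtain P M sg where sc: "scanned k P M l r" "side k P M sg"
      and cnt: "bsum k l r = (if sg then (-1) ^ k else - ((-1) ^ k)) * int (card M)" using Suc by blast
    have inj: "inj_on P {1..k}" and MK: "M \<subseteq> {1..<k}" using sc by (auto simp: scanned_def)
    have finM: "finite M" "k \<notin> M" using MK finite_subset by auto
    have before: "(P c \<le> P p \<and> (\<forall>v. 1 \<le> v \<longrightarrow> v \<le> k \<longrightarrow> P c \<le> P v \<longrightarrow> P p \<le> P v)) \<longleftrightarrow> p \<in> {c}"
      if "1 \<le> c" "c \<le> k" "1 \<le> p" "p \<le> k" for c p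
      using inj_eq[OF inj, of c p] that by (auto intro: le_antisym)
    have neqk: "P p \<noteq> P k" if "p \<in> M" for p using inj_eq[OF inj, of p k] that MK k by auto
    note bs = bsum_Suc[OF k, of l r]
    \<comment> \<open>\<open>R\<close> says that \<open>k + 1\<close> goes before \<open>k\<close>.
      If there are marks, their side decides; if there are none, either side holds vacuously and the
      bit \<open>l k\<close> decides.\<close>
    define R where "R = (if M = {} then l k else sg)"
    show ?thesis
    proof (cases R)
      case R: True
      have sgT: "side k P M (\<not> False)" using sc(2) R by (auto simp: R_def side_def split: if_splits)
      \<comment> \<open>The letter to follow \<open>k + 1\<close>: the first mark, or
        \<open>k\<close> if there is no mark.\<close>
      obtain c where c: "c \<in> M \<union> {k}" "c = k \<longleftrightarrow> M = {}" "\<And>p. p \<in> M \<union> {k} \<Longrightarrow> P c \<le> P p"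
      proof (cases "M = {}")
        case True then show thesis using that[of k] by auto
      next
        case False
        then have "Min (P ` M) \<in> P ` M" using finM by (intro Min_in) auto
        then obtain c where c: "c \<in> M" "P c = Min (P ` M)" by auto
        then have "P c \<le> P p" if "p \<in> M" for p using that finM by simp
        moreover have "P c < P k" using c sgT by (auto simp: side_def)
        ultimately show thesis using that[of c] c finM False by fastforce
      qed
      have ck: "1 \<le> c" "c \<le> k" using c(1) MK k by auto
      \<comment> \<open>\<open>k\<close> is the later letter and opens a descent if
        \<open>l k\<close> holds; \<open>k + 1\<close> closes the one ending at \<open>c\<close>
        exactly if \<open>r k\<close> holds. For \<open>c = k\<close> both may happen at
        once.\<close>
      define M' where "M' = (M \<union> (if l k then {k} else {})) - (if r k then {c} else {})"
      have Pk: "P c \<le> P k" using c(3) by simp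
      have lM: "M = {} \<Longrightarrow> l k" using R by (simp add: R_def)
      have b1: "(if P c \<le> P k then (k \<in> M' \<or> k \<in> {c}) else (\<exists>p \<in> {c}. p \<notin> M')) = l k"
        using Pk c(2) lM finM by (auto simp: M'_def)
      have b2: "(if P c \<le> P k then (\<exists>p \<in> {c}. p \<notin> M') else (k \<in> M' \<or> k \<in> {c})) = r k"
        using Pk c(1,2) lM by (auto simp: M'_def)
      have sgM: "P p < P c \<longleftrightarrow> False" if "p \<in> M'" for p
        using that c(3)[of p] by (auto simp: M'_def split: if_splits)
      have M'sub: "M' \<subseteq> M \<union> {k}" "M - {c} \<subseteq> M'" "{c} \<subseteq> M \<union> {k}" using c(1) by (auto simp: M'_def split: if_splits)
      have cX: "k \<in> {c} \<Longrightarrow> M = {}" using c(2) by auto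
      note ins = scanned_insert[OF sc(1) k before[OF ck] M'sub(3) cX M'sub(1,2) sgT sgM b1 b2 refl]
      have "int (card M') = int (card M) + of_bool (l k) - of_bool (r k)"
      proof -
        have "c \<in> M \<union> (if l k then {k} else {})" using c(1,2) lM by auto
        then have "r k \<Longrightarrow> card (M \<union> (if l k then {k} else {})) > 0" using finM by (auto simp: card_gt_0_iff)
        then show ?thesis using \<open>c \<in> M \<union> (if l k then {k} else {})\<close> finM by (auto simp: M'_def card_Diff_singleton)
      qed
      then have "int (card M') = int (card M) + (of_bool (l k) - of_bool (r k))" by simp
      then have "(-1) ^ k * int (card M') = (-1) ^ k * int (card M) + (-1) ^ k * (of_bool (l k) - of_bool (r k))"
        by (simp only: distrib_left)
      moreover have "bsum k l r = (-1) ^ k * int (card M)"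
        using cnt R by (cases "M = {}") (auto simp: R_def)
      ultimately have "bsum (k + 1) l r = (if False then (-1) ^ (k + 1) else - ((-1) ^ (k + 1))) * int (card M')"
        using bs by simp
      then show ?thesis using ins unfolding Suc_eq_plus1 by blast
    next
      case R: False
      have sgF: "side k P M (\<not> True)" using sc(2) R by (auto simp: R_def side_def split: if_splits)
      have cntF: "bsum k l r = - ((-1) ^ k) * int (card M)"
        using cnt R by (cases "M = {}") (auto simp: R_def)
      have far: "P k < P p" if "p \<in> M" for p using neqk[OF that] sgF that by (auto simp: side_def)
      show ?thesis
      \<comment> \<open>Now \<open>k + 1\<close> follows \<open>k\<close>. If \<open>l k\<close>
        holds it must be the upper end of a descent, so it closes one, and this has to be at the
        last mark to keep the other marks on its left.\<close>
      proof (cases "l k")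
        case l: True
        then have "M \<noteq> {}" using R by (auto simp: R_def)
        then have "Max (P ` M) \<in> P ` M" using finM by (intro Max_in) auto
        then obtain c where c: "c \<in> M" "P c = Max (P ` M)" by auto
        then have cmax: "P p \<le> P c" if "p \<in> M" for p using that finM by simp
        have ck: "1 \<le> c" "c \<le> k" "c \<noteq> k" using c(1) MK by auto
        define M' where "M' = (M \<union> (if r k then {k} else {})) - {c}"
        have Pk: "\<not> P c \<le> P k" using far[OF c(1)] by simp
        have b1: "(if P c \<le> P k then (k \<in> M' \<or> k \<in> {c}) else (\<exists>p \<in> {c}. p \<notin> M')) = l k"
          using Pk l by (auto simp: M'_def)
        have b2: "(if P c \<le> P k then (\<exists>p \<in> {c}. p \<notin> M') else (k \<in> M' \<or> k \<in> {c})) = r k"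
          using Pk ck finM by (auto simp: M'_def)
        have sgM: "P p < P c \<longleftrightarrow> True" if p: "p \<in> M'" for p
        proof (cases "p = k")
          case True then show ?thesis using Pk by simp
        next
          case False
          then have pM: "p \<in> M" "p \<noteq> c" using p by (auto simp: M'_def split: if_splits)
          then have "P p \<noteq> P c" using inj_eq[OF inj, of p c] MK ck by auto
          then show ?thesis using cmax[OF pM(1)] by simp
        qed
        have M'sub: "M' \<subseteq> M \<union> {k}" "M - {c} \<subseteq> M'" "{c} \<subseteq> M \<union> {k}" using c(1) by (auto simp: M'_def split: if_splits)
        have cX: "k \<in> {c} \<Longrightarrow> M = {}" using ck by auto
        note ins = scanned_insert[OF sc(1) k before[OF ck(1,2)] M'sub(3) cX M'sub(1,2) sgF sgM b1 b2 refl]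
        have "card M > 0" using \<open>M \<noteq> {}\<close> finM by (auto simp: card_gt_0_iff)
        then have "int (card M') = int (card M) + (of_bool (r k) - 1)"
          using c(1) finM by (auto simp: M'_def card_Diff_singleton)
        then have "(-1) ^ k * int (card M') = (-1) ^ k * int (card M) + (-1) ^ k * (of_bool (r k) - 1)"
          by (simp only: distrib_left)
        then have "bsum (k + 1) l r = (if True then (-1) ^ (k + 1) else - ((-1) ^ (k + 1))) * int (card M')"
          using bs cntF l by (simp add: right_diff_distrib)
        then show ?thesis using ins unfolding Suc_eq_plus1 by blast
      next
        case l: False
        \<comment> \<open>A position behind all letters: \<open>k + 1\<close> goes to the end and
          starts no descent.\<close>
        define T where "T = Suc (Max (P ` {1..k}))"
        have big: "P v < T" if "1 \<le> v" "v \<le> k" for v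
          using that by (auto simp: T_def less_Suc_eq_le)
        define M' where "M' = M \<union> (if r k then {k} else {})"
        have none: "(T \<le> P p \<and> (\<forall>v. 1 \<le> v \<longrightarrow> v \<le> k \<longrightarrow> T \<le> P v \<longrightarrow> P p \<le> P v)) \<longleftrightarrow> p \<in> {}"
          if "1 \<le> p" "p \<le> k" for p using big[OF that] by simp
        have Tk: "\<not> T \<le> P k" using big[of k] k by simp
        have b1: "(if T \<le> P k then (k \<in> M' \<or> k \<in> {}) else (\<exists>p \<in> {}. p \<notin> M')) = l k" using Tk l by simp
        have b2: "(if T \<le> P k then (\<exists>p \<in> {}. p \<notin> M') else (k \<in> M' \<or> k \<in> {})) = r k"
          using Tk finM by (auto simp: M'_def)
        have M'sub: "M' \<subseteq> M \<union> {k}" "M - {} \<subseteq> M'" "{} \<subseteq> M \<union> {k}" by (auto simp: M'_def split: if_splits)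
        have sgM: "P p < T \<longleftrightarrow> True" if p: "p \<in> M'" for p
        proof -
          have "1 \<le> p" "p \<le> k" using M'sub(1) p MK k by auto
          then show ?thesis using big by simp
        qed
        have cX: "k \<in> {} \<Longrightarrow> M = {}" by simp
        note ins = scanned_insert[OF sc(1) k none M'sub(3) cX M'sub(1,2) sgF sgM b1 b2 refl]
        have "int (card M') = int (card M) + of_bool (r k)"
          using finM by (auto simp: M'_def)
        then have "(-1) ^ k * int (card M') = (-1) ^ k * int (card M) + (-1) ^ k * of_bool (r k)"
          by (simp only: distrib_left)
        then have "bsum (k + 1) l r = (if True then (-1) ^ (k + 1) else - ((-1) ^ (k + 1))) * int (card M')"
          using bs cntF l by (simp add: right_diff_distrib)
        then show ?thesis using ins unfolding Suc_eq_plus1 by blast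
      qed
    qed
  qed
qed simp

text \<open>A vanishing signed count leaves no open mark, and a scanned word without marks is
  alternating with the prescribed bits.\<close>

theorem alternating_exists:
  assumes N: "1 \<le> N" and b: "bsum N l r = 0"
  obtains P where "alternating P N" "\<And>i. 1 \<le> i \<Longrightarrow> i < N \<Longrightarrow> lbit P N i = l i \<and> rbit P N i = r i"
proof -
  obtain P M sg where sc: "scanned N P M l r"
    and cnt: "bsum N l r = (if sg then (-1) ^ N else - ((-1) ^ N)) * int (card M)"
    using scanned_exists[OF N] by blast
  have "card M = 0" using cnt b by (auto split: if_splits)
  moreover have "finite M" using sc finite_subset by (auto simp: scanned_def)
  ultimately have "M = {}" by simp
  note sc = sc[unfolded this scanned_def]
  have "alternating P N" using sc unfolding alternating_def by simp
  moreover have "lbit P N i = l i \<and> rbit P N i = r i" if "1 \<le> i" "i < N" for i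
    using sc that unfolding lbit_def rbit_def by auto
  ultimately show thesis by (rule that)
qed

text \<open>Reflecting the index keeps its parity because \<open>N\<close> is even, so the
  alternating sums over \<open>l\<close> and \<open>r\<close> agree.\<close>

lemma bsum_palindrome:
  assumes N: "even N" and r: "\<And>i. 1 \<le> i \<Longrightarrow> i < N \<Longrightarrow> r i = l (N - i)" shows "bsum N l r = 0"
proof -
  have "(\<Sum>i \<in> {1..<N}. (-1) ^ i * of_bool (r i) :: int) = (\<Sum>i \<in> {1..<N}. (-1) ^ i * of_bool (l i))"
  proof (rule sum.reindex_bij_witness[of _ "\<lambda>i. N - i" "\<lambda>i. N - i"])
    fix i assume "i \<in> {1..<N}"
    then show "(-1) ^ (N - i) * of_bool (l (N - i)) = ((-1) ^ i * of_bool (r i) :: int)"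
      using r[of i] N by (simp add: minus_one_power_iff)
  qed auto
  then show ?thesis by (simp add: bsum_def right_diff_distrib sum_subtractf)
qed

section \<open>Comparing the descents of a word with the ascents of another\<close>

text \<open>\<open>falls\<close> says that every pair in the rectangle of the arc is inverted,
  \<open>rises\<close> that no pair in the rectangle of the opposite type is. These are the
  memberships in \<open>As\<close> and \<open>Bs\<close>, phrased for bare position
  functions.\<close>

definition falls :: "(nat \<Rightarrow> nat) \<Rightarrow> bool \<Rightarrow> nat \<Rightarrow> nat \<Rightarrow> bool" where
  "falls P e p q \<longleftrightarrow> p < q \<and> (\<forall>a b. p \<le> a \<longrightarrow> a < b \<longrightarrow> b \<le> q \<longrightarrow> (a = p \<or> even a = e) \<longrightarrow> (b = q \<or> even b \<noteq> e) \<longrightarrow> P b < P a)"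
definition rises :: "(nat \<Rightarrow> nat) \<Rightarrow> bool \<Rightarrow> nat \<Rightarrow> nat \<Rightarrow> bool" where
  "rises P e p q \<longleftrightarrow> p < q \<and> (\<forall>a b. p \<le> a \<longrightarrow> a < b \<longrightarrow> b \<le> q \<longrightarrow> (a = p \<or> even a \<noteq> e) \<longrightarrow> (b = q \<or> even b = e) \<longrightarrow> P a < P b)"

text \<open>The counterpart of \<open>lbit\<close> for ascents; it asks about the same letter, the
  later of \<open>i\<close> and \<open>i + 1\<close>.\<close>

definition ubit :: "(nat \<Rightarrow> nat) \<Rightarrow> nat \<Rightarrow> nat \<Rightarrow> bool" where
  "ubit P N i \<longleftrightarrow> (if P (i + 1) < P i then \<exists>q > i. nxt P N i q else \<exists>p < i + 1. nxt P N p (i + 1))"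

text \<open>
  The arc from \<open>p\<close> to \<open>q\<close> of type \<open>e\<close> has its lower end at \<open>i\<close> or its upper end at \<open>i + 1\<close>, and the other of
  these two points does not lie to its right. This makes the bits a function of the set of labels alone.
\<close>

definition arc_bit :: "nat \<Rightarrow> (nat \<times> nat) \<times> bool \<Rightarrow> bool" where
  "arc_bit i = (\<lambda>((p, q), e). (q = i + 1 \<and> (p = i \<or> even i \<noteq> e)) \<or> (p = i \<and> (q = i + 1 \<or> even (i + 1) \<noteq> e)))"

lemma fallsD:
  assumes "falls P e p q"
  shows "p < q" "P q < P p" "\<And>v. p < v \<Longrightarrow> v < q \<Longrightarrow> even v = e \<Longrightarrow> P q < P v"
    "\<And>v. p < v \<Longrightarrow> v < q \<Longrightarrow> even v \<noteq> e \<Longrightarrow> P v < P p"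
    "\<And>a b. p < a \<Longrightarrow> a < b \<Longrightarrow> b < q \<Longrightarrow> even a = e \<Longrightarrow> even b \<noteq> e \<Longrightarrow> P b < P a"
  using assms unfolding falls_def by auto

lemma risesD:
  assumes "rises P e p q"
  shows "p < q" "P p < P q" "\<And>v. p < v \<Longrightarrow> v < q \<Longrightarrow> even v \<noteq> e \<Longrightarrow> P v < P q"
    "\<And>v. p < v \<Longrightarrow> v < q \<Longrightarrow> even v = e \<Longrightarrow> P p < P v"
    "\<And>a b. p < a \<Longrightarrow> a < b \<Longrightarrow> b < q \<Longrightarrow> even a \<noteq> e \<Longrightarrow> even b = e \<Longrightarrow> P a < P b"
  using assms unfolding rises_def by auto

text \<open>Nothing stands between \<open>q\<close> and \<open>p\<close>, so avoiding one side of
  the pair means lying on the other. This turns the one-sided conditions of \<open>falls\<close>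
  into equivalences.\<close>

lemma fall_side:
  assumes inj: "inj_on P {1..N}" and n: "nxt P N q p" and f: "falls P e p q" and v: "p < v" "v < q"
  shows "even v = e \<longleftrightarrow> P q < P v" "even v \<noteq> e \<longleftrightarrow> P v < P p" "even v = e \<longleftrightarrow> P p < P v" "even v \<noteq> e \<longleftrightarrow> P v < P q"
proof -
  have r: "1 \<le> v" "v \<le> N" using nxtD[OF n] v by auto
  have ne: "P v \<noteq> P p" "P v \<noteq> P q" using inj_eq[OF inj, of v p] inj_eq[OF inj, of v q] nxtD[OF n] v r by auto
  have "P q < P v \<Longrightarrow> P p < P v" using nxtD(6)[OF n r] ne by auto
  then show "even v = e \<longleftrightarrow> P q < P v" "even v \<noteq> e \<longleftrightarrow> P v < P p" "even v = e \<longleftrightarrow> P p < P v" "even v \<noteq> e \<longleftrightarrow> P v < P q"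
    using fallsD(3,4)[OF f v] ne nxtD(5)[OF n] by linarith+
qed

lemma rise_side:
  assumes inj: "inj_on P {1..N}" and n: "nxt P N p q" and f: "rises P e p q" and v: "p < v" "v < q"
  shows "even v = e \<longleftrightarrow> P q < P v" "even v \<noteq> e \<longleftrightarrow> P v < P p" "even v = e \<longleftrightarrow> P p < P v" "even v \<noteq> e \<longleftrightarrow> P v < P q"
proof -
  have r: "1 \<le> v" "v \<le> N" using nxtD[OF n] v by auto
  have ne: "P v \<noteq> P p" "P v \<noteq> P q" using inj_eq[OF inj, of v p] inj_eq[OF inj, of v q] nxtD[OF n] v r by auto
  have "P p < P v \<Longrightarrow> P q < P v" using nxtD(6)[OF n r] ne by auto
  then show "even v = e \<longleftrightarrow> P q < P v" "even v \<noteq> e \<longleftrightarrow> P v < P p" "even v = e \<longleftrightarrow> P p < P v" "even v \<noteq> e \<longleftrightarrow> P v < P q"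
    using risesD(3,4)[OF f v] ne nxtD(5)[OF n] by linarith+
qed

text \<open>\<open>E\<close> is a set of labels in which every descent of the word occurs. Rowmotion
  transports label sets and not words, so the bits have to be expressed through labels.\<close>

lemma lbit_arc:
  assumes inj: "inj_on P {1..N}" and arc: "\<And>p q. nxt P N q p \<Longrightarrow> p < q \<Longrightarrow> \<exists>e. falls P e p q \<and> E p q e"
    and E: "\<And>p q e. E p q e \<Longrightarrow> falls P e p q" and i: "1 \<le> i" "i < N"
  shows "lbit P N i \<longleftrightarrow> (\<exists>p q e. nxt P N q p \<and> E p q e \<and> arc_bit i ((p, q), e))"
proof
  assume l: "lbit P N i"
  show "\<exists>p q e. nxt P N q p \<and> E p q e \<and> arc_bit i ((p, q), e)"
  proof (cases "P (i + 1) < P i")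
    case True
    then obtain q where q: "q > i" "nxt P N q i" using l by (auto simp: lbit_def)
    then obtain e where e: "falls P e i q" "E i q e" using arc by blast
    have "q = i + 1 \<or> even (i + 1) \<noteq> e"
      using fall_side(2)[OF inj q(2) e(1), of "i + 1"] q(1) True by linarith
    then show ?thesis using q e by (auto simp: arc_bit_def)
  next
    case False
    then obtain p where p: "p < i + 1" "nxt P N (i + 1) p" using l by (auto simp: lbit_def)
    then obtain e where e: "falls P e p (i + 1)" "E p (i + 1) e" using arc by blast
    have "P i \<noteq> P (i + 1)" using inj_eq[OF inj, of i "i + 1"] i by auto
    then have "p = i \<or> even i \<noteq> e"
      using fall_side(4)[OF inj p(2) e(1), of i] p(1) False by linarith
    then show ?thesis using p e by (auto simp: arc_bit_def)
  qed
next
  assume "\<exists>p q e. nxt P N q p \<and> E p q e \<and> arc_bit i ((p, q), e)"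
  then obtain p q e where h: "nxt P N q p" "falls P e p q" "arc_bit i ((p, q), e)" using E by blast
  have pq: "p < q" using fallsD(1)[OF h(2)] .
  consider "p = i" "q = i + 1" | "p < i" "q = i + 1" "even i \<noteq> e" | "p = i" "q > i + 1" "even (i + 1) \<noteq> e"
    using h(3) pq unfolding arc_bit_def by fastforce
  then show "lbit P N i"
  proof cases
    case 1 then show ?thesis using nxtD(5)[OF h(1)] h(1) by (auto simp: lbit_def)
  next
    case 2
    then have "P i < P (i + 1)" using fall_side(4)[OF inj h(1,2), of i] by auto
    moreover have "\<exists>p < i + 1. nxt P N (i + 1) p" using 2 h(1) pq by blast
    ultimately show ?thesis by (simp add: lbit_def)
  next
    case 3
    then have "P (i + 1) < P i" using fall_side(2)[OF inj h(1,2), of "i + 1"] by auto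
    moreover have "\<exists>q > i. nxt P N q i" using 3 h(1) pq by blast
    ultimately show ?thesis by (simp add: lbit_def)
  qed
qed

lemma ubit_arc:
  assumes inj: "inj_on P {1..N}" and arc: "\<And>p q. nxt P N p q \<Longrightarrow> p < q \<Longrightarrow> \<exists>e. rises P e p q \<and> E p q e"
    and E: "\<And>p q e. E p q e \<Longrightarrow> rises P e p q" and i: "1 \<le> i" "i < N"
  shows "ubit P N i \<longleftrightarrow> (\<exists>p q e. nxt P N p q \<and> E p q e \<and> arc_bit i ((p, q), e))"
proof
  assume l: "ubit P N i"
  show "\<exists>p q e. nxt P N p q \<and> E p q e \<and> arc_bit i ((p, q), e)"
  proof (cases "P (i + 1) < P i")
    case True
    then obtain q where q: "q > i" "nxt P N i q" using l by (auto simp: ubit_def)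
    then obtain e where e: "rises P e i q" "E i q e" using arc by blast
    have "q = i + 1 \<or> even (i + 1) \<noteq> e"
      using rise_side(2)[OF inj q(2) e(1), of "i + 1"] q(1) True by linarith
    then show ?thesis using q e by (auto simp: arc_bit_def)
  next
    case False
    then obtain p where p: "p < i + 1" "nxt P N p (i + 1)" using l by (auto simp: ubit_def)
    then obtain e where e: "rises P e p (i + 1)" "E p (i + 1) e" using arc by blast
    have "P i \<noteq> P (i + 1)" using inj_eq[OF inj, of i "i + 1"] i by auto
    then have "p = i \<or> even i \<noteq> e"
      using rise_side(4)[OF inj p(2) e(1), of i] p(1) False by linarith
    then show ?thesis using p e by (auto simp: arc_bit_def)
  qed
next
  assume "\<exists>p q e. nxt P N p q \<and> E p q e \<and> arc_bit i ((p, q), e)"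
  then obtain p q e where h: "nxt P N p q" "rises P e p q" "arc_bit i ((p, q), e)" using E by blast
  have pq: "p < q" using risesD(1)[OF h(2)] .
  consider "p = i" "q = i + 1" | "p < i" "q = i + 1" "even i \<noteq> e" | "p = i" "q > i + 1" "even (i + 1) \<noteq> e"
    using h(3) pq unfolding arc_bit_def by fastforce
  then show "ubit P N i"
  proof cases
    case 1 then show ?thesis using nxtD(5)[OF h(1)] h(1) by (auto simp: ubit_def)
  next
    case 2
    then have "P i < P (i + 1)" using rise_side(4)[OF inj h(1,2), of i] by auto
    moreover have "\<exists>p < i + 1. nxt P N p (i + 1)" using 2 h(1) pq by blast
    ultimately show ?thesis by (simp add: ubit_def)
  next
    case 3
    then have "P (i + 1) < P i" using rise_side(2)[OF inj h(1,2), of "i + 1"] by auto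
    moreover have "\<exists>q > i. nxt P N i q" using 3 h(1) pq by blast
    ultimately show ?thesis by (simp add: ubit_def)
  qed
qed

text \<open>Meant for the minimum \<open>P\<close> and the maximum \<open>Q\<close> of one class:
  the same arcs lie below both and above both, and the descents of \<open>P\<close> as well as the
  ascents of \<open>Q\<close> are arcs.\<close>

locale arc_words =
  fixes P Q :: "nat \<Rightarrow> nat" and N :: nat
  assumes injP: "inj_on P {1..N}" and injQ: "inj_on Q {1..N}"
    and falls_eq: "1 \<le> p \<Longrightarrow> q \<le> N \<Longrightarrow> falls P e p q = falls Q e p q"
    and rises_eq: "1 \<le> p \<Longrightarrow> q \<le> N \<Longrightarrow> rises P e p q = rises Q e p q"
    and fallP: "nxt P N q p \<Longrightarrow> p < q \<Longrightarrow> \<exists>e. falls P e p q"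
    and riseQ: "nxt Q N p q \<Longrightarrow> p < q \<Longrightarrow> \<exists>e. rises Q e p q"
begin

lemma order_1: "1 \<le> i \<Longrightarrow> i < N \<Longrightarrow> P (i + 1) < P i \<longleftrightarrow> Q (i + 1) < Q i"
proof -
  assume i: "1 \<le> i" "i < N"
  have "falls R e i (i + 1) \<longleftrightarrow> R (i + 1) < R i" for R e
  proof -
    have "a = i \<and> b = i + 1" if "i \<le> a" "a < b" "b \<le> i + 1" for a b using that by linarith
    then have "\<And>a b. i \<le> a \<Longrightarrow> a < b \<Longrightarrow> b \<le> i + 1 \<Longrightarrow> R b < R a" if "R (i + 1) < R i" using that by metis
    then show ?thesis using fallsD(2)[of R e i "i + 1"] unfolding falls_def by auto
  qed
  then show ?thesis using falls_eq[of i "i + 1"] i by simp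
qed

text \<open>With a single value in between, an inversion of \<open>i\<close> and
  \<open>i + 2\<close> makes an arc of one of the two types fall, whichever side
  \<open>i + 1\<close> is on.\<close>

lemma order_2: "1 \<le> i \<Longrightarrow> i + 1 < N \<Longrightarrow> P (i + 2) < P i \<longleftrightarrow> Q (i + 2) < Q i"
proof -
  assume i: "1 \<le> i" "i + 1 < N"
  have 1: "falls R (even (i + 1)) i (i + 2) \<longleftrightarrow> R (i + 2) < R i \<and> R (i + 2) < R (i + 1)"
    "falls R (\<not> even (i + 1)) i (i + 2) \<longleftrightarrow> R (i + 2) < R i \<and> R (i + 1) < R i" for R :: "nat \<Rightarrow> nat"
  proof -
    have c: "(a = i \<and> b = i + 1) \<or> (a = i \<and> b = i + 2) \<or> (a = i + 1 \<and> b = i + 2)" if "i \<le> a" "a < b" "b \<le> i + 2" for a b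
      using that by linarith
    show "falls R (even (i + 1)) i (i + 2) \<longleftrightarrow> R (i + 2) < R i \<and> R (i + 2) < R (i + 1)"
    proof
      assume "falls R (even (i + 1)) i (i + 2)"
      then show "R (i + 2) < R i \<and> R (i + 2) < R (i + 1)"
        using fallsD(2) fallsD(3)[of R _ i "i + 2" "i + 1"] by auto
    next
      assume h: "R (i + 2) < R i \<and> R (i + 2) < R (i + 1)"
      show "falls R (even (i + 1)) i (i + 2)" unfolding falls_def
      proof (intro conjI allI impI)
        fix a b assume ab: "i \<le> a" "a < b" "b \<le> i + 2" "b = i + 2 \<or> even b \<noteq> even (i + 1)"
        show "R b < R a" using c[OF ab(1-3)] ab(4) h by auto
      qed simp
    qed
    show "falls R (\<not> even (i + 1)) i (i + 2) \<longleftrightarrow> R (i + 2) < R i \<and> R (i + 1) < R i"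
    proof
      assume "falls R (\<not> even (i + 1)) i (i + 2)"
      then show "R (i + 2) < R i \<and> R (i + 1) < R i"
        using fallsD(2) fallsD(4)[of R _ i "i + 2" "i + 1"] by auto
    next
      assume h: "R (i + 2) < R i \<and> R (i + 1) < R i"
      show "falls R (\<not> even (i + 1)) i (i + 2)" unfolding falls_def
      proof (intro conjI allI impI)
        fix a b assume ab: "i \<le> a" "a < b" "b \<le> i + 2" "a = i \<or> even a = (\<not> even (i + 1))"
        show "R b < R a" using c[OF ab(1-3)] ab(4) h by auto
      qed simp
    qed
  qed
  have "R (i + 2) < R i \<longleftrightarrow> falls R (even (i + 1)) i (i + 2) \<or> falls R (\<not> even (i + 1)) i (i + 2)" for R
    unfolding 1 by linarith
  then show ?thesis using falls_eq[of i "i + 2"] i by simp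
qed

text \<open>An ascent from \<open>p\<close> to \<open>v\<close> in \<open>Q\<close> and a descent
  from \<open>q\<close> to \<open>v\<close> in \<open>P\<close> are arcs of the same type and glue
  to a falling arc from \<open>p\<close> to \<open>q\<close>. It forces \<open>p\<close> to stand
  between \<open>q\<close> and \<open>v\<close> in \<open>P\<close>, against their
  adjacency.\<close>

lemma no_common_neighbour:
  assumes p: "nxt Q N p v" "p < v" and q: "nxt P N q v" "v < q"
    and o1: "P (v - 1) < P v" and o2: "Q (v + 1) < Q v"
  shows False
proof -
  note pd = nxtD[OF p(1)] and qd = nxtD[OF q(1)]
  have o1': "Q (v - 1) < Q v" using order_1[of "v - 1"] o1 pd p(2) inj_eq[OF injQ, of "v - 1" v] by force
  have o2': "P (v + 1) < P v" using order_1[of v] o2 qd q(2) by auto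
  define e where "e = even v"
  obtain e2 where e2: "rises Q e2 p v" using riseQ p by blast
  obtain e1 where e1: "falls P e1 v q" using fallP q by blast
  \<comment> \<open>A nonempty interior contains \<open>v - 1\<close>, whose side fixes the type as
    the parity of \<open>v\<close>; an arc without interior has both types. The same is done with
    \<open>v + 1\<close> for the descent.\<close>
  have r: "rises Q e p v"
  proof (cases "p + 1 = v")
    case True
    then have "a = p \<and> b = v" if "p \<le> a" "a < b" "b \<le> v" for a b using that by linarith
    then show ?thesis unfolding rises_def using p pd(5) by metis
  next
    case False
    then have w: "p < v - 1" "v - 1 < v" "even (v - 1) \<noteq> even v" using p by auto
    then have "even (v - 1) \<noteq> e2" using rise_side(1)[OF injQ p(1) e2 w(1,2)] o1' by linarith
    then have "e2 = e" using w by (auto simp: e_def)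
    then show ?thesis using e2 by simp
  qed
  have f: "falls P e v q"
  proof (cases "v + 1 = q")
    case True
    then have "a = v \<and> b = q" if "v \<le> a" "a < b" "b \<le> q" for a b using that by linarith
    then show ?thesis unfolding falls_def using q qd(5) by metis
  next
    case False
    then have w: "v < v + 1" "v + 1 < q" using q by auto
    have "P (v + 1) \<noteq> P q" using inj_eq[OF injP, of "v + 1" q] w qd by auto
    moreover have "\<not> P q < P (v + 1)"
    proof
      assume "P q < P (v + 1)"
      then have "P v \<le> P (v + 1)" by (rule qd(6)[rotated 2]) (use w qd in auto)
      then show False using o2' by simp
    qed
    ultimately have "even (v + 1) \<noteq> e1" using fall_side(1)[OF injP q(1) e1 w] by linarith
    then have "e1 = e" by (auto simp: e_def)
    then show ?thesis using e1 by simp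
  qed
  have fQ: "falls Q e v q" and rP: "rises P e p v"
    using r f falls_eq[of v q e] rises_eq[of p v e] pd qd by auto
  have neq: "Q v \<noteq> Q a" if "p \<le> a" "a \<le> q" "a \<noteq> v" for a using inj_eq[OF injQ, of v a] that pd qd by auto
  have qp: "Q q < Q p"
  proof -
    have "Q q < Q v" "Q q \<noteq> Q p" using fallsD(2)[OF fQ] inj_eq[OF injQ, of q p] p q pd qd by auto
    moreover from this have "\<not> Q p < Q q" using pd(6)[of q] qd by auto
    ultimately show ?thesis by linarith
  qed
  have up: "Q p \<le> Q a" if "p \<le> a" "a \<le> v" "a = p \<or> even a = e" for a
    using risesD(4)[OF r, of a] that pd(5) by (cases "a = p \<or> a = v") auto
  have down: "Q b < Q p" if "p < b" "b \<le> q" "b = q \<or> even b \<noteq> e" for b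
  proof (cases "b = q")
    case True then show ?thesis using qp by simp
  next
    case False
    then have b: "b < q" "even b \<noteq> e" "b \<noteq> v" using that by (auto simp: e_def)
    have bv: "Q b < Q v"
    proof (cases "b < v")
      case True then show ?thesis using risesD(3)[OF r, of b] that b by auto
    next
      case False then show ?thesis using fallsD(4)[OF fQ, of b] b by auto
    qed
    moreover have "Q b \<noteq> Q p" using inj_eq[OF injQ, of b p] that pd qd by auto
    moreover have "\<not> Q p < Q b"
    proof
      assume "Q p < Q b"
      then have "Q v \<le> Q b" by (rule pd(6)[rotated 2]) (use that pd(1) qd(2) nxtD(2)[OF q(1)] in auto)
      then show False using bv by simp
    qed
    ultimately show ?thesis by linarith
  qed
  have "falls Q e p q" unfolding falls_def
  proof (intro conjI allI impI)
    fix a b assume ab: "p \<le> a" "a < b" "b \<le> q" "a = p \<or> even a = e" "b = q \<or> even b \<noteq> e"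
    show "Q b < Q a"
    proof (cases "a \<le> v")
      case True
      then show ?thesis using up[of a] down[of b] ab by auto
    next
      case False
      then show ?thesis using fallsD(3)[OF fQ, of a] fallsD(5)[OF fQ, of a b] ab p by (cases "b = q") auto
    qed
  qed (use p q in simp)
  then have "P q < P p" using falls_eq[of p q e] fallsD(2) pd qd by auto
  moreover have "P p < P v" "P p \<noteq> P q" using risesD(2)[OF rP] inj_eq[OF injP, of p q] p q pd qd by auto
  moreover have "\<not> (P q < P p \<and> P p < P v)" using qd(6)[of p] pd by auto
  ultimately show False by blast
qed

text \<open>If both neighbours were missing, the last larger letter \<open>d\<close> before
  \<open>v\<close> in \<open>P\<close> and the last smaller letter \<open>c'\<close> before
  \<open>v\<close> in \<open>Q\<close> would start arcs with ends \<open>c\<close>, \<open>d\<close>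
  and \<open>c'\<close>, \<open>d'\<close> around \<open>v\<close>, both of the same type. Their
  halves at \<open>v\<close> transfer to the other word, and the choice of \<open>d\<close> and
  \<open>c'\<close> then leaves no consistent order.\<close>

lemma some_neighbour:
  assumes v: "1 < v" "v < N" and o1: "Q (v - 1) < Q v" and o2: "P (v + 1) < P v"
    and np: "\<And>p. p < v \<Longrightarrow> \<not> nxt Q N p v" and nq: "\<And>q. q > v \<Longrightarrow> \<not> nxt P N q v"
  shows False
proof -
  define e where "e = even v"
  obtain d c where dc: "nxt P N d c" "v + 1 \<le> d" "c < v + 1" "P c \<le> P v"
    and dmax: "\<And>b. 1 \<le> b \<Longrightarrow> b \<le> N \<Longrightarrow> v + 1 \<le> b \<Longrightarrow> P b < P v \<Longrightarrow> P b \<le> P d"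
    by (rule last_drop[OF injP, of "v + 1" "v + 1" v]) (use v o2 in auto)
  have "c \<noteq> v" using nq[of d] dc by auto
  then have c: "c < v" using dc by auto
  obtain c' d' where dc': "nxt Q N c' d'" "v \<le> d'" "c' < v" "Q d' \<le> Q v"
    and cmax: "\<And>b. 1 \<le> b \<Longrightarrow> b \<le> N \<Longrightarrow> b < v \<Longrightarrow> Q b < Q v \<Longrightarrow> Q b \<le> Q c'"
    by (rule last_rise[OF injQ, of "v - 1" v v]) (use v o1 in auto)
  have "d' \<noteq> v" using np[of c'] dc' by auto
  then have d': "v < d'" using dc' by auto
  note n = nxtD[OF dc(1)] and n' = nxtD[OF dc'(1)]
  have Pcv: "P c < P v" "Q d' < Q v" using inj_eq[OF injP, of c v] inj_eq[OF injQ, of d' v] c d' dc dc' n n' v by force+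
  obtain e1 where e1: "falls P e1 c d" using fallP[OF dc(1)] dc by auto
  have "even v = e1" using fall_side(3)[OF injP dc(1) e1 c] Pcv dc by auto
  then have fP: "falls P e c d" using e1 by (simp add: e_def)
  obtain e2 where e2: "rises Q e2 c' d'" using riseQ[OF dc'(1)] dc' d' by auto
  have "even v = e2" using rise_side(1)[OF injQ dc'(1) e2 dc'(3) d'] Pcv by auto
  then have rQ: "rises Q e c' d'" using e2 by (simp add: e_def)
  have fQ: "falls Q e c d" and rP: "rises P e c' d'"
    using fP rQ falls_eq[of c d e] rises_eq[of c' d' e] n n' by auto
  note sP = fall_side[OF injP dc(1) fP] and sQ = rise_side[OF injQ dc'(1) rQ]
  \<comment> \<open>Right of \<open>v\<close>, the values of parity \<open>e\<close> stand behind
    the adjacent pair \<open>c'\<close>, \<open>d'\<close> and the others before it, so this half of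
    the rising arc is a falling arc.\<close>
  have "falls Q e v d'" unfolding falls_def
  proof (intro conjI allI impI)
    fix a b assume ab: "v \<le> a" "a < b" "b \<le> d'" "a = v \<or> even a = e" "b = d' \<or> even b \<noteq> e"
    have "Q d' < Q a" using sQ(1)[of a] ab dc'(3) Pcv by (auto simp: e_def)
    moreover have "b \<noteq> d' \<Longrightarrow> Q b < Q d'" using sQ(4)[of b] ab dc'(3) by auto
    ultimately show "Q b < Q a" by (cases "b = d'") auto
  qed (use d' in simp)
  then have "falls P e v d'" using falls_eq[of v d' e] v n' by simp
  then have Pd'v: "P d' < P v" by (rule fallsD(2))
  have "rises P e c v" unfolding rises_def
  proof (intro conjI allI impI)
    fix a b assume ab: "c \<le> a" "a < b" "b \<le> v" "a = c \<or> even a \<noteq> e" "b = v \<or> even b = e"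
    have "P c < P b" using sP(3)[of b] ab dc(2) by (auto simp: e_def)
    moreover have "a \<noteq> c \<Longrightarrow> P a < P c" using sP(2)[of a] ab dc(2) by auto
    ultimately show "P a < P b" by (cases "a = c") auto
  qed (use c in simp)
  then have "rises Q e c v" using rises_eq[of c v e] v n by simp
  then have Qcv: "Q c < Q v" by (rule risesD(2))
  have "Q c \<le> Q c'" "P d' \<le> P d" using cmax[of c] dmax[of d'] n n' c d' Qcv Pd'v by auto
  moreover have Qdc: "Q d < Q c" using fallsD(2)[OF fQ] .
  moreover have Pcd': "P c' < P d'" using risesD(2)[OF rP] .
  ultimately have "d' \<noteq> d" "c \<noteq> c'" using n(5) n'(5) by auto
  then have Pd': "P d' < P d" and Qc: "Q c < Q c'"
    using \<open>P d' \<le> P d\<close> \<open>Q c \<le> Q c'\<close> inj_eq[OF injP, of d' d] inj_eq[OF injQ, of c c'] n n' by force+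
  show False
  \<comment> \<open>If an end of one arc lies inside the other, its side there fixes its parity, and
    the transferred arc contradicts \<open>Pd'\<close> or \<open>Qc\<close>. If the arcs cross with
    \<open>c < c'\<close> and \<open>d < d'\<close>, the overlap from \<open>c'\<close> to
    \<open>d\<close> falls.\<close>
  proof (cases "d' < d")
    case True
    then have "c < d'" using c d' by simp
    have "even d' \<noteq> e" using sP(4)[OF \<open>c < d'\<close> True] Pd' by simp
    then have "Q d' < Q c" using fallsD(4)[OF fQ \<open>c < d'\<close> True] by simp
    then show False using Qc n'(5) by simp
  next
    case False
    then have d: "d < d'" using \<open>d' \<noteq> d\<close> by simp
    have "c' < d" using dc'(3) dc(2) by simp
    show False
    proof (cases "c' < c")
      case True
      then have cd': "c < d'" using c d' by simp
      have "even c \<noteq> e" using sQ(2)[OF True cd'] Qc by simp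
      then have "P c < P d'" using risesD(3)[OF rP True cd'] by simp
      then show False using Pd' n(5) by simp
    next
      case False
      then have c': "c < c'" using \<open>c \<noteq> c'\<close> by simp
      have "falls Q e c' d" unfolding falls_def
      proof (intro conjI allI impI)
        fix a b assume ab: "c' \<le> a" "a < b" "b \<le> d" "a = c' \<or> even a = e" "b = d \<or> even b \<noteq> e"
        have "Q c' \<le> Q a" using sQ(3)[of a] ab d by (cases "a = c'") auto
        moreover have "Q b < Q c'" if "b \<noteq> d" using sQ(2)[of b] ab that d by auto
        moreover have "Q d < Q c'" using Qdc Qc by simp
        ultimately show "Q b < Q a" by (cases "b = d") auto
      qed (use \<open>c' < d\<close> in simp)
      then have "P d < P c'" using falls_eq[of c' d e] fallsD(2) n n' by auto
      then show False using Pcd' Pd' by simp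
    qed
  qed
qed

lemma not_two_same_side_fall:
  assumes "nxt P N q p" "p < v" "v + 1 < q" shows "P q < P v \<longleftrightarrow> P (v + 1) < P q"
proof -
  obtain e where e: "falls P e p q" using fallP assms by fastforce
  show ?thesis using fall_side(1)[OF injP assms(1) e, of v] fall_side(4)[OF injP assms(1) e, of "v + 1"] assms by auto
qed

lemma not_two_same_side_rise:
  assumes "nxt Q N p q" "p < v" "v + 1 < q" shows "Q q < Q v \<longleftrightarrow> Q (v + 1) < Q q"
proof -
  obtain e where e: "rises Q e p q" using riseQ assms by fastforce
  show ?thesis using rise_side(1)[OF injQ assms(1) e, of v] rise_side(4)[OF injQ assms(1) e, of "v + 1"] assms by auto
qed

text \<open>The case \<open>last\<close> is decided by the two neighbour lemmas. In each of the
  other four cases, one of the two bits would put two consecutive values on the same side of an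
  adjacent pair or reverse a known order, while a drop or rise that must occur yields the other
  bit.\<close>

theorem ubit_lbit:
  assumes i: "1 \<le> i" "i + 1 < N" shows "ubit Q N i \<longleftrightarrow> \<not> lbit P N (i + 1)"
proof -
  have iQ: "Q a \<noteq> Q b" if "a \<noteq> b" "1 \<le> a" "a \<le> N" "1 \<le> b" "b \<le> N" for a b using inj_eq[OF injQ] that by blast
  have iP: "P a \<noteq> P b" if "a \<noteq> b" "1 \<le> a" "a \<le> N" "1 \<le> b" "b \<le> N" for a b using inj_eq[OF injP] that by blast
  note o1 = order_1[of i] order_1[of "i + 1"] order_2[of i]
  have n2: "i + 1 + 1 = i + 2" by simp
  consider (last) "P i < P (i + 1)" "P (i + 2) < P (i + 1)"
    | (inc) "P i < P (i + 1)" "P (i + 1) < P (i + 2)"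
    | (dec) "P (i + 2) < P (i + 1)" "P (i + 1) < P i"
    | (first1) "P (i + 1) < P i" "P i < P (i + 2)"
    | (first2) "P (i + 1) < P (i + 2)" "P (i + 2) < P i"
  proof -
    have "P i \<noteq> P (i + 1)" "P i \<noteq> P (i + 2)" "P (i + 1) \<noteq> P (i + 2)"
      using iP[of i "i + 1"] iP[of i "i + 2"] iP[of "i + 1" "i + 2"] i by auto
    then show thesis using that by linarith
  qed
  then show ?thesis
  proof cases
    case last
    then have Q: "Q i < Q (i + 1)" "Q (i + 2) < Q (i + 1)"
      using o1 iQ[of i "i + 1"] i unfolding n2 by force+
    have u: "ubit Q N i \<longleftrightarrow> (\<exists>p < i + 1. nxt Q N p (i + 1))" using Q by (simp add: ubit_def)
    have l: "lbit P N (i + 1) \<longleftrightarrow> (\<exists>q > i + 1. nxt P N q (i + 1))" using last by (simp add: lbit_def)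
    show ?thesis unfolding u l
      using no_common_neighbour[of _ "i + 1"] some_neighbour[of "i + 1"] last Q i unfolding n2 by auto
  next
    case inc
    then have Q: "Q i < Q (i + 1)" using o1 iQ[of i "i + 1"] i by force
    obtain p q where pq: "nxt Q N p q" "i + 1 \<le> q" "p < i + 1" "Q q \<le> Q (i + 1)"
      by (rule rise_exists[OF injQ, of i "i + 1" "i + 1"]) (use i Q in auto)
    have "q = i + 1"
    proof (rule ccontr)
      assume "q \<noteq> i + 1"
      then have q: "i + 1 < q" using pq by simp
      have Qq: "Q q < Q (i + 1)" using pq(4) iQ[of q "i + 1"] q i nxtD[OF pq(1)] by force
      have Q2: "Q (i + 1) < Q (i + 2)" using inc o1(2) iQ[of "i + 1" "i + 2"] i unfolding n2 by force
      show False
      proof (cases "q = i + 2")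
        case True then show False using Q2 Qq by simp
      next
        case False
        then have "i + 1 + 1 < q" using q by simp
        then show False using not_two_same_side_rise[OF pq(1) pq(3)] Qq Q2 unfolding n2 by simp
      qed
    qed
    then have "ubit Q N i" using pq Q unfolding ubit_def by auto
    moreover have "\<not> lbit P N (i + 1)"
    proof
      assume "lbit P N (i + 1)"
      then obtain p where p: "nxt P N (i + 2) p" "p < i + 2" using inc unfolding lbit_def n2 by auto
      have "p \<noteq> i" "p \<noteq> i + 1" using nxtD(5)[OF p(1)] inc by auto
      then have "p < i" using p(2) by simp
      then show False using not_two_same_side_fall[OF p(1), of i] inc by auto
    qed
    ultimately show ?thesis by simp
  next
    case dec
    then have Q: "Q (i + 1) < Q i" "Q (i + 2) < Q (i + 1)" using o1 i unfolding n2 by auto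
    have "\<not> ubit Q N i"
    proof
      assume "ubit Q N i"
      then obtain q where q: "nxt Q N i q" "q > i" using Q unfolding ubit_def by auto
      have "q \<noteq> i + 1" "q \<noteq> i + 2" using nxtD(5)[OF q(1)] Q by auto
      then have "i + 1 + 1 < q" using q(2) by simp
      then show False using not_two_same_side_rise[OF q(1), of "i + 1"] Q nxtD(5)[OF q(1)] unfolding n2 by auto
    qed
    moreover obtain q p where qp: "nxt P N q p" "i + 2 \<le> q" "p < i + 2" "P p \<le> P (i + 1)"
      by (rule drop_exists[OF injP, of "i + 2" "i + 2" "i + 1"]) (use i dec in auto)
    moreover have "p = i + 1"
    proof (rule ccontr)
      assume "p \<noteq> i + 1"
      moreover have "p \<noteq> i" using qp(4) dec by auto
      ultimately have "p < i" using qp(3) by simp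
      moreover have "P q < P (i + 1)" using nxtD(5)[OF qp(1)] qp(4) by simp
      ultimately show False using not_two_same_side_fall[OF qp(1), of i] qp dec by auto
    qed
    moreover have "q > i + 1" using qp(2) by simp
    ultimately have "\<exists>q > i + 1. nxt P N q (i + 1)" "\<not> ubit Q N i" by blast+
    then show ?thesis using dec unfolding lbit_def n2 by simp
  next
    case first1
    then have Q: "Q (i + 1) < Q i" "Q i < Q (i + 2)" using o1 iQ[of i "i + 2"] i unfolding n2 by force+
    obtain p q where pq: "nxt Q N p q" "i + 1 \<le> q" "p < i + 1" "Q i \<le> Q p"
      by (rule rise_exists[OF injQ, of i "i + 1" "i + 2"]) (use i Q in auto)
    have "p = i"
    proof (rule ccontr)
      assume "p \<noteq> i"
      then have p: "p < i" using pq by simp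
      have "q \<noteq> i + 1" using nxtD(5)[OF pq(1)] pq(4) Q by auto
      then have "i + 1 < q" using pq(2) by simp
      then show False using not_two_same_side_rise[OF pq(1) p] pq(4) nxtD(5)[OF pq(1)] Q by auto
    qed
    moreover have "i < q" using pq(2) by simp
    ultimately have "ubit Q N i" using pq(1) Q unfolding ubit_def by auto
    moreover have "\<not> lbit P N (i + 1)"
    proof
      assume "lbit P N (i + 1)"
      then obtain p where p: "nxt P N (i + 2) p" "p < i + 2" using first1 unfolding lbit_def n2 by auto
      have "p \<noteq> i" "p \<noteq> i + 1" using nxtD(5)[OF p(1)] first1 by auto
      then have "p < i" using p(2) by simp
      then show False using not_two_same_side_fall[OF p(1), of i] first1 by auto
    qed
    ultimately show ?thesis by simp
  next
    case first2
    then have Q: "Q (i + 1) < Q i" "Q (i + 2) < Q i" using o1 i unfolding n2 by auto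
    have "\<not> ubit Q N i"
    proof
      assume "ubit Q N i"
      then obtain q where q: "nxt Q N i q" "q > i" using Q unfolding ubit_def by auto
      have "q \<noteq> i + 1" "q \<noteq> i + 2" using nxtD(5)[OF q(1)] Q by auto
      then have "i + 1 + 1 < q" using q(2) by simp
      then show False using not_two_same_side_rise[OF q(1), of "i + 1"] Q nxtD(5)[OF q(1)] unfolding n2 by auto
    qed
    moreover obtain q p where qp: "nxt P N q p" "i + 2 \<le> q" "p < i + 2" "P (i + 2) \<le> P q"
      by (rule drop_exists[OF injP, of "i + 2" "i + 2" i]) (use i first2 in auto)
    moreover have "q = i + 2"
    proof (rule ccontr)
      assume "q \<noteq> i + 2"
      then have q: "i + 1 + 1 < q" using qp(2) by simp
      have "p \<noteq> i + 1" using nxtD(5)[OF qp(1)] qp(4) first2 by auto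
      then have "p < i + 1" using qp(3) by simp
      then show False using not_two_same_side_fall[OF qp(1) _ q] qp(4) first2 iP[of q "i + 2"] q nxtD[OF qp(1)] unfolding n2 by force
    qed
    ultimately have "\<exists>p < i + 2. nxt P N (i + 2) p" "\<not> ubit Q N i" by blast+
    then show ?thesis using first2 unfolding lbit_def n2 by simp
  qed
qed

end

section \<open>Symmetric inversion sets\<close>

text \<open>Joins are transitive closures, so this serves to refute membership in a join, or to find
  in a chain one step that lies in a given rectangle.\<close>

lemma trancl_crossing:
  assumes "(a, b) \<in> S\<^sup>+" "P a" "\<not> P b" and incr: "\<And>u v. (u, v) \<in> S \<Longrightarrow> u < v"
  obtains u v where "(u, v) \<in> S" "P u" "\<not> P v" "a \<le> u" "v \<le> b" "u < (v :: nat)"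
proof -
  have "\<not> P b \<Longrightarrow> \<exists>u v. (u, v) \<in> S \<and> P u \<and> \<not> P v \<and> a \<le> u \<and> v \<le> b"
    using assms(1)
  proof (induction rule: trancl_induct)
    case (base y)
    then show ?case using assms(2) by blast
  next
    case (step y z)
    have "a < y" using step(1)
      by (induction rule: trancl_induct) (use incr less_trans in blast)+
    show ?case
    proof (cases "P y")
      case True
      then show ?thesis using step \<open>a < y\<close> by (intro exI[of _ y] exI[of _ z]) auto
    next
      case False
      then show ?thesis using step incr[OF step(2)] by (meson le_trans less_imp_le)
    qed
  qed
  then show thesis using that incr assms(3) by blast
qed

locale type_B =
  fixes n :: nat
  assumes n_pos: "1 \<le> n"
begin

definition mir :: "nat \<Rightarrow> nat" where "mir v = 2 * n + 1 - v"

definition pairs :: "(nat \<times> nat) set" where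
  "pairs = {(a, b). 1 \<le> a \<and> a < b \<and> b \<le> 2 * n}"

definition bic :: "(nat \<times> nat) set \<Rightarrow> bool" where
  "bic T \<longleftrightarrow> T \<subseteq> pairs \<and> (\<forall>a b c. (a, b) \<in> T \<longrightarrow> (b, c) \<in> T \<longrightarrow> (a, c) \<in> T) \<and>
     (\<forall>a b c. a < b \<longrightarrow> b < c \<longrightarrow> (a, c) \<in> T \<longrightarrow> (a, b) \<in> T \<or> (b, c) \<in> T)"

definition K :: "(nat \<times> nat) set set" where
  "K = {T. bic T \<and> (\<forall>a b. (a, b) \<in> T \<longrightarrow> (mir b, mir a) \<in> T)}"

definition jn :: "(nat \<times> nat) set \<Rightarrow> (nat \<times> nat) set \<Rightarrow> (nat \<times> nat) set" where
  "jn S T = (S \<union> T)\<^sup>+"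
definition co :: "(nat \<times> nat) set \<Rightarrow> (nat \<times> nat) set" where
  "co T = pairs - T"
definition mt :: "(nat \<times> nat) set \<Rightarrow> (nat \<times> nat) set \<Rightarrow> (nat \<times> nat) set" where
  "mt S T = co (jn (co S) (co T))"
definition mirr :: "(nat \<times> nat) set \<Rightarrow> (nat \<times> nat) set" where
  "mirr T = {(mir b, mir a) | a b. (a, b) \<in> T}"

lemma mir_mir: "v \<le> 2 * n \<Longrightarrow> mir (mir v) = v"
  by (auto simp: mir_def)

lemma mir_ne: "v \<le> 2 * n \<Longrightarrow> mir v \<noteq> v" "v \<le> 2 * n \<Longrightarrow> v \<noteq> mir v"
  unfolding mir_def by presburger+

lemma mir_pairs: "(a, b) \<in> pairs \<Longrightarrow> (mir b, mir a) \<in> pairs"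
  by (auto simp: pairs_def mir_def)

lemma bicD:
  assumes "bic T"
  shows "T \<subseteq> pairs" "\<And>a b c. (a, b) \<in> T \<Longrightarrow> (b, c) \<in> T \<Longrightarrow> (a, c) \<in> T"
    "\<And>a b c. a < b \<Longrightarrow> b < c \<Longrightarrow> (a, c) \<in> T \<Longrightarrow> (a, b) \<in> T \<or> (b, c) \<in> T"
  using assms unfolding bic_def by blast+

lemma bicI:
  assumes "T \<subseteq> pairs" "\<And>a b c. (a, b) \<in> T \<Longrightarrow> (b, c) \<in> T \<Longrightarrow> (a, c) \<in> T"
    "\<And>a b c. a < b \<Longrightarrow> b < c \<Longrightarrow> (a, c) \<in> T \<Longrightarrow> (a, b) \<in> T \<or> (b, c) \<in> T"
  shows "bic T"
  unfolding bic_def using assms by (intro conjI allI impI)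

lemma KD:
  assumes "T \<in> K"
  shows "T \<subseteq> pairs" "\<And>a b c. (a, b) \<in> T \<Longrightarrow> (b, c) \<in> T \<Longrightarrow> (a, c) \<in> T"
    "\<And>a b c. a < b \<Longrightarrow> b < c \<Longrightarrow> (a, c) \<in> T \<Longrightarrow> (a, b) \<in> T \<or> (b, c) \<in> T"
    "\<And>a b. (a, b) \<in> T \<Longrightarrow> (mir b, mir a) \<in> T"
  using assms unfolding K_def bic_def by blast+

lemma K_mem_range:
  assumes "T \<in> K" "(a, b) \<in> T" shows "1 \<le> a" "a < b" "b \<le> 2 * n"
  using assms KD(1)[OF assms(1)] by (auto simp: pairs_def)

lemma K_mir_iff:
  assumes "T \<in> K" "a \<le> 2 * n" "b \<le> 2 * n" shows "(mir b, mir a) \<in> T \<longleftrightarrow> (a, b) \<in> T"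
  using KD(4)[OF assms(1), of a b] KD(4)[OF assms(1), of "mir b" "mir a"] mir_mir assms by auto

lemma trancl_pairs: "S \<subseteq> pairs \<Longrightarrow> S\<^sup>+ \<subseteq> pairs"
proof -
  assume S: "S \<subseteq> pairs"
  have "(a, b) \<in> pairs" if "(a, b) \<in> S\<^sup>+" for a b using that
    by (induction rule: trancl_induct) (use S in \<open>auto simp: pairs_def\<close>)
  then show ?thesis by auto
qed

text \<open>Coclosedness survives the closure: a value between the ends of a chain is a vertex of it
  or lies inside one step, and that step belongs to a coclosed set.\<close>

lemma bic_trancl_Un:
  assumes S: "bic S" and T: "bic T" shows "bic ((S \<union> T)\<^sup>+)"
proof -
  have sub: "(S \<union> T)\<^sup>+ \<subseteq> pairs" using trancl_pairs bicD(1) S T by simp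
  have "\<forall>b. a < b \<longrightarrow> b < c \<longrightarrow> (a, b) \<in> (S \<union> T)\<^sup>+ \<or> (b, c) \<in> (S \<union> T)\<^sup>+"
    if "(a, c) \<in> (S \<union> T)\<^sup>+" for a c
    using that
  proof (induction rule: trancl_induct)
    case (base y)
    then show ?case using bicD(3)[OF S] bicD(3)[OF T] by blast
  next
    case (step y z)
    show ?case
    proof (intro allI impI)
      fix b assume b: "a < b" "b < z"
      consider "b < y" | "b = y" | "y < b" by linarith
      then show "(a, b) \<in> (S \<union> T)\<^sup>+ \<or> (b, z) \<in> (S \<union> T)\<^sup>+"
      proof cases
        case 1 then show ?thesis using step b by (meson trancl.trancl_into_trancl)
      next
        case 2 then show ?thesis using step by blast
      next
        case 3
        then have "(y, b) \<in> S \<union> T \<or> (b, z) \<in> S \<union> T"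
          using step(2) b bicD(3)[OF S] bicD(3)[OF T] by blast
        then show ?thesis using step(1) by (meson r_into_trancl' trancl.trancl_into_trancl)
      qed
    qed
  qed
  then show ?thesis by (intro bicI sub) (auto intro: trancl_trans)
qed

lemma jn_K:
  assumes S: "S \<in> K" and T: "T \<in> K" shows "jn S T \<in> K"
proof -
  have "(mir b, mir a) \<in> (S \<union> T)\<^sup>+" if "(a, b) \<in> (S \<union> T)\<^sup>+" for a b
    using that
  proof (induction rule: trancl_induct)
    case (base y)
    then show ?case using KD(4)[OF S] KD(4)[OF T] by blast
  next
    case (step y z)
    then show ?case using KD(4)[OF S] KD(4)[OF T] by (meson UnE UnI1 UnI2 trancl_into_trancl2)
  qed
  then show ?thesis using bic_trancl_Un S T unfolding K_def jn_def by blast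
qed

lemma co_bic: "bic T \<Longrightarrow> bic (co T)"
proof -
  assume T: "bic T"
  have 1: "(a, c) \<in> co T" if "(a, b) \<in> co T" "(b, c) \<in> co T" for a b c
    using that bicD(3)[OF T, of a b c] by (auto simp: co_def pairs_def)
  have 2: "(a, b) \<in> co T \<or> (b, c) \<in> co T" if "a < b" "b < c" "(a, c) \<in> co T" for a b c
    using that bicD(2)[OF T, of a b c] by (auto simp: co_def pairs_def)
  show ?thesis by (rule bicI[OF _ 1 2]) (auto simp: co_def)
qed

lemma co_K: assumes "T \<in> K" shows "co T \<in> K"
proof -
  have "(mir b, mir a) \<in> co T" if "(a, b) \<in> co T" for a b
    using that mir_pairs[of a b] K_mir_iff[OF assms, of a b] by (auto simp: co_def pairs_def)
  then show ?thesis using co_bic assms by (auto simp: K_def)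
qed

lemma co_co: "T \<subseteq> pairs \<Longrightarrow> co (co T) = T"
  by (auto simp: co_def)

lemma mt_K: "S \<in> K \<Longrightarrow> T \<in> K \<Longrightarrow> mt S T \<in> K"
  by (simp add: mt_def co_K jn_K)

lemma jn_upper: "S \<subseteq> jn S T" "T \<subseteq> jn S T"
  by (auto simp: jn_def)

lemma jn_least: "U \<in> K \<Longrightarrow> S \<subseteq> U \<Longrightarrow> T \<subseteq> U \<Longrightarrow> jn S T \<subseteq> U"
proof -
  assume U: "U \<in> K" and "S \<subseteq> U" "T \<subseteq> U"
  then have "(S \<union> T)\<^sup>+ \<subseteq> U\<^sup>+" by (intro trancl_mono_subset) auto
  moreover have "trans U" using KD(2)[OF U] by (auto simp: trans_def)
  ultimately show ?thesis by (simp add: jn_def)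
qed

lemma mt_lower: assumes "S \<in> K" "T \<in> K" shows "mt S T \<subseteq> S" "mt S T \<subseteq> T"
  using jn_upper[of "co S" "co T"] jn_upper(2)[of "co T" "co S"] KD(1) assms by (auto simp: mt_def co_def)

lemma mt_greatest: assumes "U \<in> K" "S \<in> K" "T \<in> K" "U \<subseteq> S" "U \<subseteq> T" shows "U \<subseteq> mt S T"
proof -
  have "jn (co S) (co T) \<subseteq> co U"
    by (rule jn_least) (use assms co_K in \<open>auto simp: co_def\<close>)
  then show ?thesis using KD(1)[OF assms(1)] by (auto simp: mt_def co_def)
qed

lemma jn_comm: "jn S T = jn T S" by (simp add: jn_def Un_commute)
lemma mt_comm: "mt S T = mt T S" by (simp add: mt_def jn_comm)

lemma jn_absorb: "T \<in> K \<Longrightarrow> S \<subseteq> T \<Longrightarrow> jn S T = T"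
  using jn_least[of T S T] jn_upper(2)[of T S] by auto

lemma mt_absorb: "S \<in> K \<Longrightarrow> T \<in> K \<Longrightarrow> S \<subseteq> T \<Longrightarrow> mt S T = S"
  using mt_greatest[of S S T] mt_lower[of S T] by auto

lemma co_mt: "S \<in> K \<Longrightarrow> T \<in> K \<Longrightarrow> co (mt S T) = jn (co S) (co T)"
  unfolding mt_def by (intro co_co KD(1) jn_K co_K)

lemma co_jn: "S \<in> K \<Longrightarrow> T \<in> K \<Longrightarrow> co (jn S T) = mt (co S) (co T)"
  unfolding mt_def using co_co KD(1) by simp

subsection \<open>Arcs\<close>

text \<open>
  \<open>rectS S p q\<close> is the inversion set of the join-irreducible permutation whose only descent
  is the arc from \<open>p\<close> to \<open>q\<close> passing to the left of the points in \<open>S\<close> and to the right of the others.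
\<close>

definition rectS :: "nat set \<Rightarrow> nat \<Rightarrow> nat \<Rightarrow> (nat \<times> nat) set" where
  "rectS S p q = {(a, b). p \<le> a \<and> a < b \<and> b \<le> q \<and> (a = p \<or> a \<in> S) \<and> (b = q \<or> b \<notin> S)}"

definition rt :: "bool \<Rightarrow> nat set" where "rt e = {v. even v = e}"

definition As :: "bool \<Rightarrow> (nat \<times> nat) set \<Rightarrow> (nat \<times> nat) set" where
  "As e T = {(p, q) \<in> pairs. rectS (rt e) p q \<subseteq> T}"
text \<open>The rectangle is that of the opposite type: its complement is the inversion set of the
  meet-irreducible permutation belonging to the arc, and the condition says that \<open>T\<close>
  lies below it.\<close>

definition Bs :: "bool \<Rightarrow> (nat \<times> nat) set \<Rightarrow> (nat \<times> nat) set" where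
  "Bs e T = {(p, q) \<in> pairs. rectS (rt (\<not> e)) p q \<inter> T = {}}"

lemma rt_not: "v \<in> rt (\<not> e) \<longleftrightarrow> v \<notin> rt e"
  by (auto simp: rt_def)

text \<open>This makes the type well defined on mirror orbits: reversing the values swaps the sides
  of an arc and the two parities together.\<close>

lemma rt_mir: "v \<le> 2 * n \<Longrightarrow> mir v \<in> rt e \<longleftrightarrow> v \<notin> rt e"
  by (auto simp: rt_def mir_def)

lemma rectS_self: "p < q \<Longrightarrow> (p, q) \<in> rectS S p q"
  by (auto simp: rectS_def)

lemma rectS_sub: "(a, b) \<in> rectS S p q \<Longrightarrow> rectS S a b \<subseteq> rectS S p q"
  by (fastforce simp: rectS_def)

lemma rectS_bic: "1 \<le> p \<Longrightarrow> q \<le> 2 * n \<Longrightarrow> bic (rectS S p q)"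
  unfolding bic_def by (auto simp: rectS_def pairs_def)

lemma rectS_mirr:
  assumes "p \<le> 2 * n" "q \<le> 2 * n" "(a, b) \<in> rectS (rt e) p q"
  shows "(mir b, mir a) \<in> rectS (rt e) (mir q) (mir p)"
  using assms rt_mir[of a e] rt_mir[of b e] by (auto simp: rectS_def mir_def)

lemma rectS_pairs: "(p, q) \<in> pairs \<Longrightarrow> rectS S p q \<subseteq> pairs"
  by (auto simp: rectS_def pairs_def)

lemma As_co: "As (\<not> e) (co T) = Bs e T"
  using rectS_pairs by (auto simp: As_def Bs_def co_def)

lemma Bs_co: "T \<subseteq> pairs \<Longrightarrow> Bs (\<not> e) (co T) = As e T"
  using As_co[of "\<not> e" "co T"] co_co by auto

lemma As_subset: "As e T \<subseteq> T"
  using rectS_self by (fastforce simp: As_def pairs_def)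

lemma Bs_disj: "(p, q) \<in> Bs e T \<Longrightarrow> (p, q) \<notin> T"
  using rectS_self by (fastforce simp: Bs_def pairs_def)

lemma As_mono: "S \<subseteq> T \<Longrightarrow> As e S \<subseteq> As e T"
  by (auto simp: As_def)

lemma As_mir: assumes "T \<in> K" "(p, q) \<in> As e T" shows "(mir q, mir p) \<in> As e T"
proof -
  have pq: "(p, q) \<in> pairs" "rectS (rt e) p q \<subseteq> T" using assms by (auto simp: As_def)
  then have r: "1 \<le> p" "p < q" "q \<le> 2 * n" by (auto simp: pairs_def)
  have "(a, b) \<in> T" if "(a, b) \<in> rectS (rt e) (mir q) (mir p)" for a b
  proof -
    have ab: "a \<le> 2 * n" "b \<le> 2 * n" using that r by (auto simp: rectS_def mir_def)
    have "(mir b, mir a) \<in> rectS (rt e) p q"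
      using rectS_mirr[OF _ _ that] mir_mir r by (simp add: mir_def)
    then show ?thesis using pq K_mir_iff[OF assms(1) ab] by auto
  qed
  then show ?thesis using mir_pairs pq by (auto simp: As_def)
qed

lemma Bs_mir: assumes "T \<in> K" "(p, q) \<in> Bs e T" shows "(mir q, mir p) \<in> Bs e T"
  using As_mir[OF co_K[OF assms(1)], of p q "\<not> e"] assms(2) by (simp add: As_co)

text \<open>A chain of non-inversions joining the entries of a rectangle pair has a step from a
  value allowed as first entry to a value allowed as second entry. That step lies in the rectangle,
  hence is inverted in both \<open>S\<close> and \<open>T\<close>.\<close>

lemma As_mt:
  assumes S: "S \<in> K" and T: "T \<in> K" shows "As e (mt S T) = As e S \<inter> As e T"
proof
  show "As e (mt S T) \<subseteq> As e S \<inter> As e T"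
    using As_mono[OF mt_lower(1)[OF S T]] As_mono[OF mt_lower(2)[OF S T]] by simp
next
  have "(a, b) \<in> mt S T"
    if pq: "(p, q) \<in> pairs" "rectS (rt e) p q \<subseteq> S" "rectS (rt e) p q \<subseteq> T"
      and ab: "(a, b) \<in> rectS (rt e) p q" for p q a b
  proof (rule ccontr)
    assume "(a, b) \<notin> mt S T"
    then have c: "(a, b) \<in> (co S \<union> co T)\<^sup>+"
      using ab rectS_pairs[OF pq(1)] by (auto simp: mt_def co_def jn_def)
    let ?P = "\<lambda>v. (v = p \<or> v \<in> rt e) \<and> v \<noteq> q"
    have pP: "?P a" "\<not> ?P b" using ab by (auto simp: rectS_def)
    have incr: "u < v" if "(u, v) \<in> co S \<union> co T" for u v
      using that by (auto simp: co_def pairs_def)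
    obtain u v where uv: "(u, v) \<in> co S \<union> co T" "?P u" "\<not> ?P v" "a \<le> u" "v \<le> b" "u < v"
      using trancl_crossing[where P = ?P, OF c pP incr] by metis
    then have "(u, v) \<in> rectS (rt e) p q" using ab by (auto simp: rectS_def)
    then show False using uv pq by (auto simp: co_def)
  qed
  then show "As e S \<inter> As e T \<subseteq> As e (mt S T)" by (auto simp: As_def)
qed

lemma Bs_jn:
  assumes S: "S \<in> K" and T: "T \<in> K" shows "Bs e (jn S T) = Bs e S \<inter> Bs e T"
  using As_mt[OF co_K[OF S] co_K[OF T], of "\<not> e"] co_jn[OF S T] by (metis As_co)

text \<open>A pair of least width among the rectangle pairs inverted in \<open>T\<close> is an arc
  below \<open>T\<close>: the narrower ones are not inverted, so coclosedness puts the required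
  pairs into \<open>T\<close>. Thus \<open>As\<close> determines \<open>Bs\<close>, which is why the
  relation defined by \<open>As\<close> respects joins as well as meets.\<close>

lemma Bs_As:
  assumes T: "T \<in> K"
  shows "(p, q) \<in> Bs e T \<longleftrightarrow> (p, q) \<in> pairs \<and> rectS (rt (\<not> e)) p q \<inter> As e T = {}"
proof
  assume "(p, q) \<in> Bs e T"
  then show "(p, q) \<in> pairs \<and> rectS (rt (\<not> e)) p q \<inter> As e T = {}"
    using As_subset by (auto simp: Bs_def)
next
  assume h: "(p, q) \<in> pairs \<and> rectS (rt (\<not> e)) p q \<inter> As e T = {}"
  let ?R = "rectS (rt (\<not> e)) p q"
  have "(a, b) \<notin> T" if "(a, b) \<in> ?R" for a b
    using that
  proof (induction "b - a" arbitrary: a b rule: less_induct)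
    case less
    show ?case
    proof
      assume abT: "(a, b) \<in> T"
      have left: "(a, m) \<in> T \<and> (m, b) \<notin> T" if "a < m" "m < b" "m \<notin> rt e" for m
      proof -
        have "(m, b) \<in> ?R" using that less.prems by (auto simp: rectS_def rt_not)
        then have "(m, b) \<notin> T" using less.hyps[of b m] that by auto
        then show ?thesis using KD(3)[OF T that(1,2) abT] by auto
      qed
      have right: "(m, b) \<in> T \<and> (a, m) \<notin> T" if "a < m" "m < b" "m \<in> rt e" for m
      proof -
        have "(a, m) \<in> ?R" using that less.prems by (auto simp: rectS_def rt_not)
        then have "(a, m) \<notin> T" using less.hyps[of m a] that by auto
        then show ?thesis using KD(3)[OF T that(1,2) abT] by auto
      qed
      have "(c, d) \<in> T" if cd: "(c, d) \<in> rectS (rt e) a b" for c d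
      proof (cases "c = a \<or> d = b")
        case True
        then show ?thesis
          using cd abT left[of d] right[of c] by (auto simp: rectS_def order_le_less)
      next
        case False
        then have "a < c" "c < d" "d < b" "c \<in> rt e" "d \<notin> rt e" using cd by (auto simp: rectS_def)
        then show ?thesis using left[of d] right[of c] KD(3)[OF T, of a c d] by auto
      qed
      moreover have "(a, b) \<in> pairs" using abT KD(1)[OF T] by auto
      ultimately have "(a, b) \<in> As e T" by (auto simp: As_def)
      then show False using h less.prems by auto
    qed
  qed
  then show "(p, q) \<in> Bs e T" using h by (auto simp: Bs_def)
qed

lemma As_Bs:
  assumes T: "T \<in> K"
  shows "(p, q) \<in> As e T \<longleftrightarrow> (p, q) \<in> pairs \<and> rectS (rt e) p q \<inter> Bs e T = {}"
  using Bs_As[OF co_K[OF T], of p q "\<not> e"] Bs_co[OF KD(1)[OF T], of e] As_co[of e T] by simp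

lemma As_Bs_subset:
  assumes "S \<in> K" "T \<in> K" shows "As e S \<subseteq> As e T \<longleftrightarrow> Bs e T \<subseteq> Bs e S"
  using As_Bs[OF assms(1)] As_Bs[OF assms(2)] Bs_As[OF assms(1)] Bs_As[OF assms(2)] by (auto 0 3)

lemma As_Bs_sep:
  assumes S: "S \<in> K" and "\<not> As e T \<subseteq> As e S" obtains p q where "(p, q) \<in> As e T" "(p, q) \<in> Bs e S"
proof -
  obtain p q where pq: "(p, q) \<in> As e T" "(p, q) \<notin> As e S" using assms by auto
  then have "(p, q) \<in> pairs" by (auto simp: As_def)
  then obtain a b where ab: "(a, b) \<in> rectS (rt e) p q" "(a, b) \<in> Bs e S"
    using As_Bs[OF S, of p q e] pq by auto
  have "(a, b) \<in> pairs" using ab by (auto simp: Bs_def)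
  then have "(a, b) \<in> As e T" using pq rectS_sub[OF ab(1)] by (auto simp: As_def)
  then show thesis using that ab by blast
qed

section \<open>The weak order through inversion sets\<close>

abbreviation G where "G \<equiv> type_B_group n"
abbreviation W where "W \<equiv> carrier G"
abbreviation s where "s \<equiv> type_B_simple n"

section \<open>The group \<open>B_n\<close> as symmetric permutations, and their positions\<close>

definition pos :: "(nat \<Rightarrow> nat) \<Rightarrow> nat \<Rightarrow> nat" where "pos x = inv_into UNIV x"

text \<open>Inversions are taken as pairs of values: multiplication on the right acts on positions,
  so the right weak order becomes containment of these sets.\<close>

definition ivs :: "(nat \<Rightarrow> nat) \<Rightarrow> (nat \<times> nat) set" where
  "ivs x = {(a, b) \<in> pairs. pos x b < pos x a}"

definition adj :: "(nat \<Rightarrow> nat) \<Rightarrow> nat \<Rightarrow> nat \<Rightarrow> bool" where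
  "adj x a b \<longleftrightarrow> a \<in> {1..2 * n} \<and> b \<in> {1..2 * n} \<and> pos x b = pos x a + 1"

lemma mir_range: "v \<in> {1..2 * n} \<Longrightarrow> mir v \<in> {1..2 * n}"
  by (auto simp: mir_def)

lemma W_iff: "x \<in> W \<longleftrightarrow> x permutes {1..2 * n} \<and> (\<forall>i \<in> {1..2 * n}. x (mir i) = mir (x i))"
proof -
  have lp: "longest_perm (2 * n) i = (if i \<in> {1..2 * n} then mir i else i)" for i
    by (auto simp: longest_perm_def mir_def)
  have "longest_perm (2 * n) \<circ> x \<circ> longest_perm (2 * n) = x \<longleftrightarrow> (\<forall>i \<in> {1..2 * n}. x (mir i) = mir (x i))"
    if p: "x permutes {1..2 * n}"
  proof
    assume e: "longest_perm (2 * n) \<circ> x \<circ> longest_perm (2 * n) = x"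
    show "\<forall>i \<in> {1..2 * n}. x (mir i) = mir (x i)"
    proof
      fix i assume i: "i \<in> {1..2 * n}"
      have "x (mir i) \<in> {1..2 * n}" using permutes_in_image[OF p, of "mir i"] mir_range[OF i] by blast
      then have "mir (x (mir i)) = x i" using fun_cong[OF e, of i] i by (simp only: lp comp_apply if_True)
      then show "x (mir i) = mir (x i)"
        using mir_mir \<open>x (mir i) \<in> {1..2 * n}\<close> by (metis atLeastAtMost_iff)
    qed
  next
    assume h: "\<forall>i \<in> {1..2 * n}. x (mir i) = mir (x i)"
    show "longest_perm (2 * n) \<circ> x \<circ> longest_perm (2 * n) = x"
    proof
      fix i
      show "(longest_perm (2 * n) \<circ> x \<circ> longest_perm (2 * n)) i = x i"
      proof (cases "i \<in> {1..2 * n}")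
        case True
        then have "x i \<in> {1..2 * n}" using permutes_in_image[OF p, of i] by blast
        then have "mir (x i) \<in> {1..2 * n}" "mir (mir (x i)) = x i" using mir_range mir_mir by auto
        then show ?thesis using h True by (simp only: lp comp_apply if_True)
      next
        case False
        then have "x i = i" using p by (simp only: permutes_def) blast
        then show ?thesis using False by (simp only: lp comp_apply if_False)
      qed
    qed
  qed
  then show ?thesis by (auto simp: type_B_group_def sym_group_def)
qed

lemma W_permutes: "x \<in> W \<Longrightarrow> x permutes {1..2 * n}" by (simp add: W_iff)

lemma W_range: "x \<in> W \<Longrightarrow> x i \<in> {1..2 * n} \<longleftrightarrow> i \<in> {1..2 * n}"
  using W_permutes permutes_in_image by metis

lemma W_mir: "x \<in> W \<Longrightarrow> i \<in> {1..2 * n} \<Longrightarrow> x (mir i) = mir (x i)" by (simp add: W_iff)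

lemma mult_G: "x \<otimes>\<^bsub>G\<^esub> y = x \<circ> y" by (simp add: type_B_group_def sym_group_def)
lemma one_G: "\<one>\<^bsub>G\<^esub> = id" by (simp add: type_B_group_def sym_group_def)

lemma W_comp: "x \<in> W \<Longrightarrow> y \<in> W \<Longrightarrow> x \<circ> y \<in> W"
proof -
  assume x: "x \<in> W" and y: "y \<in> W"
  have "x \<circ> y permutes {1..2 * n}" using W_permutes[OF x] W_permutes[OF y] permutes_compose by blast
  then show "x \<circ> y \<in> W" unfolding W_iff using W_mir[OF x] W_mir[OF y] W_range[OF y] by auto
qed

lemma W_id: "id \<in> W" by (simp add: W_iff permutes_id)

lemma W_inv: assumes x: "x \<in> W" shows "inv_into UNIV x \<in> W"
proof -
  note p = W_permutes[OF x]
  have "inv_into UNIV x (mir i) = mir (inv_into UNIV x i)" if i: "i \<in> {1..2 * n}" for i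
  proof -
    have j: "inv_into UNIV x i \<in> {1..2 * n}" using permutes_in_image[OF permutes_inv[OF p]] i by blast
    have "x (mir (inv_into UNIV x i)) = mir i"
      using W_mir[OF x j] permutes_inverses(1)[OF p] by metis
    then show ?thesis using permutes_inverses(2)[OF p] by metis
  qed
  then show ?thesis unfolding W_iff using permutes_inv[OF p] by blast
qed

lemma group_G: "group G"
proof (rule groupI)
  fix x assume "x \<in> carrier G"
  then show "\<exists>y \<in> carrier G. y \<otimes>\<^bsub>G\<^esub> x = \<one>\<^bsub>G\<^esub>"
    using W_inv permutes_inv_o(2)[OF W_permutes] by (auto simp: mult_G one_G)
qed (auto simp: mult_G one_G W_comp W_id comp_assoc)

lemma x_pos: "x \<in> W \<Longrightarrow> x (pos x v) = v"
  using permutes_inverses(1)[OF W_permutes] by (simp add: pos_def)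

lemma pos_x: "x \<in> W \<Longrightarrow> pos x (x i) = i"
  using permutes_inverses(2)[OF W_permutes] by (simp add: pos_def)

lemma pos_eq_iff: "x \<in> W \<Longrightarrow> pos x a = pos x b \<longleftrightarrow> a = b"
  using x_pos by metis

lemma pos_W: "x \<in> W \<Longrightarrow> pos x \<in> W"
  by (simp add: pos_def W_inv)

lemma pos_range: "x \<in> W \<Longrightarrow> pos x i \<in> {1..2 * n} \<longleftrightarrow> i \<in> {1..2 * n}"
  using W_range[OF pos_W] by blast

lemma pos_mir: "x \<in> W \<Longrightarrow> i \<in> {1..2 * n} \<Longrightarrow> pos x (mir i) = mir (pos x i)"
  using W_mir[OF pos_W] by blast

lemma finite_W: "finite W"
  by (rule finite_subset[of _ "{x. x permutes {1..2 * n}}"]) (auto simp: W_iff finite_permutations)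

lemma ivs_iff: "(a, b) \<in> ivs x \<longleftrightarrow> 1 \<le> a \<and> a < b \<and> b \<le> 2 * n \<and> pos x b < pos x a"
  by (auto simp: ivs_def pairs_def)

lemma ivs_K: assumes x: "x \<in> W" shows "ivs x \<in> K"
proof -
  have "bic (ivs x)"
    by (rule bicI) (use pos_eq_iff[OF x] in \<open>auto simp: ivs_iff pairs_def\<close>)
  moreover have "(mir b, mir a) \<in> ivs x" if "(a, b) \<in> ivs x" for a b
    using that pos_mir[OF x, of a] pos_mir[OF x, of b] pos_range[OF x, of a] pos_range[OF x, of b]
    by (auto simp: ivs_iff mir_def)
  ultimately show ?thesis by (auto simp: K_def)
qed

lemma pos_less_iff:
  assumes "x \<in> W" "a \<in> {1..2 * n}" "b \<in> {1..2 * n}"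
  shows "pos x a < pos x b \<longleftrightarrow> (a < b \<and> (a, b) \<notin> ivs x) \<or> (b < a \<and> (b, a) \<in> ivs x)"
  using assms pos_eq_iff[OF assms(1), of a b] by (auto simp: ivs_iff)

lemma pos_card: assumes x: "x \<in> W" and v: "v \<in> {1..2 * n}"
  shows "pos x v = card {u \<in> {1..2 * n}. pos x u \<le> pos x v}"
proof -
  have "pos x ` {u \<in> {1..2 * n}. pos x u \<le> pos x v} = {1..pos x v}"
  proof (intro equalityI subsetI)
    fix k assume "k \<in> {1..pos x v}"
    then have "k \<in> {1..2 * n}" using pos_range[OF x, of v] v by auto
    then show "k \<in> pos x ` {u \<in> {1..2 * n}. pos x u \<le> pos x v}"
      using pos_x[OF x, of k] W_range[OF x, of k] \<open>k \<in> {1..pos x v}\<close> by (intro image_eqI[of _ _ "x k"]) auto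
  next
    fix k assume "k \<in> pos x ` {u \<in> {1..2 * n}. pos x u \<le> pos x v}"
    then obtain u where "u \<in> {1..2 * n}" "pos x u \<le> pos x v" "k = pos x u" by auto
    then show "k \<in> {1..pos x v}" using pos_range[OF x, of u] by auto
  qed
  moreover have "inj_on (pos x) {u \<in> {1..2 * n}. pos x u \<le> pos x v}"
    using pos_eq_iff[OF x] by (auto simp: inj_on_def)
  ultimately show ?thesis using card_image by fastforce
qed

lemma ivs_inj: assumes x: "x \<in> W" and y: "y \<in> W" and e: "ivs x = ivs y" shows "x = y"
proof -
  have "pos x u \<le> pos x v \<longleftrightarrow> pos y u \<le> pos y v" if "u \<in> {1..2 * n}" "v \<in> {1..2 * n}" for u v
    using pos_less_iff[OF x that(2,1)] pos_less_iff[OF y that(2,1)] e by (simp flip: not_less)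
  then have eq: "pos x v = pos y v" if "v \<in> {1..2 * n}" for v
    using pos_card[OF x that] pos_card[OF y that] that by (metis (mono_tags, lifting) Collect_cong)
  have "x i = y i" for i
  proof (cases "i \<in> {1..2 * n}")
    case True
    then have "pos y (x i) = i" using eq[of "x i"] pos_x[OF x] W_range[OF x, of i] by simp
    then show ?thesis using x_pos[OF y] by metis
  next
    case False
    then show ?thesis using W_permutes[OF x] W_permutes[OF y] permutes_not_in by metis
  qed
  then show ?thesis by blast
qed

text \<open>The position of a value is the number of its predecessors plus one.\<close>

lemma realize: assumes T: "T \<in> K" obtains x where "x \<in> W" "ivs x = T"
proof -
  define bef where "bef a b \<longleftrightarrow> (a < b \<and> (a, b) \<notin> T) \<or> (b < a \<and> (b, a) \<in> T)" for a b
  let ?I = "{1..2 * n}"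
  have tot: "bef a b \<or> bef b a" if "a \<noteq> b" for a b using that unfolding bef_def by auto
  have asym: "\<not> bef b a" if "bef a b" for a b using that unfolding bef_def by auto
  \<comment> \<open>In each of the six orders of the three values, transitivity is an instance of
    closedness or of coclosedness of \<open>T\<close>.\<close>
  have trans: "bef a c" if "bef a b" "bef b c" for a b c
  proof -
    have ne: "a \<noteq> b" "b \<noteq> c" "a \<noteq> c" using that unfolding bef_def by auto
    consider "a < b" "b < c" | "a < c" "c < b" | "b < a" "a < c" | "b < c" "c < a" | "c < a" "a < b" | "c < b" "b < a"
      using ne by linarith
    then show ?thesis
    proof cases
      case 1 then show ?thesis using that KD(3)[OF T, of a b c] unfolding bef_def by auto
    next
      case 2 then show ?thesis using that KD(2)[OF T, of a c b] unfolding bef_def by auto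
    next
      case 3 then show ?thesis using that KD(2)[OF T, of b a c] unfolding bef_def by auto
    next
      case 4 then show ?thesis using that KD(3)[OF T, of b c a] unfolding bef_def by auto
    next
      case 5 then show ?thesis using that KD(3)[OF T, of c a b] unfolding bef_def by auto
    next
      case 6 then show ?thesis using that KD(2)[OF T, of c b a] unfolding bef_def by auto
    qed
  qed
  have bmir: "bef (mir b) (mir a) \<longleftrightarrow> bef a b" if "a \<in> ?I" "b \<in> ?I" for a b
    using that K_mir_iff[OF T, of a b] K_mir_iff[OF T, of b a] unfolding bef_def by (auto simp: mir_def)
  define f where "f v = card {u \<in> ?I. u = v \<or> bef u v}" for v
  have mono: "f a < f b" if "bef a b" "b \<in> ?I" for a b
  proof -
    have "{u \<in> ?I. u = a \<or> bef u a} \<subset> {u \<in> ?I. u = b \<or> bef u b}"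
    proof
      show "{u \<in> ?I. u = a \<or> bef u a} \<subseteq> {u \<in> ?I. u = b \<or> bef u b}" using that trans by blast
      have "a \<noteq> b" "\<not> bef b a" using that(1) asym by blast+
      then have "b \<notin> {u \<in> ?I. u = a \<or> bef u a}" "b \<in> {u \<in> ?I. u = b \<or> bef u b}" using that(2) by auto
      then show "{u \<in> ?I. u = a \<or> bef u a} \<noteq> {u \<in> ?I. u = b \<or> bef u b}" by blast
    qed
    then show ?thesis unfolding f_def by (intro psubset_card_mono) auto
  qed
  have frange: "f v \<in> ?I" if "v \<in> ?I" for v
  proof -
    have "f v \<le> card ?I" unfolding f_def by (intro card_mono) auto
    moreover have "{u \<in> ?I. u = v \<or> bef u v} \<noteq> {}" using that by blast
    then have "f v > 0" unfolding f_def by (subst card_gt_0_iff) simp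
    ultimately show ?thesis by simp
  qed
  have inj: "inj_on f ?I"
    using mono tot by (intro inj_onI) (metis less_irrefl)
  \<comment> \<open>The predecessors of \<open>mir v\<close> are the mirror images of the successors
    of \<open>v\<close>. Together with the predecessors of \<open>v\<close> these exhaust all values
    and count \<open>v\<close> twice, hence the sum \<open>2 * n + 1\<close>.\<close>
  have fmir: "f (mir v) = mir (f v)" if v: "v \<in> ?I" for v
  proof -
    let ?A = "{u \<in> ?I. u = v \<or> bef u v}" and ?B = "{u \<in> ?I. u = v \<or> bef v u}"
    have "mir ` {u \<in> ?I. u = mir v \<or> bef u (mir v)} = ?B"
    proof (intro equalityI subsetI)
      fix w assume w: "w \<in> mir ` {u \<in> ?I. u = mir v \<or> bef u (mir v)}"
      then obtain u where u: "u \<in> ?I" "u = mir v \<or> bef u (mir v)" "w = mir u" by auto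
      then show "w \<in> ?B" using v mir_range[of u] bmir[of "mir u" v] bmir[of v "mir u"] mir_mir[of u] mir_mir[of v] by auto
    next
      fix w assume w: "w \<in> ?B"
      then have "bef v w \<or> w = v" "w \<in> ?I" by auto
      then show "w \<in> mir ` {u \<in> ?I. u = mir v \<or> bef u (mir v)}"
        using v mir_range[of w] bmir[of v w] mir_mir[of w] by (intro image_eqI[of _ _ "mir w"]) auto
    qed
    moreover have "inj_on mir {u \<in> ?I. u = mir v \<or> bef u (mir v)}"
      by (rule inj_on_subset[of _ ?I]) (auto simp: inj_on_def mir_def)
    ultimately have 1: "f (mir v) = card ?B"
      unfolding f_def using card_image[of mir "{u \<in> ?I. u = mir v \<or> bef u (mir v)}"] by simp
    have "?A \<union> ?B = ?I" using tot by blast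
    moreover have "?A \<inter> ?B = {v}" using v asym by auto
    ultimately have "card ?A + card ?B = 2 * n + 1"
      using card_Un_Int[of ?A ?B] by simp
    then show ?thesis using 1 unfolding f_def mir_def by simp
  qed
  define p where "p v = (if v \<in> ?I then f v else v)" for v
  have "p permutes ?I"
  proof (rule bij_imp_permutes)
    have "inj_on p ?I = inj_on f ?I" by (rule inj_on_cong) (simp only: p_def if_True)
    moreover have "p ` ?I = f ` ?I" by (rule image_cong) (simp_all only: p_def if_True)
    moreover have "f ` ?I \<subseteq> ?I" using frange by (rule image_subsetI)
    ultimately show "bij_betw p ?I ?I"
      using inj endo_inj_surj[of ?I p] by (simp add: bij_betw_def)
  qed (simp only: p_def if_False)
  moreover have "p (mir i) = mir (p i)" if "i \<in> ?I" for i
    using that fmir mir_range[OF that] by (simp only: p_def if_True)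
  ultimately have pW: "p \<in> W" by (simp only: W_iff) blast
  define x where "x = inv_into UNIV p"
  have x: "x \<in> W" using W_inv[OF pW] by (simp only: x_def)
  have px: "pos x = p" using inv_inv_eq[of p] permutes_bij[OF W_permutes[OF pW]] by (simp add: pos_def x_def)
  have "(a, b) \<in> ivs x \<longleftrightarrow> (a, b) \<in> T" for a b
  proof (cases "(a, b) \<in> pairs")
    case True
    then have ab: "a \<in> ?I" "b \<in> ?I" "a < b" by (auto simp: pairs_def)
    have "p b < p a \<longleftrightarrow> bef b a"
      using mono[of a b] mono[of b a] tot[of a b] ab by (auto simp: p_def)
    then show ?thesis using ab by (auto simp: ivs_iff px bef_def)
  next
    case False
    then show ?thesis using KD(1)[OF T] by (auto simp: ivs_def)
  qed
  then have "ivs x = T" by auto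
  then show thesis using that x by blast
qed

subsection \<open>Multiplication by a simple reflection\<close>

text \<open>Valid for \<open>i = n\<close> as well: then \<open>2 * n - i = i\<close>, and the first
  two branches capture the arguments of the last two.\<close>

lemma s_apply:
  assumes "i \<in> {1..n}"
  shows "s i j = (if j = i then i + 1 else if j = i + 1 then i
     else if j = 2 * n - i then 2 * n - i + 1 else if j = 2 * n - i + 1 then 2 * n - i else j)"
proof -
  have "i < n \<or> i = n" using assms by auto
  then show ?thesis
  proof
    assume "i < n"
    then have "i + 1 < 2 * n - i" by auto
    then show ?thesis using \<open>i < n\<close> by (simp add: type_B_simple_def adj_transp_def transpose_def)
  next
    assume "i = n"
    then show ?thesis using assms by (simp add: type_B_simple_def adj_transp_def transpose_def)
  qed
qed

lemma s_vals:
  assumes i: "i \<in> {1..n}"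
  shows "s i i = i + 1" "s i (i + 1) = i" "s i (2 * n - i) = 2 * n - i + 1" "s i (2 * n - i + 1) = 2 * n - i"
proof -
  have "2 * n - i \<noteq> i + 1" using i by presburger
  then show "s i i = i + 1" "s i (i + 1) = i" "s i (2 * n - i) = 2 * n - i + 1" "s i (2 * n - i + 1) = 2 * n - i"
    unfolding s_apply[OF i] using i by auto
qed

lemma s_s: "i \<in> {1..n} \<Longrightarrow> s i \<circ> s i = id"
proof (rule ext)
  fix j assume i: "i \<in> {1..n}"
  have "2 * n - i \<noteq> i + 1" using i by presburger
  then show "(s i \<circ> s i) j = id j" using i by (auto simp: s_apply)
qed

lemma s_W: assumes i: "i \<in> {1..n}" shows "s i \<in> W"
proof -
  have "bij (s i)" using o_bij[OF s_s[OF i] s_s[OF i]] .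
  moreover have "s i j = j" if "j \<notin> {1..2 * n}" for j using that i by (auto simp: s_apply)
  ultimately have "s i permutes {1..2 * n}" unfolding permutes_def using bij_iff[of "s i"] by blast
  moreover have "s i (mir j) = mir (s i j)" if "j \<in> {1..2 * n}" for j
  proof -
    let ?K = "2 * n - i"
    have i': "1 \<le> i" "i \<le> n" and j: "1 \<le> j" "j \<le> 2 * n" using i that by auto
    have m: "mir i = ?K + 1" "mir (i + 1) = ?K" "mir ?K = i + 1" "mir (?K + 1) = i"
      using i' by (auto simp: mir_def)
    note si = s_vals[OF i]
    show ?thesis
    proof (cases "j \<in> {i, i + 1, ?K, ?K + 1}")
      case True
      then show ?thesis using m si by auto
    next
      case False
      then have "mir j \<notin> {i, i + 1, ?K, ?K + 1}" using j i' by (auto simp: mir_def)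
      then show ?thesis using False by (simp add: s_apply[OF i])
    qed
  qed
  ultimately show ?thesis by (simp only: W_iff) blast
qed

lemma pos_comp_s: assumes x: "x \<in> W" and i: "i \<in> {1..n}" shows "pos (x \<circ> s i) v = s i (pos x v)"
proof -
  have "(x \<circ> s i) (s i (pos x v)) = v"
    using s_s[OF i] x_pos[OF x] by (metis comp_apply id_apply)
  then show ?thesis using pos_x[OF W_comp[OF x s_W[OF i]]] by metis
qed

text \<open>Exchanging neighbouring positions reverses the order of just these neighbours.\<close>

lemma s_order:
  assumes i: "i \<in> {1..n}" and ne: "P \<noteq> Q"
  shows "s i Q < s i P \<longleftrightarrow>
    (if (P = i \<and> Q = i + 1) \<or> (P = 2 * n - i \<and> Q = 2 * n - i + 1) then True
     else if (P = i + 1 \<and> Q = i) \<or> (P = 2 * n - i + 1 \<and> Q = 2 * n - i) then False else Q < P)"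
proof -
  have "i < n \<or> i = n" using i by auto
  then show ?thesis
  proof
    assume "i < n"
    then have "i + 1 < 2 * n - i" by auto
    then show ?thesis using ne unfolding s_apply[OF i] by (smt (verit) Suc_eq_plus1 less_Suc_eq less_antisym not_less_eq)
  next
    assume "i = n"
    then have "2 * n - i = i" by simp
    then show ?thesis using ne unfolding s_apply[OF i] by auto
  qed
qed

lemma ivs_step:
  assumes x: "x \<in> W" and i: "i \<in> {1..n}" and lt: "x i < x (i + 1)"
  shows "ivs (x \<circ> s i) = ivs x \<union> {(x i, x (i + 1)), (mir (x (i + 1)), mir (x i))}"
    "(x i, x (i + 1)) \<notin> ivs x"
proof -
  have r: "i \<in> {1..2 * n}" "i + 1 \<in> {1..2 * n}" using i by auto
  have xr: "x i \<in> {1..2 * n}" "x (i + 1) \<in> {1..2 * n}" using W_range[OF x] r by blast+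
  have m: "x (2 * n - i) = mir (x (i + 1))" "x (2 * n - i + 1) = mir (x i)"
    using W_mir[OF x r(2)] W_mir[OF x r(1)] i by (auto simp: mir_def Suc_diff_le)
  have px: "pos x v = k \<longleftrightarrow> v = x k" for v k using pos_x[OF x] x_pos[OF x] by metis
  show "(x i, x (i + 1)) \<notin> ivs x" using pos_x[OF x] by (simp add: ivs_iff)
  have "(c, d) \<in> ivs (x \<circ> s i) \<longleftrightarrow> (c, d) \<in> ivs x \<union> {(x i, x (i + 1)), (mir (x (i + 1)), mir (x i))}" for c d
  proof (cases "(c, d) \<in> pairs")
    case True
    then have cd: "c < d" "1 \<le> c" "d \<le> 2 * n" by (auto simp: pairs_def)
    have ne: "pos x c \<noteq> pos x d" using pos_eq_iff[OF x] cd by auto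
    have mlt: "mir (x (i + 1)) < mir (x i)" using lt xr by (auto simp: mir_def)
    have "(c, d) \<in> ivs (x \<circ> s i) \<longleftrightarrow> s i (pos x d) < s i (pos x c)"
      using cd by (simp add: ivs_iff pos_comp_s[OF x i])
    also have "\<dots> \<longleftrightarrow> (c, d) \<in> ivs x \<union> {(x i, x (i + 1)), (mir (x (i + 1)), mir (x i))}"
      unfolding s_order[OF i ne] px m using cd lt mlt by (auto simp: ivs_iff)
    finally show ?thesis .
  next
    case False
    have "(x i, x (i + 1)) \<in> pairs" using lt xr by (auto simp: pairs_def)
    moreover from mir_pairs[OF this] have "(mir (x (i + 1)), mir (x i)) \<in> pairs" .
    ultimately show ?thesis using False by (auto simp: ivs_def)
  qed
  then show "ivs (x \<circ> s i) = ivs x \<union> {(x i, x (i + 1)), (mir (x (i + 1)), mir (x i))}" by auto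
qed

text \<open>An ascent at a position beyond \<open>n\<close> is the mirror image of one at
  \<open>2 * n - k\<close>, where a simple reflection is available.\<close>

lemma ascent_step:
  assumes x: "x \<in> W" and k: "1 \<le> k" "k < 2 * n" and lt: "x k < x (k + 1)"
  obtains i where "i \<in> {1..n}" "x i < x (i + 1)"
    "ivs (x \<circ> s i) = ivs x \<union> {(x k, x (k + 1)), (mir (x (k + 1)), mir (x k))}"
proof (cases "k \<le> n")
  case True
  then have "k \<in> {1..n}" using k by auto
  then show thesis using that ivs_step[OF x _ lt] lt by blast
next
  case False
  have r: "k \<in> {1..2 * n}" "k + 1 \<in> {1..2 * n}" using k by auto
  have xr: "x k \<in> {1..2 * n}" "x (k + 1) \<in> {1..2 * n}" using W_range[OF x] r by blast+
  have m: "x (2 * n - k) = mir (x (k + 1))" "x (2 * n - k + 1) = mir (x k)"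
    using W_mir[OF x r(2)] W_mir[OF x r(1)] k by (auto simp: mir_def Suc_diff_le)
  have i: "2 * n - k \<in> {1..n}" using False k by auto
  have lt': "x (2 * n - k) < x (2 * n - k + 1)" unfolding m using lt xr by (auto simp: mir_def)
  have mm: "mir (mir (x k)) = x k" "mir (mir (x (k + 1))) = x (k + 1)" using mir_mir xr by auto
  show thesis using that[OF i lt'] ivs_step[OF x i lt'] unfolding m mm by (simp add: insert_commute)
qed

lemma adj_ascent:
  assumes x: "x \<in> W" and a: "adj x p q" and lt: "p < q"
  obtains y where "y \<in> W" "ivs y = ivs x \<union> {(p, q), (mir q, mir p)}"
proof -
  have k: "1 \<le> pos x p" "pos x p < 2 * n"
    using a pos_range[OF x, of p] pos_range[OF x, of q] unfolding adj_def by auto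
  moreover have "x (pos x p) = p" "x (pos x p + 1) = q"
    using a x_pos[OF x, of p] x_pos[OF x, of q] unfolding adj_def by auto
  ultimately show thesis using ascent_step[OF x k(1,2)] that lt W_comp[OF x s_W] by metis
qed

lemma adj_descent:
  assumes x: "x \<in> W" and a: "adj x q p" and lt: "p < q"
  obtains y where "y \<in> W" "ivs y = ivs x - {(p, q), (mir q, mir p)}"
proof -
  define k where "k = pos x q"
  have k1: "1 \<le> k" "k < 2 * n" and r: "p \<in> {1..2 * n}" "q \<in> {1..2 * n}"
    using a pos_range[OF x, of p] pos_range[OF x, of q] unfolding adj_def k_def by auto
  have "x k = q" "x (k + 1) = p"
    using a x_pos[OF x, of p] x_pos[OF x, of q] unfolding adj_def k_def by auto
  note k = k1 this
  obtain i where i: "i \<in> {1..n}" "(i = k \<or> 2 * n - i = k)"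
  proof (cases "k \<le> n")
    case True then show thesis using that k by auto
  next
    case False
    then have "2 * n - k \<in> {1..n}" "2 * n - (2 * n - k) = k" using k1 by auto
    then show thesis using that by blast
  qed
  let ?y = "x \<circ> s i"
  have y: "?y \<in> W" using W_comp[OF x s_W[OF i(1)]] .
  have yk: "?y k = p" "?y (k + 1) = q" using i k s_vals[OF i(1)] by auto
  have yy: "?y \<circ> s i = x" using s_s[OF i(1)] by (simp add: comp_assoc)
  obtain j where j: "j \<in> {1..n}" "ivs (?y \<circ> s j) = ivs ?y \<union> {(p, q), (mir q, mir p)}" "?y j < ?y (j + 1)"
    using ascent_step[OF y k(1,2)] yk lt by metis
  have ylt: "?y i < ?y (i + 1)"
  proof (cases "i = k")
    case True then show ?thesis using yk lt by simp
  next
    case False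
    then have ki: "k = 2 * n - i" "i + 1 = mir k" "i = mir (k + 1)" using i k by (auto simp: mir_def)
    have "?y i = mir q" "?y (i + 1) = mir p"
      using W_mir[OF y, of k] W_mir[OF y, of "k + 1"] k yk unfolding ki(2) using ki(3) by auto
    then show ?thesis using lt r by (auto simp: mir_def)
  qed
  note st = ivs_step(1)[OF y i(1) ylt, unfolded yy]
  have eq: "ivs x = ivs ?y \<union> {(p, q), (mir q, mir p)}"
  proof (cases "i = k")
    case True then show ?thesis using st yk by (simp only:)
  next
    case False
    then have ki: "k = 2 * n - i" "i + 1 = mir k" "i = mir (k + 1)" using i k by (auto simp: mir_def)
    have "?y i = mir q" "?y (i + 1) = mir p"
      using W_mir[OF y, of k] W_mir[OF y, of "k + 1"] k yk unfolding ki(2) using ki(3) by auto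
    moreover have "mir (mir p) = p" "mir (mir q) = q" using mir_mir r by auto
    ultimately show ?thesis using st by (simp only: insert_commute)
  qed
  have "pos ?y p = k" "pos ?y q = k + 1" using pos_x[OF y, of k] pos_x[OF y, of "k + 1"] yk by auto
  then have "(p, q) \<notin> ivs ?y" by (auto simp: ivs_iff)
  moreover then have "(mir q, mir p) \<notin> ivs ?y" using K_mir_iff[OF ivs_K[OF y], of p q] r by auto
  ultimately have "ivs ?y = ivs x - {(p, q), (mir q, mir p)}" using eq by auto
  then show thesis using that y by blast
qed

lemma descending_step:
  assumes "a < b" "g (b :: nat) < (g a :: nat)" obtains k where "a \<le> k" "k < b" "g (k + 1) < g k"
proof (rule ccontr)
  assume "\<not> thesis"
  then have h: "\<not> g (k + 1) < g k" if "a \<le> k" "k < b" for k using that \<open>\<And>k. a \<le> k \<Longrightarrow> k < b \<Longrightarrow> g (k + 1) < g k \<Longrightarrow> thesis\<close> by blast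
  have "g a \<le> g (a + d)" if "a + d \<le> b" for d using that
  proof (induction d)
    case (Suc d)
    then have "\<not> g (a + d + 1) < g (a + d)" using h[of "a + d"] by auto
    then show ?case using Suc by auto
  qed simp
  from this[of "b - a"] show False using assms by simp
qed

text \<open>Along the letters of \<open>u\<close> from \<open>a\<close> to \<open>b\<close> the
  positions in \<open>w\<close> cannot increase throughout. Where they drop stands an adjacent pair
  inverted in \<open>w\<close>; it is an ascent of \<open>u\<close>, as inversions of
  \<open>u\<close> are inversions of \<open>w\<close> with the larger value first.\<close>

lemma ex_adj_ascent:
  assumes u: "u \<in> W" and w: "w \<in> W" and sub: "ivs u \<subset> ivs w"
  obtains p q where "adj u p q" "p < q" "(p, q) \<in> ivs w" "(p, q) \<notin> ivs u"
proof -
  obtain a b where ab: "(a, b) \<in> ivs w" "(a, b) \<notin> ivs u" using sub by auto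
  then have r: "a \<in> {1..2 * n}" "b \<in> {1..2 * n}" "a < b" by (auto simp: ivs_iff)
  have "pos u a < pos u b" using ab r pos_eq_iff[OF u, of a b] by (auto simp: ivs_iff)
  moreover have "pos w (u (pos u b)) < pos w (u (pos u a))" using ab x_pos[OF u] by (auto simp: ivs_iff)
  ultimately obtain k where k: "pos u a \<le> k" "k < pos u b" "pos w (u (k + 1)) < pos w (u k)"
    using descending_step[of "pos u a" "pos u b" "\<lambda>k. pos w (u k)"] by blast
  have kr: "k \<in> {1..2 * n}" "k + 1 \<in> {1..2 * n}" using k pos_range[OF u, of a] pos_range[OF u, of b] r by auto
  let ?p = "u k" and ?q = "u (k + 1)"
  have pr: "?p \<in> {1..2 * n}" "?q \<in> {1..2 * n}" using W_range[OF u] kr by blast+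
  have pk: "pos u ?p = k" "pos u ?q = k + 1" using pos_x[OF u] by auto
  have "?p \<noteq> ?q" using pk by auto
  moreover have "\<not> ?q < ?p"
  proof
    assume "?q < ?p"
    then have "(?q, ?p) \<in> ivs u" using pk pr by (auto simp: ivs_iff)
    then have "(?q, ?p) \<in> ivs w" using sub by auto
    then show False using k by (auto simp: ivs_iff)
  qed
  ultimately have lt: "?p < ?q" by auto
  have "adj u ?p ?q" using pr pk by (auto simp: adj_def)
  moreover have "(?p, ?q) \<in> ivs w" "(?p, ?q) \<notin> ivs u" using lt pr pk k by (auto simp: ivs_iff)
  ultimately show thesis using that lt by blast
qed

lemma ex_adj_descent:
  assumes u: "u \<in> W" and w: "w \<in> W" and sub: "ivs u \<subset> ivs w"
  obtains p q where "adj w q p" "p < q" "(p, q) \<in> ivs w" "(p, q) \<notin> ivs u"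
proof -
  obtain a b where ab: "(a, b) \<in> ivs w" "(a, b) \<notin> ivs u" using sub by auto
  then have r: "a \<in> {1..2 * n}" "b \<in> {1..2 * n}" "a < b" by (auto simp: ivs_iff)
  have "pos w b < pos w a" using ab by (auto simp: ivs_iff)
  moreover have "pos u (w (pos w a)) < pos u (w (pos w b))"
    using ab r pos_eq_iff[OF u, of a b] x_pos[OF w] by (auto simp: ivs_iff)
  ultimately obtain k where k: "pos w b \<le> k" "k < pos w a" "pos u (w (k + 1)) < pos u (w k)"
    using descending_step[of "pos w b" "pos w a" "\<lambda>k. pos u (w k)"] by blast
  have kr: "k \<in> {1..2 * n}" "k + 1 \<in> {1..2 * n}" using k pos_range[OF w, of a] pos_range[OF w, of b] r by auto
  let ?q = "w k" and ?p = "w (k + 1)"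
  have pr: "?p \<in> {1..2 * n}" "?q \<in> {1..2 * n}" using W_range[OF w] kr by blast+
  have pk: "pos w ?q = k" "pos w ?p = k + 1" using pos_x[OF w] by auto
  have "?p \<noteq> ?q" using pk by auto
  moreover have "\<not> ?q < ?p"
  proof
    assume "?q < ?p"
    then have "(?q, ?p) \<in> ivs u" using k pr by (auto simp: ivs_iff)
    then have "(?q, ?p) \<in> ivs w" using sub by auto
    then show False using pk by (auto simp: ivs_iff)
  qed
  ultimately have lt: "?p < ?q" by auto
  have "adj w ?q ?p" using pr pk by (auto simp: adj_def)
  moreover have "(?p, ?q) \<in> ivs w" "(?p, ?q) \<notin> ivs u" using lt pr pk k by (auto simp: ivs_iff)
  ultimately show thesis using that lt by blast
qed

subsection \<open>Reduced words\<close>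

definition pw :: "nat list \<Rightarrow> nat \<Rightarrow> nat" where
  "pw is = foldr (\<lambda>i f. s i \<circ> f) is id"

abbreviation S where "S \<equiv> type_B_simples n"

lemma pw_Nil [simp]: "pw [] = id" and pw_Cons [simp]: "pw (i # is) = s i \<circ> pw is"
  by (simp_all add: pw_def)

lemma pw_append: "pw (is @ js) = pw is \<circ> pw js"
  by (induction "is") (simp_all add: comp_assoc)

lemma pw_W: "set is \<subseteq> {1..n} \<Longrightarrow> pw is \<in> W"
  by (induction "is") (simp_all add: W_id W_comp s_W)

lemma word_prod_map: "word_prod G (map s is) = pw is"
  by (induction "is") (simp_all add: word_prod_def mult_G one_G)

lemma simple_words: "set ws \<subseteq> S \<longleftrightarrow> (\<exists>is. ws = map s is \<and> set is \<subseteq> {1..n})"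
proof
  show "set ws \<subseteq> S \<Longrightarrow> \<exists>is. ws = map s is \<and> set is \<subseteq> {1..n}"
  proof (induction ws)
    case (Cons w ws)
    then obtain "is" i where "ws = map s is" "set is \<subseteq> {1..n}" "w = s i" "i \<in> {1..n}"
      by (auto simp: type_B_simples_def)
    then have "w # ws = map s (i # is) \<and> set (i # is) \<subseteq> {1..n}" by auto
    then show ?case by (rule exI)
  qed simp
next
  assume "\<exists>is. ws = map s is \<and> set is \<subseteq> {1..n}"
  then show "set ws \<subseteq> S" unfolding type_B_simples_def by (metis image_mono set_map)
qed

text \<open>The Coxeter length of type B. One inversion is counted from each mirror orbit, because
  the sums \<open>a + b\<close> of a pair and of its mirror image add up to
  \<open>4 * n + 2\<close>.\<close>

definition lenB :: "(nat \<Rightarrow> nat) \<Rightarrow> nat" where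
  "lenB x = card {(a, b) \<in> ivs x. a + b \<le> 2 * n + 1}"

lemma finite_ivs: "finite (ivs x)"
  by (rule finite_subset[of _ "{..2 * n} \<times> {..2 * n}"]) (auto simp: ivs_iff)

lemma lenB_step:
  assumes x: "x \<in> W" and i: "i \<in> {1..n}" and lt: "x i < x (i + 1)"
  shows "lenB (x \<circ> s i) = lenB x + 1"
proof -
  let ?a = "x i" and ?b = "x (i + 1)"
  have r: "?a \<in> {1..2 * n}" "?b \<in> {1..2 * n}" using W_range[OF x, of i] W_range[OF x, of "i + 1"] i by auto
  note st = ivs_step[OF x i lt]
  have nm: "(mir ?b, mir ?a) \<notin> ivs x" using st(2) K_mir_iff[OF ivs_K[OF x], of ?a ?b] r by auto
  define c where "c = (if ?a + ?b \<le> 2 * n + 1 then (?a, ?b) else (mir ?b, mir ?a))"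
  have "{(a, b) \<in> ivs (x \<circ> s i). a + b \<le> 2 * n + 1} = insert c {(a, b) \<in> ivs x. a + b \<le> 2 * n + 1}"
  proof (cases "?a + ?b = 2 * n + 1")
    case True
    then have "mir ?b = ?a" "mir ?a = ?b" by (auto simp: mir_def)
    then show ?thesis using st True by (auto simp: c_def)
  next
    case False
    have "?a + ?b \<le> 2 * n + 1 \<longleftrightarrow> \<not> mir ?b + mir ?a \<le> 2 * n + 1" using False r by (auto simp: mir_def)
    then show ?thesis using st by (auto simp: c_def)
  qed
  moreover have "c \<notin> {(a, b) \<in> ivs x. a + b \<le> 2 * n + 1}" using st nm by (auto simp: c_def)
  moreover have "finite {(a, b) \<in> ivs x. a + b \<le> 2 * n + 1}"
    by (rule finite_subset[OF _ finite_ivs[of x]]) auto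
  ultimately show ?thesis by (simp add: lenB_def)
qed

lemma x_ne: "x \<in> W \<Longrightarrow> x i \<noteq> x (i + 1)"
  using pos_x by (metis n_not_Suc_n Suc_eq_plus1)

lemma descent_flip:
  assumes x: "x \<in> W" and i: "i \<in> {1..n}" and gt: "x (i + 1) < x i"
  shows "(x \<circ> s i) i < (x \<circ> s i) (i + 1)" "(x \<circ> s i) \<circ> s i = x"
proof -
  show "(x \<circ> s i) i < (x \<circ> s i) (i + 1)" using gt s_vals[OF i] by simp
  show "(x \<circ> s i) \<circ> s i = x" unfolding comp_assoc s_s[OF i] by simp
qed

lemma lenB_step_down:
  assumes x: "x \<in> W" and i: "i \<in> {1..n}" and gt: "x (i + 1) < x i"
  shows "lenB x = lenB (x \<circ> s i) + 1"
  using lenB_step[OF W_comp[OF x s_W[OF i]] i descent_flip(1)[OF x i gt]]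
  unfolding descent_flip(2)[OF x i gt] .

lemma ivs_id: "ivs id = {}"
proof -
  have "pos id v = v" for v using pos_x[OF W_id, of v] by (simp only: id_apply)
  then show ?thesis by (auto simp only: ivs_iff)
qed

lemma lenB_id: "lenB id = 0"
  unfolding lenB_def ivs_id by simp

lemma lenB_pw: "set is \<subseteq> {1..n} \<Longrightarrow> lenB (pw is) \<le> length is"
proof (induction "is" rule: rev_induct)
  case Nil show ?case unfolding pw_Nil lenB_id by simp
next
  case (snoc i "is")
  then have x: "pw is \<in> W" and i: "i \<in> {1..n}" by (auto simp: pw_W)
  have e: "pw (is @ [i]) = pw is \<circ> s i" by (simp add: pw_append)
  consider "pw is i < pw is (i + 1)" | "pw is (i + 1) < pw is i" using x_ne[OF x, of i] by linarith
  then show ?case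
  proof cases
    case 1
    then have "lenB (pw is \<circ> s i) \<le> Suc (length is)" using lenB_step[OF x i] snoc by simp
    then show ?thesis unfolding e length_append_singleton .
  next
    case 2
    then have "lenB (pw is \<circ> s i) \<le> Suc (length is)" using lenB_step_down[OF x i] snoc by simp
    then show ?thesis unfolding e length_append_singleton .
  qed
qed

text \<open>Multiplying repeatedly at an adjacent ascent that is inverted in \<open>w\<close> climbs
  from \<open>u\<close> to \<open>w\<close> without leaving the interval, and each step adds one to
  \<open>lenB\<close>.\<close>

lemma ex_word:
  assumes "u \<in> W" "w \<in> W" "ivs u \<subseteq> ivs w"
  shows "\<exists>is. set is \<subseteq> {1..n} \<and> u \<circ> pw is = w \<and> length is + lenB u = lenB w"
  using assms
proof (induction "card (ivs w - ivs u)" arbitrary: u rule: less_induct)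
  case (less u)
  show ?case
  proof (cases "ivs u = ivs w")
    case True
    then have "u = w" using ivs_inj less.prems by blast
    then show ?thesis by (intro exI[of _ "[]"]) auto
  next
    case False
    then obtain p q where pq: "adj u p q" "p < q" "(p, q) \<in> ivs w" "(p, q) \<notin> ivs u"
      using ex_adj_ascent less.prems by (metis psubsetI)
    define k where "k = pos u p"
    have k: "1 \<le> k" "k < 2 * n"
      using pq(1) pos_range[OF less.prems(1), of p] pos_range[OF less.prems(1), of q] unfolding adj_def k_def by auto
    have uk: "u k = p" "u (k + 1) = q"
      using pq(1) x_pos[OF less.prems(1), of p] x_pos[OF less.prems(1), of q] unfolding adj_def k_def by auto
    obtain i where i: "i \<in> {1..n}" "u i < u (i + 1)" "ivs (u \<circ> s i) = ivs u \<union> {(p, q), (mir q, mir p)}"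
      using ascent_step[OF less.prems(1) k] uk pq(2) by metis
    have v: "u \<circ> s i \<in> W" using W_comp less.prems s_W i by blast
    have sub: "ivs (u \<circ> s i) \<subseteq> ivs w"
      using i(3) less.prems pq(3) KD(4)[OF ivs_K[OF less.prems(2)]] by auto
    have "card (ivs w - ivs (u \<circ> s i)) < card (ivs w - ivs u)"
      by (rule psubset_card_mono) (use finite_ivs i(3) pq in auto)
    then obtain "is" where "is": "set is \<subseteq> {1..n}" "u \<circ> s i \<circ> pw is = w" "length is + lenB (u \<circ> s i) = lenB w"
      using less.hyps[OF _ v less.prems(2) sub] by blast
    then show ?thesis using i lenB_step[OF less.prems(1) i(1,2)]
      by (intro exI[of _ "i # is"]) (auto simp: comp_assoc)
  qed
qed

lemma reduced_iff:
  assumes w: "w \<in> W"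
  shows "reduced_word G S ws w \<longleftrightarrow> (\<exists>is. ws = map s is \<and> set is \<subseteq> {1..n} \<and> pw is = w \<and> length is = lenB w)"
proof
  assume r: "reduced_word G S ws w"
  then obtain "is" where "is": "ws = map s is" "set is \<subseteq> {1..n}" "pw is = w"
    using simple_words word_prod_map unfolding reduced_word_def by metis
  obtain js where js: "set js \<subseteq> {1..n}" "pw js = w" "length js = lenB w"
    using ex_word[OF W_id w] ivs_id lenB_id by auto
  have "set (map s js) \<subseteq> S" "word_prod G (map s js) = w"
    using js simple_words[of "map s js"] word_prod_map[of js] by blast+
  moreover have "\<And>vs. set vs \<subseteq> S \<Longrightarrow> word_prod G vs = w \<Longrightarrow> length ws \<le> length vs"
    using r unfolding reduced_word_def by blast
  ultimately have "length ws \<le> length (map s js)" by blast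
  then have "length is = lenB w" using lenB_pw[OF "is"(2)] "is" js by auto
  then show "\<exists>is. ws = map s is \<and> set is \<subseteq> {1..n} \<and> pw is = w \<and> length is = lenB w" using "is" by blast
next
  assume "\<exists>is. ws = map s is \<and> set is \<subseteq> {1..n} \<and> pw is = w \<and> length is = lenB w"
  then obtain "is" where "is": "ws = map s is" "set is \<subseteq> {1..n}" "pw is = w" "length is = lenB w" by blast
  have "length ws \<le> length vs" if vs: "set vs \<subseteq> S" "word_prod G vs = w" for vs
  proof -
    obtain js where "vs = map s js" "set js \<subseteq> {1..n}" using simple_words vs by blast
    then show ?thesis using lenB_pw[of js] vs "is" word_prod_map by auto
  qed
  moreover have "set ws \<subseteq> S" "word_prod G ws = w"
    using "is" simple_words[of ws] word_prod_map[of "is"] by blast+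
  ultimately show "reduced_word G S ws w" unfolding reduced_word_def by blast
qed

text \<open>If a letter of the second part went down, the total length could not be reached by the
  bound \<open>lenB_pw\<close>; so each of these letters only adds inversions.\<close>

lemma ivs_prefix:
  "set (is @ js) \<subseteq> {1..n} \<Longrightarrow> lenB (pw (is @ js)) = length (is @ js) \<Longrightarrow> ivs (pw is) \<subseteq> ivs (pw (is @ js))"
proof (induction js rule: rev_induct)
  case (snoc i js)
  let ?x = "pw (is @ js)"
  have x: "?x \<in> W" and i: "i \<in> {1..n}" using snoc.prems pw_W[of "is @ js"] by simp_all
  have e: "pw (is @ js @ [i]) = ?x \<circ> s i" by (simp add: pw_append comp_assoc)
  have le: "lenB ?x \<le> length (is @ js)" by (rule lenB_pw) (use snoc.prems in auto)
  have "lenB (?x \<circ> s i) = length (is @ js @ [i])" using snoc.prems(2) unfolding e .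
  then have len: "lenB (?x \<circ> s i) = length (is @ js) + 1" by (simp only: length_append list.size)
  have lt: "?x i < ?x (i + 1)"
  proof (rule ccontr)
    assume "\<not> ?x i < ?x (i + 1)"
    then have "lenB ?x = lenB (?x \<circ> s i) + 1" using lenB_step_down[OF x i] x_ne[OF x, of i] by linarith
    then show False using le len by simp
  qed
  then have "lenB ?x = length (is @ js)" using lenB_step[OF x i] len by simp
  then have "ivs (pw is) \<subseteq> ivs ?x" using snoc by simp
  then show ?case unfolding e ivs_step(1)[OF x i lt] by blast
qed simp

section \<open>Order, joins and meets of the weak order of \<open>B_n\<close>\<close>

abbreviation L where "L \<equiv> weak_order_B n"

lemma carrier_L: "carrier L = W" and eq_L: "x .=\<^bsub>L\<^esub> y \<longleftrightarrow> x = y"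
  by (simp_all add: weak_order_B_def weak_order_def)

lemma le_L: assumes w: "w \<in> W" shows "u \<sqsubseteq>\<^bsub>L\<^esub> w \<longleftrightarrow> u \<in> W \<and> ivs u \<subseteq> ivs w"
proof
  assume "u \<sqsubseteq>\<^bsub>L\<^esub> w"
  then obtain us vs where uv: "word_prod G us = u" "reduced_word G S (us @ vs) w"
    by (auto simp: weak_order_B_def weak_order_def)
  then obtain ks where ks: "us @ vs = map s ks" "set ks \<subseteq> {1..n}" "pw ks = w" "length ks = lenB w"
    using reduced_iff[OF w] by blast
  then obtain "is" js where ij: "ks = is @ js" "us = map s is"
    by (metis append_eq_map_conv)
  have "u = pw is" using uv ij word_prod_map by auto
  moreover have "ivs (pw is) \<subseteq> ivs (pw (is @ js))" by (rule ivs_prefix) (use ks ij in auto)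
  ultimately show "u \<in> W \<and> ivs u \<subseteq> ivs w" using ks ij pw_W by auto
next
  assume u: "u \<in> W \<and> ivs u \<subseteq> ivs w"
  obtain "is" where "is": "set is \<subseteq> {1..n}" "pw is = u" "length is = lenB u"
    using ex_word[OF W_id, of u] u ivs_id lenB_id by auto
  obtain js where js: "set js \<subseteq> {1..n}" "u \<circ> pw js = w" "length js + lenB u = lenB w"
    using ex_word[of u w] u w by auto
  have "map s is @ map s js = map s (is @ js) \<and> set (is @ js) \<subseteq> {1..n} \<and> pw (is @ js) = w \<and> length (is @ js) = lenB w"
    using "is" js by (auto simp: pw_append)
  then have "reduced_word G S (map s is @ map s js) w" unfolding reduced_iff[OF w] by blast
  moreover have "word_prod G (map s is) = u" using "is" word_prod_map by simp
  ultimately show "u \<sqsubseteq>\<^bsub>L\<^esub> w" by (auto simp: weak_order_B_def weak_order_def)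
qed

lemma join_L: assumes x: "x \<in> W" and y: "y \<in> W"
  shows "x \<squnion>\<^bsub>L\<^esub> y \<in> W" "ivs (x \<squnion>\<^bsub>L\<^esub> y) = jn (ivs x) (ivs y)"
proof -
  obtain z where z: "z \<in> W" "ivs z = jn (ivs x) (ivs y)" using realize jn_K ivs_K x y by metis
  have up: "x \<sqsubseteq>\<^bsub>L\<^esub> z" "y \<sqsubseteq>\<^bsub>L\<^esub> z" using z x y le_L[OF z(1)] jn_upper by auto
  have "z \<sqsubseteq>\<^bsub>L\<^esub> u" if "u \<in> W" "x \<sqsubseteq>\<^bsub>L\<^esub> u" "y \<sqsubseteq>\<^bsub>L\<^esub> u" for u
    using that z jn_least[OF ivs_K[OF that(1)], of "ivs x" "ivs y"] le_L[OF that(1)] by simp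
  then have l: "least L z (Upper L {x, y})"
    using z up x y by (auto simp: least_def Upper_def carrier_L)
  have "w = z" if "least L w (Upper L {x, y})" for w
  proof -
    have "w \<in> W" "z \<sqsubseteq>\<^bsub>L\<^esub> w" "w \<sqsubseteq>\<^bsub>L\<^esub> z" using l that by (auto simp: least_def Upper_def carrier_L)
    then show ?thesis using le_L ivs_inj z by (metis subset_antisym)
  qed
  then have "x \<squnion>\<^bsub>L\<^esub> y = z" unfolding join_def sup_def using l some_equality by metis
  then show "x \<squnion>\<^bsub>L\<^esub> y \<in> W" "ivs (x \<squnion>\<^bsub>L\<^esub> y) = jn (ivs x) (ivs y)" using z by auto
qed

lemma meet_L: assumes x: "x \<in> W" and y: "y \<in> W"
  shows "x \<sqinter>\<^bsub>L\<^esub> y \<in> W" "ivs (x \<sqinter>\<^bsub>L\<^esub> y) = mt (ivs x) (ivs y)"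
proof -
  obtain z where z: "z \<in> W" "ivs z = mt (ivs x) (ivs y)" using realize mt_K ivs_K x y by metis
  have l: "greatest L z (Lower L {x, y})"
    using z x y le_L mt_lower[OF ivs_K ivs_K] mt_greatest[OF ivs_K ivs_K ivs_K]
    by (auto simp: greatest_def Lower_def carrier_L)
  have "w = z" if "greatest L w (Lower L {x, y})" for w
  proof -
    have "w \<in> W" "z \<sqsubseteq>\<^bsub>L\<^esub> w" "w \<sqsubseteq>\<^bsub>L\<^esub> z" using l that by (auto simp: greatest_def Lower_def carrier_L)
    then show ?thesis using le_L ivs_inj z by (metis subset_antisym)
  qed
  then have "x \<sqinter>\<^bsub>L\<^esub> y = z" unfolding meet_def inf_def using l some_equality by metis
  then show "x \<sqinter>\<^bsub>L\<^esub> y \<in> W" "ivs (x \<sqinter>\<^bsub>L\<^esub> y) = mt (ivs x) (ivs y)" using z by auto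
qed

definition theta :: "bool \<Rightarrow> ((nat \<Rightarrow> nat) \<times> (nat \<Rightarrow> nat)) set" where
  "theta e = {(x, y). x \<in> W \<and> y \<in> W \<and> As e (ivs x) = As e (ivs y)}"

lemma As_eq_iff_Bs_eq: "I \<in> K \<Longrightarrow> J \<in> K \<Longrightarrow> As e I = As e J \<longleftrightarrow> Bs e I = Bs e J"
  using As_Bs_subset[of I J e] As_Bs_subset[of J I e] by auto

text \<open>\<open>As\<close> turns meets into intersections and \<open>Bs\<close> turns joins into
  intersections. Since each determines the other, one and the same kernel respects both
  operations.\<close>

lemma theta_congruence: "lattice_congruence L (theta e)"
proof -
  have "equiv (carrier L) (theta e)"
    unfolding carrier_L theta_def by (rule equivI) (auto simp: refl_on_def sym_def trans_def)
  moreover have "(x \<squnion>\<^bsub>L\<^esub> y, x' \<squnion>\<^bsub>L\<^esub> y') \<in> theta e \<and> (x \<sqinter>\<^bsub>L\<^esub> y, x' \<sqinter>\<^bsub>L\<^esub> y') \<in> theta e"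
    if "(x, x') \<in> theta e" "(y, y') \<in> theta e" for x x' y y'
  proof -
    have W: "x \<in> W" "x' \<in> W" "y \<in> W" "y' \<in> W"
      and A: "As e (ivs x) = As e (ivs x')" "As e (ivs y) = As e (ivs y')"
      using that by (auto simp: theta_def)
    then have B: "Bs e (ivs x) = Bs e (ivs x')" "Bs e (ivs y) = Bs e (ivs y')"
      using As_eq_iff_Bs_eq ivs_K by blast+
    have "As e (mt (ivs x) (ivs y)) = As e (mt (ivs x') (ivs y'))"
      using As_mt ivs_K W A by auto
    moreover have "Bs e (jn (ivs x) (ivs y)) = Bs e (jn (ivs x') (ivs y'))"
      using Bs_jn ivs_K W B by auto
    then have "As e (jn (ivs x) (ivs y)) = As e (jn (ivs x') (ivs y'))"
      using As_eq_iff_Bs_eq jn_K ivs_K W by meson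
    ultimately show ?thesis using join_L meet_L W by (auto simp: theta_def)
  qed
  ultimately show ?thesis unfolding lattice_congruence_def by blast
qed

subsection \<open>Words of the Coxeter element\<close>

text \<open>Every generator other than \<open>s i\<close> preserves the initial segment up to
  \<open>i\<close>, so the segment detects whether a word contains the letter
  \<open>i\<close>.\<close>

lemma s_below: "k \<in> {1..n} \<Longrightarrow> i \<in> {1..n} \<Longrightarrow> k \<noteq> i \<Longrightarrow> s k v \<le> i \<longleftrightarrow> v \<le> i"
proof -
  assume k: "k \<in> {1..n}" and i: "i \<in> {1..n}" and ne: "k \<noteq> i"
  define m where "m = 2 * n - k"
  have "i < m" using k i ne by (auto simp: m_def)
  moreover have "s k v = (if v = k then k + 1 else if v = k + 1 then k else if v = m then m + 1 else if v = m + 1 then m else v)"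
    unfolding s_apply[OF k] m_def ..
  ultimately show ?thesis using ne by auto
qed

lemma pw_below:
  "set is \<subseteq> {1..n} \<Longrightarrow> i \<in> {1..n} \<Longrightarrow> i \<notin> set is \<Longrightarrow> pw is v \<le> i \<longleftrightarrow> v \<le> i"
  by (induction "is") (simp_all add: s_below)

lemma s_fix: "k \<in> {1..n} \<Longrightarrow> i + 1 \<in> {1..n} \<Longrightarrow> k \<noteq> i \<Longrightarrow> k \<noteq> i + 1 \<Longrightarrow> s k (i + 1) = i + 1"
  using s_apply[of k "i + 1"] by auto

lemma pw_fix: "set is \<subseteq> {1..n} \<Longrightarrow> i + 1 \<in> {1..n} \<Longrightarrow> i \<notin> set is \<Longrightarrow> i + 1 \<notin> set is \<Longrightarrow> pw is (i + 1) = i + 1"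
  by (induction "is") (use s_fix in auto)

lemma inj_s: "inj_on s {1..n}"
proof (rule inj_onI)
  fix i k assume i: "i \<in> {1..n}" and k: "k \<in> {1..n}" and e: "s i = s k"
  show "i = k"
  proof (rule ccontr)
    assume "i \<noteq> k"
    then have "s k i \<le> i" using s_below[OF k i, of i] by auto
    then show False using s_vals(1)[OF i] e by simp
  qed
qed

text \<open>The single letter \<open>i\<close> moves one element out of the initial segment, and no
  other letter can bring it back.\<close>

lemma pw_once_above:
  assumes "set (A @ [i] @ C) \<subseteq> {1..n}" "i \<notin> set A" "i \<notin> set C"
  shows "\<not> (\<forall>v. pw (A @ [i] @ C) v \<le> i \<longleftrightarrow> v \<le> i)"
proof -
  have i: "i \<in> {1..n}" and A: "set A \<subseteq> {1..n}" and C: "pw C \<in> W" "set C \<subseteq> {1..n}"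
    using assms pw_W[of C] by auto
  define v where "v = pos (pw C) i"
  have v: "pw C v = i" using x_pos[OF C(1)] by (simp add: v_def)
  then have "v \<le> i" using pw_below[OF C(2) i assms(3), of v] by simp
  moreover have "pw (A @ [i] @ C) v = pw A (i + 1)" using v s_vals[OF i] by (simp add: pw_append)
  moreover have "\<not> pw A (i + 1) \<le> i" using pw_below[OF A i assms(2), of "i + 1"] by simp
  ultimately show ?thesis by metis
qed

text \<open>
  Every reduced word of \<open>pw is0\<close> uses each generator exactly once, and the image of \<open>i + 1\<close>
  reveals which of \<open>i\<close> and \<open>i + 1\<close> comes first.
\<close>

lemma reduced_standard:
  assumes d: "distinct is0" "set is0 = {1..n}" and r: "reduced_word G S ws (pw is0)"
  obtains "is" where "ws = map s is" "distinct is" "set is = {1..n}" "pw is = pw is0"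
proof -
  have full: "set js = {1..n}" if js: "set js \<subseteq> {1..n}" "pw js = pw is0" for js
  proof (rule ccontr)
    assume "set js \<noteq> {1..n}"
    then obtain i where i: "i \<in> {1..n}" "i \<notin> set js" using js by blast
    then obtain A C where AC: "is0 = A @ i # C" using d split_list by metis
    then have "i \<notin> set A" "i \<notin> set C" using d by auto
    moreover have "set (A @ [i] @ C) \<subseteq> {1..n}" using d AC by auto
    ultimately have "\<not> (\<forall>v. pw (A @ [i] @ C) v \<le> i \<longleftrightarrow> v \<le> i)" by (rule pw_once_above[rotated])
    then show False using pw_below[OF js(1) i] js AC by simp
  qed
  have W0: "pw is0 \<in> W" using d pw_W by simp
  obtain "is" where "is": "ws = map s is" "set is \<subseteq> {1..n}" "pw is = pw is0" "length is = lenB (pw is0)"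
    using r reduced_iff[OF W0] by blast
  have "lenB (pw is0) \<le> length is0" using lenB_pw d by simp
  also have "\<dots> = n" using distinct_card[OF d(1)] d by simp
  finally have "length is \<le> n" using "is" by simp
  moreover have "card (set is) = n" unfolding full[OF "is"(2,3)] by simp
  ultimately have "distinct is" using card_length[of "is"] by (intro card_distinct) simp
  then show thesis using that "is" full by blast
qed

lemma standard_reduced:
  assumes d: "distinct is0" "set is0 = {1..n}"
  shows "reduced_word G S (map s is0) (pw is0)"
proof -
  have W0: "pw is0 \<in> W" using d pw_W by simp
  obtain js where js: "set js \<subseteq> {1..n}" "pw js = pw is0" "length js = lenB (pw is0)"
    using ex_word[OF W_id W0] ivs_id lenB_id by auto
  then have "reduced_word G S (map s js) (pw is0)" using reduced_iff[OF W0] by blast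
  then obtain "is" where "is": "map s js = map s is" "distinct is" "set is = {1..n}"
    using reduced_standard[OF d] by metis
  have "length js = n" using "is" distinct_card by (metis length_map card_atLeastAtMost diff_Suc_1)
  moreover have "length is0 = n" using distinct_card[OF d(1)] d by simp
  ultimately show ?thesis using js d reduced_iff[OF W0] by auto
qed

lemma order_in_word:
  assumes d: "distinct is" "set is = {1..n}" and i: "i \<in> {1..n}" "i + 1 \<in> {1..n}"
  shows "is = A @ (i + 1) # B @ i # C \<Longrightarrow> pw is (i + 1) \<le> i"
    "is = A @ i # B @ (i + 1) # C \<Longrightarrow> \<not> pw is (i + 1) \<le> i"
proof -
  assume e: "is = A @ (i + 1) # B @ i # C"
  then have sets: "set C \<subseteq> {1..n}" "set (A @ (i + 1) # B) \<subseteq> {1..n}" "i \<notin> set C" "i + 1 \<notin> set C"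
    "i \<notin> set (A @ (i + 1) # B)" using d by auto
  have "is = (A @ (i + 1) # B) @ i # C" using e by simp
  then have "pw is (i + 1) = pw (A @ (i + 1) # B) (s i (pw C (i + 1)))"
    by (simp only: pw_append pw_Cons comp_apply)
  also have "\<dots> = pw (A @ (i + 1) # B) i" using pw_fix[OF sets(1) i(2) sets(3,4)] s_vals[OF i(1)] by simp
  finally show "pw is (i + 1) \<le> i" using pw_below[OF sets(2) i(1) sets(5), of i] by simp
next
  assume e: "is = A @ i # B @ (i + 1) # C"
  then have sets: "set C \<subseteq> {1..n}" "set (A @ i # B) \<subseteq> {1..n}" "i \<notin> set C" "i + 1 \<notin> set C"
    "i + 1 \<notin> set (A @ i # B)" using d by auto
  have "is = (A @ i # B) @ (i + 1) # C" using e by simp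
  then have "pw is (i + 1) = pw (A @ i # B) (s (i + 1) (pw C (i + 1)))"
    by (simp only: pw_append pw_Cons comp_apply)
  also have "\<dots> = pw (A @ i # B) (i + 2)" using pw_fix[OF sets(1) i(2) sets(3,4)] s_vals[OF i(2)] by simp
  finally show "\<not> pw is (i + 1) \<le> i" using pw_below[OF sets(2) i(2) sets(5), of "i + 2"] by simp
qed

text \<open>\<open>precedes\<close> ranges over all reduced words, so its failure needs an invariant
  of the element itself: whether the larger of the two indices is mapped into the initial segment up
  to the smaller.\<close>

lemma precedes_word:
  assumes d: "distinct is0" "set is0 = {1..n}"
    and ab: "a \<in> {1..n}" "b \<in> {1..n}" "a = b + 1 \<or> b = a + 1"
    and e: "is0 = A @ a # B @ b # C"
  shows "precedes G S (pw is0) (s a) (s b)" "\<not> precedes G S (pw is0) (s b) (s a)"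
proof -
  show "precedes G S (pw is0) (s a) (s b)"
    unfolding precedes_def
  proof (intro exI conjI)
    show "reduced_word G S (map s is0) (pw is0)" by (rule standard_reduced[OF d])
    show "map s is0 ! length A = s a" using e by (simp add: nth_append)
    show "map s is0 ! (length A + 1 + length B) = s b" using e by (simp add: nth_append)
  qed (use e in auto)
  show "\<not> precedes G S (pw is0) (s b) (s a)"
  proof
    assume "precedes G S (pw is0) (s b) (s a)"
    then obtain ws k l where ws: "reduced_word G S ws (pw is0)" "k < l" "l < length ws" "ws ! k = s b" "ws ! l = s a"
      unfolding precedes_def by blast
    obtain "is" where "is": "ws = map s is" "distinct is" "set is = {1..n}" "pw is = pw is0"
      using reduced_standard[OF d ws(1)] by blast
    have kl: "k < length is" "l < length is" using ws "is" by auto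
    have "is ! k \<in> {1..n}" "is ! l \<in> {1..n}" using kl "is" nth_mem by blast+
    then have nth: "is ! k = b" "is ! l = a" using ws "is" kl inj_onD[OF inj_s] ab by auto
    have "is = take k is @ b # drop (Suc k) is" using id_take_nth_drop[OF kl(1)] nth by simp
    moreover have "a \<in> set (drop (Suc k) is)"
      using nth kl ws(2) by (auto simp: in_set_conv_nth intro!: exI[of _ "l - Suc k"])
    then obtain B' C' where "drop (Suc k) is = B' @ a # C'" using split_list by metis
    ultimately have e': "is = take k is @ b # B' @ a # C'" by simp
    show False using ab(3)
    proof
      assume "a = b + 1"
      then show False using order_in_word[OF d, of b A B C] order_in_word[OF "is"(2,3), of b "take k is" B' C']
          e e' ab "is" by auto
    next
      assume "b = a + 1"
      then show False using order_in_word[OF d, of a A B C] order_in_word[OF "is"(2,3), of a "take k is" B' C']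
          e e' ab "is" by auto
    qed
  qed
qed

abbreviation c where "c \<equiv> bipartite_coxeter_B n"

definition evens where "evens = filter even [1..<n + 1]"
definition odds where "odds = filter odd [1..<n + 1]"

lemma c_pw: "c = pw (evens @ odds)"
  by (simp add: bipartite_coxeter_B_def c_plus_def c_minus_def word_prod_map pw_append mult_G evens_def odds_def)

lemma pw_rev: "set is \<subseteq> {1..n} \<Longrightarrow> pw (rev is) (pw is v) = v"
proof (induction "is")
  case (Cons i "is")
  then show ?case using s_s[of i] by (simp add: pw_append pointfree_idE)
qed simp

lemma sets_eo: "distinct (evens @ odds)" "set (evens @ odds) = {1..n}"
  by (auto simp: evens_def odds_def)

lemma inv_c: "inv\<^bsub>G\<^esub> c = pw (rev odds @ rev evens)"
proof -
  have "pw (rev (evens @ odds)) \<otimes>\<^bsub>G\<^esub> c = \<one>\<^bsub>G\<^esub>"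
    unfolding c_pw mult_G one_G by (rule ext) (simp only: comp_apply id_apply pw_rev[OF eq_refl[OF sets_eo(2)]])
  moreover have "pw (rev (evens @ odds)) \<in> W" "c \<in> W"
    unfolding c_pw using pw_W[of "rev (evens @ odds)"] pw_W[of "evens @ odds"] sets_eo(2) by (simp_all only: set_rev subset_refl)
  ultimately show ?thesis using group.inv_equality[OF group_G] by fastforce
qed

text \<open>Indexed so that the type of an arc names the Coxeter element it belongs to:
  \<open>True\<close> for \<open>c\<close>, where the even generators come first, and
  \<open>False\<close> for its inverse.\<close>

definition cx :: "bool \<Rightarrow> nat \<Rightarrow> nat" where "cx e = (if e then c else inv\<^bsub>G\<^esub> c)"

lemma precedes_cx:
  assumes ab: "a \<in> {1..n}" "b \<in> {1..n}" "a = b + 1 \<or> b = a + 1"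
  shows "precedes G S (cx e) (s a) (s b) \<longleftrightarrow> even a = e"
proof -
  define w where "w = (if e then evens @ odds else rev odds @ rev evens)"
  have w: "distinct w" "set w = {1..n}" "cx e = pw w"
    using sets_eo c_pw inv_c by (auto simp: w_def cx_def)
  have split: "\<exists>A B C. w = A @ a' # B @ b' # C"
    if "a' \<in> {1..n}" "b' \<in> {1..n}" "even a' = e" "even b' \<noteq> e" for a' b'
  proof -
    define P Q where "P = (if e then evens else rev odds)" and "Q = (if e then odds else rev evens)"
    have PQ: "w = P @ Q" "a' \<in> set P" "b' \<in> set Q"
      using that by (cases e; simp add: w_def P_def Q_def evens_def odds_def del: upt_Suc)+
    obtain A1 A2 B1 B2 where "P = A1 @ a' # A2" "Q = B1 @ b' # B2" using PQ split_list by metis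
    then have "w = A1 @ a' # (A2 @ B1) @ b' # B2" using PQ by simp
    then show ?thesis by blast
  qed
  have par: "even a \<noteq> even b" using ab(3) by auto
  show ?thesis
  proof (cases "even a = e")
    case True
    then have "even b \<noteq> e" using par by auto
    then obtain A B C where "w = A @ a # B @ b # C" using split[of a b] ab True by blast
    then show ?thesis using precedes_word(1)[OF w(1,2) ab] w(3) True by simp
  next
    case False
    then have "even b = e" using par by auto
    then obtain A B C where "w = A @ b # B @ a # C" using split[of b a] ab False by blast
    then show ?thesis using precedes_word(2)[OF w(1,2), of b a] ab w(3) False by auto
  qed
qed

section \<open>Minimality of the Cambrian congruences\<close>

text \<open>Lattice congruences moved to inversion sets; compatibility with one varying argument is
  the form in which collapses are derived.\<close>

definition cong :: "((nat \<times> nat) set \<times> (nat \<times> nat) set) set \<Rightarrow> bool" where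
  "cong \<Theta> \<longleftrightarrow> equiv K \<Theta> \<and> (\<forall>I J T. (I, J) \<in> \<Theta> \<longrightarrow> T \<in> K \<longrightarrow> (jn I T, jn J T) \<in> \<Theta> \<and> (mt I T, mt J T) \<in> \<Theta>)"

definition Gl :: "nat \<Rightarrow> (nat \<times> nat) set" where
  "Gl r = {(r, r + 1), (mir r - 1, mir r)}"
definition Gd :: "nat \<Rightarrow> (nat \<times> nat) set" where
  "Gd r = {(r - 1, r + 1), (mir r - 1, mir r + 1)} \<union>
     (if r = n \<or> r = n + 1 then {(n - 1, n + 2)} else {})"

text \<open>
  \<open>Gl r\<close> and \<open>Gl r \<union> Gd r\<close> are the inversion sets of the two elements identified by a generator of a
  Cambrian congruence, which thereby collapses the arc from \<open>r - 1\<close> to \<open>r + 1\<close> passing to the left of \<open>r\<close>.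
\<close>

definition gen :: "((nat \<times> nat) set \<times> (nat \<times> nat) set) set \<Rightarrow> nat \<Rightarrow> bool" where
  "gen \<Theta> r \<longleftrightarrow> (Gl r, Gl r \<union> Gd r) \<in> \<Theta>"

lemma congD:
  assumes "cong \<Theta>"
  shows "\<And>I J. (I, J) \<in> \<Theta> \<Longrightarrow> I \<in> K \<and> J \<in> K"
    "\<And>I J. (I, J) \<in> \<Theta> \<Longrightarrow> (J, I) \<in> \<Theta>"
    "\<And>I J M. (I, J) \<in> \<Theta> \<Longrightarrow> (J, M) \<in> \<Theta> \<Longrightarrow> (I, M) \<in> \<Theta>"
    "\<And>I. I \<in> K \<Longrightarrow> (I, I) \<in> \<Theta>"
    "\<And>I J T. (I, J) \<in> \<Theta> \<Longrightarrow> T \<in> K \<Longrightarrow> (jn I T, jn J T) \<in> \<Theta>"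
    "\<And>I J T. (I, J) \<in> \<Theta> \<Longrightarrow> T \<in> K \<Longrightarrow> (mt I T, mt J T) \<in> \<Theta>"
proof -
  have e: "equiv K \<Theta>" using assms by (simp add: cong_def)
  show "\<And>I J. (I, J) \<in> \<Theta> \<Longrightarrow> I \<in> K \<and> J \<in> K" using equiv_type[OF e] by blast
  show "\<And>I J. (I, J) \<in> \<Theta> \<Longrightarrow> (J, I) \<in> \<Theta>" using e by (meson equivE symD)
  show "\<And>I J M. (I, J) \<in> \<Theta> \<Longrightarrow> (J, M) \<in> \<Theta> \<Longrightarrow> (I, M) \<in> \<Theta>" using e by (meson equivE transD)
  show "\<And>I. I \<in> K \<Longrightarrow> (I, I) \<in> \<Theta>" using e by (meson equivE refl_onD)
  show "\<And>I J T. (I, J) \<in> \<Theta> \<Longrightarrow> T \<in> K \<Longrightarrow> (jn I T, jn J T) \<in> \<Theta>"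
    "\<And>I J T. (I, J) \<in> \<Theta> \<Longrightarrow> T \<in> K \<Longrightarrow> (mt I T, mt J T) \<in> \<Theta>"
    using assms by (simp_all add: cong_def)
qed

text \<open>\<open>I' \<subset> I\<close> differ by the arc from \<open>p\<close> to \<open>q\<close>, which passes to the left of the points \<open>v\<close> with \<open>(v, q) \<in> I\<close>.\<close>

definition cover :: "(nat \<times> nat) set \<Rightarrow> (nat \<times> nat) set \<Rightarrow> nat \<Rightarrow> nat \<Rightarrow> bool" where
  "cover I' I p q \<longleftrightarrow> I' \<in> K \<and> I \<in> K \<and> (p, q) \<in> I \<and> I' = I - {(p, q), (mir q, mir p)} \<and>
     (\<forall>v. p < v \<longrightarrow> v < q \<longrightarrow> ((p, v) \<in> I \<longleftrightarrow> (v, q) \<notin> I))"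

lemma coverD:
  assumes "cover I' I p q"
  shows "I' \<in> K" "I \<in> K" "(p, q) \<in> I" "I' = I - {(p, q), (mir q, mir p)}"
    "\<And>v. p < v \<Longrightarrow> v < q \<Longrightarrow> (p, v) \<in> I \<longleftrightarrow> (v, q) \<notin> I"
    "1 \<le> p" "p < q" "q \<le> 2 * n" "(mir q, mir p) \<in> I"
  using assms K_mem_range[of I p q] KD(4)[of I p q] by (auto simp: cover_def)

text \<open>Meeting with \<open>I\<close> and then joining with \<open>I'\<close> sends
  \<open>U\<close> to \<open>I'\<close> and \<open>V\<close> to \<open>I\<close>, so one related
  pair separated by the arc collapses the cover.\<close>

lemma collapse:
  assumes c: "cong \<Theta>" and cv: "cover I' I p q"
    and UV: "(U, V) \<in> \<Theta>" "(p, q) \<notin> U" "rectS {v. (v, q) \<in> I} p q \<subseteq> V"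
  shows "(I', I) \<in> \<Theta>"
proof -
  note d = coverD[OF cv]
  have UK: "U \<in> K" "V \<in> K" using congD(1)[OF c UV(1)] by auto
  have "(jn (mt U I) I', jn (mt V I) I') \<in> \<Theta>" using congD(5,6)[OF c] UV d by blast
  moreover have "jn (mt U I) I' = I'"
  proof (rule jn_absorb[OF d(1)])
    have "(p, q) \<notin> mt U I" using mt_lower[OF UK(1) d(2)] UV by auto
    moreover then have "(mir q, mir p) \<notin> mt U I"
      using K_mir_iff[OF mt_K[OF UK(1) d(2)], of p q] d by auto
    ultimately show "mt U I \<subseteq> I'" using mt_lower[OF UK(1) d(2)] d(4) by auto
  qed
  moreover have "jn (mt V I) I' = I"
  proof
    show "jn (mt V I) I' \<subseteq> I" by (rule jn_least[OF d(2)]) (use mt_lower[OF UK(2) d(2)] d(4) in auto)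
    have pq: "(p, q) \<in> mt V I"
    proof (rule ccontr)
      assume "(p, q) \<notin> mt V I"
      then have ch: "(p, q) \<in> (co V \<union> co I)\<^sup>+"
        using KD(1)[OF d(2)] d(3) by (auto simp: mt_def co_def jn_def)
      \<comment> \<open>A chain of non-inversions from \<open>p\<close> to \<open>q\<close> must
        leave the set formed by \<open>p\<close> and the values left of the arc. The leaving step is
        a rectangle pair, inverted in \<open>V\<close> and, by the shape of the cover, in
        \<open>I\<close>.\<close>
      let ?P = "\<lambda>v. (v, q) \<in> I"
      have np: "\<not> ?P q" using K_mem_range[OF d(2)] by blast
      have incr: "u < v" if "(u, v) \<in> co V \<union> co I" for u v
        using that by (auto simp: co_def pairs_def)
      obtain u v where uv: "(u, v) \<in> co V \<union> co I" "?P u" "\<not> ?P v" "p \<le> u" "v \<le> q" "u < v"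
        using trancl_crossing[where P = ?P, OF ch d(3) np incr] by metis
      have "(u, v) \<in> rectS {v. (v, q) \<in> I} p q" using uv by (auto simp: rectS_def)
      then have "(u, v) \<in> V" using UV by blast
      moreover have "(u, v) \<in> I"
      proof (cases "v = q")
        case True then show ?thesis using uv by simp
      next
        case False
        then have pv: "(p, v) \<in> I" using d(5)[of v] uv by auto
        show ?thesis
        proof (cases "u = p")
          case True then show ?thesis using pv by simp
        next
          case False
          then have "(p, u) \<notin> I" using d(5)[of u] uv \<open>v \<noteq> q\<close> by auto
          then show ?thesis using KD(3)[OF d(2), of p u v] pv uv False by auto
        qed
      qed
      ultimately show False using uv by (auto simp: co_def)
    qed
    then have "(mir q, mir p) \<in> mt V I" using KD(4)[OF mt_K[OF UK(2) d(2)]] by blast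
    then show "I \<subseteq> jn (mt V I) I'" using pq jn_upper[of "mt V I" I'] jn_upper(2)[of I' "mt V I"] d(4) by auto
  qed
  ultimately show ?thesis by simp
qed

text \<open>The parabolic element in which exactly the pairs separated by a cut next to \<open>r\<close> or \<open>mir r\<close> are not inverted.\<close>

definition cuts :: "nat \<Rightarrow> nat set" where
  "cuts r = {r - 1, r, mir r - 1, mir r}"
definition zcut :: "nat \<Rightarrow> (nat \<times> nat) set" where
  "zcut r = {(a, b) \<in> pairs. \<forall>k \<in> cuts r. \<not> (a \<le> k \<and> k < b)}"

lemma zcut_K: assumes r: "2 \<le> r" "r \<le> 2 * n - 1" shows "zcut r \<in> K"
proof -
  have "bic (zcut r)"
    by (rule bicI) (auto simp: zcut_def pairs_def; meson le_trans less_imp_le not_le le_less_trans less_le_trans)+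
  moreover have "(mir b, mir a) \<in> zcut r" if ab: "(a, b) \<in> zcut r" for a b
  proof -
    have p: "(a, b) \<in> pairs" using ab by (auto simp: zcut_def)
    have "\<not> (mir b \<le> k \<and> k < mir a)" if k: "k \<in> cuts r" for k
    proof -
      have "2 * n - k \<in> cuts r" using k r by (auto simp: cuts_def mir_def)
      then have "\<not> (a \<le> 2 * n - k \<and> 2 * n - k < b)" using ab by (auto simp: zcut_def)
      then show ?thesis using p by (auto simp: mir_def pairs_def)
    qed
    then show ?thesis using mir_pairs[OF p] by (auto simp: zcut_def)
  qed
  ultimately show ?thesis by (auto simp: K_def)
qed

text \<open>The join with the parabolic element spreads the generator out: in \<open>U\<close> no
  pair crosses the cut below \<open>r\<close>, while in \<open>V\<close> only pairs ending at
  \<open>r\<close> or beginning at \<open>mir r\<close> can be missing.\<close>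

lemma cut_lemma:
  assumes c: "cong \<Theta>" and g: "gen \<Theta> r" and pq: "1 \<le> p" "p < r" "r < q" "q \<le> 2 * n"
  obtains U V where "(U, V) \<in> \<Theta>" "(p, q) \<notin> U"
    "\<And>a b. 1 \<le> a \<Longrightarrow> a < b \<Longrightarrow> b \<le> 2 * n \<Longrightarrow> b \<noteq> r \<Longrightarrow> a \<noteq> mir r \<Longrightarrow> (a, b) \<in> V"
proof -
  have r: "2 \<le> r" "r \<le> 2 * n - 1" using pq by auto
  let ?U = "jn (Gl r) (zcut r)" and ?V = "jn (Gl r \<union> Gd r) (zcut r)"
  have UV: "(?U, ?V) \<in> \<Theta>" using congD(5)[OF c] g zcut_K[OF r] by (auto simp: gen_def)
  have VK: "?V \<in> K" using congD(1)[OF c UV] by simp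
  have Vup: "(a, b) \<in> ?V" if "(a, b) \<in> Gl r \<union> Gd r \<union> zcut r" for a b
    using that jn_upper(1)[of "Gl r \<union> Gd r" "zcut r"] jn_upper(2)[of "zcut r" "Gl r \<union> Gd r"] by blast
  have "(p, q) \<notin> ?U"
  proof
    assume "(p, q) \<in> ?U"
    then have ch: "(p, q) \<in> (Gl r \<union> zcut r)\<^sup>+" by (simp add: jn_def)
    have GK: "Gl r \<in> K" using congD(1)[OF c] g by (auto simp: gen_def)
    let ?P = "\<lambda>v. v \<le> r - 1"
    have pP: "?P p" "\<not> ?P q" using pq by auto
    have incr: "u < v" if "(u, v) \<in> Gl r \<union> zcut r" for u v
      using that KD(1)[OF GK] by (auto simp: zcut_def pairs_def)
    obtain u v where uv: "(u, v) \<in> Gl r \<union> zcut r" "u \<le> r - 1" "\<not> v \<le> r - 1"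
      using trancl_crossing[where P = ?P, OF ch pP incr] by metis
    have "(u, v) \<notin> zcut r" using uv by (auto simp: zcut_def cuts_def)
    then have "u = mir r - 1" "v = mir r" using uv r by (auto simp: Gl_def)
    then show False using uv r unfolding mir_def by presburger
  qed
  moreover have "(a, b) \<in> ?V" if "1 \<le> a" "a < b" "b \<le> 2 * n" "b \<noteq> r" "a \<noteq> mir r" for a b
    using that
  proof (induction "b - a" arbitrary: a b rule: less_induct)
    case less
    note IH = less.hyps
    have trans: "(a, b) \<in> ?V" if "(a, k) \<in> ?V" "(k, b) \<in> ?V" for k using that KD(2)[OF VK] by blast
    have mr: "mir r \<noteq> r" using mir_ne[of r] r by auto
    have rr: "1 \<le> mir r" "r + mir r = 2 * n + 1" using r by (auto simp: mir_def)
    show ?case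
    proof (cases "b = a + 1")
      case True
      show ?thesis
      proof (cases "a = r \<or> a = mir r - 1")
        case True then show ?thesis using \<open>b = a + 1\<close> rr by (intro Vup) (auto simp: Gl_def)
      next
        case False
        then have "(a, b) \<in> zcut r" using True less.prems by (auto simp: zcut_def cuts_def pairs_def)
        then show ?thesis by (intro Vup) auto
      qed
    next
      case b: False
      \<comment> \<open>The last unit step is split off. This is blocked only for
        \<open>b - 1\<close> equal to \<open>r\<close> or \<open>mir r\<close>, where a pair of
        width two from \<open>Gd r\<close> replaces it.\<close>
      consider "b - 1 = mir r" | "b - 1 = r" | "b - 1 \<noteq> r" "b - 1 \<noteq> mir r" by blast
      then show ?thesis
      proof cases
        case 1
        have "b - 2 = mir r - 1" "b = mir r + 1" using 1 less.prems by auto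
        then have g: "(b - 2, b) \<in> ?V" by (intro Vup) (simp add: Gd_def)
        show ?thesis
        proof (cases "a = b - 2")
          case True then show ?thesis using g by simp
        next
          case False
          show ?thesis
          proof (cases "b - 2 = r")
            case False
            have "(a, b - 2) \<in> ?V" by (rule IH) (use less.prems b \<open>a \<noteq> b - 2\<close> False in auto)
            then show ?thesis using trans g by blast
          next
            case True
            \<comment> \<open>For \<open>r = n\<close> the step of width two would leave a pair
              ending at \<open>r\<close>. The extra pair \<open>(n - 1, n + 2)\<close>, contributed
              by the relation with \<open>m = 4\<close>, bridges the gap.\<close>
            then have rn: "r = n" "b = n + 2" using 1 rr less.prems by auto
            have g2: "(r - 1, b) \<in> ?V" using rn by (intro Vup) (auto simp: Gd_def)
            show ?thesis
            proof (cases "a = r - 1")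
              case True then show ?thesis using g2 by simp
            next
              case False
              then have a: "a < r - 1" using less.prems(2) \<open>a \<noteq> b - 2\<close> rn b by linarith
              have "r - 1 - a < b - a" "r - 1 \<le> 2 * n" "r - 1 \<noteq> r" using a rn less.prems(3) by linarith+
              then have "(a, r - 1) \<in> ?V" using IH[of "r - 1" a] less.prems(1,5) a by blast
              then show ?thesis using trans g2 by blast
            qed
          qed
        qed
      next
        case 2
        have "b - 2 = r - 1" "b = r + 1" using 2 less.prems by auto
        then have g: "(b - 2, b) \<in> ?V" by (intro Vup) (simp add: Gd_def)
        show ?thesis
        proof (cases "a = b - 2")
          case True then show ?thesis using g by simp
        next
          case False
          have "(a, b - 2) \<in> ?V" by (rule IH) (use less.prems b 2 False in auto)
          then show ?thesis using trans g by blast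
        qed
      next
        case 3
        have "(a, b - 1) \<in> ?V" by (rule IH) (use less.prems b 3 in auto)
        moreover have "(b - 1, b) \<in> ?V" by (rule IH) (use less.prems b 3 in auto)
        ultimately show ?thesis using trans by blast
      qed
    qed
  qed
  ultimately show thesis using that UV by blast
qed

text \<open>No rectangle pair ends at \<open>r\<close>, which is left of the arc, and none begins at
  \<open>mir r\<close>, which is neither \<open>p\<close> nor left of the arc. So the rectangle lies
  in \<open>V\<close> of \<open>cut_lemma\<close>.\<close>

lemma collapse_A:
  assumes c: "cong \<Theta>" and g: "gen \<Theta> r" and cv: "cover I' I p q" and r: "p < r" "r < q" "(r, q) \<in> I"
    and nr: "\<not> (p < mir r \<and> mir r < q \<and> (mir r, q) \<in> I)" "mir r \<noteq> p"
  shows "(I', I) \<in> \<Theta>"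
proof -
  note d = coverD[OF cv]
  obtain U V where UV: "(U, V) \<in> \<Theta>" "(p, q) \<notin> U"
    "\<And>a b. 1 \<le> a \<Longrightarrow> a < b \<Longrightarrow> b \<le> 2 * n \<Longrightarrow> b \<noteq> r \<Longrightarrow> a \<noteq> mir r \<Longrightarrow> (a, b) \<in> V"
    using cut_lemma[OF c g d(6) r(1,2) d(8)] by blast
  have "rectS {v. (v, q) \<in> I} p q \<subseteq> V"
  proof (rule subrelI)
    fix a b assume ab: "(a, b) \<in> rectS {v. (v, q) \<in> I} p q"
    then have "b \<noteq> r" using r by (auto simp: rectS_def)
    moreover have "a \<noteq> mir r" using ab nr by (auto simp: rectS_def)
    ultimately show "(a, b) \<in> V" using UV(3) ab d by (auto simp: rectS_def)
  qed
  then show ?thesis using collapse[OF c cv UV(1,2)] by blast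
qed

lemma mirr_bic: assumes "bic T" shows "bic (mirr T)"
proof (rule bicI)
  show "mirr T \<subseteq> pairs" using bicD(1)[OF assms] mir_pairs by (auto simp: mirr_def)
next
  have mem: "(a, b) \<in> mirr T \<longleftrightarrow> a \<le> 2 * n \<and> b \<le> 2 * n \<and> (mir b, mir a) \<in> T" for a b
  proof
    assume "(a, b) \<in> mirr T"
    then obtain c d where "(c, d) \<in> T" "a = mir d" "b = mir c" by (auto simp: mirr_def)
    moreover then have "(c, d) \<in> pairs" using bicD(1)[OF assms] by auto
    ultimately show "a \<le> 2 * n \<and> b \<le> 2 * n \<and> (mir b, mir a) \<in> T" using mir_mir by (auto simp: pairs_def mir_def)
  next
    assume "a \<le> 2 * n \<and> b \<le> 2 * n \<and> (mir b, mir a) \<in> T"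
    then show "(a, b) \<in> mirr T" unfolding mirr_def using mir_mir by force
  qed
  show "(a, b) \<in> mirr T \<Longrightarrow> (b, c) \<in> mirr T \<Longrightarrow> (a, c) \<in> mirr T" for a b c
    unfolding mem using bicD(2)[OF assms] by blast
  show "(a, b) \<in> mirr T \<or> (b, c) \<in> mirr T" if "a < b" "b < c" "(a, c) \<in> mirr T" for a b c
    using that bicD(3)[OF assms, of "mir c" "mir b" "mir a"] unfolding mem by (auto simp: mir_def)
qed

lemma symj_K: assumes T: "bic T" shows "(T \<union> mirr T)\<^sup>+ \<in> K"
proof -
  have m: "(mir b, mir a) \<in> T \<union> mirr T" if "(a, b) \<in> T \<union> mirr T" for a b
    using that
  proof
    assume "(a, b) \<in> T" then show ?thesis by (auto simp: mirr_def)
  next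
    assume "(a, b) \<in> mirr T"
    then obtain c d where "(c, d) \<in> T" "a = mir d" "b = mir c" by (auto simp: mirr_def)
    moreover then have "c \<le> 2 * n" "d \<le> 2 * n" using bicD(1)[OF T] by (auto simp: pairs_def)
    ultimately show ?thesis using mir_mir by auto
  qed
  have "(mir b, mir a) \<in> (T \<union> mirr T)\<^sup>+" if "(a, b) \<in> (T \<union> mirr T)\<^sup>+" for a b
    using that
  proof (induction rule: trancl_induct)
    case (base y) then show ?case using m by blast
  next
    case (step y z) then show ?case using m by (meson trancl_into_trancl2)
  qed
  then show ?thesis using bic_trancl_Un[OF T mirr_bic[OF T]] by (auto simp: K_def)
qed

text \<open>Rectangle pairs beginning at \<open>mir r\<close> do occur here, so
  \<open>cut_lemma\<close> is used only for the part of the arc up to \<open>r + 1\<close>, which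
  ends before \<open>mir r\<close> matters. The part from \<open>r + 1\<close> on is supplied on
  both sides by the join with \<open>z\<close>; the work is to see that this does not bring
  \<open>(p, q)\<close> into the lower element.\<close>

lemma collapse_B:
  assumes c: "cong \<Theta>" and g: "gen \<Theta> r" and cv: "cover I' I p q" and r: "p < r" "r < q" "(r, q) \<in> I"
    and r': "r < mir r" "mir r < q" "(mir r, q) \<in> I"
  shows "(I', I) \<in> \<Theta>"
proof -
  note d = coverD[OF cv]
  let ?R = "{v. (v, q) \<in> I}"
  have "r \<le> 2 * n" using r d by simp
  then have "r + 1 \<noteq> mir r - 1" unfolding mir_def by presburger
  then have rN: "1 \<le> r" "r + mir r = 2 * n + 1" "r + 1 \<noteq> mir r - 1"
    using r d(6) \<open>r \<le> 2 * n\<close> by (auto simp: mir_def)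
  have nq: "(q, q) \<notin> I" using K_mem_range[OF d(2)] by blast
  have pm: "p < mir r" "mir r < mir p" using r r' d(8) rN by (auto simp: mir_def)
  \<comment> \<open>With \<open>r\<close> and \<open>mir r\<close> both left of the arc, the
    symmetry of \<open>I\<close> rules out an inversion of \<open>p\<close> and
    \<open>mir p\<close>.\<close>
  have pp: "(p, mir p) \<notin> I"
  proof
    assume h: "(p, mir p) \<in> I"
    have "(p, mir r) \<notin> I" using d(5)[of "mir r"] r' pm by auto
    then have "(mir r, mir p) \<in> I" using KD(3)[OF d(2) pm h] by blast
    then have "(p, r) \<in> I" using K_mir_iff[OF d(2), of p r] r d by auto
    then show False using d(5)[of r] r by auto
  qed
  have q'p: "q \<noteq> mir p" using pp d(3) by auto
  obtain U1 V1 where UV1: "(U1, V1) \<in> \<Theta>" "(p, r + 1) \<notin> U1"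
    "\<And>a b. 1 \<le> a \<Longrightarrow> a < b \<Longrightarrow> b \<le> 2 * n \<Longrightarrow> b \<noteq> r \<Longrightarrow> a \<noteq> mir r \<Longrightarrow> (a, b) \<in> V1"
    using cut_lemma[OF c g d(6) r(1), of "r + 1"] r d by auto
  have UK: "U1 \<in> K" "V1 \<in> K" using congD(1)[OF c UV1(1)] by auto
  let ?r1 = "rectS ?R p (r + 1)" and ?T2 = "rectS ?R (r + 1) q"
  define J where "J = (?r1 \<union> mirr ?r1)\<^sup>+"
  define z where "z = (?T2 \<union> mirr ?T2)\<^sup>+"
  have b1: "bic ?r1" "bic ?T2" using rectS_bic d r by auto
  have JK: "J \<in> K" "z \<in> K" using symj_K b1 by (simp_all add: J_def z_def)
  have r1V: "?r1 \<subseteq> V1"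
  proof (rule subrelI)
    fix a b assume ab: "(a, b) \<in> ?r1"
    then have "b \<noteq> r" "a \<noteq> mir r" using r r' by (auto simp: rectS_def)
    then show "(a, b) \<in> V1" using UV1(3) ab d r by (auto simp: rectS_def)
  qed
  have "J \<subseteq> V1"
  proof -
    have "mirr ?r1 \<subseteq> V1" using r1V KD(4)[OF UK(2)] by (auto simp: mirr_def)
    then have "J \<subseteq> V1\<^sup>+" unfolding J_def using r1V by (intro trancl_mono_subset) auto
    moreover have "trans V1" using KD(2)[OF UK(2)] by (auto simp: trans_def)
    ultimately show ?thesis by simp
  qed
  then have mJ: "mt V1 J = J" using mt_absorb[OF JK(1) UK(2)] by (simp add: mt_comm)
  have UV: "(jn (mt U1 J) z, jn J z) \<in> \<Theta>"
    using congD(5)[OF c congD(6)[OF c UV1(1) JK(1)] JK(2)] mJ by simp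
  have VK: "jn J z \<in> K" using congD(1)[OF c UV] by simp
  have rect: "rectS ?R p q \<subseteq> jn J z"
  proof (rule subrelI)
    fix a b assume ab: "(a, b) \<in> rectS ?R p q"
    have J1: "(u, v) \<in> jn J z" if "(u, v) \<in> ?r1" for u v
      using that jn_upper(1)[of J z] by (auto simp: J_def)
    have T2: "(u, v) \<in> jn J z" if "(u, v) \<in> ?T2" for u v
      using that jn_upper(2)[of z J] by (auto simp: z_def)
    consider "b \<le> r + 1" | "a \<ge> r + 1" "b > r + 1" | "a \<le> r" "b > r + 1" by linarith
    then show "(a, b) \<in> jn J z"
    proof cases
      case 1
      then have "(a, b) \<in> ?r1" using ab r nq by (auto simp: rectS_def)
      then show ?thesis by (rule J1)
    next
      case 2
      then have "(a, b) \<in> ?T2" using ab r by (auto simp: rectS_def)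
      then show ?thesis by (rule T2)
    next
      case 3
      then have "(a, r + 1) \<in> ?r1" "(r + 1, b) \<in> ?T2" using ab r by (auto simp: rectS_def)
      then show ?thesis using J1 T2 KD(2)[OF VK] by blast
    qed
  qed
  \<comment> \<open>A chain from \<open>p\<close> in the lower element stays among \<open>p\<close>
    and the values below \<open>r\<close> on the right of the arc: the only exit within
    \<open>J\<close> is \<open>(p, r + 1)\<close>, which is absent from \<open>U1\<close>, and a
    mirrored pair of the second part would invert \<open>p\<close> and \<open>mir p\<close>.\<close>
  let ?P = "\<lambda>v. v = p \<or> (p < v \<and> v < r \<and> v \<notin> ?R)"
  have mirrD: "\<exists>c d. (c, d) \<in> T \<and> u = mir d \<and> v = mir c" if "(u, v) \<in> mirr T" for u v T
    using that by (auto simp: mirr_def)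
  have step_r1: "u = p \<and> (?P v \<or> v = r + 1)" if u: "?P u" and uv: "(u, v) \<in> ?r1 \<union> mirr ?r1" for u v
    using uv
  proof
    assume "(u, v) \<in> ?r1"
    then show ?thesis using u r by (auto simp: rectS_def order_le_less less_Suc_eq)
  next
    assume "(u, v) \<in> mirr ?r1"
    then obtain a b where "(a, b) \<in> ?r1" "u = mir b" using mirrD by blast
    then have "u \<ge> mir r - 1" by (auto simp: rectS_def mir_def)
    then show ?thesis using u r r' by auto
  qed
  have step2: "\<not> (r + 1, v) \<in> ?r1 \<union> mirr ?r1" for v
  proof
    assume "(r + 1, v) \<in> ?r1 \<union> mirr ?r1"
    then have "(r + 1, v) \<in> mirr ?r1" by (auto simp: rectS_def)
    then obtain a b where ab: "(a, b) \<in> ?r1" "r + 1 = mir b" using mirrD by blast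
    then have "b = mir (r + 1)" using mir_mir r d by (auto simp: rectS_def)
    then have "b = mir r - 1" by (simp add: mir_def)
    moreover have "b \<le> r + 1" using ab by (auto simp: rectS_def)
    ultimately have "b = r" using rN r' by auto
    then show False using ab r by (auto simp: rectS_def)
  qed
  have stepJ: "u = p \<and> (?P v \<or> v = r + 1)" if "?P u" "(u, v) \<in> J" for u v
    using that(2) unfolding J_def
  proof (induction rule: trancl_induct)
    case (base y) then show ?case using step_r1[OF that(1)] by blast
  next
    case (step y z')
    have "y \<noteq> r + 1" using step(2) step2 by auto
    then have "?P y" using step by blast
    then have "y = p" using step_r1 step(2) by blast
    moreover have "u < y" using step(1) trancl_pairs[of "?r1 \<union> mirr ?r1"] bicD(1) b1 mirr_bic
      by (auto simp: pairs_def)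
    ultimately show ?case using step(3) by auto
  qed
  have stepU: "?P v" if u: "?P u" and uv: "(u, v) \<in> mt U1 J \<union> (?T2 \<union> mirr ?T2)" for u v
    using uv
  proof
    assume h: "(u, v) \<in> mt U1 J"
    then have "u = p \<and> (?P v \<or> v = r + 1)" using stepJ[OF u] mt_lower[OF UK(1) JK(1)] by blast
    moreover have "(u, v) \<in> U1" using h mt_lower[OF UK(1) JK(1)] by blast
    ultimately show ?thesis using UV1(2) by auto
  next
    assume "(u, v) \<in> ?T2 \<union> mirr ?T2"
    moreover have "(u, v) \<notin> ?T2" using u r by (auto simp: rectS_def)
    ultimately have "(u, v) \<in> mirr ?T2" by blast
    then obtain a b where ab: "(a, b) \<in> ?T2" "u = mir b" using mirrD by blast
    then have b: "b \<le> q" "b \<le> 2 * n" "b = q \<or> (b, q) \<notin> I" "r + 1 < b" "b = mir u"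
      using d mir_mir by (auto simp: rectS_def)
    from u have False
    proof
      assume "u = p"
      then have bp: "b = mir p" using b by simp
      then have "(b, q) \<notin> I" "p < b" "b < q" using b q'p r by auto
      then have "(p, b) \<in> I" using d(5) by blast
      then show False using pp bp by simp
    next
      assume u': "p < u \<and> u < r \<and> u \<notin> ?R"
      then have pu: "(p, u) \<in> I" using d(5)[of u] r by auto
      have "(u, mir p) \<in> I"
      proof (cases "b = q")
        case True
        then show ?thesis using d(9) ab by simp
      next
        case False
        then have "(p, b) \<in> I" using d(5)[of b] b r by auto
        then show ?thesis using KD(4)[OF d(2)] ab by blast
      qed
      then show False using KD(2)[OF d(2) pu] pp by blast
    qed
    then show ?thesis ..
  qed
  have "(p, q) \<notin> jn (mt U1 J) z"
  proof
    assume "(p, q) \<in> jn (mt U1 J) z"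
    then have "(p, q) \<in> (mt U1 J \<union> (?T2 \<union> mirr ?T2)\<^sup>+)\<^sup>+" by (simp add: jn_def z_def)
    moreover have "(mt U1 J \<union> (?T2 \<union> mirr ?T2)\<^sup>+)\<^sup>+ \<subseteq> ((mt U1 J \<union> (?T2 \<union> mirr ?T2))\<^sup>+)\<^sup>+"
      by (intro trancl_mono_subset Un_least) (auto intro: trancl_mono_subset[THEN subsetD])
    ultimately have ch: "(p, q) \<in> (mt U1 J \<union> (?T2 \<union> mirr ?T2))\<^sup>+" by auto
    have "?P v" if "(p, v) \<in> (mt U1 J \<union> (?T2 \<union> mirr ?T2))\<^sup>+" for v
      using that by (induction rule: trancl_induct) (use stepU in blast)+
    from this[OF ch] show False using r by auto
  qed
  then show ?thesis using collapse[OF c cv UV _ rect] by blast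
qed

section \<open>Duality: complements of inversion sets\<close>

definition dual :: "((nat \<times> nat) set \<times> (nat \<times> nat) set) set \<Rightarrow> ((nat \<times> nat) set \<times> (nat \<times> nat) set) set" where
  "dual \<Theta> = {(co I, co J) | I J. (I, J) \<in> \<Theta>}"

lemma co_co_K: "I \<in> K \<Longrightarrow> co (co I) = I"
  using co_co KD(1) by blast

lemma dual_iff: "cong \<Theta> \<Longrightarrow> I \<in> K \<Longrightarrow> J \<in> K \<Longrightarrow> (I, J) \<in> dual \<Theta> \<longleftrightarrow> (co I, co J) \<in> \<Theta>"
proof
  assume c: "cong \<Theta>" and I: "I \<in> K" and J: "J \<in> K"
  assume "(I, J) \<in> dual \<Theta>"
  then obtain I' J' where "(I', J') \<in> \<Theta>" "I = co I'" "J = co J'" unfolding dual_def by blast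
  then show "(co I, co J) \<in> \<Theta>" using congD(1)[OF c, of I' J'] co_co_K by simp
next
  assume c: "cong \<Theta>" and I: "I \<in> K" and J: "J \<in> K"
  assume "(co I, co J) \<in> \<Theta>"
  then have "(co (co I), co (co J)) \<in> dual \<Theta>" unfolding dual_def by blast
  then show "(I, J) \<in> dual \<Theta>" using co_co_K I J by simp
qed

lemma dual_cong: assumes c: "cong \<Theta>" shows "cong (dual \<Theta>)"
proof -
  have sub: "dual \<Theta> \<subseteq> K \<times> K" unfolding dual_def using congD(1)[OF c] co_K by blast
  have "equiv K (dual \<Theta>)"
  proof (rule equivI)
    show "refl_on K (dual \<Theta>)" unfolding refl_on_def using sub dual_iff[OF c] congD(4)[OF c] co_K by blast
    show "sym (dual \<Theta>)" unfolding sym_def dual_def using congD(2)[OF c] by blast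
    show "trans (dual \<Theta>)"
    proof (rule transI)
      fix x y z assume "(x, y) \<in> dual \<Theta>" "(y, z) \<in> dual \<Theta>"
      then show "(x, z) \<in> dual \<Theta>" using sub dual_iff[OF c] congD(3)[OF c] by blast
    qed
    show "dual \<Theta> \<subseteq> K \<times> K" by (rule sub)
  qed
  moreover have "(jn I T, jn J T) \<in> dual \<Theta> \<and> (mt I T, mt J T) \<in> dual \<Theta>"
    if IJ: "(I, J) \<in> dual \<Theta>" and T: "T \<in> K" for I J T
  proof -
    have IJK: "I \<in> K" "J \<in> K" using IJ sub by auto
    then have h: "(co I, co J) \<in> \<Theta>" using IJ dual_iff[OF c] by blast
    have "(mt (co I) (co T), mt (co J) (co T)) \<in> \<Theta>" "(jn (co I) (co T), jn (co J) (co T)) \<in> \<Theta>"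
      using congD(5,6)[OF c h co_K[OF T]] by auto
    then have "(co (jn I T), co (jn J T)) \<in> \<Theta>" "(co (mt I T), co (mt J T)) \<in> \<Theta>"
      using co_jn co_mt IJK T by auto
    then show ?thesis
      using dual_iff[OF c jn_K[OF IJK(1) T] jn_K[OF IJK(2) T]]
        dual_iff[OF c mt_K[OF IJK(1) T] mt_K[OF IJK(2) T]] by simp
  qed
  ultimately show ?thesis unfolding cong_def by blast
qed

lemma dual_cover:
  assumes cv: "cover I' I p q" shows "cover (co I) (co I') (mir q) (mir p)"
proof -
  note d = coverD[OF cv]
  have mm: "mir (mir p) = p" "mir (mir q) = q" using mir_mir d by auto
  have mp: "(mir q, mir p) \<in> pairs" "(p, q) \<in> pairs" using KD(1)[OF d(2)] d(3,9) by auto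
  have "(mir q, v) \<in> co I' \<longleftrightarrow> (v, mir p) \<notin> co I'" if v: "mir q < v" "v < mir p" for v
  proof -
    have vr: "p < mir v" "mir v < q" "v \<le> 2 * n" "1 \<le> v" using v d by (auto simp: mir_def)
    have pr: "(mir q, v) \<in> pairs" "(v, mir p) \<in> pairs" using v vr d by (auto simp: pairs_def mir_def)
    have "(mir q, v) \<in> I \<longleftrightarrow> (mir v, q) \<in> I" using K_mir_iff[OF d(2), of "mir v" q] mir_mir[OF vr(3)] vr d by auto
    moreover have "(v, mir p) \<in> I \<longleftrightarrow> (p, mir v) \<in> I" using K_mir_iff[OF d(2), of p "mir v"] mir_mir[OF vr(3)] vr d by auto
    moreover have "(mir q, v) \<in> I' \<longleftrightarrow> (mir q, v) \<in> I" "(v, mir p) \<in> I' \<longleftrightarrow> (v, mir p) \<in> I"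
      using d(4) v vr mm by (auto simp: mir_def)
    ultimately show ?thesis using d(5)[OF vr(1,2)] pr by (auto simp: co_def)
  qed
  moreover have "co I = co I' - {(mir q, mir p), (mir (mir p), mir (mir q))}"
    using d(3,4,9) mm KD(1)[OF d(2)] by (auto simp: co_def)
  moreover have "(mir q, mir p) \<in> co I'" using mp d(4) by (auto simp: co_def)
  ultimately show ?thesis unfolding cover_def using co_K d(1,2) by blast
qed

text \<open>\<open>Gd (mir r)\<close> equals \<open>Gd r\<close>. Joining both sides of the
  generator at \<open>r\<close> with the complement of \<open>Gl (mir r) \<union> Gd (mir r)\<close>
  returns this complement on one side and, with \<open>Gd r\<close> added, the complement of
  \<open>Gl (mir r)\<close> on the other.\<close>

lemma dual_gen:
  assumes c: "cong \<Theta>" and g: "gen \<Theta> r" and r: "2 \<le> r" "r \<le> 2 * n - 1"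
    and GK: "Gl (mir r) \<in> K" "Gl (mir r) \<union> Gd (mir r) \<in> K"
  shows "gen (dual \<Theta>) (mir r)"
proof -
  let ?X' = "co (Gl (mir r) \<union> Gd (mir r))"
  have m: "mir (mir r) = r" "mir r + r = 2 * n + 1" "mir r \<noteq> r" using r mir_mir mir_ne by (auto simp: mir_def)
  have Gd: "Gd (mir r) = Gd r" using m r by (auto simp: Gd_def mir_def)
  have Gr: "Gl r \<in> K" "Gl r \<union> Gd r \<in> K" using g congD(1)[OF c] by (auto simp: gen_def)
  have dj: "Gl r \<inter> (Gl (mir r) \<union> Gd (mir r)) = {}"
    unfolding Gd using m r by (auto simp: Gl_def Gd_def; presburger)
  have "(jn (Gl r) ?X', jn (Gl r \<union> Gd r) ?X') \<in> \<Theta>"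
    using congD(5)[OF c] g co_K[OF GK(2)] by (auto simp: gen_def)
  moreover have "jn (Gl r) ?X' = ?X'"
  proof (rule jn_absorb[OF co_K[OF GK(2)]])
    show "Gl r \<subseteq> ?X'" using dj KD(1)[OF Gr(1)] unfolding co_def by blast
  qed
  moreover have "jn (Gl r \<union> Gd r) ?X' = co (Gl (mir r))"
  proof
    have "Gd r \<inter> Gl (mir r) = {}" using m r by (auto simp: Gl_def Gd_def; presburger)
    then show "jn (Gl r \<union> Gd r) ?X' \<subseteq> co (Gl (mir r))"
      by (intro jn_least[OF co_K[OF GK(1)]]) (use dj KD(1)[OF Gr(2)] in \<open>unfold co_def, blast+\<close>)
    show "co (Gl (mir r)) \<subseteq> jn (Gl r \<union> Gd r) ?X'"
      using jn_upper(1)[of "Gl r \<union> Gd r" ?X'] jn_upper(2)[of ?X' "Gl r \<union> Gd r"]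
      unfolding co_def Gd by blast
  qed
  ultimately have "(co (Gl (mir r) \<union> Gd (mir r)), co (Gl (mir r))) \<in> \<Theta>" by simp
  then have "(co (Gl (mir r)), co (Gl (mir r) \<union> Gd (mir r))) \<in> \<Theta>" using congD(2)[OF c] by blast
  then show ?thesis unfolding gen_def using dual_iff[OF c GK] by blast
qed

text \<open>The place of \<open>mir r\<close> decides. If it is also left of the arc,
  \<open>collapse_B\<close> applies at the smaller of the two values, in the dual if that is
  \<open>mir r\<close>. If it is the lower end \<open>p\<close>, duality turns the conflict into one
  at the upper end, which \<open>collapse_A\<close> permits.\<close>

theorem collapse_right:
  assumes c: "cong \<Theta>" and g: "gen \<Theta> r" and cv: "cover I' I p q" and r: "p < r" "r < q" "(r, q) \<in> I"
    and GK: "Gl (mir r) \<in> K" "Gl (mir r) \<union> Gd (mir r) \<in> K"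
  shows "(I', I) \<in> \<Theta>"
proof -
  note d = coverD[OF cv]
  have rr: "2 \<le> r" "r \<le> 2 * n - 1" using r d by auto
  have m: "mir (mir r) = r" "mir r \<noteq> r" using rr mir_mir mir_ne by auto
  \<comment> \<open>Complementing and mirroring each exchange the sides, so \<open>mir v\<close> is
    left of the dual arc exactly if \<open>v\<close> is left of the original one.\<close>
  have mI': "(mir v, mir p) \<in> co I' \<longleftrightarrow> (v, q) \<in> I" if "p < v" "v < q" for v
  proof -
    have "(mir v, mir p) \<in> I' \<longleftrightarrow> (mir v, mir p) \<in> I" using d(4) that d by (auto simp: mir_def)
    moreover have "(mir v, mir p) \<in> I \<longleftrightarrow> (p, v) \<in> I" using K_mir_iff[OF d(2), of p v] that d by auto
    moreover have "(mir v, mir p) \<in> pairs" using that d by (auto simp: pairs_def mir_def)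
    ultimately show ?thesis using d(5)[OF that] by (auto simp: co_def)
  qed
  have dc: "cong (dual \<Theta>)" "gen (dual \<Theta>) (mir r)" using dual_cong[OF c] dual_gen[OF c g rr GK] .
  note cv' = dual_cover[OF cv]
  have r2: "mir q < mir r" "mir r < mir p" "(mir r, mir p) \<in> co I'"
    using r mI' d by (auto simp: mir_def)
  have fin: "(I', I) \<in> \<Theta>" if "(co I, co I') \<in> dual \<Theta>"
    using that dual_iff[OF c] co_K co_co_K congD(2)[OF c] d(1,2) by metis
  consider "mir r = p" | "p < mir r" "mir r < q" "(mir r, q) \<in> I" "r < mir r"
    | "p < mir r" "mir r < q" "(mir r, q) \<in> I" "mir r < r"
    | "\<not> (p < mir r \<and> mir r < q \<and> (mir r, q) \<in> I)" "mir r \<noteq> p"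
    using m(2) by linarith
  then show ?thesis
  proof cases
    case 1
    have "mir p = r" using 1 m by simp
    then have "\<not> (mir q < r \<and> r < mir p \<and> (r, mir p) \<in> co I')" by simp
    moreover have "r \<noteq> mir q" using 1 m d r by (auto simp: mir_def)
    ultimately show ?thesis using fin collapse_A[OF dc cv' r2] m by simp
  next
    case 2 then show ?thesis using collapse_B[OF c g cv r] by blast
  next
    case 3
    have "(r, mir p) \<in> co I'" using mI'[of "mir r"] 3 m by simp
    moreover have "r < mir p" using 3 m by (auto simp: mir_def)
    ultimately show ?thesis using fin collapse_B[OF dc cv' r2] m 3 by simp
  next
    case 4 then show ?thesis using collapse_A[OF c g cv r] by blast
  qed
qed

lemma mirror_cover:
  assumes cv: "cover I' I p q" shows "cover I' I (mir q) (mir p)"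
proof -
  note d = coverD[OF cv]
  have mm: "mir (mir p) = p" "mir (mir q) = q" using mir_mir d by auto
  have "(mir q, v) \<in> I \<longleftrightarrow> (v, mir p) \<notin> I" if v: "mir q < v" "v < mir p" for v
  proof -
    have vr: "p < mir v" "mir v < q" "v \<le> 2 * n" "1 \<le> v" using v d by (auto simp: mir_def)
    have "(mir q, v) \<in> I \<longleftrightarrow> (mir v, q) \<in> I" using K_mir_iff[OF d(2), of "mir v" q] mir_mir[OF vr(3)] vr d by auto
    moreover have "(v, mir p) \<in> I \<longleftrightarrow> (p, mir v) \<in> I" using K_mir_iff[OF d(2), of p "mir v"] mir_mir[OF vr(3)] vr d by auto
    ultimately show ?thesis using d(5)[OF vr(1,2)] by auto
  qed
  then show ?thesis unfolding cover_def using d mm by (auto simp: insert_commute)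
qed

text \<open>An arc outside \<open>As e\<close> passes some value on the wrong side. A value not in
  \<open>rt e\<close> on the left is handled by its generator; a value in \<open>rt e\<close> on the
  right has a mirror image that is not in \<open>rt e\<close> and lies left of the mirrored
  arc.\<close>

theorem collapse_bad:
  assumes c: "cong \<Theta>" and g: "\<And>r. 2 \<le> r \<Longrightarrow> r \<le> 2 * n - 1 \<Longrightarrow> r \<notin> rt e \<Longrightarrow> gen \<Theta> r"
    and GK: "\<And>r. 2 \<le> r \<Longrightarrow> r \<le> 2 * n - 1 \<Longrightarrow> Gl r \<in> K \<and> Gl r \<union> Gd r \<in> K"
    and cv: "cover I' I p q" and bad: "(p, q) \<notin> As e I"
  shows "(I', I) \<in> \<Theta>"
proof -
  note d = coverD[OF cv]
  have right: "(J', J) \<in> \<Theta>" if cv: "cover J' J a b" and v: "a < v" "v < b" "(v, b) \<in> J" "v \<notin> rt e" for J' J a b v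
  proof -
    note d = coverD[OF cv]
    have vr: "2 \<le> v" "v \<le> 2 * n - 1" using v d by auto
    then have "2 \<le> mir v" "mir v \<le> 2 * n - 1" by (auto simp: mir_def)
    then show ?thesis using collapse_right[OF c g[OF vr v(4)] cv v(1-3)] GK by blast
  qed
  have "(p, q) \<in> pairs" using d(3) KD(1)[OF d(2)] by blast
  then obtain a b where ab: "(a, b) \<in> rectS (rt e) p q" "(a, b) \<notin> I" using bad by (auto simp: As_def)
  have "\<exists>v. p < v \<and> v < q \<and> ((v, q) \<in> I \<longleftrightarrow> v \<notin> rt e)"
  proof (rule ccontr)
    assume h: "\<not> ?thesis"
    have a: "a = p \<or> (p < a \<and> a < q \<and> a \<in> rt e)" and b: "b = q \<or> (p < b \<and> b < q \<and> b \<notin> rt e)" "a < b"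
      using ab by (auto simp: rectS_def)
    have aq: "(a, q) \<in> I" using a h d(3) by blast
    have pb: "(p, b) \<in> I" using b h d(3,5) by blast
    show False
    proof (cases "a = p \<or> b = q")
      case True then show ?thesis using aq pb ab by auto
    next
      case False
      then have "(p, a) \<notin> I" using d(5)[of a] a aq by blast
      then show ?thesis using KD(3)[OF d(2), of p a b] pb ab a b False by auto
    qed
  qed
  then obtain v where v: "p < v" "v < q" "(v, q) \<in> I \<longleftrightarrow> v \<notin> rt e" by blast
  show ?thesis
  proof (cases "(v, q) \<in> I")
    case True then show ?thesis using right[OF cv v(1,2)] v by blast
  next
    case False
    have vN: "v \<le> 2 * n" using v d by auto
    have "(p, v) \<in> I" using d(5)[OF v(1,2)] False by blast
    then have "(mir v, mir p) \<in> I" using KD(4)[OF d(2)] by blast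
    moreover have "mir q < mir v" "mir v < mir p" using v d by (auto simp: mir_def)
    moreover have "mir v \<notin> rt e" using rt_mir[OF vN] v False by blast
    ultimately show ?thesis using right[OF mirror_cover[OF cv]] by blast
  qed
qed

subsection \<open>The generators of the Cambrian congruences\<close>

lemma ivs_s: assumes j: "j \<in> {1..n}" shows "ivs (s j) = Gl j"
proof -
  have "mir (j + 1) = mir j - 1" by (simp add: mir_def)
  then show ?thesis using ivs_step(1)[OF W_id j] ivs_id by (simp add: Gl_def)
qed

lemma Gl_flip: "j \<in> {1..n} \<Longrightarrow> Gl (2 * n - j) = Gl j"
  by (auto simp: Gl_def mir_def)

lemma ivs_step':
  assumes "x \<in> W" "i \<in> {1..n}" "x i = a" "x (i + 1) = b" "a < b"
  shows "ivs (x \<circ> s i) = ivs x \<union> {(a, b), (mir b, mir a)}"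
  using ivs_step(1)[of x i] assms by simp

lemma s_other: assumes "i \<in> {1..n}" "v \<noteq> i" "v \<noteq> i + 1" "v \<noteq> 2 * n - i" "v \<noteq> 2 * n - i + 1" shows "s i v = v"
  using assms s_apply[of i v] by simp

lemma ivs_low_high:
  assumes j: "j \<in> {1..n}" "j - 1 \<in> {1..n}"
  shows "ivs (s j \<circ> s (j - 1)) = Gl j \<union> {(j - 1, j + 1), (mir j - 1, mir j + 1)}"
    "j = n \<Longrightarrow> ivs (s j \<circ> s (j - 1) \<circ> s j) = Gl j \<union> {(j - 1, j + 1), (mir j - 1, mir j + 1), (n - 1, n + 2)}"
    "j < n \<Longrightarrow> ivs (s j \<circ> s (j - 1) \<circ> s j) = Gl j \<union> Gl (j - 1) \<union> {(j - 1, j + 1), (mir j - 1, mir j + 1)}"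
    "j = n \<Longrightarrow> ivs (s j \<circ> s (j - 1) \<circ> s j \<circ> s (j - 1)) =
      Gl j \<union> Gl (j - 1) \<union> {(j - 1, j + 1), (mir j - 1, mir j + 1), (n - 1, n + 2)}"
proof -
  obtain i where i: "j = i + 1" "i \<in> {1..n}" using j by (cases j) auto
  have mm: "mir (i + 2) = mir j - 1" "mir i = mir j + 1" using i j by (auto simp: mir_def)
  have ji: "s j i = i" using s_other[OF j(1), of i] i j by auto
  have jj: "s j j = i + 2" "s j (i + 2) = j" using s_vals[OF j(1)] i by auto
  have W: "s j \<in> W" "s j \<circ> s i \<in> W" "s j \<circ> s i \<circ> s j \<in> W" using s_W W_comp j i by auto
  have iv: "s i i = j" "s i j = i" using s_vals[OF i(2)] i by auto
  have 1: "ivs (s j \<circ> s i) = Gl j \<union> {(i, i + 2), (mir j - 1, mir j + 1)}"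
    using ivs_step'[OF W(1) i(2), of i "i + 2"] ji jj ivs_s[OF j(1)] mm i by simp
  then show "ivs (s j \<circ> s (j - 1)) = Gl j \<union> {(j - 1, j + 1), (mir j - 1, mir j + 1)}" using i by simp
  {
    assume jn: "j = n"
    have a: "s i (i + 2) = i + 3" "s i (i + 3) = i + 2" using s_vals(3,4)[OF i(2)] i jn by (simp_all add: mult_2 numeral_3_eq_3)
    have b: "s j (i + 3) = i + 3" using s_other[OF j(1), of "i + 3"] i jn by auto
    have m3: "mir (i + 3) = i" "mir i = i + 3" "n - 1 = i" "n + 2 = i + 3" unfolding mir_def using i jn by auto
    have "ivs (s j \<circ> s i \<circ> s j) = ivs (s j \<circ> s i) \<union> {(i, i + 3), (mir (i + 3), mir i)}"
      by (rule ivs_step'[OF W(2) j(1)]) (use iv ji jj a b i in auto)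
    then have 2: "ivs (s j \<circ> s i \<circ> s j) = Gl j \<union> {(i, i + 2), (mir j - 1, mir j + 1), (i, i + 3)}"
      unfolding 1 m3(1,2) by auto
    have j1: "j - 1 = i" "j + 1 = i + 2" using i by auto
    show "ivs (s j \<circ> s (j - 1) \<circ> s j) = Gl j \<union> {(j - 1, j + 1), (mir j - 1, mir j + 1), (n - 1, n + 2)}"
      unfolding m3(3,4) j1 by (rule 2)
    have "ivs (s j \<circ> s i \<circ> s j \<circ> s i) = ivs (s j \<circ> s i \<circ> s j) \<union> {(i + 2, i + 3), (mir (i + 3), mir (i + 2))}"
      by (rule ivs_step'[OF W(3) i(2)]) (use iv ji jj a b i in auto)
    moreover have "Gl i = {(i + 2, i + 3), (mir (i + 3), mir (i + 2))}"
      unfolding Gl_def mir_def using i jn by auto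
    ultimately have "ivs (s j \<circ> s i \<circ> s j \<circ> s i) = Gl j \<union> {(i, i + 2), (mir j - 1, mir j + 1), (i, i + 3)} \<union> Gl i"
      using 2 by (simp only:)
    then show "ivs (s j \<circ> s (j - 1) \<circ> s j \<circ> s (j - 1)) =
      Gl j \<union> Gl (j - 1) \<union> {(j - 1, j + 1), (mir j - 1, mir j + 1), (n - 1, n + 2)}"
      unfolding m3(3,4) j1 by (simp only: Un_ac)
  }
  {
    assume jn: "j < n"
    have a: "s i (i + 2) = i + 2" using s_other[OF i(2), of "i + 2"] i jn by auto
    have "ivs (s j \<circ> s i \<circ> s j) = ivs (s j \<circ> s i) \<union> {(i, j), (mir j, mir i)}"
      by (rule ivs_step'[OF W(2) j(1)]) (use iv ji jj a i in auto)
    moreover have "Gl i = {(i, j), (mir j, mir i)}" using i by (auto simp: Gl_def mir_def)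
    ultimately show "ivs (s j \<circ> s (j - 1) \<circ> s j) = Gl j \<union> Gl (j - 1) \<union> {(j - 1, j + 1), (mir j - 1, mir j + 1)}"
      using 1 i by auto
  }
qed

lemma ivs_high_low:
  assumes j: "j \<in> {1..n}" "j + 1 \<in> {1..n}"
  shows "j + 1 < n \<Longrightarrow> ivs (s j \<circ> s (j + 1)) = Gl j \<union> {(j, j + 2), (mir (j + 1) - 1, mir (j + 1) + 1)}"
    "j + 1 = n \<Longrightarrow> ivs (s j \<circ> s (j + 1)) = Gl j \<union> {(n - 1, n + 2)}"
    "j + 1 < n \<Longrightarrow> ivs (s j \<circ> s (j + 1) \<circ> s j) = Gl j \<union> Gl (j + 1) \<union> {(j, j + 2), (mir (j + 1) - 1, mir (j + 1) + 1)}"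
    "j + 1 = n \<Longrightarrow> ivs (s j \<circ> s (j + 1) \<circ> s j) = Gl j \<union> {(j, j + 2), (mir (j + 1) - 1, mir (j + 1) + 1), (n - 1, n + 2)}"
    "j + 1 = n \<Longrightarrow> ivs (s j \<circ> s (j + 1) \<circ> s j \<circ> s (j + 1)) =
      Gl j \<union> Gl (j + 1) \<union> {(j, j + 2), (mir (j + 1) - 1, mir (j + 1) + 1), (n - 1, n + 2)}"
proof -
  define i where "i = j + 1"
  have i: "i \<in> {1..n}" using j by (simp add: i_def)
  have jj: "s j j = i" "s j i = j" using s_vals[OF j(1)] by (auto simp: i_def)
  have iv: "s i i = j + 2" "s i (j + 2) = i" using s_vals[OF i] by (auto simp: i_def)
  have ij: "s i j = j" using s_other[OF i, of j] j by (auto simp: i_def)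
  have W: "s j \<in> W" "s j \<circ> s i \<in> W" "s j \<circ> s i \<circ> s j \<in> W" using s_W W_comp j i by auto
  have mm: "mir (j + 2) = mir i - 1" "mir j = mir i + 1" using j by (auto simp: mir_def i_def)
  {
    assume jn: "j + 1 < n"
    have a: "s j (j + 2) = j + 2" using s_other[OF j(1), of "j + 2"] jn by auto
    have 1: "ivs (s j \<circ> s i) = Gl j \<union> {(j, j + 2), (mir i - 1, mir i + 1)}"
      using ivs_step'[OF W(1) i, of j "j + 2"] jj a ivs_s[OF j(1)] mm by (simp add: i_def)
    then show "ivs (s j \<circ> s (j + 1)) = Gl j \<union> {(j, j + 2), (mir (j + 1) - 1, mir (j + 1) + 1)}"
      by (simp add: i_def)
    have "ivs (s j \<circ> s i \<circ> s j) = ivs (s j \<circ> s i) \<union> {(i, j + 2), (mir (j + 2), mir i)}"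
      by (rule ivs_step'[OF W(2) j(1)]) (use jj iv ij a in \<open>auto simp: i_def\<close>)
    moreover have "Gl i = {(i, j + 2), (mir (j + 2), mir i)}" by (auto simp: Gl_def mir_def i_def)
    ultimately show "ivs (s j \<circ> s (j + 1) \<circ> s j) = Gl j \<union> Gl (j + 1) \<union> {(j, j + 2), (mir (j + 1) - 1, mir (j + 1) + 1)}"
      using 1 by (auto simp: i_def)
  }
  {
    assume jn: "j + 1 = n"
    have a: "s j (j + 2) = j + 3" "s j (j + 3) = j + 2"
      using s_vals(3,4)[OF j(1)] jn by (simp_all add: mult_2 numeral_3_eq_3 flip: jn)
    have b: "s i (j + 3) = j + 3" using s_other[OF i, of "j + 3"] jn by (auto simp: i_def)
    have m3: "mir (j + 3) = j" "mir j = j + 3" "n - 1 = j" "n + 2 = j + 3" "mir i = j + 2"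
      using jn j by (auto simp: mir_def i_def)
    have 1: "ivs (s j \<circ> s i) = Gl j \<union> {(j, j + 3)}"
      using ivs_step'[OF W(1) i, of j "j + 3"] jj a ivs_s[OF j(1)] m3 by (simp add: i_def)
    then show "ivs (s j \<circ> s (j + 1)) = Gl j \<union> {(n - 1, n + 2)}" unfolding m3(3,4) i_def .
    have "ivs (s j \<circ> s i \<circ> s j) = ivs (s j \<circ> s i) \<union> {(i, j + 3), (mir (j + 3), mir i)}"
      by (rule ivs_step'[OF W(2) j(1)]) (use jj iv ij a b in \<open>auto simp: i_def\<close>)
    then have 2: "ivs (s j \<circ> s i \<circ> s j) = Gl j \<union> {(j, j + 2), (mir i - 1, mir i + 1), (j, j + 3)}"
      using 1 m3 by (auto simp: i_def)
    then show "ivs (s j \<circ> s (j + 1) \<circ> s j) = Gl j \<union> {(j, j + 2), (mir (j + 1) - 1, mir (j + 1) + 1), (n - 1, n + 2)}"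
      unfolding m3(3,4) i_def .
    have "ivs (s j \<circ> s i \<circ> s j \<circ> s i) = ivs (s j \<circ> s i \<circ> s j) \<union> {(i, j + 2), (mir (j + 2), mir i)}"
      by (rule ivs_step'[OF W(3) i]) (use jj iv ij a b in \<open>auto simp: i_def\<close>)
    moreover have "Gl i = {(i, j + 2), (mir (j + 2), mir i)}" by (auto simp: Gl_def mir_def i_def)
    ultimately have "ivs (s j \<circ> s i \<circ> s j \<circ> s i) = Gl j \<union> {(j, j + 2), (mir i - 1, mir i + 1), (j, j + 3)} \<union> Gl i"
      using 2 by (simp only:)
    then show "ivs (s j \<circ> s (j + 1) \<circ> s j \<circ> s (j + 1)) =
      Gl j \<union> Gl (j + 1) \<union> {(j, j + 2), (mir (j + 1) - 1, mir (j + 1) + 1), (n - 1, n + 2)}"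
      unfolding m3(3,4) i_def by (simp only: Un_ac)
  }
qed

text \<open>For neighbouring indices this is the alternating word with \<open>m - 1\<close> letters
  starting with \<open>s j\<close>: \<open>m = 4\<close> if \<open>s n\<close> takes part and
  \<open>m = 3\<close> otherwise.\<close>

definition alt :: "nat \<Rightarrow> nat \<Rightarrow> nat \<Rightarrow> nat" where
  "alt i j = (if i = n \<or> j = n then s j \<circ> s i \<circ> s j else s j \<circ> s i)"

lemma ivs_alt:
  assumes "i \<in> {1..n}" "j \<in> {1..n}"
  shows "j = i + 1 \<Longrightarrow> ivs (alt i j) = Gl j \<union> Gd j"
    "i = j + 1 \<Longrightarrow> ivs (alt i j) = Gl (2 * n - j) \<union> Gd (2 * n - j)"
proof -
  assume ji: "j = i + 1"
  then have i: "j - 1 = i" "j - 1 \<in> {1..n}" using assms by auto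
  show "ivs (alt i j) = Gl j \<union> Gd j"
  proof (cases "j = n")
    case True then show ?thesis using ivs_low_high(2)[OF assms(2) i(2)] i by (auto simp: alt_def Gd_def)
  next
    case False then show ?thesis using ivs_low_high(1)[OF assms(2) i(2)] i ji assms by (auto simp: alt_def Gd_def)
  qed
next
  assume ij: "i = j + 1"
  have m: "mir (2 * n - j) = j + 1" "mir (j + 1) = 2 * n - j" using ij assms by (auto simp: mir_def)
  have ji: "j + 1 \<in> {1..n}" using assms ij by simp
  show "ivs (alt i j) = Gl (2 * n - j) \<union> Gd (2 * n - j)"
  proof (cases "i = n")
    case True
    then have "2 * n - j = n + 1" using ij by simp
    then show ?thesis using ivs_high_low(4)[OF assms(2) ji] True ij m Gl_flip[OF assms(2)]
      by (auto simp: alt_def Gd_def)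
  next
    case False
    then have "2 * n - j \<noteq> n" "2 * n - j \<noteq> n + 1" using ij assms by auto
    then show ?thesis using ivs_high_low(1)[OF assms(2) ji] False ij assms m Gl_flip[OF assms(2)]
      by (auto simp: alt_def Gd_def)
  qed
qed

lemma alt_W: "i \<in> {1..n} \<Longrightarrow> j \<in> {1..n} \<Longrightarrow> alt i j \<in> W"
  by (simp add: alt_def W_comp s_W)

text \<open>The generator \<open>s j\<close> accounts for two values of \<open>r\<close>, both with
  the parity of \<open>j\<close>: for \<open>r = j\<close> it is paired with the index below, and
  for \<open>r = 2 * n - j\<close> with the index above.\<close>

lemma gen_index:
  assumes "2 \<le> r" "r \<le> 2 * n - 1"
  obtains i j where "i \<in> {1..n}" "j \<in> {1..n}" "i = j + 1 \<or> j = i + 1" "even j = even r"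
    "ivs (s j) = Gl r" "ivs (alt i j) = Gl r \<union> Gd r"
proof (cases "r \<le> n")
  case True
  then have "r - 1 \<in> {1..n}" "r \<in> {1..n}" "r = (r - 1) + 1" using assms by auto
  then show thesis using that[of "r - 1" r] ivs_s ivs_alt(1) by blast
next
  case False
  then have r: "2 * n - r + 1 \<in> {1..n}" "2 * n - r \<in> {1..n}" "2 * n - (2 * n - r) = r" using assms by auto
  moreover have "even (2 * n - r) = even r" using assms by auto
  ultimately show thesis using that[of "2 * n - r + 1" "2 * n - r"] ivs_s[OF r(2)] ivs_alt(2)[OF r(1,2)] Gl_flip[OF r(2)] by auto
qed

lemma Gl_Gd_K: "2 \<le> r \<Longrightarrow> r \<le> 2 * n - 1 \<Longrightarrow> Gl r \<in> K \<and> Gl r \<union> Gd r \<in> K"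
  using gen_index ivs_K s_W alt_W by metis

section \<open>Braid relations and orders of products of generators\<close>

lemma braid3: assumes "i \<in> {1..n}" "i + 1 < n" shows "s i \<circ> s (i + 1) \<circ> s i = s (i + 1) \<circ> s i \<circ> s (i + 1)"
proof (rule ivs_inj)
  have i: "i + 1 \<in> {1..n}" using assms by auto
  show "s i \<circ> s (i + 1) \<circ> s i \<in> W" "s (i + 1) \<circ> s i \<circ> s (i + 1) \<in> W" using s_W W_comp assms i by auto
  show "ivs (s i \<circ> s (i + 1) \<circ> s i) = ivs (s (i + 1) \<circ> s i \<circ> s (i + 1))"
    using ivs_high_low(3)[OF assms(1) i assms(2)] ivs_low_high(3)[OF i] assms by (simp add: Un_commute)
qed

text \<open>As in \<open>braid3\<close>, the two words are compared through their inversion sets,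
  which determine the element.\<close>

lemma braid4: assumes "i \<in> {1..n}" "i + 1 = n"
  shows "s i \<circ> s (i + 1) \<circ> s i \<circ> s (i + 1) = s (i + 1) \<circ> s i \<circ> s (i + 1) \<circ> s i"
proof (rule ivs_inj)
  have i: "i + 1 \<in> {1..n}" using assms by auto
  show "s i \<circ> s (i + 1) \<circ> s i \<circ> s (i + 1) \<in> W" "s (i + 1) \<circ> s i \<circ> s (i + 1) \<circ> s i \<in> W"
    using s_W W_comp assms i by auto
  show "ivs (s i \<circ> s (i + 1) \<circ> s i \<circ> s (i + 1)) = ivs (s (i + 1) \<circ> s i \<circ> s (i + 1) \<circ> s i)"
    using ivs_high_low(5)[OF assms(1) i assms(2)] ivs_low_high(4)[OF i] assms by (simp add: Un_commute)
qed

lemma commute: assumes "i \<in> {1..n}" "j \<in> {1..n}" "i \<noteq> j" "i \<noteq> j + 1" "j \<noteq> i + 1"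
  shows "s i \<circ> s j = s j \<circ> s i"
proof (rule ivs_inj)
  have one: "ivs (s k \<circ> s l) = Gl k \<union> Gl l" if "k \<in> {1..n}" "l \<in> {1..n}" "k \<noteq> l" "k \<noteq> l + 1" "l \<noteq> k + 1" for k l
  proof -
    have "s k l = l" "s k (l + 1) = l + 1" using s_other[OF that(1)] that by auto
    moreover have "mir (l + 1) = mir l - 1" by (simp add: mir_def)
    ultimately show ?thesis using ivs_step'[OF s_W[OF that(1)] that(2), of l "l + 1"] ivs_s[OF that(1)]
      by (simp add: Gl_def)
  qed
  show "s i \<circ> s j \<in> W" "s j \<circ> s i \<in> W" using s_W W_comp assms by auto
  show "ivs (s i \<circ> s j) = ivs (s j \<circ> s i)" using one[of i j] one[of j i] assms by auto
qed

lemma s_cancel: "i \<in> {1..n} \<Longrightarrow> s i (s i v) = v"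
  using s_s pointfree_idE by metis

lemma ord_small:
  assumes "i \<in> {1..n}" "j \<in> {1..n}" "i \<noteq> j + 1" "j \<noteq> i + 1"
  shows "group.ord G (s i \<otimes>\<^bsub>G\<^esub> s j) \<le> 2"
proof -
  interpret group G by (rule group_G)
  have x: "s i \<circ> s j \<in> W" using s_W W_comp assms by auto
  have "(s i \<circ> s j) \<circ> (s i \<circ> s j) = id"
  proof (cases "i = j")
    case True then show ?thesis using s_s assms by simp
  next
    case False
    have "s i (s j v) = s j (s i v)" for v using commute[OF assms(1,2) False assms(3,4)] by (metis comp_apply)
    then show ?thesis using s_cancel assms by (intro ext) simp
  qed
  then have "(s i \<circ> s j) [^]\<^bsub>G\<^esub> (2 :: nat) = \<one>\<^bsub>G\<^esub>"
    by (simp add: numeral_2_eq_2 mult_G one_G comp_assoc)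
  then have "ord (s i \<circ> s j) dvd 2" using pow_eq_id[OF x] by blast
  then show ?thesis using dvd_imp_le by (simp add: mult_G)
qed

text \<open>The braid relation bounds the order from above. For \<open>m = 4\<close>, an order
  dividing 2 would make the generators commute, which their inversion sets refute.\<close>

lemma ord_adjacent:
  assumes "i \<in> {1..n}" "j \<in> {1..n}" "i = j + 1 \<or> j = i + 1"
  shows "group.ord G (s i \<otimes>\<^bsub>G\<^esub> s j) = (if i = n \<or> j = n then 4 else 3)"
proof -
  interpret group G by (rule group_G)
  let ?x = "s i \<circ> s j"
  have x: "?x \<in> W" using s_W W_comp assms by auto
  have ne: "?x \<noteq> id"
  proof
    assume "?x = id"
    then have "s i = s j" using s_cancel[OF assms(1)] by (metis comp_apply id_apply ext)
    then have "i = j" using inj_onD[OF inj_s] assms by blast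
    then show False using assms by auto
  qed
  show ?thesis
  proof (cases "i = n \<or> j = n")
    case False
    have b: "s i \<circ> s j \<circ> s i = s j \<circ> s i \<circ> s j" using assms False braid3[of i] braid3[of j] by auto
    have "s i (s j (s i (s j (s i (s j v))))) = v" for v
    proof -
      have "s i (s j (s i w)) = s j (s i (s j w))" for w using b by (metis comp_apply)
      then show ?thesis using s_cancel assms by metis
    qed
    then have "?x [^]\<^bsub>G\<^esub> (3 :: nat) = \<one>\<^bsub>G\<^esub>"
      by (simp add: numeral_3_eq_3 mult_G one_G) (rule ext, simp)
    then have "ord ?x dvd 3" using pow_eq_id[OF x] by blast
    moreover have "ord ?x \<noteq> 1" using ord_eq_1[OF x] ne one_G by simp
    moreover have "ord ?x \<noteq> 0" "ord ?x \<noteq> 2" using \<open>ord ?x dvd 3\<close> dvd_pos_nat[of 3 "ord ?x"] by auto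
    moreover have "ord ?x \<le> 3" using \<open>ord ?x dvd 3\<close> dvd_imp_le[of "ord ?x" 3] by simp
    ultimately have "ord ?x = 3" by linarith
    then show ?thesis using False by (simp add: mult_G)
  next
    case True
    have b: "s i \<circ> s j \<circ> s i \<circ> s j = s j \<circ> s i \<circ> s j \<circ> s i" using assms True braid4[of i] braid4[of j] by auto
    have "s i (s j (s i (s j (s i (s j (s i (s j v))))))) = v" for v
    proof -
      have "s i (s j (s i (s j w))) = s j (s i (s j (s i w)))" for w using b by (metis comp_apply)
      then show ?thesis using s_cancel assms by metis
    qed
    then have "?x [^]\<^bsub>G\<^esub> (4 :: nat) = \<one>\<^bsub>G\<^esub>"
      by (simp add: eval_nat_numeral mult_G one_G) (rule ext, simp)
    then have d: "ord ?x dvd 4" using pow_eq_id[OF x] by blast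
    have "?x [^]\<^bsub>G\<^esub> (2 :: nat) \<noteq> \<one>\<^bsub>G\<^esub>"
    proof
      assume "?x [^]\<^bsub>G\<^esub> (2 :: nat) = \<one>\<^bsub>G\<^esub>"
      then have "?x \<circ> ?x = id" by (simp add: numeral_2_eq_2 mult_G one_G)
      then have sq: "s i (s j (s i (s j v))) = v" for v by (metis comp_apply id_apply)
      have "s i (s j v) = s j (s i v)" for v
        using sq[of "s j (s i v)"] s_cancel assms by metis
      then have c: "s i \<circ> s j = s j \<circ> s i" by auto
      define k where "k = n - 1"
      have k: "k \<in> {1..n}" "k + 1 = n" "k + 1 \<in> {1..n}" using assms True by (auto simp: k_def)
      have "s k \<circ> s (k + 1) = s (k + 1) \<circ> s k" using c assms True k by auto
      then have "Gl k \<union> {(n - 1, n + 2)} = Gl (k + 1) \<union> {(k, k + 1 + 1), (mir (k + 1) - 1, mir (k + 1) + 1)}"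
        using ivs_high_low(2)[OF k(1,3,2)] ivs_low_high(1)[OF k(3)] k by simp
      moreover have "(k + 1, k + 2) \<in> Gl (k + 1)" by (auto simp: Gl_def)
      ultimately have "(k + 1, k + 2) \<in> Gl k \<union> {(n - 1, n + 2)}" by blast
      then show False using k by (auto simp: Gl_def mir_def)
    qed
    then have "\<not> ord ?x dvd 2" using pow_eq_id[OF x] by blast
    then have "ord ?x \<noteq> 1" "ord ?x \<noteq> 2" by auto
    moreover have "ord ?x \<noteq> 0" "ord ?x \<noteq> 3" using d dvd_pos_nat[of 4 "ord ?x"] by auto
    moreover have "ord ?x \<le> 4" using d dvd_imp_le[of "ord ?x" 4] by simp
    ultimately have "ord ?x = 4" by linarith
    then show ?thesis using True by (simp add: mult_G)
  qed
qed

lemma generators_cx: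
  "cambrian_generators G S (cx e) =
    {(s j, alt i j) | i j. i \<in> {1..n} \<and> j \<in> {1..n} \<and> (i = j + 1 \<or> j = i + 1) \<and> even i = e}"
proof -
  have w: "word_prod G (alternating_word (s j) (s i) (group.ord G (s i \<otimes>\<^bsub>G\<^esub> s j) - 1)) = alt i j"
    if "i \<in> {1..n}" "j \<in> {1..n}" "i = j + 1 \<or> j = i + 1" for i j
    using ord_adjacent[OF that] by (simp add: alternating_word_def alt_def word_prod_def mult_G one_G eval_nat_numeral comp_assoc)
  have "\<exists>i j. (x, y) = (s j, alt i j) \<and> i \<in> {1..n} \<and> j \<in> {1..n} \<and> (i = j + 1 \<or> j = i + 1) \<and> even i = e"
    if xy: "(x, y) \<in> cambrian_generators G S (cx e)" for x y
  proof -
    obtain i j where ij: "i \<in> {1..n}" "j \<in> {1..n}" "group.ord G (s i \<otimes>\<^bsub>G\<^esub> s j) \<ge> 3"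
      "precedes G S (cx e) (s i) (s j)" "x = s j"
      "y = word_prod G (alternating_word (s j) (s i) (group.ord G (s i \<otimes>\<^bsub>G\<^esub> s j) - 1))"
      using xy unfolding cambrian_generators_def type_B_simples_def by blast
    have adj: "i = j + 1 \<or> j = i + 1" using ord_small[OF ij(1,2)] ij(3) by linarith
    then show ?thesis using precedes_cx[OF ij(1,2)] ij w by blast
  qed
  moreover have "(s j, alt i j) \<in> cambrian_generators G S (cx e)"
    if ij: "i \<in> {1..n}" "j \<in> {1..n}" "i = j + 1 \<or> j = i + 1" "even i = e" for i j
  proof -
    have "group.ord G (s i \<otimes>\<^bsub>G\<^esub> s j) \<ge> 3" using ord_adjacent[OF ij(1-3)] by simp
    moreover have "precedes G S (cx e) (s i) (s j)" using precedes_cx[OF ij(1-3)] ij(4) by blast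
    moreover have "s i \<in> S" "s j \<in> S" using ij by (auto simp: type_B_simples_def)
    ultimately show ?thesis unfolding cambrian_generators_def using w[OF ij(1-3)] by force
  qed
  ultimately have "(x, y) \<in> cambrian_generators G S (cx e) \<longleftrightarrow>
      (\<exists>i j. (x, y) = (s j, alt i j) \<and> i \<in> {1..n} \<and> j \<in> {1..n} \<and> (i = j + 1 \<or> j = i + 1) \<and> even i = e)" for x y
    by blast
  then show ?thesis by auto
qed

text \<open>For each pair of \<open>Gd r\<close>, the rectangle of type \<open>e\<close> contains
  two neighbouring values that are not inverted, since this type passes \<open>r\<close> on the
  other side. Hence adding \<open>Gd r\<close> puts no new arc below.\<close>

lemma As_Gl:
  assumes r: "2 \<le> r" "r \<le> 2 * n - 1" "r \<notin> rt e"
  shows "As e (Gl r) = As e (Gl r \<union> Gd r)"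
proof
  show "As e (Gl r) \<subseteq> As e (Gl r \<union> Gd r)" by (rule As_mono) auto
  show "As e (Gl r \<union> Gd r) \<subseteq> As e (Gl r)"
  proof (rule subrelI)
    fix p q assume h: "(p, q) \<in> As e (Gl r \<union> Gd r)"
    then have pq: "(p, q) \<in> Gl r \<union> Gd r" "(p, q) \<in> pairs" "rectS (rt e) p q \<subseteq> Gl r \<union> Gd r"
      using As_subset[of e "Gl r \<union> Gd r"] by (auto simp: As_def)
    have m: "mir r + r = 2 * n + 1" "mir r \<noteq> r" "mir r \<in> rt e" using r mir_ne[of r] rt_mir[of r e] by (auto simp: mir_def)
    have d1: "d = c + 1 \<longrightarrow> c = r \<or> c = mir r - 1" if "(c, d) \<in> Gl r \<union> Gd r" for c d
      using that r m by (auto simp: Gl_def Gd_def split: if_splits)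
    have no: "(r - 1, r) \<notin> Gl r \<union> Gd r" "(mir r, mir r + 1) \<notin> Gl r \<union> Gd r"
      using d1[of "r - 1" r] d1[of "mir r" "mir r + 1"] r m by auto
    have "(p, q) \<in> Gl r"
    proof (rule ccontr)
      assume "(p, q) \<notin> Gl r"
      then consider "(p, q) = (r - 1, r + 1)" | "(p, q) = (mir r - 1, mir r + 1)"
        | "(p, q) = (n - 1, n + 2)" "r = n" | "(p, q) = (n - 1, n + 2)" "r = n + 1"
        using pq by (auto simp: Gd_def split: if_splits)
      then show False
      proof cases
        case 1
        then have "(r - 1, r) \<in> rectS (rt e) p q" using r by (auto simp: rectS_def)
        then show False using pq no by blast
      next
        case 2
        then have "(mir r, mir r + 1) \<in> rectS (rt e) p q" using m by (auto simp: rectS_def)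
        then show False using pq no by blast
      next
        case 3
        then have "(r - 1, r) \<in> rectS (rt e) p q" using r by (auto simp: rectS_def)
        then show False using pq no by blast
      next
        case 4
        then have "n \<in> rt e" "p = n - 1" "q = n + 2" "n + 1 \<notin> rt e" using m r by auto
        then have "(n, n + 1) \<in> rectS (rt e) p q" by (simp add: rectS_def)
        then have "(n, n + 1) \<in> Gl r \<union> Gd r" using pq by blast
        then show False using d1[of n "n + 1"] 4 m n_pos by auto
      qed
    qed
    then have "q = p + 1" using r m by (auto simp: Gl_def)
    then have "rectS (rt e) p q = {(p, q)}" by (auto simp: rectS_def)
    then show "(p, q) \<in> As e (Gl r)" using \<open>(p, q) \<in> Gl r\<close> pq by (auto simp: As_def)
  qed
qed

lemma generators_theta: "cambrian_generators G S (cx e) \<subseteq> theta e"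
proof
  fix z assume "z \<in> cambrian_generators G S (cx e)"
  then obtain i j where ij: "i \<in> {1..n}" "j \<in> {1..n}" "i = j + 1 \<or> j = i + 1" "even i = e"
    and z: "z = (s j, alt i j)" unfolding generators_cx by blast
  obtain r where r: "2 \<le> r" "r \<le> 2 * n - 1" "even r = even j" "ivs (s j) = Gl r" "ivs (alt i j) = Gl r \<union> Gd r"
  proof (cases "j = i + 1")
    case True
    then show thesis using that[of j] ivs_s[OF ij(2)] ivs_alt(1)[OF ij(1,2)] ij by auto
  next
    case False
    then have "i = j + 1" using ij by simp
    moreover have "even (2 * n - j) = even j" "2 \<le> 2 * n - j" using ij \<open>i = j + 1\<close> by auto
    ultimately show thesis using that[of "2 * n - j"] ivs_s[OF ij(2)] ivs_alt(2)[OF ij(1,2)] Gl_flip[OF ij(2)] ij by auto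
  qed
  have "r \<notin> rt e" using r ij by (auto simp: rt_def)
  then have "As e (Gl r) = As e (Gl r \<union> Gd r)" by (rule As_Gl[OF r(1,2)])
  then show "z \<in> theta e" using r s_W alt_W ij z by (simp add: theta_def)
qed

text \<open>Inside a class the larger element is lowered one cover at a time: a descent of
  \<open>x\<close> not inverted in \<open>y\<close> is no arc below \<open>x\<close>, so
  \<open>collapse_bad\<close> applies. Arbitrary related elements are compared through their
  meet.\<close>

lemma theta_least:
  assumes c: "lattice_congruence L \<theta>" and g: "cambrian_generators G S (cx e) \<subseteq> \<theta>"
  shows "theta e \<subseteq> \<theta>"
proof -
  have eq: "equiv W \<theta>" using c unfolding lattice_congruence_def carrier_L by blast
  have refl: "(x, x) \<in> \<theta>" if "x \<in> W" for x using eq that by (meson equivE refl_onD)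
  have sym: "(y, x) \<in> \<theta>" if "(x, y) \<in> \<theta>" for x y using eq that by (meson equivE symD)
  have trans: "(x, z) \<in> \<theta>" if "(x, y) \<in> \<theta>" "(y, z) \<in> \<theta>" for x y z using eq that by (meson equivE transD)
  have sub0: "x \<in> W \<and> y \<in> W" if "(x, y) \<in> \<theta>" for x y using equiv_type[OF eq] that by blast
  note sub = conjunct1[OF sub0] conjunct2[OF sub0]
  \<comment> \<open>The congruence is moved to inversion sets, where the collapsing results live;
    \<open>lift\<close> moves it back.\<close>
  define Th where "Th = {(ivs x, ivs y) | x y. (x, y) \<in> \<theta>}"
  have lift: "(x, y) \<in> \<theta>" if xy: "(ivs x, ivs y) \<in> Th" "x \<in> W" "y \<in> W" for x y
  proof -
    obtain x' y' where h: "(x', y') \<in> \<theta>" "ivs x = ivs x'" "ivs y = ivs y'"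
      using xy(1) unfolding Th_def by blast
    have "x = x'" using ivs_inj[OF xy(2) _ h(2)] sub[OF h(1)] by blast
    moreover have "y = y'" using ivs_inj[OF xy(3) _ h(3)] sub[OF h(1)] by blast
    ultimately show ?thesis using h(1) by simp
  qed
  have cong: "cong Th" unfolding cong_def
  proof (intro conjI allI impI)
    show "equiv K Th"
    proof (rule equivI)
      show "Th \<subseteq> K \<times> K" unfolding Th_def using sub ivs_K by blast
      show "refl_on K Th"
      proof (rule refl_onI)
        fix T assume "T \<in> K"
        then obtain x where "x \<in> W" "ivs x = T" using realize by blast
        then show "(T, T) \<in> Th" unfolding Th_def using refl[of x] by blast
      qed
      show "Relation.sym Th"
      proof (rule symI)
        fix I J assume "(I, J) \<in> Th"
        then show "(J, I) \<in> Th" unfolding Th_def using sym by blast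
      qed
      show "Relation.trans Th"
      proof (rule transI)
        fix I J M assume "(I, J) \<in> Th" "(J, M) \<in> Th"
        then obtain x y y' z where h: "(x, y) \<in> \<theta>" "(y', z) \<in> \<theta>" "I = ivs x" "M = ivs z" "ivs y = ivs y'"
          unfolding Th_def by blast
        have "y = y'" using ivs_inj[OF _ _ h(5)] sub[OF h(1)] sub[OF h(2)] by blast
        then have "(x, z) \<in> \<theta>" using trans h(1,2) by blast
        then show "(I, M) \<in> Th" using h(3,4) unfolding Th_def by blast
      qed
    qed
  next
    fix I J T assume IJ: "(I, J) \<in> Th" and T: "T \<in> K"
    then obtain x y where xy: "(x, y) \<in> \<theta>" "I = ivs x" "J = ivs y" unfolding Th_def by blast
    obtain t where t: "t \<in> W" "ivs t = T" using realize T by blast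
    have "(x \<squnion>\<^bsub>L\<^esub> t, y \<squnion>\<^bsub>L\<^esub> t) \<in> \<theta>" "(x \<sqinter>\<^bsub>L\<^esub> t, y \<sqinter>\<^bsub>L\<^esub> t) \<in> \<theta>"
      using c xy refl[OF t(1)] unfolding lattice_congruence_def by blast+
    then have "(ivs (x \<squnion>\<^bsub>L\<^esub> t), ivs (y \<squnion>\<^bsub>L\<^esub> t)) \<in> Th" "(ivs (x \<sqinter>\<^bsub>L\<^esub> t), ivs (y \<sqinter>\<^bsub>L\<^esub> t)) \<in> Th"
      unfolding Th_def by blast+
    then show "(jn I T, jn J T) \<in> Th" "(mt I T, mt J T) \<in> Th"
      using join_L(2) meet_L(2) sub[OF xy(1)] t xy by auto
  qed
  have gens: "gen Th r" if r: "2 \<le> r" "r \<le> 2 * n - 1" "r \<notin> rt e" for r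
  proof -
    obtain i j where ij: "i \<in> {1..n}" "j \<in> {1..n}" "i = j + 1 \<or> j = i + 1" "even j = even r"
      "ivs (s j) = Gl r" "ivs (alt i j) = Gl r \<union> Gd r" using gen_index[OF r(1,2)] by blast
    have "even i = e" using ij r by (auto simp: rt_def)
    then have "(s j, alt i j) \<in> \<theta>" using g ij unfolding generators_cx by blast
    then have "(ivs (s j), ivs (alt i j)) \<in> Th" unfolding Th_def by blast
    then show ?thesis unfolding gen_def ij(5,6) .
  qed
  have below: "(y, x) \<in> \<theta>" if "x \<in> W" "y \<in> W" "ivs y \<subseteq> ivs x" "As e (ivs y) = As e (ivs x)" for x y
    using that
  proof (induction "card (ivs x - ivs y)" arbitrary: x rule: less_induct)
    case (less x)
    show ?case
    proof (cases "ivs y = ivs x")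
      case True then show ?thesis using ivs_inj less.prems refl by blast
    next
      case False
      then have "ivs y \<subset> ivs x" using less.prems(3) by (rule psubsetI[rotated])
      then obtain p q where pq: "adj x q p" "p < q" "(p, q) \<in> ivs x" "(p, q) \<notin> ivs y"
        using ex_adj_descent[OF less.prems(2,1)] by metis
      obtain x' where x': "x' \<in> W" "ivs x' = ivs x - {(p, q), (mir q, mir p)}"
        using adj_descent[OF less.prems(1) pq(1,2)] by blast
      have r: "p \<in> {1..2 * n}" "q \<in> {1..2 * n}" "pos x p = pos x q + 1" using pq(1) by (auto simp: adj_def)
      have "(p, v) \<in> ivs x \<longleftrightarrow> (v, q) \<notin> ivs x" if v: "p < v" "v < q" for v
      proof -
        have "pos x v \<noteq> pos x p" "pos x v \<noteq> pos x q" using pos_eq_iff[OF less.prems(1)] v by auto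
        then show ?thesis using v r by (auto simp: ivs_iff)
      qed
      then have cv: "cover (ivs x') (ivs x) p q"
        unfolding cover_def using ivs_K x' less.prems(1) pq by blast
      have bad: "(p, q) \<notin> As e (ivs x)" using pq less.prems(4) As_subset by blast
      have "(ivs x', ivs x) \<in> Th"
        using collapse_bad[OF cong gens Gl_Gd_K cv bad] by blast
      then have 1: "(x', x) \<in> \<theta>" using lift x' less.prems by blast
      have "(mir q, mir p) \<notin> ivs y" using K_mir_iff[OF ivs_K[OF less.prems(2)], of p q] pq r by auto
      then have yx: "ivs y \<subseteq> ivs x'" using less.prems(3) pq x' by auto
      have "As e (ivs y) = As e (ivs x')"
        using As_mono[OF yx, of e] As_mono[of "ivs x'" "ivs x" e] x' less.prems(4) by blast
      moreover have "card (ivs x' - ivs y) < card (ivs x - ivs y)"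
        by (rule psubset_card_mono) (use finite_ivs pq x' in auto)
      ultimately have "(y, x') \<in> \<theta>" using less.hyps x' less.prems yx by blast
      then show ?thesis using 1 trans by blast
    qed
  qed
  show ?thesis
  proof (rule subrelI)
    fix x y assume "(x, y) \<in> theta e"
    then have xy: "x \<in> W" "y \<in> W" "As e (ivs x) = As e (ivs y)" by (auto simp: theta_def)
    obtain z where z: "z \<in> W" "ivs z = mt (ivs x) (ivs y)" using realize mt_K ivs_K xy by metis
    have "ivs z \<subseteq> ivs x" "ivs z \<subseteq> ivs y" using mt_lower ivs_K xy z by auto
    moreover have "As e (ivs z) = As e (ivs x)" "As e (ivs z) = As e (ivs y)"
      using As_mt[OF ivs_K[OF xy(1)] ivs_K[OF xy(2)]] xy z by auto
    ultimately have "(z, x) \<in> \<theta>" "(z, y) \<in> \<theta>" using below z xy by auto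
    then show "(x, y) \<in> \<theta>" using sym trans by blast
  qed
qed

lemma cambrian_cx: "cambrian_congruence G S (cx e) = theta e"
proof -
  have L: "weak_order G S = L" by (simp add: weak_order_B_def)
  show ?thesis unfolding cambrian_congruence_def L
    using theta_congruence generators_theta theta_least by blast
qed

lemma bicambrian_c: "bicambrian_congruence G S c = theta True \<inter> theta False"
  using cambrian_cx[of True] cambrian_cx[of False] by (simp add: bicambrian_congruence_def cx_def)

section \<open>The lattice of class minima\<close>

definition below :: "(nat \<Rightarrow> nat) \<Rightarrow> ((nat \<times> nat) \<times> bool) set" where
  "below x = {((p, q), e). (p, q) \<in> As e (ivs x)}"
definition above :: "(nat \<Rightarrow> nat) \<Rightarrow> ((nat \<times> nat) \<times> bool) set" where
  "above x = {((p, q), e). (p, q) \<in> Bs e (ivs x)}"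
text \<open>
  An arc and its mirror image label the same covers, and the type is irrelevant for an arc that passes no point.
\<close>

definition same_label :: "(nat \<times> nat) \<times> bool \<Rightarrow> (nat \<times> nat) \<times> bool \<Rightarrow> bool" where
  "same_label = (\<lambda>((p, q), e) (pq', e'). (pq' = (p, q) \<or> pq' = (mir q, mir p)) \<and> (e = e' \<or> q = p + 1))"
definition minima :: "(nat \<Rightarrow> nat) set" where
  "minima = {x \<in> W. \<forall>y \<in> W. below y = below x \<longrightarrow> ivs x \<subseteq> ivs y}"

abbreviation BL where "BL \<equiv> bicambrian_lattice_B n"

lemma in_below: "((p, q), e) \<in> below x \<longleftrightarrow> (p, q) \<in> As e (ivs x)" and in_above: "((p, q), e) \<in> above x \<longleftrightarrow> (p, q) \<in> Bs e (ivs x)"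
  by (simp_all add: below_def above_def)

lemma below_sub_iff: "below x \<subseteq> below y \<longleftrightarrow> (\<forall>e. As e (ivs x) \<subseteq> As e (ivs y))" and above_sub_iff: "above x \<subseteq> above y \<longleftrightarrow> (\<forall>e. Bs e (ivs x) \<subseteq> Bs e (ivs y))"
  by (auto simp: below_def above_def)

lemma below_subset_iff_above: "x \<in> W \<Longrightarrow> y \<in> W \<Longrightarrow> below x \<subseteq> below y \<longleftrightarrow> above y \<subseteq> above x"
  unfolding below_sub_iff above_sub_iff using As_Bs_subset[OF ivs_K ivs_K] by blast

lemma below_eq_iff_above_eq: "x \<in> W \<Longrightarrow> y \<in> W \<Longrightarrow> below x = below y \<longleftrightarrow> above x = above y"
  using below_subset_iff_above[of x y] below_subset_iff_above[of y x] by blast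

lemma below_mono: "ivs x \<subseteq> ivs y \<Longrightarrow> below x \<subseteq> below y"
  unfolding below_sub_iff using As_mono by blast

lemma below_meet: assumes "x \<in> W" "y \<in> W"
  obtains z where "z \<in> W" "below z = below x \<inter> below y" "ivs z \<subseteq> ivs x" "ivs z \<subseteq> ivs y"
proof -
  note K = ivs_K[OF assms(1)] ivs_K[OF assms(2)]
  obtain z where z: "z \<in> W" "ivs z = mt (ivs x) (ivs y)" using realize[OF mt_K[OF K]] by blast
  have "below z = below x \<inter> below y" unfolding below_def z(2) As_mt[OF K] by auto
  then show thesis using that z mt_lower[OF K] by auto
qed

lemma above_join: assumes "x \<in> W" "y \<in> W"
  obtains z where "z \<in> W" "above z = above x \<inter> above y" "ivs x \<subseteq> ivs z" "ivs y \<subseteq> ivs z"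
proof -
  note K = ivs_K[OF assms(1)] ivs_K[OF assms(2)]
  obtain z where z: "z \<in> W" "ivs z = jn (ivs x) (ivs y)" using realize[OF jn_K[OF K]] by blast
  have "above z = above x \<inter> above y" unfolding above_def z(2) Bs_jn[OF K] by auto
  then show thesis using that z jn_upper by auto
qed

lemma below_above_ivs: "((p, q), e) \<in> below y \<Longrightarrow> ((p, q), e) \<in> above x \<Longrightarrow> (p, q) \<in> ivs y \<and> (p, q) \<notin> ivs x"
  unfolding in_below in_above using As_subset Bs_disj by blast

lemma below_above_disj: "l \<in> below x \<Longrightarrow> l \<in> above x \<Longrightarrow> False"
  using below_above_ivs by (metis surj_pair)

lemma below_mir: "x \<in> W \<Longrightarrow> ((p, q), e) \<in> below x \<Longrightarrow> ((mir q, mir p), e) \<in> below x"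
  and above_mir: "x \<in> W \<Longrightarrow> ((p, q), e) \<in> above x \<Longrightarrow> ((mir q, mir p), e) \<in> above x"
  using As_mir Bs_mir ivs_K by (auto simp: in_below in_above)

lemma below_above_sep: assumes "x \<in> W" "\<not> below y \<subseteq> below x" obtains l where "l \<in> below y" "l \<in> above x"
proof -
  obtain e where "\<not> As e (ivs y) \<subseteq> As e (ivs x)" using assms(2) below_sub_iff by blast
  then obtain p q where "(p, q) \<in> As e (ivs y)" "(p, q) \<in> Bs e (ivs x)" by (rule As_Bs_sep[OF ivs_K[OF assms(1)]])
  then show thesis using that[of "((p, q), e)"] by (simp add: in_below in_above)
qed

lemma minima_W: "x \<in> minima \<Longrightarrow> x \<in> W" by (simp add: minima_def)

text \<open>The meet of two elements of a class stays in the class, so an element with fewest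
  inversions is below all others.\<close>

lemma class_min: assumes x: "x \<in> W" obtains m where "m \<in> minima" "below m = below x" "ivs m \<subseteq> ivs x"
proof -
  obtain m where m: "m \<in> W \<and> below m = below x" "\<And>y. y \<in> W \<and> below y = below x \<Longrightarrow> card (ivs m) \<le> card (ivs y)"
    using ex_has_least_nat[of "\<lambda>y. y \<in> W \<and> below y = below x" x "\<lambda>y. card (ivs y)"] x by blast
  have sub: "ivs m \<subseteq> ivs y" if y: "y \<in> W" "below y = below x" for y
  proof -
    obtain z where z: "z \<in> W" "below z = below m \<inter> below y" "ivs z \<subseteq> ivs m" "ivs z \<subseteq> ivs y" using below_meet m(1) y(1) by blast
    then have "card (ivs m) \<le> card (ivs z)" using m y by simp
    then have "ivs z = ivs m" using z(3) finite_ivs card_seteq by blast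
    then show ?thesis using z(4) by simp
  qed
  then have "m \<in> minima" using m(1) by (simp add: minima_def)
  then show thesis using that m(1) sub[of x] x by blast
qed

text \<open>Stronger than being the largest of its class: any element with no further labels is
  dominated too, because joining it does not leave the class.\<close>

lemma class_max: assumes x: "x \<in> W" obtains m where "m \<in> W" "below m = below x" "\<And>y. y \<in> W \<Longrightarrow> below y \<subseteq> below x \<Longrightarrow> ivs y \<subseteq> ivs m"
proof -
  have fin: "finite ((\<lambda>y. card (ivs y)) ` W)" using finite_W by simp
  have bd: "\<forall>y. y \<in> W \<and> below y = below x \<longrightarrow> card (ivs y) < Suc (Max ((\<lambda>y. card (ivs y)) ` W))"
    using Max_ge[OF fin] by (auto simp: less_Suc_eq_le)
  obtain m where m: "m \<in> W \<and> below m = below x" "\<And>y. y \<in> W \<and> below y = below x \<Longrightarrow> card (ivs y) \<le> card (ivs m)"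
    using ex_has_greatest_nat[of "\<lambda>y. y \<in> W \<and> below y = below x" x, OF _ bd] x by blast
  have "ivs y \<subseteq> ivs m" if y: "y \<in> W" "below y \<subseteq> below x" for y
  proof -
    obtain z where z: "z \<in> W" "above z = above m \<inter> above y" "ivs m \<subseteq> ivs z" "ivs y \<subseteq> ivs z" using above_join m(1) y(1) by blast
    have "above m \<subseteq> above y" using below_subset_iff_above[of y m] y m(1) by simp
    then have "below z = below x" using z below_eq_iff_above_eq[of z m] m(1) by auto
    then have "card (ivs z) \<le> card (ivs m)" using m z(1) by simp
    then have "ivs m = ivs z" using z(3) finite_ivs card_seteq by blast
    then show ?thesis using z(4) by simp
  qed
  then show thesis using that m(1) by blast
qed

lemma minima_least: assumes "x \<in> minima" "y \<in> W" "below x \<subseteq> below y" shows "ivs x \<subseteq> ivs y"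
proof -
  obtain z where z: "z \<in> W" "below z = below x \<inter> below y" "ivs z \<subseteq> ivs x" "ivs z \<subseteq> ivs y" using below_meet minima_W assms by blast
  then have "below z = below x" using assms by auto
  then show ?thesis using assms(1) z unfolding minima_def by blast
qed

lemma minima_inj: "x \<in> minima \<Longrightarrow> y \<in> minima \<Longrightarrow> below x = below y \<Longrightarrow> x = y"
  using minima_least[of x y] minima_least[of y x] minima_W ivs_inj by blast

lemma class_c: assumes x: "x \<in> W" shows "bicambrian_congruence G S c `` {x} = {y \<in> W. below y = below x}"
proof -
  have "below y = below x \<longleftrightarrow> (\<forall>e. As e (ivs x) = As e (ivs y))" for y
    using below_sub_iff[of x y] below_sub_iff[of y x] by auto
  then show ?thesis using x unfolding bicambrian_c theta_def by (auto simp: all_bool_eq)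
qed

lemma pi_down_min: assumes x: "x \<in> W" and m: "m \<in> minima" "below m = below x" shows "pi_down_B n x = m"
proof -
  have L: "weak_order G S = L" by (simp add: weak_order_B_def)
  have mW: "m \<in> W" using m minima_W by blast
  have 1: "least L m {y \<in> W. below y = below x}"
    unfolding least_def using m mW carrier_L le_L by (auto simp: minima_def)
  have 2: "k = m" if "least L k {y \<in> W. below y = below x}" for k
  proof -
    have k: "k \<in> W" "below k = below x" "k \<sqsubseteq>\<^bsub>L\<^esub> m" using that m mW unfolding least_def by auto
    then have "ivs k \<subseteq> ivs m" using le_L[OF mW] by blast
    moreover have "ivs m \<subseteq> ivs k" using minima_least[OF m(1) k(1)] m k by simp
    ultimately show ?thesis using ivs_inj k(1) mW by blast
  qed
  show ?thesis unfolding pi_down_B_def pi_down_def L class_c[OF x] using 1 2 by (rule the_equality)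
qed

lemma pi_down_image: "pi_down_B n ` W = minima"
proof
  show "pi_down_B n ` W \<subseteq> minima" using class_min pi_down_min by (metis image_subsetI)
  show "minima \<subseteq> pi_down_B n ` W"
  proof
    fix x assume "x \<in> minima"
    then have "pi_down_B n x = x" "x \<in> W" using pi_down_min[of x x] minima_W by auto
    then show "x \<in> pi_down_B n ` W" by force
  qed
qed

lemma carrier_BL: "carrier BL = minima" by (simp add: bicambrian_lattice_B_def pi_down_image)

lemma le_BL: assumes "x \<in> minima" "y \<in> minima" shows "x \<sqsubseteq>\<^bsub>BL\<^esub> y \<longleftrightarrow> below x \<subseteq> below y"
proof -
  have "x \<sqsubseteq>\<^bsub>BL\<^esub> y \<longleftrightarrow> x \<sqsubseteq>\<^bsub>L\<^esub> y" by (simp add: bicambrian_lattice_B_def)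
  also have "\<dots> \<longleftrightarrow> ivs x \<subseteq> ivs y" using le_L[OF minima_W[OF assms(2)]] minima_W[OF assms(1)] by simp
  also have "\<dots> \<longleftrightarrow> below x \<subseteq> below y" using below_mono minima_least[OF assms(1) minima_W[OF assms(2)]] by blast
  finally show ?thesis .
qed

lemma eq_BL: "x .=\<^bsub>BL\<^esub> y \<longleftrightarrow> x = y"
  using eq_L by (simp add: bicambrian_lattice_B_def)

section \<open>Covers in the lattice of minima and their labels\<close>

lemma covers_BL:
  assumes "covers BL x y"
  shows "x \<in> minima" "y \<in> minima" "below x \<subseteq> below y" "below x \<noteq> below y"
    "\<And>z. z \<in> W \<Longrightarrow> below x \<subseteq> below z \<Longrightarrow> below z \<subseteq> below y \<Longrightarrow> below z = below x \<or> below z = below y"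
proof -
  show L: "x \<in> minima" "y \<in> minima" using assms by (auto simp: covers_def carrier_BL)
  show "below x \<subseteq> below y" "below x \<noteq> below y"
    using assms le_BL[OF L] minima_inj[OF L] by (auto simp: covers_def lless_def eq_BL)
  show "below z = below x \<or> below z = below y" if z: "z \<in> W" "below x \<subseteq> below z" "below z \<subseteq> below y" for z
  proof -
    obtain m where m: "m \<in> minima" "below m = below z" by (rule class_min[OF z(1)])
    have "\<not> (x \<sqsubset>\<^bsub>BL\<^esub> m \<and> m \<sqsubset>\<^bsub>BL\<^esub> y)" using assms m by (auto simp: covers_def carrier_BL)
    moreover have "x \<sqsubseteq>\<^bsub>BL\<^esub> m" "m \<sqsubseteq>\<^bsub>BL\<^esub> y" using le_BL L m z by auto
    ultimately show ?thesis using m by (auto simp: lless_def eq_BL)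
  qed
qed

lemma coversI_BL:
  assumes L: "x \<in> minima" "y \<in> minima" and "below x \<subseteq> below y" "below x \<noteq> below y"
    "\<And>z. z \<in> minima \<Longrightarrow> below x \<subseteq> below z \<Longrightarrow> below z \<subseteq> below y \<Longrightarrow> below z = below x \<or> below z = below y"
  shows "covers BL x y"
  unfolding covers_def carrier_BL lless_def eq_BL
proof (intro conjI notI; (elim bexE conjE)?)
  fix z assume "z \<in> minima" "x \<sqsubseteq>\<^bsub>BL\<^esub> z" "x \<noteq> z" "z \<sqsubseteq>\<^bsub>BL\<^esub> y" "z \<noteq> y"
  then show False using assms(5)[of z] le_BL L minima_inj by metis
qed (use assms le_BL in auto)

lemma falls_As:
  assumes x: "x \<in> W" and r: "1 \<le> p" "q \<le> 2 * n"
  shows "(p, q) \<in> As e (ivs x) \<longleftrightarrow> falls (pos x) e p q"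
  unfolding As_def falls_def rectS_def rt_def pairs_def ivs_def using r by auto

lemma rises_Bs:
  assumes x: "x \<in> W" and r: "1 \<le> p" "q \<le> 2 * n"
  shows "(p, q) \<in> Bs e (ivs x) \<longleftrightarrow> rises (pos x) e p q"
proof -
  have "(p, q) \<in> Bs e (ivs x) \<longleftrightarrow> p < q \<and> (\<forall>a b. p \<le> a \<longrightarrow> a < b \<longrightarrow> b \<le> q \<longrightarrow>
      (a = p \<or> even a \<noteq> e) \<longrightarrow> (b = q \<or> even b = e) \<longrightarrow> (a, b) \<notin> ivs x)"
  proof -
    have "(a, b) \<in> rectS (rt (\<not> e)) p q \<longleftrightarrow> p \<le> a \<and> a < b \<and> b \<le> q \<and> (a = p \<or> even a \<noteq> e) \<and> (b = q \<or> even b = e)" for a b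
      by (auto simp: rectS_def rt_def)
    moreover have "(p, q) \<in> Bs e (ivs x) \<longleftrightarrow> p < q \<and> (\<forall>a b. (a, b) \<in> rectS (rt (\<not> e)) p q \<longrightarrow> (a, b) \<notin> ivs x)"
      using r by (simp add: Bs_def pairs_def) auto
    ultimately show ?thesis by (simp add: imp_conjL)
  qed
  also have "\<dots> \<longleftrightarrow> rises (pos x) e p q"
  proof -
    have "(a, b) \<notin> ivs x \<longleftrightarrow> pos x a < pos x b" if "p \<le> a" "a < b" "b \<le> q" for a b
    proof -
      have "pos x a \<noteq> pos x b" using pos_eq_iff[OF x, of a b] that by auto
      then show ?thesis using that r by (auto simp: ivs_iff)
    qed
    then show ?thesis unfolding rises_def by (simp cong: imp_cong)
  qed
  finally show ?thesis .
qed

lemma pos_inj: "x \<in> W \<Longrightarrow> inj_on (pos x) {1..2 * n}"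
  using pos_eq_iff by (auto simp: inj_on_def)

lemma nxt_adj: assumes x: "x \<in> W" shows "nxt (pos x) (2 * n) a b \<longleftrightarrow> adj x a b"
proof
  assume "nxt (pos x) (2 * n) a b"
  then have h: "a \<in> {1..2 * n}" "b \<in> {1..2 * n}" "pos x a < pos x b"
    "\<And>c. c \<in> {1..2 * n} \<Longrightarrow> \<not> (pos x a < pos x c \<and> pos x c < pos x b)" by (auto simp: nxt_def)
  have "pos x a + 1 \<in> {1..2 * n}" using h(3) pos_range[OF x, of b] h(2) by auto
  then have "x (pos x a + 1) \<in> {1..2 * n}" using W_range[OF x] by blast
  then show "adj x a b" using h(4)[of "x (pos x a + 1)"] h(1-3) pos_x[OF x] by (auto simp: adj_def)
qed (auto simp: adj_def nxt_def)

lemma adj_mir: assumes x: "x \<in> W" and a: "adj x a b" shows "adj x (mir b) (mir a)"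
proof -
  have r: "a \<in> {1..2 * n}" "b \<in> {1..2 * n}" "pos x b = pos x a + 1" using a by (auto simp: adj_def)
  then have "pos x (mir a) = mir (pos x a)" "pos x (mir b) = mir (pos x b)" using pos_mir[OF x] by auto
  moreover have "pos x b \<le> 2 * n" using pos_range[OF x, of b] r by auto
  ultimately show ?thesis using r mir_range by (auto simp: adj_def mir_def)
qed

lemma descent_pair:
  assumes x: "x \<in> W" and a: "adj x q p" "p < q"
  obtains y where "y \<in> W" "ivs y = ivs x - {(p, q), (mir q, mir p)}" "(p, q) \<in> ivs x"
    "\<And>v w. (v, w) \<in> {(p, q), (mir q, mir p)} \<Longrightarrow> adj x w v \<and> v < w \<and> (v, w) \<in> ivs x"
proof -
  have r: "p \<in> {1..2 * n}" "q \<in> {1..2 * n}" "pos x q < pos x p" using a by (auto simp: adj_def)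
  then have pq: "(p, q) \<in> ivs x" using a(2) by (simp add: ivs_iff)
  then have "(mir q, mir p) \<in> ivs x" using KD(4)[OF ivs_K[OF x]] by blast
  then have 1: "adj x w v \<and> v < w \<and> (v, w) \<in> ivs x" if "(v, w) \<in> {(p, q), (mir q, mir p)}" for v w
    using that adj_mir[OF x a(1)] a pq by (auto simp: ivs_iff)
  obtain y where "y \<in> W" "ivs y = ivs x - {(p, q), (mir q, mir p)}" by (rule adj_descent[OF x a])
  then show thesis using that pq 1 by blast
qed

lemma ascent_pair:
  assumes x: "x \<in> W" and a: "adj x p q" "p < q"
  obtains y where "y \<in> W" "ivs y = ivs x \<union> {(p, q), (mir q, mir p)}" "(p, q) \<notin> ivs x"
    "\<And>v w. (v, w) \<in> {(p, q), (mir q, mir p)} \<Longrightarrow> adj x v w \<and> v < w \<and> (v, w) \<notin> ivs x"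
proof -
  have r: "p \<in> {1..2 * n}" "q \<in> {1..2 * n}" "pos x p < pos x q" using a by (auto simp: adj_def)
  then have pq: "(p, q) \<notin> ivs x" by (simp add: ivs_iff)
  have "mir q < mir p" using r(1,2) a(2) by (auto simp: mir_def)
  moreover have "(mir q, mir p) \<notin> ivs x" using adj_mir[OF x a(1)] by (simp add: ivs_iff adj_def)
  ultimately have 1: "adj x v w \<and> v < w \<and> (v, w) \<notin> ivs x" if "(v, w) \<in> {(p, q), (mir q, mir p)}" for v w
    using that adj_mir[OF x a(1)] a pq by auto
  obtain y where "y \<in> W" "ivs y = ivs x \<union> {(p, q), (mir q, mir p)}" by (rule adj_ascent[OF x a])
  then show thesis using that pq 1 by blast
qed

lemma mir_pair: assumes "p \<in> {1..2 * n}" "q \<in> {1..2 * n}" "(v, w) \<in> {(p, q), (mir q, mir p)}"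
  shows "(p, q) = (v, w) \<or> (p, q) = (mir w, mir v)" "w = v + 1 \<longleftrightarrow> q = p + 1"
  using assms by (auto simp: mir_def)

lemma label_in_pair:
  assumes y: "y \<in> W" and x: "ivs x = ivs y - {(p, q), (mir q, mir p)}"
    and l: "l \<in> below y" "l \<in> above x"
  obtains v w e where "l = ((v, w), e)" "(v, w) \<in> {(p, q), (mir q, mir p)}"
proof -
  obtain v w e where e: "l = ((v, w), e)" by (metis surj_pair)
  then have "(v, w) \<in> ivs y" "(v, w) \<notin> ivs x" using below_above_ivs l by auto
  then show thesis using that[OF e] x by blast
qed

text \<open>A separating label sits on the removed arc or on its mirror image, and both
  \<open>below\<close> and \<open>above\<close> are closed under mirroring.\<close>

lemma ex_label:
  assumes y: "y \<in> W" and xW: "x \<in> W" and x: "ivs x = ivs y - {(p, q), (mir q, mir p)}"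
    and r: "p \<in> {1..2 * n}" "q \<in> {1..2 * n}" and ne: "\<not> below y \<subseteq> below x"
  obtains e where "((p, q), e) \<in> below y" "((p, q), e) \<in> above x"
proof -
  obtain l where l: "l \<in> below y" "l \<in> above x" by (rule below_above_sep[OF xW ne])
  obtain v w e where e: "l = ((v, w), e)" "(v, w) \<in> {(p, q), (mir q, mir p)}" by (rule label_in_pair[OF y x l])
  then show thesis
    using that[of e] l below_mir[OF y, of v w e] above_mir[OF xW, of v w e] mir_pair(1)[OF r e(2)] by auto
qed

text \<open>Some descent of \<open>y\<close> is not inverted in \<open>x\<close>. Removing it leaves
  the class of \<open>y\<close>, which has \<open>y\<close> as minimum, but not the interval above
  \<open>x\<close>, so it ends in the class of \<open>x\<close>.\<close>

lemma cover_descent: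
  assumes c: "covers BL x y"
  obtains p q x' where "adj y q p" "p < q" "x' \<in> W" "ivs x' = ivs y - {(p, q), (mir q, mir p)}" "below x' = below x"
proof -
  note cv = covers_BL[OF c]
  have xy: "x \<in> W" "y \<in> W" using cv minima_W by auto
  have "ivs x \<subset> ivs y" using minima_least[OF cv(1) xy(2) cv(3)] cv(4) by (auto simp: below_def)
  then obtain p q where pq: "adj y q p" "p < q" "(p, q) \<notin> ivs x" using ex_adj_descent[OF xy] by metis
  obtain x' where x': "x' \<in> W" "ivs x' = ivs y - {(p, q), (mir q, mir p)}" "(p, q) \<in> ivs y"
    by (rule descent_pair[OF xy(2) pq(1,2)])
  have r: "p \<in> {1..2 * n}" "q \<in> {1..2 * n}" using pq(1) by (auto simp: adj_def)
  then have "(mir q, mir p) \<notin> ivs x" using K_mir_iff[OF ivs_K[OF xy(1)], of p q] pq(3) by auto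
  then have "ivs x \<subseteq> ivs x'" using \<open>ivs x \<subset> ivs y\<close> pq(3) x'(2) by auto
  then have "below x \<subseteq> below x'" "below x' \<subseteq> below y" using below_mono x'(2) by auto
  then have "below x' = below x \<or> below x' = below y" using cv(5)[OF x'(1)] by blast
  moreover have "below x' \<noteq> below y" using minima_least[OF cv(2) x'(1)] x'(2,3) by auto
  ultimately show thesis using that pq x' by blast
qed

text \<open>The dual argument starts from the class maximum \<open>u\<close>, so that adding any
  inversion leaves the class.\<close>

lemma cover_ascent:
  assumes c: "covers BL x y" and u: "u \<in> W" "below u = below x" "\<And>z. z \<in> W \<Longrightarrow> below z \<subseteq> below x \<Longrightarrow> ivs z \<subseteq> ivs u"
  obtains p q y' where "adj u p q" "p < q" "y' \<in> W" "ivs y' = ivs u \<union> {(p, q), (mir q, mir p)}" "below y' = below y"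
proof -
  note cv = covers_BL[OF c]
  have xy: "x \<in> W" "y \<in> W" using cv minima_W by auto
  obtain z where z: "z \<in> W" "below z = below y" "\<And>t. t \<in> W \<Longrightarrow> below t \<subseteq> below y \<Longrightarrow> ivs t \<subseteq> ivs z"
    using class_max[OF xy(2)] by metis
  have "ivs u \<noteq> ivs z" using below_mono[of u z] below_mono[of z u] u(2) cv(3,4) z(2) by auto
  then have "ivs u \<subset> ivs z" using z(3)[OF u(1)] u(2) cv(3) by auto
  then obtain p q where pq: "adj u p q" "p < q" "(p, q) \<in> ivs z" using ex_adj_ascent[OF u(1) z(1)] by metis
  obtain y' where y': "y' \<in> W" "ivs y' = ivs u \<union> {(p, q), (mir q, mir p)}" "(p, q) \<notin> ivs u"
    by (rule ascent_pair[OF u(1) pq(1,2)])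
  have "(mir q, mir p) \<in> ivs z" using KD(4)[OF ivs_K[OF z(1)] pq(3)] .
  then have "ivs y' \<subseteq> ivs z" using \<open>ivs u \<subset> ivs z\<close> pq(3) y'(2) by auto
  then have "below y' \<subseteq> below y" "below x \<subseteq> below y'" using below_mono[of y' z] below_mono[of u y'] y'(2) z(2) u(2) by auto
  then have "below y' = below x \<or> below y' = below y" using cv(5)[OF y'(1)] by blast
  moreover have "below y' \<noteq> below x" using u(3)[OF y'(1)] y'(2,3) by auto
  ultimately show thesis using that pq y' by blast
qed

text \<open>The value \<open>p + 1\<close> lies inside the arc, and its side in \<open>y\<close>
  fixes the type.\<close>

lemma labels_same_type:
  assumes y: "y \<in> W" and a: "adj y q p" "p < q" "q \<noteq> p + 1" and e: "((p, q), e) \<in> below y" "((p, q), e') \<in> below y"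
  shows "e = e'"
proof -
  have r: "1 \<le> p" "q \<le> 2 * n" "p < p + 1" "p + 1 < q" using a by (auto simp: adj_def)
  have f: "falls (pos y) e p q" "falls (pos y) e' p q" using e falls_As[OF y r(1,2)] by (auto simp: in_below)
  have "nxt (pos y) (2 * n) q p" using nxt_adj[OF y] a by simp
  then show ?thesis using fall_side(1)[OF pos_inj[OF y] _ f(1) r(3,4)] fall_side(1)[OF pos_inj[OF y] _ f(2) r(3,4)] by auto
qed

lemma As_Bs_neighbours: assumes "T \<in> K" "p < 2 * n" "1 \<le> p" shows "(p, p + 1) \<in> As e T \<longleftrightarrow> (p, p + 1) \<in> T" "(p, p + 1) \<in> Bs e T \<longleftrightarrow> (p, p + 1) \<notin> T"
proof -
  have "rectS S p (p + 1) = {(p, p + 1)}" for S by (auto simp: rectS_def)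
  then show "(p, p + 1) \<in> As e T \<longleftrightarrow> (p, p + 1) \<in> T" "(p, p + 1) \<in> Bs e T \<longleftrightarrow> (p, p + 1) \<notin> T"
    using assms by (auto simp: As_def Bs_def pairs_def)
qed

lemma neighbours_any_type: assumes x: "x \<in> W"
  shows "((p, p + 1), e) \<in> below x \<Longrightarrow> ((p, p + 1), e') \<in> below x" "((p, p + 1), e) \<in> above x \<Longrightarrow> ((p, p + 1), e') \<in> above x"
proof -
  have *: "1 \<le> p \<and> p < 2 * n" if "(p, p + 1) \<in> pairs" using that by (auto simp: pairs_def)
  show "((p, p + 1), e) \<in> below x \<Longrightarrow> ((p, p + 1), e') \<in> below x" "((p, p + 1), e) \<in> above x \<Longrightarrow> ((p, p + 1), e') \<in> above x"
    using As_Bs_neighbours[OF ivs_K[OF x], of p] * by (auto simp: in_below in_above As_def Bs_def)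
qed

lemma same_label_iff: "same_label ((p, q), e) ((v, w), e') \<longleftrightarrow> ((v, w) = (p, q) \<or> (v, w) = (mir q, mir p)) \<and> (e = e' \<or> q = p + 1)"
  by (simp add: same_label_def)

lemma same_label_below: assumes x: "x \<in> W" and l: "l \<in> below x" and E: "same_label l k" shows "k \<in> below x"
proof -
  obtain p q e v w e' where lk: "l = ((p, q), e)" "k = ((v, w), e')" by (metis surj_pair)
  note E = E[unfolded lk same_label_iff]
  have "((p, q), e') \<in> below x" using neighbours_any_type(1)[OF x, of p e e'] l E unfolding lk by blast
  then show ?thesis using below_mir[OF x, of p q e'] E unfolding lk by auto
qed

lemma same_label_above: assumes x: "x \<in> W" and l: "l \<in> above x" and E: "same_label l k" shows "k \<in> above x"
proof -
  obtain p q e v w e' where lk: "l = ((p, q), e)" "k = ((v, w), e')" by (metis surj_pair)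
  note E = E[unfolded lk same_label_iff]
  have "((p, q), e') \<in> above x" using neighbours_any_type(2)[OF x, of p e e'] l E unfolding lk by blast
  then show ?thesis using above_mir[OF x, of p q e'] E unfolding lk by auto
qed

lemma cover_labels_same:
  assumes c: "covers BL x y" and l: "l \<in> below y" "l \<in> above x" and k: "k \<in> below y" "k \<in> above x"
  shows "same_label l k"
proof -
  have xy: "x \<in> W" "y \<in> W" using covers_BL[OF c] minima_W by auto
  obtain p q x' where h: "adj y q p" "p < q" "x' \<in> W" "ivs x' = ivs y - {(p, q), (mir q, mir p)}" "below x' = below x"
    by (rule cover_descent[OF c])
  have r: "p \<in> {1..2 * n}" "q \<in> {1..2 * n}" using h(1) by (auto simp: adj_def)
  have B: "above x' = above x" using below_eq_iff_above_eq[OF h(3) xy(1)] h(5) by simp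
  obtain v w e where e: "l = ((v, w), e)" "(v, w) \<in> {(p, q), (mir q, mir p)}"
    by (rule label_in_pair[OF xy(2) h(4) l(1) l(2)[folded B]])
  obtain v' w' e' where e': "k = ((v', w'), e')" "(v', w') \<in> {(p, q), (mir q, mir p)}"
    by (rule label_in_pair[OF xy(2) h(4) k(1) k(2)[folded B]])
  have "((p, q), e) \<in> below y" using l below_mir[OF xy(2), of v w e] mir_pair(1)[OF r e(2)] e by auto
  moreover have "((p, q), e') \<in> below y" using k below_mir[OF xy(2), of v' w' e'] mir_pair(1)[OF r e'(2)] e' by auto
  ultimately have "e = e' \<or> q = p + 1" using labels_same_type[OF xy(2) h(1,2)] by blast
  then have "e = e' \<or> w = v + 1" using mir_pair(2)[OF r e(2)] by simp
  moreover have "(v', w') = (v, w) \<or> (v', w') = (mir w, mir v)"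
    using e(2) e'(2) r mir_mir by auto
  ultimately show ?thesis unfolding e(1) e'(1) same_label_iff by blast
qed

lemma label_lattice_BL: "label_lattice BL below above same_label"
proof
  show "finite (carrier BL)" unfolding carrier_BL using finite_W by (rule rev_finite_subset) (auto simp: minima_W)
  show "x .=\<^bsub>BL\<^esub> y \<longleftrightarrow> x = y" for x y by (rule eq_BL)
  show "x = y" if "x \<in> carrier BL" "y \<in> carrier BL" "below x = below y" for x y using that minima_inj by (simp add: carrier_BL)
  show "same_label l k" if "covers BL x y" "l \<in> below y" "l \<in> above x" "k \<in> below y" "k \<in> above x" for x y l k
    using cover_labels_same that .
  show "k \<in> below x" if "x \<in> carrier BL" "l \<in> below x" "same_label l k" for x l k using same_label_below that minima_W by (auto simp: carrier_BL)
  show "k \<in> above x" if "x \<in> carrier BL" "l \<in> above x" "same_label l k" for x l k using same_label_above that minima_W by (auto simp: carrier_BL)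
  show "False" if "l \<in> below x" "l \<in> above x" for x l using below_above_disj that .
  fix x y assume "x \<in> carrier BL" "y \<in> carrier BL"
  then have m: "x \<in> minima" "y \<in> minima" and w: "x \<in> W" "y \<in> W" using carrier_BL minima_W by auto
  show 1: "x \<sqsubseteq>\<^bsub>BL\<^esub> y \<longleftrightarrow> below x \<subseteq> below y" using le_BL m .
  show "x \<sqsubseteq>\<^bsub>BL\<^esub> y \<longleftrightarrow> above y \<subseteq> above x" using 1 below_subset_iff_above w by simp
  show "\<exists>z \<in> carrier BL. below z = below x \<inter> below y"
  proof -
    obtain t where t: "t \<in> W" "below t = below x \<inter> below y" by (rule below_meet[OF w])
    obtain z where "z \<in> minima" "below z = below t" by (rule class_min[OF t(1)])
    then show ?thesis using t carrier_BL by auto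
  qed
  show "\<exists>z \<in> carrier BL. above z = above x \<inter> above y"
  proof -
    obtain t where t: "t \<in> W" "above t = above x \<inter> above y" by (rule above_join[OF w])
    obtain z where "z \<in> minima" "below z = below t" by (rule class_min[OF t(1)])
    then have "z \<in> carrier BL" "above z = above t" using below_eq_iff_above_eq[of z t] t(1) minima_W carrier_BL by auto
    then show ?thesis using t by auto
  qed
  show "\<exists>l. l \<in> below y \<and> l \<in> above x" if "\<not> y \<sqsubseteq>\<^bsub>BL\<^esub> x"
  proof -
    have "\<not> below y \<subseteq> below x" using that le_BL m by simp
    then show ?thesis using below_above_sep[OF w(1)] by metis
  qed
qed

interpretation BL: label_lattice BL below above same_label by (rule label_lattice_BL)

lemma D_descent:
  assumes "l \<in> BL.D y"
  obtains p q e where "l = ((p, q), e)" "adj y q p" "p < q" "((p, q), e) \<in> below y"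
proof -
  obtain x where c: "covers BL x y" and l: "l \<in> below y" "l \<in> above x" using assms unfolding BL.D_def by blast
  have xy: "x \<in> W" "y \<in> W" using covers_BL[OF c] minima_W by auto
  obtain p q x' where h: "adj y q p" "p < q" "x' \<in> W" "ivs x' = ivs y - {(p, q), (mir q, mir p)}" "below x' = below x"
    by (rule cover_descent[OF c])
  have B: "above x' = above x" using below_eq_iff_above_eq[OF h(3) xy(1)] h(5) by simp
  obtain v w e where e: "l = ((v, w), e)" "(v, w) \<in> {(p, q), (mir q, mir p)}"
    by (rule label_in_pair[OF xy(2) h(4) l(1) l(2)[folded B]])
  have "adj y w v \<and> v < w" by (rule descent_pair[OF xy(2) h(1,2)]) (use e(2) in blast)
  then show thesis using that e(1) l by blast
qed

lemma U_ascent: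
  assumes u: "u \<in> W" "below u = below x" "\<And>z. z \<in> W \<Longrightarrow> below z \<subseteq> below x \<Longrightarrow> ivs z \<subseteq> ivs u" and l: "l \<in> BL.U x"
  obtains p q e where "l = ((p, q), e)" "adj u p q" "p < q" "((p, q), e) \<in> above u"
proof -
  obtain y where c: "covers BL x y" and l: "l \<in> below y" "l \<in> above x" using l unfolding BL.U_def by blast
  have xy: "x \<in> W" "y \<in> W" using covers_BL[OF c] minima_W by auto
  obtain p q y' where h: "adj u p q" "p < q" "y' \<in> W" "ivs y' = ivs u \<union> {(p, q), (mir q, mir p)}" "below y' = below y"
    using cover_ascent[OF c u] by blast
  have B: "above u = above x" using below_eq_iff_above_eq[OF u(1) xy(1)] u(2) by simp
  obtain v w e where e: "l = ((v, w), e)" by (metis surj_pair)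
  have "(v, w) \<in> ivs y'" "(v, w) \<notin> ivs u" using below_above_ivs[of v w e y' u] l e h(5) B by auto
  then have vw: "(v, w) \<in> {(p, q), (mir q, mir p)}" using h(4) by blast
  have "adj u v w \<and> v < w" by (rule ascent_pair[OF u(1) h(1,2)]) (use vw in blast)
  then show thesis using that e l B by blast
qed

text \<open>Otherwise \<open>p\<close> would stand behind \<open>p'\<close> while \<open>q\<close>
  stands before \<open>q'\<close>, which is impossible for two adjacent pairs.\<close>

lemma descent_not_in_rect:
  assumes y: "y \<in> W" and a: "adj y q p" "p < q" and b: "adj y q' p'" "p' < q'"
    and A: "((p', q'), e) \<in> below y" and r: "(p, q) \<in> rectS (rt e) p' q'"
  shows "(p, q) = (p', q')"
proof (rule ccontr)
  assume ne: "(p, q) \<noteq> (p', q')"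
  have pq: "pos y p = pos y q + 1" "pos y p' = pos y q' + 1" using a b by (auto simp: adj_def)
  have "p = p' \<longleftrightarrow> q = q'" using pq pos_eq_iff[OF y] by (metis add_right_imp_eq)
  then have "p \<noteq> p'" "q \<noteq> q'" using ne by auto
  then have h: "p' < p" "q < q'" "even p = e" "even q \<noteq> e" using r by (auto simp: rectS_def rt_def)
  have r': "1 \<le> p'" "q' \<le> 2 * n" using b by (auto simp: adj_def)
  have f: "falls (pos y) e p' q'" using A falls_As[OF y r'] by (simp add: in_below)
  have "nxt (pos y) (2 * n) q' p'" using nxt_adj[OF y] b by simp
  note side = fall_side[OF pos_inj[OF y] this f]
  have "pos y p' < pos y p" "pos y q < pos y q'" using side(3)[of p] side(4)[of q] h a(2) by auto
  then show False using pq by simp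
qed

lemma ascent_not_in_rect:
  assumes y: "y \<in> W" and a: "adj y p q" "p < q" and b: "adj y p' q'" "p' < q'"
    and A: "((p', q'), e) \<in> above y" and r: "(p, q) \<in> rectS (rt (\<not> e)) p' q'"
  shows "(p, q) = (p', q')"
proof (rule ccontr)
  assume ne: "(p, q) \<noteq> (p', q')"
  have pq: "pos y q = pos y p + 1" "pos y q' = pos y p' + 1" using a b by (auto simp: adj_def)
  have "p = p' \<longleftrightarrow> q = q'" using pq pos_eq_iff[OF y] by (metis add_right_imp_eq)
  then have "p \<noteq> p'" "q \<noteq> q'" using ne by auto
  then have h: "p' < p" "q < q'" "even p \<noteq> e" "even q = e" using r by (auto simp: rectS_def rt_def)
  have r': "1 \<le> p'" "q' \<le> 2 * n" using b by (auto simp: adj_def)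
  have f: "rises (pos y) e p' q'" using A rises_Bs[OF y r'] by (simp add: in_above)
  have "nxt (pos y) (2 * n) p' q'" using nxt_adj[OF y] b by simp
  note side = rise_side[OF pos_inj[OF y] this f]
  have "pos y p < pos y p'" "pos y q' < pos y q" using side(2)[of p] side(1)[of q] h a(2) by auto
  then show False using pq by simp
qed

text \<open>Let \<open>z\<close> lie between the two classes but not in that of \<open>y\<close>. A
  descent of \<open>y\<close> missing in \<open>z\<close> carries a label that \<open>y'\<close> has
  lost, so its rectangle contains the removed pair or its mirror image. By
  \<open>descent_not_in_rect\<close> it is that pair, hence \<open>z\<close> lies below the class of
  \<open>y'\<close>.\<close>

lemma descent_D:
  assumes y: "y \<in> minima" and a: "adj y q p" "p < q"
  obtains e where "((p, q), e) \<in> BL.D y"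
proof -
  note yW = minima_W[OF y]
  have r: "p \<in> {1..2 * n}" "q \<in> {1..2 * n}" using a(1) by (auto simp: adj_def)
  obtain y' where y': "y' \<in> W" "ivs y' = ivs y - {(p, q), (mir q, mir p)}" "(p, q) \<in> ivs y"
    and pairD: "\<And>v w. (v, w) \<in> {(p, q), (mir q, mir p)} \<Longrightarrow> adj y w v \<and> v < w \<and> (v, w) \<in> ivs y"
    by (rule descent_pair[OF yW a]) blast
  have "\<not> below y \<subseteq> below y'" using minima_least[OF y y'(1)] y'(2,3) by auto
  then obtain e where e: "((p, q), e) \<in> below y" "((p, q), e) \<in> above y'" by (rule ex_label[OF yW y'(1,2) r])
  obtain x where x: "x \<in> minima" "below x = below y'" by (rule class_min[OF y'(1)])
  have B: "above x = above y'" using below_eq_iff_above_eq[of x y'] x y'(1) minima_W by blast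
  have "covers BL x y"
  proof (rule coversI_BL[OF x(1) y])
    show "below x \<subseteq> below y" "below x \<noteq> below y" using below_mono[of y' y] y'(2) x(2) \<open>\<not> below y \<subseteq> below y'\<close> by auto
    fix z assume z: "z \<in> minima" "below x \<subseteq> below z" "below z \<subseteq> below y"
    show "below z = below x \<or> below z = below y"
    proof (cases "below z = below y")
      case False
      note zW = minima_W[OF z(1)]
      have "ivs z \<noteq> ivs y" using False below_mono[of y z] z(3) by blast
      then have "ivs z \<subset> ivs y" using minima_least[OF z(1) yW z(3)] by blast
      then obtain p2 q2 where d: "adj y q2 p2" "p2 < q2" "(p2, q2) \<notin> ivs z" using ex_adj_descent[OF zW yW] by metis
      have r2: "p2 \<in> {1..2 * n}" "q2 \<in> {1..2 * n}" using d(1) by (auto simp: adj_def)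
      obtain t where t: "t \<in> W" "ivs t = ivs y - {(p2, q2), (mir q2, mir p2)}" "(p2, q2) \<in> ivs y" by (rule descent_pair[OF yW d(1,2)])
      have "(mir q2, mir p2) \<notin> ivs z" using K_mir_iff[OF ivs_K[OF zW], of p2 q2] d(3) r2 by auto
      then have zt: "ivs z \<subseteq> ivs t" using \<open>ivs z \<subset> ivs y\<close> d(3) t(2) by auto
      have "\<not> below y \<subseteq> below t" using minima_least[OF y t(1)] t(2,3) by auto
      then obtain e2 where e2: "((p2, q2), e2) \<in> below y" "((p2, q2), e2) \<in> above t" by (rule ex_label[OF yW t(1,2) r2])
      have "((p2, q2), e2) \<notin> below y'"
        using below_above_disj[of _ t] e2(2) below_mono[OF zt] z(2) x(2) by blast
      then obtain v w where "(v, w) \<in> rectS (rt e2) p2 q2" "(v, w) \<notin> ivs y'" "(v, w) \<in> ivs y"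
        using e2(1) by (auto simp: in_below As_def)
      moreover from this have vw: "(v, w) \<in> {(p, q), (mir q, mir p)}" using y'(2) by blast
      ultimately have "(v, w) = (p2, q2)"
        using descent_not_in_rect[OF yW _ _ d(1,2) e2(1), of w v] pairD by blast
      then have "{(p2, q2), (mir q2, mir p2)} = {(p, q), (mir q, mir p)}" using vw r mir_mir by auto
      then have "below z \<subseteq> below y'" using below_mono[OF zt] t(2) y'(2) by (simp add: below_def)
      then show ?thesis using z(2) x(2) by blast
    qed simp
  qed
  then show thesis using that e B unfolding BL.D_def by blast
qed

lemma ascent_U:
  assumes x: "x \<in> minima" and u: "u \<in> W" "below u = below x" "\<And>z. z \<in> W \<Longrightarrow> below z \<subseteq> below x \<Longrightarrow> ivs z \<subseteq> ivs u"
    and a: "adj u p q" "p < q"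
  obtains e where "((p, q), e) \<in> BL.U x"
proof -
  note xW = minima_W[OF x]
  have Bu: "above u = above x" using below_eq_iff_above_eq[OF u(1) xW] u(2) by simp
  have r: "p \<in> {1..2 * n}" "q \<in> {1..2 * n}" using a(1) by (auto simp: adj_def)
  obtain u' where u': "u' \<in> W" "ivs u' = ivs u \<union> {(p, q), (mir q, mir p)}" "(p, q) \<notin> ivs u"
    and pairU: "\<And>v w. (v, w) \<in> {(p, q), (mir q, mir p)} \<Longrightarrow> adj u v w \<and> v < w \<and> (v, w) \<notin> ivs u"
    by (rule ascent_pair[OF u(1) a]) blast
  have "(p, q) \<notin> ivs u" "(mir q, mir p) \<notin> ivs u" using pairU by auto
  then have minus: "ivs u = ivs u' - {(p, q), (mir q, mir p)}" unfolding u'(2) by blast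
  have "\<not> below u' \<subseteq> below u" using u(3)[OF u'(1)] u(2) u'(2,3) by auto
  then obtain e where e: "((p, q), e) \<in> below u'" "((p, q), e) \<in> above u" by (rule ex_label[OF u'(1) u(1) minus r])
  obtain y where y: "y \<in> minima" "below y = below u'" by (rule class_min[OF u'(1)])
  have B: "above y = above u'" using below_eq_iff_above_eq[of y u'] y u'(1) minima_W by blast
  have "covers BL x y"
  proof (rule coversI_BL[OF x y(1)])
    show "below x \<subseteq> below y" "below x \<noteq> below y" using below_mono[of u u'] u'(2) y(2) u(2) \<open>\<not> below u' \<subseteq> below u\<close> by auto
    fix z assume z: "z \<in> minima" "below x \<subseteq> below z" "below z \<subseteq> below y"
    show "below z = below x \<or> below z = below y"
    proof (cases "below z = below x")
      case False
      obtain zz where zz: "zz \<in> W" "below zz = below z" "\<And>t. t \<in> W \<Longrightarrow> below t \<subseteq> below z \<Longrightarrow> ivs t \<subseteq> ivs zz"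
        using class_max[OF minima_W[OF z(1)]] by metis
      have "ivs u \<noteq> ivs zz" using False below_mono[of zz u] z(2) zz(2) u(2) by blast
      then have "ivs u \<subset> ivs zz" using zz(3)[OF u(1)] u(2) z(2) by blast
      then obtain p2 q2 where d: "adj u p2 q2" "p2 < q2" "(p2, q2) \<in> ivs zz" using ex_adj_ascent[OF u(1) zz(1)] by metis
      have r2: "p2 \<in> {1..2 * n}" "q2 \<in> {1..2 * n}" using d(1) by (auto simp: adj_def)
      obtain t where t: "t \<in> W" "ivs t = ivs u \<union> {(p2, q2), (mir q2, mir p2)}" "(p2, q2) \<notin> ivs u"
        and tU: "\<And>v w. (v, w) \<in> {(p2, q2), (mir q2, mir p2)} \<Longrightarrow> adj u v w \<and> v < w \<and> (v, w) \<notin> ivs u"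
        by (rule ascent_pair[OF u(1) d(1,2)]) blast
      have "(p2, q2) \<notin> ivs u" "(mir q2, mir p2) \<notin> ivs u" using tU by auto
      then have tm: "ivs u = ivs t - {(p2, q2), (mir q2, mir p2)}" unfolding t(2) by blast
      have "(mir q2, mir p2) \<in> ivs zz" using KD(4)[OF ivs_K[OF zz(1)] d(3)] .
      then have tz: "ivs t \<subseteq> ivs zz" using \<open>ivs u \<subset> ivs zz\<close> d(3) t(2) by auto
      have "\<not> below t \<subseteq> below u" using u(3)[OF t(1)] u(2) t(2,3) by auto
      then obtain e2 where e2: "((p2, q2), e2) \<in> below t" "((p2, q2), e2) \<in> above u" by (rule ex_label[OF t(1) u(1) tm r2])
      have "((p2, q2), e2) \<in> below u'" using e2(1) below_mono[OF tz] zz(2) z(3) y(2) by blast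
      then have "((p2, q2), e2) \<notin> above u'" using below_above_disj by blast
      then obtain v w where "(v, w) \<in> rectS (rt (\<not> e2)) p2 q2" "(v, w) \<in> ivs u'" "(v, w) \<notin> ivs u"
        using e2(2) by (auto simp: in_above Bs_def)
      moreover from this have vw: "(v, w) \<in> {(p, q), (mir q, mir p)}" using u'(2) by blast
      ultimately have "(v, w) = (p2, q2)"
        using ascent_not_in_rect[OF u(1) _ _ d(1,2) e2(2), of v w] pairU by blast
      then have "{(p2, q2), (mir q2, mir p2)} = {(p, q), (mir q, mir p)}" using vw r mir_mir by auto
      then have "below u' \<subseteq> below z" using below_mono[OF tz] t(2) u'(2) zz(2) by (simp add: below_def)
      then show ?thesis using z(3) y(2) by blast
    qed simp
  qed
  then show thesis using that e B y(2) Bu unfolding BL.U_def by blast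
qed

section \<open>Rowmotion in terms of the bits\<close>

abbreviation lb where "lb x \<equiv> lbit (pos x) (2 * n)"

text \<open>The descents of a class minimum are exactly the arcs occurring in its \<open>D\<close>,
  so its bits are a function of the labels. \<open>ub_U\<close> is the counterpart for class maxima
  and \<open>U\<close>.\<close>

lemma lb_D: assumes x: "x \<in> minima" and i: "1 \<le> i" "i < 2 * n"
  shows "lb x i \<longleftrightarrow> (\<exists>l \<in> BL.D x. arc_bit i l)"
proof -
  note xW = minima_W[OF x]
  have E: "nxt (pos x) (2 * n) q p \<and> falls (pos x) e p q" if l: "((p, q), e) \<in> BL.D x" for p q e
  proof -
    have h: "adj x q p" "((p, q), e) \<in> below x" using D_descent[OF l] by auto
    then have "1 \<le> p" "q \<le> 2 * n" by (auto simp: adj_def)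
    then show ?thesis using falls_As[OF xW] h nxt_adj[OF xW] by (simp add: in_below)
  qed
  have "lb x i \<longleftrightarrow> (\<exists>p q e. nxt (pos x) (2 * n) q p \<and> ((p, q), e) \<in> BL.D x \<and> arc_bit i ((p, q), e))"
  proof (rule lbit_arc[OF pos_inj[OF xW] _ _ i])
    show "\<exists>e. falls (pos x) e p q \<and> ((p, q), e) \<in> BL.D x" if "nxt (pos x) (2 * n) q p" "p < q" for p q
      using descent_D[OF x _ that(2)] that(1) nxt_adj[OF xW] E by metis
  qed (use E in blast)
  then show ?thesis using E by auto
qed

lemma ub_U: assumes x: "x \<in> minima" and u: "u \<in> W" "below u = below x" "\<And>z. z \<in> W \<Longrightarrow> below z \<subseteq> below x \<Longrightarrow> ivs z \<subseteq> ivs u"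
  and i: "1 \<le> i" "i < 2 * n"
  shows "ubit (pos u) (2 * n) i \<longleftrightarrow> (\<exists>l \<in> BL.U x. arc_bit i l)"
proof -
  have E: "nxt (pos u) (2 * n) p q \<and> rises (pos u) e p q" if l: "((p, q), e) \<in> BL.U x" for p q e
  proof -
    have h: "adj u p q" "((p, q), e) \<in> above u" using U_ascent[OF u l] by auto
    then have "1 \<le> p" "q \<le> 2 * n" by (auto simp: adj_def)
    then show ?thesis using rises_Bs[OF u(1)] h nxt_adj[OF u(1)] by (simp add: in_above)
  qed
  have "ubit (pos u) (2 * n) i \<longleftrightarrow> (\<exists>p q e. nxt (pos u) (2 * n) p q \<and> ((p, q), e) \<in> BL.U x \<and> arc_bit i ((p, q), e))"
  proof (rule ubit_arc[OF pos_inj[OF u(1)] _ _ i])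
    show "\<exists>e. rises (pos u) e p q \<and> ((p, q), e) \<in> BL.U x" if "nxt (pos u) (2 * n) p q" "p < q" for p q
      using ascent_U[OF x u _ that(2)] that(1) nxt_adj[OF u(1)] E by metis
  qed (use E in blast)
  then show ?thesis using E by auto
qed

lemma class_arc_words:
  assumes x: "x \<in> minima" and u: "u \<in> W" "below u = below x" "\<And>z. z \<in> W \<Longrightarrow> below z \<subseteq> below x \<Longrightarrow> ivs z \<subseteq> ivs u"
  shows "arc_words (pos x) (pos u) (2 * n)"
proof
  note xW = minima_W[OF x]
  have B: "above u = above x" using below_eq_iff_above_eq[OF u(1) xW] u(2) by simp
  show "inj_on (pos x) {1..2 * n}" "inj_on (pos u) {1..2 * n}" using pos_inj xW u(1) by auto
  show "falls (pos x) e p q = falls (pos u) e p q" if "1 \<le> p" "q \<le> 2 * n" for p q e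
    using falls_As[OF xW that] falls_As[OF u(1) that] u(2) by (metis in_below)
  show "rises (pos x) e p q = rises (pos u) e p q" if "1 \<le> p" "q \<le> 2 * n" for p q e
    using rises_Bs[OF xW that] rises_Bs[OF u(1) that] B by (metis in_above)
  show "\<exists>e. falls (pos x) e p q" if h: "nxt (pos x) (2 * n) q p" "p < q" for p q
  proof -
    obtain e where e: "((p, q), e) \<in> BL.D x" using descent_D[OF x _ h(2)] h(1) nxt_adj[OF xW] by metis
    then have "((p, q), e) \<in> below x" using D_descent by auto
    then show ?thesis using falls_As[OF xW] nxtD[OF h(1)] by (auto simp: in_below)
  qed
  show "\<exists>e. rises (pos u) e p q" if h: "nxt (pos u) (2 * n) p q" "p < q" for p q
  proof -
    obtain e where e: "((p, q), e) \<in> BL.U x" using ascent_U[OF x u _ h(2)] h(1) nxt_adj[OF u(1)] by metis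
    then have "((p, q), e) \<in> above u" using U_ascent[OF u e] by auto
    then show ?thesis using rises_Bs[OF u(1)] nxtD[OF h(1)] by (auto simp: in_above)
  qed
qed

text \<open>For the image \<open>r\<close>, the equation \<open>U r = D x\<close> makes bit
  \<open>j\<close> of \<open>x\<close> the ascent bit \<open>j\<close> of the maximum of the class
  of \<open>r\<close>, which \<open>ubit_lbit\<close> compares with bit \<open>j + 1\<close> of
  \<open>r\<close>. At the ends of the range the bits reduce to the order of
  \<open>2 * n - 1\<close> and \<open>2 * n\<close> and to that of 1 and 2, which symmetry
  links.\<close>

lemma lb_Row:
  assumes x: "x \<in> minima" and i: "1 \<le> i"
  shows "Row_B n x \<in> minima" "i + 1 < 2 * n \<Longrightarrow> lb x i \<longleftrightarrow> \<not> lb (Row_B n x) (i + 1)"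
    "lb x (2 * n - 1) \<longleftrightarrow> \<not> lb (Row_B n x) 1"
proof -
  define r where "r = Row_B n x"
  have r: "r \<in> minima" "BL.U r = BL.D x" using BL.lattice_row_labels[of x] x by (auto simp: carrier_BL r_def Row_B_def)
  then show "Row_B n x \<in> minima" by (simp add: r_def)
  note rW = minima_W[OF r(1)]
  obtain u where u: "u \<in> W" "below u = below r" "\<And>z. z \<in> W \<Longrightarrow> below z \<subseteq> below r \<Longrightarrow> ivs z \<subseteq> ivs u"
    using class_max[OF rW] by metis
  interpret arc_words "pos r" "pos u" "2 * n" by (rule class_arc_words[OF r(1) u])
  have eq: "lb x j \<longleftrightarrow> ubit (pos u) (2 * n) j" if "1 \<le> j" "j < 2 * n" for j
    using lb_D[OF x that] ub_U[OF r(1) u that] r(2) by simp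
  show "lb x i \<longleftrightarrow> \<not> lb (Row_B n x) (i + 1)" if "i + 1 < 2 * n"
    using ubit_lbit[OF i that] eq[of i] i that by (simp add: r_def)
  define m where "m = 2 * n - 1"
  have m: "m + 1 = 2 * n" "1 \<le> m" "m < 2 * n" using n_pos by (auto simp: m_def)
  have 1: "ubit (pos u) (2 * n) m \<longleftrightarrow> \<not> pos u (m + 1) < pos u m"
  proof (cases "pos u (m + 1) < pos u m")
    case True
    have "\<not> nxt (pos u) (2 * n) m q" if "m < q" for q
    proof
      assume q: "nxt (pos u) (2 * n) m q"
      then have "q = m + 1" using nxtD(4)[OF q] that m by simp
      then show False using nxtD(5)[OF q] True by simp
    qed
    then show ?thesis using True by (simp add: ubit_def)
  next
    case False
    have "pos u m \<noteq> pos u (m + 1)" using pos_eq_iff[OF u(1)] by simp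
    then have lt: "pos u m < pos u (m + 1)" using False by simp
    obtain p q where pq: "nxt (pos u) (2 * n) p q" "m + 1 \<le> q" "p < m + 1"
      by (rule rise_exists[OF injQ, of m "m + 1" "m + 1"]) (use m lt in auto)
    then have "q = m + 1" using nxtD(4)[OF pq(1)] m by simp
    then have "\<exists>p < m + 1. nxt (pos u) (2 * n) p (m + 1)" using pq by blast
    then show ?thesis using False by (simp add: ubit_def)
  qed
  have 2: "lb r 1 \<longleftrightarrow> pos r (1 + 1) < pos r 1"
  proof (cases "pos r (1 + 1) < pos r 1")
    case True
    obtain q p where qp: "nxt (pos r) (2 * n) q p" "1 + 1 \<le> q" "p < 1 + 1"
      by (rule drop_exists[OF injP, of "1 + 1" "1 + 1" 1]) (use m True in auto)
    then have "p = 1" "q > 1" using nxtD(3)[OF qp(1)] by auto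
    then have "\<exists>q > 1. nxt (pos r) (2 * n) q 1" using qp(1) by blast
    then show ?thesis using True by (simp add: lbit_def)
  next
    case False
    have "\<not> nxt (pos r) (2 * n) (1 + 1) p" if "p < 1 + 1" for p
    proof
      assume p: "nxt (pos r) (2 * n) (1 + 1) p"
      then have "p = 1" using nxtD(3)[OF p] that by simp
      then show False using nxtD(5)[OF p] False by simp
    qed
    then show ?thesis using False by (simp add: lbit_def)
  qed
  have "pos u (m + 1) < pos u m \<longleftrightarrow> pos r (m + 1) < pos r m" using order_1[of m] m by simp
  also have "\<dots> \<longleftrightarrow> pos r (1 + 1) < pos r 1"
  proof -
    have a: "1 \<in> {1..2 * n}" "1 + 1 \<in> {1..2 * n}" using m by auto
    have b: "mir 1 = m + 1" "mir (1 + 1) = m" using m by (auto simp: mir_def)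
    have "pos r 1 \<in> {1..2 * n}" "pos r (1 + 1) \<in> {1..2 * n}" using iffD2[OF pos_range[OF rW]] a by blast+
    then have "pos r 1 \<le> 2 * n" "pos r (1 + 1) \<le> 2 * n" by simp_all
    then show ?thesis using pos_mir[OF rW a(1), unfolded b] pos_mir[OF rW a(2), unfolded b] unfolding mir_def by linarith
  qed
  finally have "lb x m \<longleftrightarrow> \<not> lb r 1" using 1 2 eq[of m] m by simp
  then show "lb x (2 * n - 1) \<longleftrightarrow> \<not> lb (Row_B n x) 1" unfolding m_def r_def .
qed

section \<open>The minima are the alternating elements\<close>

lemma minima_alternating: assumes x: "x \<in> minima" shows "alternating (pos x) (2 * n)"
  unfolding alternating_def
proof (intro conjI allI impI)
  note xW = minima_W[OF x]
  show "inj_on (pos x) {1..2 * n}" by (rule pos_inj[OF xW])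
  fix p q assume h: "nxt (pos x) (2 * n) q p" "p < q"
  obtain e where e: "((p, q), e) \<in> BL.D x" using descent_D[OF x _ h(2)] h(1) nxt_adj[OF xW] by metis
  then have "((p, q), e) \<in> below x" using D_descent by auto
  then have "falls (pos x) e p q" using falls_As[OF xW] nxtD[OF h(1)] by (auto simp: in_below)
  then show "\<exists>e. \<forall>v. p < v \<longrightarrow> v < q \<longrightarrow> ((even v = e) \<longleftrightarrow> pos x q < pos x v)"
    using fall_side(1)[OF pos_inj[OF xW] h(1)] by blast
qed

text \<open>If \<open>x\<close> were not below some element of its class, a descent of
  \<open>x\<close> missing in their meet would be an arc below \<open>x\<close> by alternation,
  hence below the meet and inverted there after all.\<close>

lemma alternating_minima: assumes x: "x \<in> W" and alt: "alternating (pos x) (2 * n)" shows "x \<in> minima"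
proof -
  have "ivs x \<subseteq> ivs y" if y: "y \<in> W" "below y = below x" for y
  proof (rule ccontr)
    assume n: "\<not> ivs x \<subseteq> ivs y"
    obtain z where z: "z \<in> W" "below z = below x \<inter> below y" "ivs z \<subseteq> ivs x" "ivs z \<subseteq> ivs y" using below_meet x y(1) by blast
    then have "ivs z \<subset> ivs x" using n by blast
    then obtain p q where pq: "adj x q p" "p < q" "(p, q) \<notin> ivs z" using ex_adj_descent[OF z(1) x] by metis
    have nx: "nxt (pos x) (2 * n) q p" using pq nxt_adj[OF x] by simp
    note nd = nxtD[OF nx]
    obtain e where e: "\<forall>v. p < v \<longrightarrow> v < q \<longrightarrow> ((even v = e) \<longleftrightarrow> pos x q < pos x v)"
      using alt nx pq(2) unfolding alternating_def by blast
    have "falls (pos x) e p q" unfolding falls_def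
    proof (intro conjI allI impI)
      fix a b assume ab: "p \<le> a" "a < b" "b \<le> q" "a = p \<or> even a = e" "b = q \<or> even b \<noteq> e"
      have "pos x p \<le> pos x a"
      proof (cases "a = p")
        case False
        then have "pos x q < pos x a" using e ab by auto
        then show ?thesis using nd(6)[of a] ab nd by auto
      qed simp
      moreover have "pos x b \<le> pos x q" using e[rule_format, of b] ab by (cases "b = q") auto
      ultimately show "pos x b < pos x a" using nd(5) by linarith
    qed (rule pq(2))
    then have "((p, q), e) \<in> below z" using falls_As[OF x] nd y(2) z(2) by (auto simp: in_below)
    then show False using As_subset pq(3) by (auto simp: in_below)
  qed
  then show ?thesis using x by (simp add: minima_def)
qed

text \<open>The reverse complement of a word, expressed by a constant sum so that it makes sense for
  position functions with arbitrary values.\<close>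

definition flipped :: "(nat \<Rightarrow> nat) \<Rightarrow> (nat \<Rightarrow> nat) \<Rightarrow> bool" where
  "flipped P P' \<longleftrightarrow> (\<exists>C. \<forall>v \<in> {1..2 * n}. P' v + P (mir v) = C)"

lemma flipped_less: assumes f: "flipped P P'" and r: "a \<in> {1..2 * n}" "b \<in> {1..2 * n}"
  shows "P' a < P' b \<longleftrightarrow> P (mir b) < P (mir a)"
  using f r unfolding flipped_def by (metis add_less_cancel_left add_less_cancel_right not_less_iff_gr_or_eq add.commute add_less_mono)

lemma flipped_nxt: assumes f: "flipped P P'" and r: "a \<in> {1..2 * n}" "b \<in> {1..2 * n}"
  shows "nxt P' (2 * n) a b \<longleftrightarrow> nxt P (2 * n) (mir b) (mir a)"
proof -
  have "(\<forall>c \<in> {1..2 * n}. \<not> (P' a < P' c \<and> P' c < P' b)) \<longleftrightarrow> (\<forall>c \<in> {1..2 * n}. \<not> (P (mir b) < P c \<and> P c < P (mir a)))"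
  proof
    assume h: "\<forall>c \<in> {1..2 * n}. \<not> (P' a < P' c \<and> P' c < P' b)"
    show "\<forall>c \<in> {1..2 * n}. \<not> (P (mir b) < P c \<and> P c < P (mir a))"
    proof
      fix c assume c: "c \<in> {1..2 * n}"
      then show "\<not> (P (mir b) < P c \<and> P c < P (mir a))"
        using h mir_range[OF c] flipped_less[OF f] r mir_mir[of c] by (metis atLeastAtMost_iff)
    qed
  next
    assume h: "\<forall>c \<in> {1..2 * n}. \<not> (P (mir b) < P c \<and> P c < P (mir a))"
    show "\<forall>c \<in> {1..2 * n}. \<not> (P' a < P' c \<and> P' c < P' b)"
    proof
      fix c assume c: "c \<in> {1..2 * n}"
      then show "\<not> (P' a < P' c \<and> P' c < P' b)" using h mir_range[OF c] flipped_less[OF f] r by blast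
    qed
  qed
  then show ?thesis unfolding nxt_def using flipped_less[OF f r] r mir_range by blast
qed

lemma mir_Suc: assumes "1 \<le> i" "i < 2 * n" shows "2 * n - i = mir (i + 1)" "2 * n - i + 1 = mir i"
  using assms by (auto simp: mir_def)

lemma flipped_bits: assumes f: "flipped P P'" and i: "1 \<le> i" "i < 2 * n"
  shows "lbit P' (2 * n) i \<longleftrightarrow> rbit P (2 * n) (2 * n - i)" "rbit P' (2 * n) i \<longleftrightarrow> lbit P (2 * n) (2 * n - i)"
proof -
  have r: "i \<in> {1..2 * n}" "i + 1 \<in> {1..2 * n}" using i by auto
  have up: "(\<exists>q > i. nxt P' (2 * n) q i) \<longleftrightarrow> (\<exists>p < mir i. nxt P (2 * n) (mir i) p)"
  proof
    assume "\<exists>q > i. nxt P' (2 * n) q i"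
    then obtain q where q: "q > i" "nxt P' (2 * n) q i" by blast
    then have "q \<in> {1..2 * n}" using nxtD[OF q(2)] by simp
    then have "mir q < mir i" "nxt P (2 * n) (mir i) (mir q)" using flipped_nxt[OF f _ r(1)] q by (auto simp: mir_def)
    then show "\<exists>p < mir i. nxt P (2 * n) (mir i) p" by blast
  next
    assume "\<exists>p < mir i. nxt P (2 * n) (mir i) p"
    then obtain p where p: "p < mir i" "nxt P (2 * n) (mir i) p" by blast
    then have pr: "p \<in> {1..2 * n}" using nxtD[OF p(2)] by simp
    then have "mir (mir p) = p" using mir_mir by simp
    then have "nxt P' (2 * n) (mir p) i" using flipped_nxt[OF f mir_range[OF pr] r(1)] p by simp
    moreover have "mir p > i" using p(1) pr r by (auto simp: mir_def)
    ultimately show "\<exists>q > i. nxt P' (2 * n) q i" by blast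
  qed
  have down: "(\<exists>p < i + 1. nxt P' (2 * n) (i + 1) p) \<longleftrightarrow> (\<exists>q > mir (i + 1). nxt P (2 * n) q (mir (i + 1)))"
  proof
    assume "\<exists>p < i + 1. nxt P' (2 * n) (i + 1) p"
    then obtain p where p: "p < i + 1" "nxt P' (2 * n) (i + 1) p" by blast
    then have "p \<in> {1..2 * n}" using nxtD[OF p(2)] by simp
    then have "mir (i + 1) < mir p" "nxt P (2 * n) (mir p) (mir (i + 1))" using flipped_nxt[OF f r(2)] p r by (auto simp: mir_def)
    then show "\<exists>q > mir (i + 1). nxt P (2 * n) q (mir (i + 1))" by blast
  next
    assume "\<exists>q > mir (i + 1). nxt P (2 * n) q (mir (i + 1))"
    then obtain q where q: "q > mir (i + 1)" "nxt P (2 * n) q (mir (i + 1))" by blast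
    then have qr: "q \<in> {1..2 * n}" using nxtD[OF q(2)] by simp
    then have "mir (mir q) = q" using mir_mir by simp
    then have "nxt P' (2 * n) (i + 1) (mir q)" using flipped_nxt[OF f r(2) mir_range[OF qr]] q by simp
    moreover have "mir q < i + 1" using q(1) qr r by (auto simp: mir_def)
    ultimately show "\<exists>p < i + 1. nxt P' (2 * n) (i + 1) p" by blast
  qed
  have Sm: "mir (i + 1) + 1 = mir i" using mir_Suc[OF i] by simp
  have lt: "P' (i + 1) < P' i \<longleftrightarrow> P (mir i) < P (mir (i + 1))" using flipped_less[OF f r(2,1)] .
  show "lbit P' (2 * n) i \<longleftrightarrow> rbit P (2 * n) (2 * n - i)" "rbit P' (2 * n) i \<longleftrightarrow> lbit P (2 * n) (2 * n - i)"
    unfolding lbit_def rbit_def lt up down mir_Suc(1)[OF i] Sm by simp_all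
qed

lemma flipped_pos: assumes x: "x \<in> W" shows "flipped (pos x) (pos x)"
  unfolding flipped_def
proof (intro exI ballI)
  fix v assume v: "v \<in> {1..2 * n}"
  then have "pos x v \<le> 2 * n" using pos_range[OF x, of v] by auto
  then show "pos x v + pos x (mir v) = 2 * n + 1" using pos_mir[OF x v] by (simp add: mir_def)
qed

text \<open>Reversal swaps the sides and \<open>mir\<close> swaps the parities, so the same type
  \<open>e\<close> serves for the mirrored descent.\<close>

lemma flipped_alternating: assumes f: "flipped P P'" and alt: "alternating P (2 * n)" shows "alternating P' (2 * n)"
  unfolding alternating_def
proof (intro conjI allI impI)
  have inj: "inj_on P {1..2 * n}" using alt by (simp add: alternating_def)
  obtain C where C: "\<And>v. v \<in> {1..2 * n} \<Longrightarrow> P' v + P (mir v) = C" using f unfolding flipped_def by blast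
  show "inj_on P' {1..2 * n}"
  proof (rule inj_onI)
    fix a b assume h: "a \<in> {1..2 * n}" "b \<in> {1..2 * n}" "P' a = P' b"
    then have "P (mir a) = P (mir b)" using C[of a] C[of b] by simp
    then have "mir a = mir b" using inj_onD[OF inj] mir_range h by blast
    then show "a = b" using h by (auto simp: mir_def)
  qed
  fix p q assume h: "nxt P' (2 * n) q p" "p < q"
  have r: "p \<in> {1..2 * n}" "q \<in> {1..2 * n}" using nxtD[OF h(1)] by auto
  have nx: "nxt P (2 * n) (mir p) (mir q)" using flipped_nxt[OF f r(2,1)] h by simp
  have "mir q < mir p" using r h by (auto simp: mir_def)
  then obtain e where e: "\<forall>v. mir q < v \<longrightarrow> v < mir p \<longrightarrow> ((even v = e) \<longleftrightarrow> P (mir p) < P v)"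
    using alt nx unfolding alternating_def by blast
  have "(even v = e) \<longleftrightarrow> P' q < P' v" if v: "p < v" "v < q" for v
  proof -
    have vr: "v \<in> {1..2 * n}" "mir q < mir v" "mir v < mir p" using v r by (auto simp: mir_def)
    have "even (mir v) \<longleftrightarrow> odd v" using vr(1) by (auto simp: mir_def)
    moreover have "P (mir p) < P (mir v) \<longleftrightarrow> \<not> P (mir v) < P (mir q)"
      using nxtD(5)[OF nx] nxtD(6)[OF nx, of "mir v"] mir_range[OF vr(1)] by auto
    ultimately show ?thesis using e[rule_format, OF vr(2,3)] flipped_less[OF f r(2) vr(1)] by auto
  qed
  then show "\<exists>e. \<forall>v. p < v \<longrightarrow> v < q \<longrightarrow> ((even v = e) \<longleftrightarrow> P' q < P' v)" by blast
qed

text \<open>Symmetry supplies the \<open>rbit\<close> values from the \<open>lbit\<close> values, so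
  \<open>alternating_unique\<close> applies.\<close>

lemma lb_inj:
  assumes x: "x \<in> minima" and y: "y \<in> minima" and eq: "\<And>i. 1 \<le> i \<Longrightarrow> i < 2 * n \<Longrightarrow> lb x i = lb y i"
  shows "x = y"
proof -
  note W = minima_W[OF x] minima_W[OF y]
  have "same_order (2 * n) (pos x) (pos y)"
  proof (rule alternating_unique[OF minima_alternating[OF x] minima_alternating[OF y]])
    fix i assume i: "1 \<le> i" "i < 2 * n"
    then show "lb x i = lb y i \<and> rbit (pos x) (2 * n) i = rbit (pos y) (2 * n) i"
      using eq[of i] eq[of "2 * n - i"] flipped_bits(2)[OF flipped_pos[OF W(1)] i] flipped_bits(2)[OF flipped_pos[OF W(2)] i] by auto
  qed
  then have "ivs x = ivs y" unfolding ivs_def pairs_def same_order_def by auto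
  then show ?thesis using ivs_inj W by blast
qed

lemma same_order_nxt:
  assumes "same_order N P Q" shows "nxt P N a b = nxt Q N a b"
  using assms unfolding same_order_def nxt_def by (smt (verit) atLeastAtMost_iff)

lemma same_order_lbit:
  assumes s: "same_order N P Q" and i: "1 \<le> i" "i < N" shows "lbit P N i = lbit Q N i"
proof -
  have "P (i + 1) < P i \<longleftrightarrow> Q (i + 1) < Q i" using s i by (auto simp: same_order_def)
  then show ?thesis unfolding lbit_def same_order_nxt[OF s] by simp
qed

lemma same_order_alternating:
  assumes s: "same_order N P Q" and "alternating P N" "inj_on Q {1..N}" shows "alternating Q N"
  unfolding alternating_def
proof (intro conjI allI impI)
  fix p q assume h: "nxt Q N q p" "p < q"
  then obtain e where e: "\<forall>v. p < v \<longrightarrow> v < q \<longrightarrow> ((even v = e) \<longleftrightarrow> P q < P v)"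
    using assms(2) same_order_nxt[OF s] unfolding alternating_def by blast
  have "P q < P v \<longleftrightarrow> Q q < Q v" if "p < v" "v < q" for v
    using s that nxtD[OF h(1)] by (auto simp: same_order_def)
  then show "\<exists>e. \<forall>v. p < v \<longrightarrow> v < q \<longrightarrow> ((even v = e) \<longleftrightarrow> Q q < Q v)" using e by blast
qed (rule assms(3))

text \<open>Taking \<open>r\<close> as the mirror image of \<open>l\<close> makes
  \<open>bsum\<close> vanish and gives the word and its reverse complement the same bits. By
  uniqueness the two have the same order, so the word is symmetric and comes from an element of
  \<open>B_n\<close>.\<close>

lemma lb_surj: obtains x where "x \<in> minima" "\<And>i. 1 \<le> i \<Longrightarrow> i < 2 * n \<Longrightarrow> lb x i = l i"
proof -
  let ?N = "2 * n"
  define r where "r i = l (?N - i)" for i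
  have "bsum ?N l r = 0" by (rule bsum_palindrome) (simp_all add: r_def)
  then obtain P where alt: "alternating P ?N" and bits: "\<And>i. 1 \<le> i \<Longrightarrow> i < ?N \<Longrightarrow> lbit P ?N i = l i \<and> rbit P ?N i = r i"
    using alternating_exists[of ?N l r] n_pos by auto
  have inj: "inj_on P {1..?N}" using alt by (simp add: alternating_def)
  \<comment> \<open>The maximum keeps the subtraction \<open>C - P (mir v)\<close> from being cut
    off at 0.\<close>
  define C where "C = Max (P ` {1..?N})"
  define P' where "P' v = C - P (mir v)" for v
  have f: "flipped P P'" unfolding flipped_def
  proof (intro exI ballI)
    fix v assume "v \<in> {1..?N}"
    then have "P (mir v) \<le> C" unfolding C_def using mir_range by (intro Max_ge) auto
    then show "P' v + P (mir v) = C" by (simp add: P'_def)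
  qed
  have so: "same_order ?N P P'"
  proof (rule alternating_unique[OF alt flipped_alternating[OF f alt]])
    fix i assume i: "1 \<le> i" "i < ?N"
    have "1 \<le> ?N - i" "?N - i < ?N" "?N - (?N - i) = i" using i by auto
    then show "lbit P ?N i = lbit P' ?N i \<and> rbit P ?N i = rbit P' ?N i"
      using bits[OF i] bits[of "?N - i"] unfolding flipped_bits[OF f i] r_def by simp
  qed
  have flip: "P (mir b) < P (mir a) \<longleftrightarrow> P a < P b" if "a \<in> {1..?N}" "b \<in> {1..?N}" for a b
    using flipped_less[OF f that] so that by (auto simp: same_order_def)
  define T where "T = {(a, b) \<in> pairs. P b < P a}"
  have ne: "P a \<noteq> P b" if "1 \<le> a" "a < b" "b \<le> ?N" for a b using inj_eq[OF inj, of a b] that by auto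
  have "bic T"
    by (rule bicI) (use ne in \<open>auto simp: T_def pairs_def\<close>)
  moreover have "(mir b, mir a) \<in> T" if "(a, b) \<in> T" for a b
    using that mir_pairs[of a b] flip[of b a] by (auto simp: T_def pairs_def)
  ultimately have "T \<in> K" by (simp add: K_def)
  then obtain x where x: "x \<in> W" "ivs x = T" by (rule realize)
  have so': "same_order ?N P (pos x)" unfolding same_order_def
  proof (intro allI impI)
    fix a b assume ab: "1 \<le> a" "a \<le> ?N" "1 \<le> b" "b \<le> ?N"
    then show "P a < P b \<longleftrightarrow> pos x a < pos x b"
      using pos_less_iff[OF x(1), of a b] ne[of a b] ne[of b a] unfolding x(2) T_def pairs_def
      by (cases a b rule: linorder_cases) auto
  qed
  have "x \<in> minima" using alternating_minima[OF x(1)] same_order_alternating[OF so' alt pos_inj[OF x(1)]] .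
  moreover have "lb x i = l i" if "1 \<le> i" "i < ?N" for i using bits[OF that] same_order_lbit[OF so' that] by simp
  ultimately show thesis using that by blast
qed

section \<open>The conjugacy\<close>

text \<open>
  Reversing the indices and flipping every other bit turns the shift with negation performed by rowmotion into
  the one that negates only when wrapping around.
\<close>

definition code :: "(nat \<Rightarrow> nat) \<Rightarrow> nat set" where
  "code x = {i \<in> {1..2 * n - 1}. lb x (2 * n - i) \<noteq> odd i}"

lemma code_bij: "bij_betw code minima (Pow {1..2 * n - 1})"
  unfolding bij_betw_def
proof
  show "inj_on code minima"
  proof (rule inj_onI)
    fix x y assume h: "x \<in> minima" "y \<in> minima" "code x = code y"
    show "x = y"
    proof (rule lb_inj[OF h(1,2)])
      fix i assume i: "1 \<le> i" "i < 2 * n"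
      then have "2 * n - i \<in> code x \<longleftrightarrow> 2 * n - i \<in> code y" "2 * n - i \<in> {1..2 * n - 1}" "2 * n - (2 * n - i) = i"
        using h(3) by auto
      then show "lb x i = lb y i" unfolding code_def by auto
    qed
  qed
  show "code ` minima = Pow {1..2 * n - 1}"
  proof
    show "code ` minima \<subseteq> Pow {1..2 * n - 1}" by (auto simp: code_def)
    show "Pow {1..2 * n - 1} \<subseteq> code ` minima"
    proof
      fix X assume X: "X \<in> Pow {1..2 * n - 1}"
      obtain x where x: "x \<in> minima" "\<And>i. 1 \<le> i \<Longrightarrow> i < 2 * n \<Longrightarrow> lb x i = ((2 * n - i \<in> X) \<noteq> odd (2 * n - i))"
        using lb_surj[of "\<lambda>i. (2 * n - i \<in> X) \<noteq> odd (2 * n - i)"] by metis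
      have "i \<in> code x \<longleftrightarrow> i \<in> X" if i: "i \<in> {1..2 * n - 1}" for i
      proof -
        have "1 \<le> 2 * n - i" "2 * n - i < 2 * n" "2 * n - (2 * n - i) = i" using i by auto
        then show ?thesis using x(2)[of "2 * n - i"] i by (auto simp: code_def)
      qed
      moreover have "code x \<subseteq> {1..2 * n - 1}" by (auto simp: code_def)
      ultimately have "code x = X" using X by blast
      then show "X \<in> code ` minima" using x(1) by blast
    qed
  qed
qed

lemma code_Row: assumes x: "x \<in> minima" shows "code (Row_B n x) = negacyclic (2 * n - 1) (code x)"
proof (rule Set.set_eqI)
  fix i
  consider "i \<notin> {1..2 * n - 1}" | "1 \<le> i" "i < 2 * n - 1" | "i = 2 * n - 1" "1 \<le> i" by fastforce
  then show "i \<in> code (Row_B n x) \<longleftrightarrow> i \<in> negacyclic (2 * n - 1) (code x)"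
  proof cases
    case 1 then show ?thesis by (auto simp: code_def negacyclic_def)
  next
    case 2
    define j where "j = 2 * n - (i + 1)"
    have j: "1 \<le> j" "j + 1 < 2 * n" "2 * n - i = j + 1" using 2 by (auto simp: j_def)
    have "i \<in> code (Row_B n x) \<longleftrightarrow> lb (Row_B n x) (j + 1) \<noteq> odd i" using 2 j by (simp add: code_def)
    moreover have "i + 1 \<in> code x \<longleftrightarrow> lb x j \<noteq> odd (i + 1)" using 2 by (simp add: code_def j_def)
    moreover have "i \<in> negacyclic (2 * n - 1) (code x) \<longleftrightarrow> i + 1 \<in> code x" using 2 by (simp add: negacyclic_def)
    ultimately show ?thesis using lb_Row(2)[OF x j(1,2)] by auto
  next
    case 3
    \<comment> \<open>The indices 1 and \<open>2 * n - 1\<close> are both odd, so both bits are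
      flipped and the negation at the wrap-around remains.\<close>
    have "2 * n - i = 1" "odd i" using 3 by auto
    then have "i \<in> code (Row_B n x) \<longleftrightarrow> \<not> lb (Row_B n x) 1" using 3 by (simp add: code_def)
    moreover have "1 \<in> code x \<longleftrightarrow> \<not> lb x (2 * n - 1)" using 3 by (auto simp: code_def)
    moreover have "i \<in> negacyclic (2 * n - 1) (code x) \<longleftrightarrow> 1 \<notin> code x" using 3 by (simp add: negacyclic_def)
    ultimately show ?thesis using lb_Row(3)[OF x order_refl] by blast
  qed
qed

lemma orbit_structure_Row_B:
  "orbit_structure (Row_B n) minima = orbit_structure (negacyclic (2 * n - 1)) (Pow {1..2 * n - 1})"
  by (rule orbit_structure_conj[OF code_bij]) (use lb_Row(1)[OF _ order_refl] code_Row in auto)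

end

theorem proposition8p4:
  fixes n :: nat
  assumes "n \<ge> 1"
  shows "orbit_structure (Row_B n) (pi_down_B n ` carrier (type_B_group n)) =
         orbit_structure (ideal_row (shifted_staircase n)) (order_ideals (shifted_staircase n))"
proof -
  interpret type_B n by unfold_locales (rule assms)
  have "2 * n - 1 \<ge> 1" using assms by simp
  then show ?thesis
    unfolding pi_down_image orbit_structure_Row_B shifted_staircase_stair by (rule orbit_structure_ideal_row[symmetric])
qed

end
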